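(* Let $\Omega\subseteq\mathbb{R}^d$ be a domain and let $(H_s)_{s\in[0,1]}$ be an admissible bundle of reproducing kernel Hilbert spaces of vector fields on $\Omega$ (with Lebesgue measure on $[0,1]$) with kernels $\mathsf{k}_s$, ordered by inclusion, $H_s\subseteq H_t$ for $s\le t$. Let $0=s_0<s_1<\dots<s_n=1$, $I_k=[s_{k-1},s_k]$, and let $H_{(k)}$ be the reproducing kernel Hilbert space (RKHS) with kernel $\int_{I_k}\mathsf{k}_s\,\mathrm{d}s$. Consider the following three matching problems. (A) (LDDMM with an integral over kernels) Find the minimiser $v(t)$ of $$\frac12\int_0^1\|v(t)\|_H^2\,\mathrm{d}t+d^2(\varphi(1).I_0,I_{\mathrm{target}}),$$ where $\varphi(t)$ is the flow of $v(t)$ and $H$ is the RKHS with kernel $\mathsf{k}=\int_0^1\mathsf{k}_s\,\mathrm{d}s$. (B) (LDDMM with a kernel bundle) Find the one-parameter family $v_s(t)$ of vector fields which minimises $$\frac12\int_0^1\int_0^1\|v_s(t)\|_{H_s}^2\,\mathrm{d}s\,\mathrm{d}t+d^2(\varphi(1).I_0,I_{\mathrm{target}}),$$ where $\varphi(t)$ is the flow of the vector field $v(t)=\int_0^1v_s(t)\,\mathrm{d}s$. (C) (LDDMM with the reversed order semidirect product) Find the minimising $n$-tuple $(u_1(t),\dots,u_n(t))$, with $u_k(t)\in H_{(k)}$, of $$\frac12\sum_{k=1}^n\int_0^1\|u_k(t)\|_{H_{(k)}}^2\,\mathrm{d}t+d^2(\varphi(1).I_0,I_{\mathrm{target}}),$$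 where $\varphi(t)=\varphi_1(t)\circ\dots\circ\varphi_n(t)$ and $\varphi_k(t)$ is defined via $\varphi_k(0)=\mathrm{Id}$ and $$\partial_t\varphi_k(t)=\big(\mathrm{Ad}_{(\varphi_1(t)\circ\dots\circ\varphi_{k-1}(t))^{-1}}u_k(t)\big)\circ\varphi_k(t).$$ Then the matching problems (A) and (B) are equivalent, and using the sampling map $$\Psi:V\to H_{(1)}\times\dots\times H_{(n)},\qquad v\mapsto\Big(\int_{I_1}v_s\,\mathrm{d}s,\dots,\int_{I_n}v_s\,\mathrm{d}s\Big)$$ they are also equivalent to the discrete problem (C).
   Context: LDDMM stands for large deformation diffeomorphic metric mapping. An admissible reproducing kernel Hilbert space of vector fields on $\Omega$ is a Hilbert space $H$ of $C^1$ vector fields $\Omega\to\mathbb{R}^d$ such that $\|v\|_{1,\infty}\le M\|v\|_H$ for all $v\in H$ and some constant $M>0$. Its kernel is $\mathsf{k}(x,y)=(\delta_x,K\delta_y)\in L(\mathbb{R}^d,\mathbb{R}^d)$, with $K:H^*\to H$ the Riesz isomorphism, $\delta_x$ evaluation at $x$ and $(\cdot,\cdot)$ the dual pairing. The family $(H_s)_{s\in[0,1]}$ of admissible RKHS is an admissible bundle if: (1) for each $s$ there is $M_s>0$ with $\|v\|_{1,\infty}\le M_s\|v\|_{H_s}$ for all $v\in H_s$; (2) $(s,x,y)\mapsto\mathsf{k}_s(x,y)$ is Borel measurable; (3) $s\mapsto M_s$ is Borel measurable with $\int_0^1M_s^2\,\mathrm{d}s<\infty$. The space $V$ consists of the $u\in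 L^2([0,1]\times\Omega)$ such that $s\mapsto u(s,x)$ is measurable for all $x\in\Omega$, $s\mapsto\|u(s,\cdot)\|_{H_s}$ is measurable, and $\int_0^1\|u(s,\cdot)\|_{H_s}^2\,\mathrm{d}s<\infty$; we write $u_s=u(s,\cdot)$. All vector fields are assumed to vanish on the boundary of $\Omega$, so that flows are well defined. The flow $\varphi(t)$ of a time-dependent vector field $v(t)$ is the solution of $\partial_t\varphi(t)=v(t)\circ\varphi(t)$, $\varphi(0)=\mathrm{Id}$. For a diffeomorphism $\varphi$ and a vector field $w$, $\mathrm{Ad}_\varphi w=(D\varphi\cdot w)\circ\varphi^{-1}$; for $k=1$ the empty composition is the identity. Diffeomorphisms obtained as time-one flows act on a set $Q$ of objects (for example images), the action being denoted $\varphi.I$; $d$ is a distance on $Q$, and $I_0,I_{\mathrm{target}}\in Q$ are fixed.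
   Formalization: In the space V, and so in problem (B), families u need only be jointly measurable on [0,1]×Ω with square-integrable H_s-norm; membership in L²([0,1]×Ω) is dropped, since with it (B) can lack a minimiser when (A) has one. *)

theory Defs
  imports "HOL-Analysis.Analysis"
begin

text \<open>
  Vector fields on \<open>\<Omega>\<close> that vanish on the boundary are represented by their extension by zero to
  the whole Euclidean space, and diffeomorphisms of \<open>\<Omega>\<close> by their extension by the identity. So
  equality of functions is equality on \<open>\<Omega>\<close>, and composition and inverse are those of total
  functions.
\<close>

type_synonym 'a vfield = "'a \<Rightarrow> 'a"

text \<open>
  A vector field in this class may well fail to be differentiable at boundary points: \<open>C\<^sup>1\<close>
  refers to the open set \<open>\<Omega>\<close>, continuity on the whole space says that the field
  tends to zero at the boundary.
\<close>

definition C1_field :: "'a::euclidean_space set \<Rightarrow> 'a vfield \<Rightarrow> bool" where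
  "C1_field \<Omega> v \<longleftrightarrow>
     continuous_on UNIV v \<and> (\<forall>x. x \<notin> \<Omega> \<longrightarrow> v x = 0) \<and>
     (\<exists>v' :: 'a \<Rightarrow> 'a \<Rightarrow>\<^sub>L 'a. continuous_on \<Omega> v' \<and>
        (\<forall>x\<in>\<Omega>. (v has_derivative blinfun_apply (v' x)) (at x)))"

definition norm_1_inf :: "'a::euclidean_space set \<Rightarrow> 'a vfield \<Rightarrow> ennreal" where
  "norm_1_inf \<Omega> v =
     (SUP x\<in>\<Omega>. ennreal (norm (v x))) +
     (SUP x\<in>\<Omega>. ennreal (onorm (frechet_derivative v (at x))))"


section \<open>Hilbert spaces of vector fields and their kernels\<close>

text \<open>The values of \<open>ip\<close> outside \<open>vfields\<close> carry no meaning.\<close>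

record 'a field_space =
  vfields :: "'a vfield set"
  ip :: "'a vfield \<Rightarrow> 'a vfield \<Rightarrow> real"

definition hnorm :: "'a field_space \<Rightarrow> 'a vfield \<Rightarrow> real" where
  "hnorm H v = sqrt (ip H v v)"

definition hilbert_space :: "'a::euclidean_space field_space \<Rightarrow> bool" where
  "hilbert_space H \<longleftrightarrow>
     (\<lambda>x. 0) \<in> vfields H \<and>
     (\<forall>v\<in>vfields H. \<forall>w\<in>vfields H. (\<lambda>x. v x + w x) \<in> vfields H) \<and>
     (\<forall>c. \<forall>v\<in>vfields H. (\<lambda>x. c *\<^sub>R v x) \<in> vfields H) \<and>
     (\<forall>v\<in>vfields H. \<forall>w\<in>vfields H. ip H v w = ip H w v) \<and>
     (\<forall>v\<in>vfields H. \<forall>w\<in>vfields H. \<forall>z\<in>vfields H.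
        ip H (\<lambda>x. v x + w x) z = ip H v z + ip H w z) \<and>
     (\<forall>c. \<forall>v\<in>vfields H. \<forall>w\<in>vfields H. ip H (\<lambda>x. c *\<^sub>R v x) w = c * ip H v w) \<and>
     (\<forall>v\<in>vfields H. v \<noteq> (\<lambda>x. 0) \<longrightarrow> ip H v v > 0) \<and>
     (\<forall>X. (\<forall>n::nat. X n \<in> vfields H) \<and>
        (\<forall>e>0. \<exists>N. \<forall>m\<ge>N. \<forall>n\<ge>N. hnorm H (\<lambda>x. X m x - X n x) < e) \<longrightarrow>
        (\<exists>v\<in>vfields H. (\<lambda>n. hnorm H (\<lambda>x. X n x - v x)) \<longlonglongrightarrow> 0))"

definition rkhs :: "'a::euclidean_space set \<Rightarrow> 'a field_space \<Rightarrow> bool" where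
  "rkhs \<Omega> H \<longleftrightarrow>
     hilbert_space H \<and>
     (\<forall>v\<in>vfields H. \<forall>x. x \<notin> \<Omega> \<longrightarrow> v x = 0) \<and>
     (\<forall>x\<in>\<Omega>. \<exists>C. \<forall>v\<in>vfields H. norm (v x) \<le> C * hnorm H v)"

definition admissible_rkhs :: "'a::euclidean_space set \<Rightarrow> 'a field_space \<Rightarrow> bool" where
  "admissible_rkhs \<Omega> H \<longleftrightarrow>
     hilbert_space H \<and>
     (\<forall>v\<in>vfields H. C1_field \<Omega> v) \<and>
     (\<exists>M>0. \<forall>v\<in>vfields H. norm_1_inf \<Omega> v \<le> ennreal (M * hnorm H v))"

definition riesz :: "'a field_space \<Rightarrow> ('a vfield \<Rightarrow> real) \<Rightarrow> 'a vfield" where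
  "riesz H l = (THE w. w \<in> vfields H \<and> (\<forall>v\<in>vfields H. ip H w v = l v))"

text \<open>
  The kernel \<open>k(x,y) = (\<delta>\<^sub>x, K \<delta>\<^sub>y)\<close> sends a vector \<open>q\<close> to the value at \<open>x\<close> of the Riesz
  representative of the functional \<open>v \<mapsto> v(y) \<bullet> q\<close>.
\<close>

definition kernel :: "'a::euclidean_space field_space \<Rightarrow> 'a \<Rightarrow> 'a \<Rightarrow> 'a \<Rightarrow>\<^sub>L 'a" where
  "kernel H x y = Blinfun (\<lambda>q. riesz H (\<lambda>v. v y \<bullet> q) x)"

definition rkhs_with_kernel ::
  "'a::euclidean_space set \<Rightarrow> ('a \<Rightarrow> 'a \<Rightarrow> 'a \<Rightarrow>\<^sub>L 'a) \<Rightarrow> 'a field_space \<Rightarrow> bool" where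
  "rkhs_with_kernel \<Omega> k H \<longleftrightarrow> rkhs \<Omega> H \<and> (\<forall>x\<in>\<Omega>. \<forall>y\<in>\<Omega>. kernel H x y = k x y)"

text \<open>The operator-valued integral is taken entrywise, i.e. on each vector \<open>q\<close>.\<close>

definition integral_kernel ::
  "(real \<Rightarrow> 'a::euclidean_space field_space) \<Rightarrow> real set \<Rightarrow> 'a \<Rightarrow> 'a \<Rightarrow> 'a \<Rightarrow>\<^sub>L 'a" where
  "integral_kernel H I x y = Blinfun (\<lambda>q. LINT s:I|lborel. blinfun_apply (kernel (H s) x y) q)"

definition admissible_bundle ::
  "'a::euclidean_space set \<Rightarrow> (real \<Rightarrow> 'a field_space) \<Rightarrow> bool" where
  "admissible_bundle \<Omega> H \<longleftrightarrow>
     (\<forall>s\<in>{0..1}. admissible_rkhs \<Omega> (H s)) \<and>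
     (\<lambda>(s, x, y). kernel (H s) x y) \<in> borel_measurable (restrict_space borel ({0..1} \<times> \<Omega> \<times> \<Omega>)) \<and>
     (\<exists>M. (\<forall>s\<in>{0..1}. M s > 0 \<and> (\<forall>v\<in>vfields (H s). norm_1_inf \<Omega> v \<le> ennreal (M s * hnorm (H s) v))) \<and>
        M \<in> borel_measurable (restrict_space borel {0..1}) \<and>
        set_integrable lborel {0..1} (\<lambda>s. (M s)\<^sup>2))"


section \<open>Square integrable families\<close>

text \<open>
  For a bundle \<open>H\<close> this is the space \<open>V\<close>; for a constant bundle it is \<open>L\<^sup>2([0,1], H)\<close>.
  Elements are everywhere defined representatives; they are identified almost everywhere only
  when problems are compared. The ambient space \<open>L\<^sup>2([0,1] \<times> \<Omega>)\<close> enters through joint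
  measurability only. Its square integrability is not required: it does not follow from
  the other conditions (not even for bounded \<open>\<Omega>\<close>), and with it \<open>V\<close> need not be complete
  nor contain the minimal-norm family with a prescribed integral.
\<close>

definition sections ::
  "'a::euclidean_space set \<Rightarrow> (real \<Rightarrow> 'a field_space) \<Rightarrow> (real \<Rightarrow> 'a vfield) set" where
  "sections \<Omega> H = {u.
     (\<forall>s\<in>{0..1}. u s \<in> vfields (H s)) \<and>
     (\<lambda>(s, x). u s x) \<in> borel_measurable (restrict_space borel ({0..1} \<times> \<Omega>)) \<and>
     (\<forall>x\<in>\<Omega>. (\<lambda>s. u s x) \<in> borel_measurable (restrict_space borel {0..1})) \<and>
     (\<lambda>s. hnorm (H s) (u s)) \<in> borel_measurable (restrict_space borel {0..1}) \<and>
     set_integrable lborel {0..1} (\<lambda>s. (hnorm (H s) (u s))\<^sup>2)}"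

definition family_integral :: "real set \<Rightarrow> (real \<Rightarrow> 'a::euclidean_space vfield) \<Rightarrow> 'a vfield" where
  "family_integral I u = (\<lambda>x. LINT s:I|lborel. u s x)"

text \<open>The sampling map \<open>\<Psi>\<close>; only the components \<open>k \<in> {1..n}\<close> are meant.\<close>

definition sampling ::
  "(nat \<Rightarrow> real) \<Rightarrow> (real \<Rightarrow> 'a::euclidean_space vfield) \<Rightarrow> nat \<Rightarrow> 'a vfield" where
  "sampling \<sigma> u k = family_integral {\<sigma> (k - 1)..\<sigma> k} u"


section \<open>Flows\<close>

text \<open>
  Vector fields are only square integrable in time, so the flow equation is understood in
  integrated (Caratheodory) form.
\<close>

definition is_flow ::
  "(real \<Rightarrow> 'a::euclidean_space vfield) \<Rightarrow> (real \<Rightarrow> 'a \<Rightarrow> 'a) \<Rightarrow> bool" where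
  "is_flow v \<phi> \<longleftrightarrow>
     (\<forall>x. \<forall>t\<in>{0..1}.
        set_integrable lborel {0..t} (\<lambda>r. v r (\<phi> r x)) \<and>
        \<phi> t x = x + (LINT r:{0..t}|lborel. v r (\<phi> r x)))"

text \<open>Only the values \<open>flow v t\<close> with \<open>t \<in> {0..1}\<close> are determined by the choice.\<close>

definition flow :: "(real \<Rightarrow> 'a::euclidean_space vfield) \<Rightarrow> real \<Rightarrow> 'a \<Rightarrow> 'a" where
  "flow v = (SOME \<phi>. is_flow v \<phi>)"

definition Ad ::
  "'a::euclidean_space set \<Rightarrow> ('a \<Rightarrow> 'a) \<Rightarrow> 'a vfield \<Rightarrow> 'a vfield" where
  "Ad \<Omega> \<phi> w = (\<lambda>x. if x \<in> \<Omega>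
                    then frechet_derivative \<phi> (at (inv \<phi> x)) (w (inv \<phi> x)) else 0)"

text \<open>The composition \<open>\<phi>\<^sub>1(t) \<circ> \<dots> \<circ> \<phi>\<^sub>k(t)\<close> of the reversed order semidirect product.\<close>

primrec semidirect_flow ::
  "'a::euclidean_space set \<Rightarrow> (nat \<Rightarrow> real \<Rightarrow> 'a vfield) \<Rightarrow> nat \<Rightarrow> real \<Rightarrow> 'a \<Rightarrow> 'a" where
  "semidirect_flow \<Omega> u 0 = (\<lambda>t. id)"
| "semidirect_flow \<Omega> u (Suc k) =
     (\<lambda>t. semidirect_flow \<Omega> u k t \<circ>
          flow (\<lambda>r. Ad \<Omega> (inv (semidirect_flow \<Omega> u k r)) (u (Suc k) r)) t)"

definition flow_diffeos ::
  "'a::euclidean_space set \<Rightarrow> 'a field_space \<Rightarrow> ('a \<Rightarrow> 'a) set" where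
  "flow_diffeos \<Omega> H = {flow v 1 | v. v \<in> sections \<Omega> (\<lambda>_. H)}"

definition acts_on ::
  "('a \<Rightarrow> 'a) set \<Rightarrow> 'q set \<Rightarrow> (('a \<Rightarrow> 'a) \<Rightarrow> 'q \<Rightarrow> 'q) \<Rightarrow> bool" where
  "acts_on G Q act \<longleftrightarrow>
     (\<forall>\<phi>\<in>G. \<forall>q\<in>Q. act \<phi> q \<in> Q) \<and>
     (\<forall>q\<in>Q. act id q = q) \<and>
     (\<forall>\<phi>\<in>G. \<forall>\<psi>\<in>G. \<forall>q\<in>Q. act (\<phi> \<circ> \<psi>) q = act \<phi> (act \<psi> q))"


section \<open>Matching problems and their equivalence\<close>

text \<open>\<open>agree\<close> is the almost everywhere identification of admissible candidates.\<close>

record ('x, 'a) matching_problem =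
  feasible :: "'x set"
  objective :: "'x \<Rightarrow> real"
  deformation :: "'x \<Rightarrow> real \<Rightarrow> 'a \<Rightarrow> 'a"
  agree :: "'x \<Rightarrow> 'x \<Rightarrow> bool"

definition minimiser :: "('x, 'a) matching_problem \<Rightarrow> 'x \<Rightarrow> bool" where
  "minimiser P = is_arg_min (objective P) (\<lambda>x. x \<in> feasible P)"

text \<open>
  Two problems are equivalent via a map \<open>f\<close> of candidates if \<open>f\<close> preserves the deformations
  (hence the matching term), the infima of the two functionals are equal, and \<open>f\<close> induces a
  bijection between the minimisers, up to almost everywhere identification. The existence
  of minimisers is not part of the claim.
\<close>

definition equivalent_via ::
  "('x \<Rightarrow> 'y) \<Rightarrow> ('x, 'a) matching_problem \<Rightarrow> ('y, 'a) matching_problem \<Rightarrow> bool" where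
  "equivalent_via f P Q \<longleftrightarrow>
     (\<forall>x\<in>feasible P. f x \<in> feasible Q \<and>
        (\<forall>t\<in>{0..1}. deformation Q (f x) t = deformation P x t)) \<and>
     (INF x\<in>feasible P. objective P x) = (INF y\<in>feasible Q. objective Q y) \<and>
     (\<forall>x. minimiser P x \<longrightarrow> minimiser Q (f x)) \<and>
     (\<forall>y. minimiser Q y \<longrightarrow> (\<exists>x. minimiser P x \<and> agree Q (f x) y)) \<and>
     (\<forall>x x'. minimiser P x \<and> minimiser P x' \<longrightarrow>
        (agree Q (f x) (f x') \<longleftrightarrow> agree P x x'))"

definition problem_A ::
  "'a::euclidean_space set \<Rightarrow> 'a field_space \<Rightarrow>
   (('a \<Rightarrow> 'a) \<Rightarrow> 'q \<Rightarrow> 'q) \<Rightarrow> ('q \<Rightarrow> 'q \<Rightarrow> real) \<Rightarrow> 'q \<Rightarrow> 'q \<Rightarrow>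
   (real \<Rightarrow> 'a vfield, 'a) matching_problem" where
  "problem_A \<Omega> H act d I\<^sub>0 I\<^sub>t =
     \<lparr> feasible = sections \<Omega> (\<lambda>_. H),
       objective = (\<lambda>v. 1 / 2 * (LINT t:{0..1}|lborel. (hnorm H (v t))\<^sup>2) +
                        (d (act (flow v 1) I\<^sub>0) I\<^sub>t)\<^sup>2),
       deformation = flow,
       agree = (\<lambda>v w. AE t in lborel. t \<in> {0..1} \<longrightarrow> v t = w t) \<rparr>"

text \<open>
  In problem (B) the first argument of a candidate is the time \<open>t\<close>, the second one the scale
  \<open>s\<close>: candidates are square integrable maps from \<open>[0,1]\<close> to \<open>V\<close>.
\<close>

definition families ::
  "'a::euclidean_space set \<Rightarrow> (real \<Rightarrow> 'a field_space) \<Rightarrow> (real \<Rightarrow> real \<Rightarrow> 'a vfield) set" where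
  "families \<Omega> H = {v.
     (\<forall>t\<in>{0..1}. v t \<in> sections \<Omega> H) \<and>
     (\<forall>x\<in>\<Omega>. (\<lambda>(t, s). v t s x) \<in> borel_measurable (restrict_space borel ({0..1} \<times> {0..1}))) \<and>
     (\<lambda>(t, s). hnorm (H s) (v t s)) \<in> borel_measurable (restrict_space borel ({0..1} \<times> {0..1})) \<and>
     set_integrable lborel {0..1} (\<lambda>t. LINT s:{0..1}|lborel. (hnorm (H s) (v t s))\<^sup>2)}"

definition total_field ::
  "(real \<Rightarrow> real \<Rightarrow> 'a::euclidean_space vfield) \<Rightarrow> real \<Rightarrow> 'a vfield" where
  "total_field v t = family_integral {0..1} (v t)"

definition problem_B ::
  "'a::euclidean_space set \<Rightarrow> (real \<Rightarrow> 'a field_space) \<Rightarrow>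
   (('a \<Rightarrow> 'a) \<Rightarrow> 'q \<Rightarrow> 'q) \<Rightarrow> ('q \<Rightarrow> 'q \<Rightarrow> real) \<Rightarrow> 'q \<Rightarrow> 'q \<Rightarrow>
   (real \<Rightarrow> real \<Rightarrow> 'a vfield, 'a) matching_problem" where
  "problem_B \<Omega> H act d I\<^sub>0 I\<^sub>t =
     \<lparr> feasible = families \<Omega> H,
       objective = (\<lambda>v. 1 / 2 * (LINT t:{0..1}|lborel. LINT s:{0..1}|lborel. (hnorm (H s) (v t s))\<^sup>2) +
                        (d (act (flow (total_field v) 1) I\<^sub>0) I\<^sub>t)\<^sup>2),
       deformation = (\<lambda>v. flow (total_field v)),
       agree = (\<lambda>v w. AE t in lborel. t \<in> {0..1} \<longrightarrow>
                        (AE s in lborel. s \<in> {0..1} \<longrightarrow> v t s = w t s)) \<rparr>"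

definition problem_C ::
  "'a::euclidean_space set \<Rightarrow> nat \<Rightarrow> (nat \<Rightarrow> 'a field_space) \<Rightarrow>
   (('a \<Rightarrow> 'a) \<Rightarrow> 'q \<Rightarrow> 'q) \<Rightarrow> ('q \<Rightarrow> 'q \<Rightarrow> real) \<Rightarrow> 'q \<Rightarrow> 'q \<Rightarrow>
   (nat \<Rightarrow> real \<Rightarrow> 'a vfield, 'a) matching_problem" where
  "problem_C \<Omega> n Hd act d I\<^sub>0 I\<^sub>t =
     \<lparr> feasible = {u. \<forall>k\<in>{1..n}. u k \<in> sections \<Omega> (\<lambda>_. Hd k)},
       objective = (\<lambda>u. 1 / 2 * (\<Sum>k=1..n. LINT t:{0..1}|lborel. (hnorm (Hd k) (u k t))\<^sup>2) +
                        (d (act (semidirect_flow \<Omega> u n 1) I\<^sub>0) I\<^sub>t)\<^sup>2),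
       deformation = (\<lambda>u. semidirect_flow \<Omega> u n),
       agree = (\<lambda>u w. \<forall>k\<in>{1..n}. AE t in lborel. t \<in> {0..1} \<longrightarrow> u k t = w k t) \<rparr>"

end

theory Submission
  imports Defs
begin

text \<open>
  Write \<open>L\<close> for the space of square integrable families over an interval \<open>I\<close> of scales.
  Evaluating against finite kernel combinations \<open>\<Sum> k(-,y) q\<close> shows that integration
  \<open>w \<mapsto> \<integral> w_s ds\<close> maps \<open>L\<close> to the space with kernel \<open>\<integral> k_s ds\<close> without increasing
  norms; it is isometric on the lifts \<open>s \<mapsto> \<Sum> k_s(-,y) q\<close>, and kernel combinations are dense, so
  every field has a lift of the same norm, unique almost everywhere by the parallelogram law, and
  measurable in time when the field is. Hence passing to the integral, or to the tuple of integrals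
  over the \<open>I_k\<close>, does not increase the energy and has a right inverse that preserves it; this
  matches infima and minimisers once the deformations are known to agree. For (A) they agree by
  definition. For (C), if \<open>\<psi>\<close> is the flow of \<open>v\<close> and \<open>\<Phi>\<close> that of \<open>v + u\<close>, then
  \<open>\<psi>\<inverse> \<circ> \<Phi>\<close> is the only flow of the field \<open>Ad_(\<psi>\<inverse>) u\<close>. This field is merely
  continuous in space, so uniqueness is obtained from the Lipschitz field \<open>v + u\<close> rather than from the
  equation itself.
\<close>


section \<open>Hilbert spaces of vector fields\<close>

text \<open>The spaces \<open>H s\<close> vary with \<open>s\<close> and are measurable only through
  their kernels, so there is no ambient Hilbert space in which to integrate. Statements about
  families are therefore reduced to pairings with kernel combinations given by one list of points
  and coefficients, used simultaneously in all fibres.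

  For (C) the deformations have to agree for every candidate, not only for minimisers, since the
  matching terms must coincide before energies can be compared. The fields are merely integrable in
  time, so flows have no time derivative at a prescribed time. Identities between flows are obtained
  from increment estimates instead: on short windows the error is at most a small multiple of the
  integral of a fixed weight, and bisection adds the windows up. This forces control of the
  derivatives of flows and inverse flows uniformly over nearby times and points. Uniqueness cannot
  be avoided, because \<open>flow\<close> is an arbitrary choice among the flows of its
  field.\<close>

locale hilbert_fields =
  fixes G :: "'a::euclidean_space field_space"
  assumes hilbert: "hilbert_space G"
begin

lemma zero_in: "(\<lambda>x. 0) \<in> vfields G"
  and add_in: "v \<in> vfields G \<Longrightarrow> w \<in> vfields G \<Longrightarrow> (\<lambda>x. v x + w x) \<in> vfields G"
  and scale_in: "v \<in> vfields G \<Longrightarrow> (\<lambda>x. c *\<^sub>R v x) \<in> vfields G"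
  and ip_sym: "v \<in> vfields G \<Longrightarrow> w \<in> vfields G \<Longrightarrow> ip G v w = ip G w v"
  and ip_add_left: "v \<in> vfields G \<Longrightarrow> w \<in> vfields G \<Longrightarrow> z \<in> vfields G \<Longrightarrow>
        ip G (\<lambda>x. v x + w x) z = ip G v z + ip G w z"
  and ip_scale_left: "v \<in> vfields G \<Longrightarrow> w \<in> vfields G \<Longrightarrow> ip G (\<lambda>x. c *\<^sub>R v x) w = c * ip G v w"
  and ip_pos: "v \<in> vfields G \<Longrightarrow> v \<noteq> (\<lambda>x. 0) \<Longrightarrow> ip G v v > 0"
  and complete: "(\<And>n::nat. X n \<in> vfields G) \<Longrightarrow>
        (\<And>e. e > 0 \<Longrightarrow> \<exists>N. \<forall>m\<ge>N. \<forall>n\<ge>N. hnorm G (\<lambda>x. X m x - X n x) < e) \<Longrightarrow>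
        \<exists>v\<in>vfields G. (\<lambda>n. hnorm G (\<lambda>x. X n x - v x)) \<longlonglongrightarrow> 0"
  using hilbert unfolding hilbert_space_def by blast+

lemma diff_in: "v \<in> vfields G \<Longrightarrow> w \<in> vfields G \<Longrightarrow> (\<lambda>x. v x - w x) \<in> vfields G"
  using add_in[of v "\<lambda>x. (-1) *\<^sub>R w x"] scale_in[of w "-1"] by simp

lemma ip_diff_left:
  assumes "v \<in> vfields G" "w \<in> vfields G" "z \<in> vfields G"
  shows "ip G (\<lambda>x. v x - w x) z = ip G v z - ip G w z"
  using ip_add_left[of v "\<lambda>x. (-1) *\<^sub>R w x" z] scale_in[of w "-1"] ip_scale_left[of w z "-1"] assms
  by simp

lemma ip_zero_left: "z \<in> vfields G \<Longrightarrow> ip G (\<lambda>x. 0) z = 0"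
  using ip_scale_left[of "\<lambda>x. 0" z 0] zero_in by simp

lemma ip_add_right:
  assumes "v \<in> vfields G" "w \<in> vfields G" "z \<in> vfields G"
  shows "ip G z (\<lambda>x. v x + w x) = ip G z v + ip G z w"
  unfolding ip_sym[OF assms(3) add_in[OF assms(1,2)]] ip_add_left[OF assms]
    ip_sym[OF assms(1,3)] ip_sym[OF assms(2,3)] ..

lemma ip_diff_right:
  assumes "v \<in> vfields G" "w \<in> vfields G" "z \<in> vfields G"
  shows "ip G z (\<lambda>x. v x - w x) = ip G z v - ip G z w"
  unfolding ip_sym[OF assms(3) diff_in[OF assms(1,2)]] ip_diff_left[OF assms]
    ip_sym[OF assms(1,3)] ip_sym[OF assms(2,3)] ..

lemma ip_scale_right:
  assumes "v \<in> vfields G" "w \<in> vfields G"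
  shows "ip G w (\<lambda>x. c *\<^sub>R v x) = c * ip G w v"
  unfolding ip_sym[OF assms(2) scale_in[OF assms(1)]] ip_scale_left[OF assms]
    ip_sym[OF assms] ..

lemma ip_nonneg: "v \<in> vfields G \<Longrightarrow> 0 \<le> ip G v v"
  using ip_pos[of v] ip_zero_left[OF zero_in] by (cases "v = (\<lambda>x. 0)") auto

lemma hnorm_nonneg [simp]: "v \<in> vfields G \<Longrightarrow> 0 \<le> hnorm G v"
  unfolding hnorm_def using ip_nonneg by simp

lemma hnorm_sq: "v \<in> vfields G \<Longrightarrow> (hnorm G v)\<^sup>2 = ip G v v"
  unfolding hnorm_def using ip_nonneg by simp

lemma hnorm_zero [simp]: "hnorm G (\<lambda>x. 0) = 0"
  unfolding hnorm_def using ip_zero_left[OF zero_in] by simp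

lemma hnorm_eq_0D: "v \<in> vfields G \<Longrightarrow> hnorm G v = 0 \<Longrightarrow> v = (\<lambda>x. 0)"
  unfolding hnorm_def using ip_pos[of v] by fastforce

lemma hnorm_scale:
  assumes "v \<in> vfields G"
  shows "hnorm G (\<lambda>x. c *\<^sub>R v x) = \<bar>c\<bar> * hnorm G v"
proof -
  have "ip G (\<lambda>x. c *\<^sub>R v x) (\<lambda>x. c *\<^sub>R v x) = c\<^sup>2 * ip G v v"
    unfolding ip_scale_left[OF assms scale_in[OF assms]] ip_scale_right[OF assms assms]
    by (simp add: power2_eq_square)
  then show ?thesis unfolding hnorm_def by (simp add: real_sqrt_mult)
qed

lemma hnorm_minus_commute:
  assumes "v \<in> vfields G" "w \<in> vfields G"
  shows "hnorm G (\<lambda>x. v x - w x) = hnorm G (\<lambda>x. w x - v x)"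
  using hnorm_scale[of "\<lambda>x. v x - w x" "-1"] diff_in[OF assms] by simp

lemma hnorm_add_sq:
  assumes "v \<in> vfields G" "w \<in> vfields G"
  shows "(hnorm G (\<lambda>x. v x + w x))\<^sup>2 = (hnorm G v)\<^sup>2 + 2 * ip G v w + (hnorm G w)\<^sup>2"
  unfolding hnorm_sq[OF assms(1)] hnorm_sq[OF assms(2)] hnorm_sq[OF add_in[OF assms]]
    ip_add_left[OF assms add_in[OF assms]] ip_add_right[OF assms assms(1)]
    ip_add_right[OF assms assms(2)] ip_sym[OF assms(2,1)] by simp

lemma hnorm_diff_sq:
  assumes "v \<in> vfields G" "w \<in> vfields G"
  shows "(hnorm G (\<lambda>x. v x - w x))\<^sup>2 = (hnorm G v)\<^sup>2 - 2 * ip G v w + (hnorm G w)\<^sup>2"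
  unfolding hnorm_sq[OF assms(1)] hnorm_sq[OF assms(2)] hnorm_sq[OF diff_in[OF assms]]
    ip_diff_left[OF assms diff_in[OF assms]] ip_diff_right[OF assms assms(1)]
    ip_diff_right[OF assms assms(2)] ip_sym[OF assms(2,1)] by simp

text \<open>Unlike the product form of Cauchy-Schwarz, this inequality is linear in
  \<open>ip\<close> and can be integrated over the scales.\<close>

lemma two_ip_le:
  assumes "v \<in> vfields G" "w \<in> vfields G"
  shows "2 * ip G v w - (hnorm G w)\<^sup>2 \<le> (hnorm G v)\<^sup>2"
  using hnorm_diff_sq[OF assms] zero_le_power2[of "hnorm G (\<lambda>x. v x - w x)"] by linarith

lemma Cauchy_Schwarz:
  assumes v: "v \<in> vfields G" and w: "w \<in> vfields G"
  shows "\<bar>ip G v w\<bar> \<le> hnorm G v * hnorm G w"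
proof -
  define a b c where "a = ip G v v" and "b = ip G w w" and "c = ip G v w"
  have *: "2 * t * c - t\<^sup>2 * b \<le> a" for t
  proof -
    have "(hnorm G (\<lambda>x. t *\<^sub>R w x))\<^sup>2 = t\<^sup>2 * b" "(hnorm G v)\<^sup>2 = a"
      using v w by (simp_all add: hnorm_scale hnorm_sq power_mult_distrib a_def b_def)
    then show ?thesis
      using two_ip_le[OF v scale_in[OF w, of t]] ip_scale_right[OF w v, of t] by (simp add: c_def)
  qed
  have "c\<^sup>2 \<le> a * b"
  proof (cases "w = (\<lambda>x. 0)")
    case True
    then have "c = 0" "b = 0"
      unfolding b_def c_def ip_sym[OF v w] using ip_zero_left[OF v] ip_zero_left[OF zero_in] by auto
    then show ?thesis by simp
  next
    case False
    then have "b > 0" using ip_pos w by (simp add: b_def)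
    \<comment> \<open>The choice \<open>t = c / b\<close> maximises the left side of
      \<open>*\<close>.\<close>
    have "c\<^sup>2 / b = 2 * (c / b) * c - (c / b)\<^sup>2 * b"
      using \<open>b > 0\<close> by (simp add: power2_eq_square)
    also have "\<dots> \<le> a" by (rule *)
    finally show ?thesis using \<open>b > 0\<close> by (metis pos_divide_le_eq)
  qed
  then have "sqrt (c\<^sup>2) \<le> sqrt (a * b)" by (rule real_sqrt_le_mono)
  then have "\<bar>c\<bar> \<le> sqrt a * sqrt b" by (simp only: real_sqrt_abs real_sqrt_mult)
  then show ?thesis unfolding hnorm_def a_def b_def c_def .
qed

lemma hnorm_triangle:
  assumes v: "v \<in> vfields G" and w: "w \<in> vfields G"
  shows "hnorm G (\<lambda>x. v x + w x) \<le> hnorm G v + hnorm G w"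
proof (rule power2_le_imp_le)
  show "(hnorm G (\<lambda>x. v x + w x))\<^sup>2 \<le> (hnorm G v + hnorm G w)\<^sup>2"
  proof -
    have "ip G v w \<le> hnorm G v * hnorm G w"
      using Cauchy_Schwarz[OF v w] by (rule order_trans[OF abs_ge_self])
    then show ?thesis unfolding power2_sum hnorm_add_sq[OF v w] by simp
  qed
  show "0 \<le> hnorm G v + hnorm G w" using v w by (intro add_nonneg_nonneg hnorm_nonneg)
qed

lemma hnorm_triangle_diff:
  assumes "v \<in> vfields G" "w \<in> vfields G" "z \<in> vfields G"
  shows "hnorm G (\<lambda>x. v x - z x) \<le> hnorm G (\<lambda>x. v x - w x) + hnorm G (\<lambda>x. w x - z x)"
  using hnorm_triangle[of "\<lambda>x. v x - w x" "\<lambda>x. w x - z x"] assms diff_in by simp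

lemma abs_hnorm_diff_le:
  assumes v: "v \<in> vfields G" and w: "w \<in> vfields G"
  shows "\<bar>hnorm G v - hnorm G w\<bar> \<le> hnorm G (\<lambda>x. v x - w x)"
  using hnorm_triangle_diff[OF v w zero_in] hnorm_triangle_diff[OF w v zero_in]
    hnorm_minus_commute[OF v w] by auto

lemma tendsto_ip_left:
  assumes X: "\<And>n::nat. X n \<in> vfields G" and v: "v \<in> vfields G" and w: "w \<in> vfields G"
    and lim: "(\<lambda>n. hnorm G (\<lambda>x. X n x - v x)) \<longlonglongrightarrow> 0"
  shows "(\<lambda>n. ip G (X n) w) \<longlonglongrightarrow> ip G v w"
proof -
  have "(\<lambda>n. ip G (X n) w - ip G v w) \<longlonglongrightarrow> 0"
  proof (rule Lim_null_comparison)
    show "\<forall>\<^sub>F n in sequentially. norm (ip G (X n) w - ip G v w)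
        \<le> hnorm G (\<lambda>x. X n x - v x) * hnorm G w"
      using Cauchy_Schwarz[OF diff_in[OF X v] w] ip_diff_left[OF X v w] by auto
  qed (use lim tendsto_mult_left_zero in blast)
  then show ?thesis by (simp add: LIM_zero_iff)
qed

lemma tendsto_hnorm:
  assumes X: "\<And>n::nat. X n \<in> vfields G" and v: "v \<in> vfields G"
    and lim: "(\<lambda>n. hnorm G (\<lambda>x. X n x - v x)) \<longlonglongrightarrow> 0"
  shows "(\<lambda>n. hnorm G (X n)) \<longlonglongrightarrow> hnorm G v"
proof -
  have "(\<lambda>n. hnorm G (X n) - hnorm G v) \<longlonglongrightarrow> 0"
    by (rule Lim_null_comparison[OF _ lim]) (use abs_hnorm_diff_le[OF X v] in auto)
  then show ?thesis by (simp add: LIM_zero_iff)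
qed

lemma parallelogram:
  assumes "v \<in> vfields G" "w \<in> vfields G"
  shows "(hnorm G (\<lambda>x. v x + w x))\<^sup>2 + (hnorm G (\<lambda>x. v x - w x))\<^sup>2 =
    2 * (hnorm G v)\<^sup>2 + 2 * (hnorm G w)\<^sup>2"
  using hnorm_add_sq[OF assms] hnorm_diff_sq[OF assms] by simp

text \<open>The minimiser of the quadratic functional \<open>g \<mapsto> \<Parallel>g\<Parallel>\<^sup>2 - 2 l(g)\<close> over a subspace, in the
  closure of that subspace. With the whole space it gives the Riesz theorem, with \<open>l = \<langle>f, -\<rangle>\<close> the
  orthogonal projection of \<open>f\<close>.\<close>

lemma subspace_representer:
  assumes S: "S \<subseteq> vfields G" and S0: "(\<lambda>x. 0) \<in> S"
    and S_add: "\<And>g h. g \<in> S \<Longrightarrow> h \<in> S \<Longrightarrow> (\<lambda>x. g x + h x) \<in> S"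
    and S_scale: "\<And>c g. g \<in> S \<Longrightarrow> (\<lambda>x. c *\<^sub>R g x) \<in> S"
    and l_add: "\<And>g h. g \<in> S \<Longrightarrow> h \<in> S \<Longrightarrow> l (\<lambda>x. g x + h x) = l g + l h"
    and l_scale: "\<And>c g. g \<in> S \<Longrightarrow> l (\<lambda>x. c *\<^sub>R g x) = c * l g"
    and bound: "\<And>g. g \<in> S \<Longrightarrow> 2 * l g - (hnorm G g)\<^sup>2 \<le> C"
  obtains p where "p \<in> vfields G" "\<And>g. g \<in> S \<Longrightarrow> ip G p g = l g" "(hnorm G p)\<^sup>2 \<le> C"
    "\<And>e. e > 0 \<Longrightarrow> \<exists>g\<in>S. hnorm G (\<lambda>x. g x - p x) < e"
proof -
  \<comment> \<open>\<open>F\<close> is the negative of that functional, so \<open>X\<close> below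
    is a maximising sequence.\<close>
  define F where "F g = 2 * l g - (hnorm G g)\<^sup>2" for g
  define s where "s = (SUP g\<in>S. F g)"
  have bdd: "bdd_above (F ` S)" using bound unfolding F_def bdd_above_def by auto
  have F_le: "F g \<le> s" if "g \<in> S" for g unfolding s_def by (rule cSUP_upper[OF that bdd])
  have "\<exists>g\<in>S. s - 1 / real (Suc n) < F g" for n
    using less_cSUP_iff[of S F "s - 1 / real (Suc n)"] S0 bdd by (auto simp: s_def)
  then obtain X where X: "\<And>n. X n \<in> S" and FX: "\<And>n. s - 1 / real (Suc n) < F (X n)" by metis
  have XV: "X n \<in> vfields G" for n using X S by auto
  \<comment> \<open>The midpoint of \<open>g\<close> and \<open>h\<close> also has value at most
    \<open>s\<close>, so the parallelogram law bounds the distance of two near-maximisers by their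
    deficits. Hence a maximising sequence is Cauchy.\<close>
  have F_diff: "(hnorm G (\<lambda>x. g x - h x))\<^sup>2 \<le> 2 * (s - F g) + 2 * (s - F h)"
    if "g \<in> S" "h \<in> S" for g h
  proof -
    have V: "g \<in> vfields G" "h \<in> vfields G" using that S by auto
    have gh: "(\<lambda>x. g x + h x) \<in> S" using that S_add by auto
    have "l (\<lambda>x. (1/2) *\<^sub>R (g x + h x)) = (l g + l h) / 2"
      using l_scale[OF gh, of "1/2"] l_add[OF that] by simp
    moreover have "(hnorm G (\<lambda>x. (1/2) *\<^sub>R (g x + h x)))\<^sup>2 = (hnorm G (\<lambda>x. g x + h x))\<^sup>2 / 4"
      unfolding hnorm_scale[OF add_in[OF V]] by (simp add: power_mult_distrib power2_eq_square)
    ultimately show ?thesis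
      using F_le[OF S_scale[OF gh, of "1/2"]] parallelogram[OF V] unfolding F_def by (simp add: field_simps)
  qed
  have "\<exists>N. \<forall>m\<ge>N. \<forall>n\<ge>N. hnorm G (\<lambda>x. X m x - X n x) < e" if "e > 0" for e
  proof -
    \<comment> \<open>Both deficits will be below \<open>1 / N\<close>, so \<open>F_diff\<close>
      gives \<open>4 / N\<close>.\<close>
    obtain N where N: "4 / e\<^sup>2 < real N" using reals_Archimedean2 by blast
    have "hnorm G (\<lambda>x. X m x - X n x) < e" if mn: "m \<ge> N" "n \<ge> N" for m n
    proof (rule power2_less_imp_less)
      have "0 < 4 / e\<^sup>2" using \<open>e > 0\<close> by simp
      then have "0 < N" using N by (cases N) auto
      have "1 / real (Suc k) \<le> 1 / real N" if "k \<ge> N" for k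
        using that \<open>0 < N\<close> by (intro divide_left_mono) auto
      then have "s - F (X k) < 1 / real N" if "k \<ge> N" for k using FX[of k] that by fastforce
      then have "(hnorm G (\<lambda>x. X m x - X n x))\<^sup>2 < 4 / real N"
        using F_diff[OF X X, of m n] mn by (smt (verit) add_divide_distrib)
      also have "\<dots> < e\<^sup>2" using N \<open>0 < N\<close> \<open>e > 0\<close> by (simp add: field_simps)
      finally show "(hnorm G (\<lambda>x. X m x - X n x))\<^sup>2 < e\<^sup>2" .
    qed (use \<open>e > 0\<close> in simp)
    then show ?thesis by blast
  qed
  from complete[OF XV this] obtain p
    where p: "p \<in> vfields G" and lim: "(\<lambda>n. hnorm G (\<lambda>x. X n x - p x)) \<longlonglongrightarrow> 0" by blast
  have ip_eq: "ip G p g = l g" if g: "g \<in> S" for g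
  proof -
    have gV: "g \<in> vfields G" using g S by auto
    \<comment> \<open>First variation at \<open>p\<close> in the direction \<open>g\<close>.
      Comparing the orders \<open>t\<close> and \<open>t^2\<close> near zero forces
      \<open>ip G p g = l g\<close>.\<close>
    have *: "2 * t * (l g - ip G p g) \<le> t\<^sup>2 * (hnorm G g)\<^sup>2" for t
    proof -
      have "2 * t * (l g - ip G (X n) g) - t\<^sup>2 * (hnorm G g)\<^sup>2 \<le> 1 / real (Suc n)" for n
      proof -
        have "F (\<lambda>x. X n x + t *\<^sub>R g x) = F (X n) + 2 * t * (l g - ip G (X n) g) - t\<^sup>2 * (hnorm G g)\<^sup>2"
          unfolding F_def using l_add[OF X[of n] S_scale[OF g, of t]] l_scale[OF g, of t]
            hnorm_add_sq[OF XV[of n] scale_in[OF gV, of t]] hnorm_scale[OF gV, of t]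
            ip_scale_right[OF gV XV[of n], of t]
          by (simp add: algebra_simps power_mult_distrib)
        then show ?thesis using F_le[OF S_add[OF X[of n] S_scale[OF g, of t]]] FX[of n] by linarith
      qed
      moreover have "(\<lambda>n. 2 * t * (l g - ip G (X n) g) - t\<^sup>2 * (hnorm G g)\<^sup>2) \<longlonglongrightarrow>
          2 * t * (l g - ip G p g) - t\<^sup>2 * (hnorm G g)\<^sup>2"
        by (intro tendsto_intros tendsto_ip_left XV p gV lim)
      ultimately have "2 * t * (l g - ip G p g) - t\<^sup>2 * (hnorm G g)\<^sup>2 \<le> 0"
        by (intro LIMSEQ_le[OF _ LIMSEQ_Suc[OF lim_1_over_n]]) auto
      then show ?thesis by simp
    qed
    show ?thesis
    proof (rule ccontr)
      assume "ip G p g \<noteq> l g"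
      define c a where "c = l g - ip G p g" and "a = (hnorm G g)\<^sup>2"
      have "c\<^sup>2 > 0" "a \<ge> 0" using \<open>ip G p g \<noteq> l g\<close> by (auto simp: c_def a_def)
      \<comment> \<open>\<open>t = c / (a + 1)\<close> is small enough to violate \<open>*\<close>;
        adding \<open>1\<close> covers the case \<open>a = 0\<close>.\<close>
      have "2 * (c / (a + 1)) * c \<le> (c / (a + 1))\<^sup>2 * a" using *[of "c / (a + 1)"] by (simp add: c_def a_def)
      then have "2 * c\<^sup>2 * (a + 1) \<le> c\<^sup>2 * a"
        using \<open>a \<ge> 0\<close> by (simp add: divide_simps power2_eq_square mult_ac split: if_splits)
      then have "c\<^sup>2 * (a + 2) \<le> 0" by (simp add: algebra_simps)
      then show False using \<open>c\<^sup>2 > 0\<close> \<open>a \<ge> 0\<close> by (simp add: mult_le_0_iff)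
    qed
  qed
  \<comment> \<open>Since \<open>l\<close> is the pairing with \<open>p\<close> on \<open>S\<close>,
    the value of \<open>F\<close> at \<open>X n\<close> is the squared norm of \<open>p\<close>
    minus the squared distance of \<open>X n\<close> from \<open>p\<close>.\<close>
  have "(\<lambda>n. (hnorm G p)\<^sup>2 - (hnorm G (\<lambda>x. X n x - p x))\<^sup>2) \<longlonglongrightarrow> (hnorm G p)\<^sup>2 - 0\<^sup>2"
    by (intro tendsto_intros lim)
  moreover have "(hnorm G p)\<^sup>2 - (hnorm G (\<lambda>x. X n x - p x))\<^sup>2 \<le> C" for n
    using bound[OF X, of n] ip_eq[OF X, of n] hnorm_diff_sq[OF XV p, of n] ip_sym[OF p XV, of n]
    by linarith
  ultimately have "(hnorm G p)\<^sup>2 \<le> C" by (intro LIMSEQ_le_const2) auto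
  moreover have "\<exists>g\<in>S. hnorm G (\<lambda>x. g x - p x) < e" if "e > 0" for e
    using order_tendstoD(2)[OF lim that] X by (meson eventually_sequentially order_refl)
  ultimately show thesis using that p ip_eq by blast
qed

lemma riesz_unique:
  assumes "w \<in> vfields G" "w' \<in> vfields G" "\<And>v. v \<in> vfields G \<Longrightarrow> ip G w v = ip G w' v"
  shows "w = w'"
proof -
  have "ip G (\<lambda>x. w x - w' x) (\<lambda>x. w x - w' x) = 0"
    using assms by (simp add: ip_diff_left diff_in)
  then have "(\<lambda>x. w x - w' x) = (\<lambda>x. 0)" using ip_pos[OF diff_in[OF assms(1,2)]] by fastforce
  then show ?thesis by (metis eq_iff_diff_eq_0 ext)
qed

lemma riesz:
  assumes l_add: "\<And>g h. g \<in> vfields G \<Longrightarrow> h \<in> vfields G \<Longrightarrow> l (\<lambda>x. g x + h x) = l g + l h"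
    and l_scale: "\<And>c g. g \<in> vfields G \<Longrightarrow> l (\<lambda>x. c *\<^sub>R g x) = c * l g"
    and bound: "\<And>g. g \<in> vfields G \<Longrightarrow> \<bar>l g\<bar> \<le> K * hnorm G g"
  shows "riesz G l \<in> vfields G" and "v \<in> vfields G \<Longrightarrow> ip G (riesz G l) v = l v"
proof -
  \<comment> \<open>Completing the square: \<open>2 * K * h - h^2 \<le> K^2\<close>.\<close>
  have "2 * l g - (hnorm G g)\<^sup>2 \<le> K\<^sup>2" if "g \<in> vfields G" for g
  proof -
    have "0 \<le> (K - hnorm G g)\<^sup>2" by simp
    then show ?thesis using bound[OF that] by (simp add: power2_diff)
  qed
  then obtain p where p: "p \<in> vfields G" "\<And>g. g \<in> vfields G \<Longrightarrow> ip G p g = l g"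
    using subspace_representer[of "vfields G" l "K\<^sup>2", OF order_refl zero_in add_in scale_in l_add l_scale]
    by metis
  then have "\<exists>!w. w \<in> vfields G \<and> (\<forall>v\<in>vfields G. ip G w v = l v)"
    by (intro ex1I[of _ p]) (auto intro: riesz_unique)
  from theI'[OF this] show "riesz G l \<in> vfields G" "v \<in> vfields G \<Longrightarrow> ip G (riesz G l) v = l v"
    unfolding riesz_def by auto
qed

end

section \<open>Kernel combinations\<close>

text \<open>A list of pairs \<open>(y, q)\<close> stands for the functional \<open>v \<mapsto> \<Sum> q \<bullet> v y\<close>; \<open>kcomb\<close> is its Riesz
  representative.\<close>

definition kcomb :: "'a::euclidean_space field_space \<Rightarrow> ('a \<times> 'a) list \<Rightarrow> 'a vfield" where
  "kcomb G c = (\<lambda>x. \<Sum>(y, q)\<leftarrow>c. blinfun_apply (kernel G x y) q)"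

definition lpair :: "('a::euclidean_space \<times> 'a) list \<Rightarrow> 'a vfield \<Rightarrow> real" where
  "lpair c f = (\<Sum>(y, q)\<leftarrow>c. q \<bullet> f y)"

text \<open>Lists represent the span of kernel sections without a quotient: concatenation is
  addition and \<open>lscale\<close> scalar multiplication. The same list makes sense in every space
  of a bundle.\<close>

abbreviation lscale :: "real \<Rightarrow> ('a::euclidean_space \<times> 'a) list \<Rightarrow> ('a \<times> 'a) list" where
  "lscale r c \<equiv> map (\<lambda>(y, q). (y, r *\<^sub>R q)) c"

lemma kcomb_Nil [simp]: "kcomb G [] = (\<lambda>x. 0)"
  and kcomb_Cons: "kcomb G ((y, q) # c) = (\<lambda>x. blinfun_apply (kernel G x y) q + kcomb G c x)"
  and kcomb_append: "kcomb G (c @ c') = (\<lambda>x. kcomb G c x + kcomb G c' x)"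
  by (simp_all add: kcomb_def)

lemma kcomb_lscale: "kcomb G (lscale r c) = (\<lambda>x. r *\<^sub>R kcomb G c x)"
  by (induction c) (auto simp: kcomb_def blinfun.scaleR_right scaleR_add_right fun_eq_iff)

lemma lpair_Nil [simp]: "lpair [] f = 0"
  and lpair_Cons: "lpair ((y, q) # c) f = q \<bullet> f y + lpair c f"
  and lpair_append: "lpair (c @ c') f = lpair c f + lpair c' f"
  by (simp_all add: lpair_def)

lemma lpair_lscale: "lpair (lscale r c) f = r * lpair c f"
  by (induction c) (auto simp: lpair_def distrib_left)

text \<open>Evaluation is bounded at every point of the Euclidean space. Fields vanish outside their
  domain, so the kernel calculus can be done without reference to \<open>\<Omega>\<close>.\<close>

locale eval_bounded = hilbert_fields +
  assumes eval_bound: "\<exists>C. \<forall>v\<in>vfields G. norm (v x) \<le> C * hnorm G v"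
begin

lemma riesz_eval:
  shows riesz_eval_in: "riesz G (\<lambda>v. v y \<bullet> q) \<in> vfields G"
    and ip_riesz_eval: "v \<in> vfields G \<Longrightarrow> ip G (riesz G (\<lambda>v. v y \<bullet> q)) v = v y \<bullet> q"
proof -
  obtain C where C: "\<forall>v\<in>vfields G. norm (v y) \<le> C * hnorm G v" using eval_bound by blast
  have "\<bar>v y \<bullet> q\<bar> \<le> C * norm q * hnorm G v" if "v \<in> vfields G" for v
  proof -
    have "\<bar>v y \<bullet> q\<bar> \<le> norm (v y) * norm q" by (rule Cauchy_Schwarz_ineq2)
    also have "\<dots> \<le> C * hnorm G v * norm q" using C that by (simp add: mult_right_mono)
    finally show ?thesis by (simp add: mult_ac)
  qed
  then show "riesz G (\<lambda>v. v y \<bullet> q) \<in> vfields G"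
    "v \<in> vfields G \<Longrightarrow> ip G (riesz G (\<lambda>v. v y \<bullet> q)) v = v y \<bullet> q"
    using riesz[of "\<lambda>v. v y \<bullet> q" "C * norm q"] by (auto simp: inner_add_left)
qed

text \<open>\<open>Blinfun\<close> is meaningful only on bounded linear maps. Linearity in
  \<open>q\<close> follows from uniqueness of Riesz representatives, boundedness from finite
  dimension.\<close>

lemma kernel_apply: "blinfun_apply (kernel G x y) q = riesz G (\<lambda>v. v y \<bullet> q) x"
proof -
  define k where "k q = riesz G (\<lambda>v. v y \<bullet> q)" for q
  have k_in: "k q \<in> vfields G" and ip_k: "v \<in> vfields G \<Longrightarrow> ip G (k q) v = v y \<bullet> q" for q v
    unfolding k_def by (fact riesz_eval)+
  have add: "k (p + q) = (\<lambda>x. k p x + k q x)" for p q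
    by (rule riesz_unique) (simp_all add: k_in add_in ip_add_left ip_k inner_add_right)
  have scale: "k (c *\<^sub>R q) = (\<lambda>x. c *\<^sub>R k q x)" for c q
    by (rule riesz_unique) (simp_all add: k_in scale_in ip_scale_left ip_k)
  have "linear (\<lambda>q. k q x)"
    by (rule linearI) (simp_all add: add scale)
  then have "bounded_linear (\<lambda>q. k q x)" by (simp add: linear_conv_bounded_linear)
  then show ?thesis unfolding kernel_def k_def
    by (rule bounded_linear_Blinfun_apply[THEN fun_cong])
qed

lemma kernel_in: "(\<lambda>x. blinfun_apply (kernel G x y) q) \<in> vfields G"
  and ip_kernel: "v \<in> vfields G \<Longrightarrow> ip G (\<lambda>x. blinfun_apply (kernel G x y) q) v = q \<bullet> v y"
  unfolding kernel_apply using riesz_eval_in ip_riesz_eval by (simp_all add: inner_commute)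

text \<open>For \<open>z = y\<close> the section represents the zero functional; for
  \<open>z = x\<close> it is itself a field vanishing at \<open>x\<close>. This extends kernel
  identities from \<open>\<Omega> \<times> \<Omega>\<close> to all pairs of points.\<close>

lemma kernel_eq_0:
  assumes z: "\<And>v. v \<in> vfields G \<Longrightarrow> v z = 0" and xy: "z = x \<or> z = y"
  shows "blinfun_apply (kernel G x y) q = 0"
  using xy
proof
  let ?k = "\<lambda>x. blinfun_apply (kernel G x y) q"
  assume "z = y"
  then have "ip G ?k ?k = 0" using ip_kernel[OF kernel_in, of y q y q] z[OF kernel_in] by simp
  then have "hnorm G ?k = 0" unfolding hnorm_def by simp
  from fun_cong[OF hnorm_eq_0D[OF kernel_in this]] show ?thesis .
next
  assume "z = x"
  then show ?thesis using z[OF kernel_in] by simp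
qed

lemma kcomb_in [simp]: "kcomb G c \<in> vfields G"
proof (induction c)
  case (Cons a c)
  then show ?case by (cases a) (simp only: kcomb_Cons add_in kernel_in)
qed (simp add: zero_in)

lemma ip_kcomb: "v \<in> vfields G \<Longrightarrow> ip G (kcomb G c) v = lpair c v"
proof (induction c)
  case (Cons a c)
  then show ?case
    by (cases a) (simp only: kcomb_Cons ip_add_left kernel_in kcomb_in ip_kernel lpair_Cons)
qed (simp add: ip_zero_left)

lemma ip_kcomb_right: "v \<in> vfields G \<Longrightarrow> ip G v (kcomb G c) = lpair c v"
  using ip_kcomb[of v c] ip_sym[of v "kcomb G c"] by simp

lemma hnorm_kcomb_sq: "(hnorm G (kcomb G c))\<^sup>2 = lpair c (kcomb G c)"
  by (simp add: hnorm_sq ip_kcomb)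

lemma tendsto_eval:
  assumes X: "\<And>n::nat. X n \<in> vfields G" and v: "v \<in> vfields G"
    and lim: "(\<lambda>n. hnorm G (\<lambda>x. X n x - v x)) \<longlonglongrightarrow> 0"
  shows "(\<lambda>n. X n x) \<longlonglongrightarrow> v x"
proof -
  obtain C where C: "\<forall>v\<in>vfields G. norm (v x) \<le> C * hnorm G v" using eval_bound by blast
  have "(\<lambda>n. X n x - v x) \<longlonglongrightarrow> 0"
  proof (rule Lim_null_comparison)
    show "\<forall>\<^sub>F n in sequentially. norm (X n x - v x) \<le> C * hnorm G (\<lambda>x. X n x - v x)"
      by (intro always_eventually allI bspec[OF C] diff_in[OF X v])
    show "(\<lambda>n. C * hnorm G (\<lambda>x. X n x - v x)) \<longlonglongrightarrow> 0"
      using lim by (rule tendsto_mult_right_zero)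
  qed
  then show ?thesis by (simp add: LIM_zero_iff)
qed

text \<open>A converse of \<open>two_ip_le\<close> in which \<open>f\<close> is not assumed to lie
  in the space. The bound makes \<open>kcomb G c \<mapsto> lpair c f\<close> a bounded functional on
  the span, and its representer has the point values of \<open>f\<close>. This is how integrals of
  families are recognised as elements of the integrated space.\<close>

lemma kernel_pairing_in:
  assumes bound: "\<And>c. 2 * lpair c f - (hnorm G (kcomb G c))\<^sup>2 \<le> C"
  shows "f \<in> vfields G" and "(hnorm G f)\<^sup>2 \<le> C"
proof -
  \<comment> \<open>A kernel combination may have several lists; \<open>l_kcomb\<close> shows that
    the value does not depend on the chosen one.\<close>
  define l where "l g = lpair (SOME c. kcomb G c = g) f" for g
  have l_zero: "lpair c f = 0" if "kcomb G c = (\<lambda>x. 0)" for c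
  proof (rule ccontr)
    assume nz: "lpair c f \<noteq> 0"
    \<comment> \<open>A linear function of \<open>r\<close> that is bounded above vanishes.\<close>
    have "2 * (r * lpair c f) \<le> C" for r
      using bound[of "lscale r c"] by (simp add: lpair_lscale kcomb_lscale that)
    from this[of "(\<bar>C\<bar> + 1) / (2 * lpair c f)"] show False using nz by simp
  qed
  have l_kcomb: "l (kcomb G c) = lpair c f" for c
  proof -
    define c' where "c' = (SOME c'. kcomb G c' = kcomb G c)"
    have "kcomb G c' = kcomb G c" unfolding c'_def by (rule someI) simp
    then have "kcomb G (c @ lscale (-1) c') = (\<lambda>x. 0)"
      unfolding kcomb_append kcomb_lscale by simp
    from l_zero[OF this] show ?thesis
      unfolding l_def c'_def[symmetric] lpair_append lpair_lscale by simp
  qed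
  obtain p where p: "p \<in> vfields G" "\<And>g. g \<in> range (kcomb G) \<Longrightarrow> ip G p g = l g"
      and pC: "(hnorm G p)\<^sup>2 \<le> C"
  proof (rule subspace_representer[of "range (kcomb G)" l C])
    show "range (kcomb G) \<subseteq> vfields G" by auto
    show "(\<lambda>x. 0) \<in> range (kcomb G)" by (rule range_eqI[of _ _ "[]"]) simp
    show "(\<lambda>x. g x + h x) \<in> range (kcomb G)" "l (\<lambda>x. g x + h x) = l g + l h"
      if gh: "g \<in> range (kcomb G)" "h \<in> range (kcomb G)" for g h
    proof -
      obtain c c' where c: "g = kcomb G c" "h = kcomb G c'" using gh by auto
      then have *: "(\<lambda>x. g x + h x) = kcomb G (c @ c')" by (simp add: kcomb_append)
      show "(\<lambda>x. g x + h x) \<in> range (kcomb G)" "l (\<lambda>x. g x + h x) = l g + l h"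
        unfolding * unfolding c l_kcomb lpair_append by auto
    qed
    show "(\<lambda>x. r *\<^sub>R g x) \<in> range (kcomb G)" "l (\<lambda>x. r *\<^sub>R g x) = r * l g"
      if g: "g \<in> range (kcomb G)" for r g
    proof -
      obtain c where c: "g = kcomb G c" using g by auto
      then have *: "(\<lambda>x. r *\<^sub>R g x) = kcomb G (lscale r c)" by (simp add: kcomb_lscale)
      show "(\<lambda>x. r *\<^sub>R g x) \<in> range (kcomb G)" "l (\<lambda>x. r *\<^sub>R g x) = r * l g"
        unfolding * unfolding c l_kcomb lpair_lscale by auto
    qed
    show "2 * l g - (hnorm G g)\<^sup>2 \<le> C" if "g \<in> range (kcomb G)" for g
      using that bound l_kcomb by auto
  qed (use that in blast)
  have "p = f"
  proof
    fix y
    have "q \<bullet> p y = q \<bullet> f y" for q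
      using p(2)[of "kcomb G [(y, q)]"] ip_kcomb_right[OF p(1), of "[(y, q)]"] l_kcomb[of "[(y, q)]"]
      by (simp add: lpair_def)
    then show "p y = f y" by (metis inner_commute vector_eq_rdot)
  qed
  then show "f \<in> vfields G" "(hnorm G f)\<^sup>2 \<le> C" using p(1) pC by auto
qed

text \<open>By the reproducing property the squared norm of a section is
  \<open>q \<bullet> k y\<close>, at most \<open>\<bar>C\<bar> * norm q\<close> times the norm
  itself. So coefficients can be perturbed into a countable set.\<close>

lemma kernel_hnorm_le: "\<exists>C\<ge>0. \<forall>q. hnorm G (\<lambda>x. blinfun_apply (kernel G x y) q) \<le> C * norm q"
proof -
  obtain C where C: "\<forall>v\<in>vfields G. norm (v y) \<le> C * hnorm G v" using eval_bound by blast
  have "hnorm G k \<le> \<bar>C\<bar> * norm q" if k: "k = (\<lambda>x. blinfun_apply (kernel G x y) q)" for k q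
  proof (cases "hnorm G k = 0")
    case False
    have kin: "k \<in> vfields G" using kernel_in k by simp
    have "hnorm G k * hnorm G k = q \<bullet> k y"
      using hnorm_sq[OF kin] ip_kernel[OF kin, of y q] k by (simp add: power2_eq_square)
    also have "\<dots> \<le> norm q * norm (k y)" by (rule norm_cauchy_schwarz)
    also have "\<dots> \<le> norm q * (C * hnorm G k)" using C kin by (intro mult_left_mono) auto
    also have "\<dots> \<le> norm q * (\<bar>C\<bar> * hnorm G k)"
      using kin by (intro mult_left_mono mult_right_mono) auto
    finally have "hnorm G k * hnorm G k \<le> (\<bar>C\<bar> * norm q) * hnorm G k" by (simp add: mult_ac)
    moreover have "hnorm G k > 0" using hnorm_nonneg[OF kin] False by linarith
    ultimately show ?thesis by (simp only: mult_le_cancel_right_pos)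
  qed simp
  then show ?thesis by (intro exI[of _ "\<bar>C\<bar>"]) auto
qed

end

text \<open>A continuous field is determined by its values on a countable dense set. Separability,
  and with it the measurability of norms, rests on this.\<close>

locale continuous_rkhs = eval_bounded +
  assumes continuous_fields: "v \<in> vfields G \<Longrightarrow> continuous_on UNIV v"
begin

text \<open>The projection of \<open>f\<close> onto the closed span of the sections at points of
  \<open>D\<close> agrees with \<open>f\<close> on \<open>D\<close>, hence everywhere by continuity.
  Coefficients are moved into \<open>D\<close> afterwards.\<close>

lemma kcomb_dense:
  assumes D: "\<And>U::'a set. open U \<Longrightarrow> U \<noteq> {} \<Longrightarrow> \<exists>d\<in>D. d \<in> U"
    and f: "f \<in> vfields G" and e: "e > 0"
  shows "\<exists>c\<in>lists (D \<times> D). hnorm G (\<lambda>x. kcomb G c x - f x) < e"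
proof -
  have near: "\<exists>q'\<in>D. norm (q - q') < r" if "r > 0" for q r
    using D[of "ball q r"] that by (auto simp: dist_norm)
  \<comment> \<open>Arbitrary coefficients at this stage, because lists over
    \<open>D \<times> D\<close> need not be closed under scaling.\<close>
  let ?S = "kcomb G ` lists (D \<times> UNIV)"
  obtain p where p: "p \<in> vfields G" "\<And>g. g \<in> ?S \<Longrightarrow> ip G p g = ip G f g"
      and dense: "\<And>e. e > 0 \<Longrightarrow> \<exists>g\<in>?S. hnorm G (\<lambda>x. g x - p x) < e"
  proof (rule subspace_representer[of ?S "ip G f" "(hnorm G f)\<^sup>2"])
    show "?S \<subseteq> vfields G" by auto
    show "(\<lambda>x. 0) \<in> ?S" by (rule image_eqI[of _ _ "[]"]) auto
    show "(\<lambda>x. g x + h x) \<in> ?S" if "g \<in> ?S" "h \<in> ?S" for g h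
    proof -
      obtain c c' where "g = kcomb G c" "h = kcomb G c'" "c \<in> lists (D \<times> UNIV)" "c' \<in> lists (D \<times> UNIV)"
        using \<open>g \<in> ?S\<close> \<open>h \<in> ?S\<close> by blast
      then show ?thesis by (intro image_eqI[of _ _ "c @ c'"]) (auto simp: kcomb_append)
    qed
    show "(\<lambda>x. r *\<^sub>R g x) \<in> ?S" if "g \<in> ?S" for r g
    proof -
      obtain c where "g = kcomb G c" "c \<in> lists (D \<times> UNIV)" using \<open>g \<in> ?S\<close> by blast
      then show ?thesis by (intro image_eqI[of _ _ "lscale r c"]) (auto simp: kcomb_lscale)
    qed
  qed (use f two_ip_le ip_add_right ip_scale_right that in auto)
  have "p = f"
  proof
    have "p y = f y" if "y \<in> D" for y
    proof -
      have "q \<bullet> p y = q \<bullet> f y" for q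
        using p(2)[of "kcomb G [(y, q)]"] ip_kcomb_right[OF p(1), of "[(y, q)]"]
          ip_kcomb_right[OF f, of "[(y, q)]"] that by (simp add: lpair_def)
      then show ?thesis by (metis inner_commute vector_eq_rdot)
    qed
    moreover have "closure D = UNIV"
      using D closure_eq_empty open_Int_closure_eq_empty[of "- closure D" D]
      by (metis Compl_iff closure_closed closure_subset compl_bot_eq double_compl open_Compl closed_closure subsetD)
    moreover have "continuous_on UNIV (\<lambda>x. p x - f x)"
      using continuous_fields p(1) f by (intro continuous_intros)
    ultimately show "p x = f x" for x
      using continuous_constant_on_closure[of D "\<lambda>x. p x - f x" 0] by simp
  qed
  then obtain c where c: "c \<in> lists (D \<times> UNIV)" "hnorm G (\<lambda>x. kcomb G c x - f x) < e / 2"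
    using dense[of "e / 2"] e by auto
  have "\<exists>c'\<in>lists (D \<times> D). hnorm G (\<lambda>x. kcomb G c' x - kcomb G c x) < r" if "r > 0" for r
    using c(1) that
  proof (induction c arbitrary: r)
    case Nil
    then show ?case by (intro bexI[of _ "[]"]) auto
  next
    case (Cons a c)
    obtain y q where a: "a = (y, q)" by (cases a)
    then have "y \<in> D" using Cons.hyps(1) by simp
    obtain c' where c': "c' \<in> lists (D \<times> D)" "hnorm G (\<lambda>x. kcomb G c' x - kcomb G c x) < r / 2"
      using Cons.IH[of "r / 2"] Cons.prems by auto
    obtain C where C: "C \<ge> 0" "\<And>q. hnorm G (\<lambda>x. blinfun_apply (kernel G x y) q) \<le> C * norm q"
      using kernel_hnorm_le[of y] by blast
    \<comment> \<open>The constant \<open>C\<close> may be \<open>0\<close>, hence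
      \<open>C + 1\<close>.\<close>
    obtain q' where q': "q' \<in> D" "norm (q - q') < r / (2 * (C + 1))"
      using near[of "r / (2 * (C + 1))" q] C(1) Cons.prems by (auto simp: divide_pos_pos)
    have "hnorm G (\<lambda>x. blinfun_apply (kernel G x y) (q' - q)) \<le> C * norm (q - q')"
      using C(2)[of "q' - q"] by (simp add: norm_minus_commute)
    also have "\<dots> \<le> (C + 1) * norm (q - q')" by (simp add: mult_right_mono)
    also have "\<dots> < r / 2" using q'(2) C(1) by (simp add: field_simps)
    finally have "hnorm G (\<lambda>x. blinfun_apply (kernel G x y) (q' - q)) +
        hnorm G (\<lambda>x. kcomb G c' x - kcomb G c x) < r" using c'(2) by simp
    with hnorm_triangle[OF kernel_in[of y "q' - q"] diff_in[OF kcomb_in[of c'] kcomb_in[of c]]]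
    have "hnorm G (\<lambda>x. blinfun_apply (kernel G x y) (q' - q) + (kcomb G c' x - kcomb G c x)) < r"
      by simp
    then have "hnorm G (\<lambda>x. kcomb G ((y, q') # c') x - kcomb G ((y, q) # c) x) < r"
      by (simp add: kcomb_Cons blinfun.diff_right algebra_simps)
    then show ?case using a \<open>y \<in> D\<close> q'(1) c'(1) by (intro bexI[of _ "(y, q') # c'"]) auto
  qed
  from this[of "e / 2"] e obtain c'
    where "c' \<in> lists (D \<times> D)" "hnorm G (\<lambda>x. kcomb G c' x - kcomb G c x) < e / 2" by auto
  then show ?thesis
    using hnorm_triangle_diff[OF kcomb_in[of c'] kcomb_in[of c] f] c(2) by (intro bexI[of _ c']) auto
qed

text \<open>Completing the square: the value at \<open>c\<close> is the squared norm of
  \<open>f\<close> minus the squared distance from \<open>f\<close> to the combination, and density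
  closes the gap. The supremum is countable if \<open>D\<close> is.\<close>

lemma hnorm_sq_eq_SUP:
  assumes D: "\<And>U::'a set. open U \<Longrightarrow> U \<noteq> {} \<Longrightarrow> \<exists>d\<in>D. d \<in> U" and f: "f \<in> vfields G"
  shows "(hnorm G f)\<^sup>2 = (SUP c\<in>lists (D \<times> D). 2 * lpair c f - lpair c (kcomb G c))"
    and "bdd_above ((\<lambda>c. 2 * lpair c f - lpair c (kcomb G c)) ` lists (D \<times> D))"
proof -
  have eq: "2 * lpair c f - lpair c (kcomb G c) = (hnorm G f)\<^sup>2 - (hnorm G (\<lambda>x. kcomb G c x - f x))\<^sup>2" for c
    using hnorm_diff_sq[OF kcomb_in f, of c] ip_kcomb[OF f, of c] hnorm_kcomb_sq[of c] by simp
  show bdd: "bdd_above ((\<lambda>c. 2 * lpair c f - lpair c (kcomb G c)) ` lists (D \<times> D))"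
    unfolding eq by (auto simp: bdd_above_def intro!: exI[of _ "(hnorm G f)\<^sup>2"])
  show "(hnorm G f)\<^sup>2 = (SUP c\<in>lists (D \<times> D). 2 * lpair c f - lpair c (kcomb G c))"
  proof (rule antisym)
    show "(SUP c\<in>lists (D \<times> D). 2 * lpair c f - lpair c (kcomb G c)) \<le> (hnorm G f)\<^sup>2"
      unfolding eq by (rule cSUP_least) auto
    show "(hnorm G f)\<^sup>2 \<le> (SUP c\<in>lists (D \<times> D). 2 * lpair c f - lpair c (kcomb G c))"
    proof (rule field_le_epsilon)
      fix e :: real assume "e > 0"
      then obtain c where c: "c \<in> lists (D \<times> D)" "hnorm G (\<lambda>x. kcomb G c x - f x) < sqrt e"
        using kcomb_dense[OF D f, of "sqrt e"] by auto
      have "(hnorm G (\<lambda>x. kcomb G c x - f x))\<^sup>2 \<le> (sqrt e)\<^sup>2"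
          using c(2) by (intro power_mono hnorm_nonneg diff_in f kcomb_in) simp
      then have "(hnorm G f)\<^sup>2 \<le> (2 * lpair c f - lpair c (kcomb G c)) + e"
        unfolding eq using \<open>e > 0\<close> by simp
      also have "2 * lpair c f - lpair c (kcomb G c)
          \<le> (SUP c\<in>lists (D \<times> D). 2 * lpair c f - lpair c (kcomb G c))"
        by (rule cSUP_upper[OF c(1) bdd])
      finally show "(hnorm G f)\<^sup>2 \<le> (SUP c\<in>lists (D \<times> D). 2 * lpair c f - lpair c (kcomb G c)) + e"
        by simp
    qed
  qed
qed

end

lemma borel_measurable_lpair:
  assumes "\<And>x. (\<lambda>m. w m x) \<in> borel_measurable M"
  shows "(\<lambda>m. lpair c (w m)) \<in> borel_measurable M"
  by (induction c) (use assms in \<open>auto simp: lpair_def\<close>)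

lemma borel_measurable_kcomb:
  assumes "\<And>y q. (\<lambda>m. blinfun_apply (kernel (G m) x y) q) \<in> borel_measurable M"
  shows "(\<lambda>m. kcomb (G m) c x) \<in> borel_measurable M"
  by (induction c) (use assms in \<open>auto simp: kcomb_def\<close>)

text \<open>By density, the squared norm is a supremum over countably many kernel combinations.\<close>

lemma borel_measurable_hnorm:
  fixes G :: "'m \<Rightarrow> 'a::euclidean_space field_space"
  assumes G: "\<And>m. m \<in> space M \<Longrightarrow> continuous_rkhs (G m)"
    and k: "\<And>x y q. (\<lambda>m. blinfun_apply (kernel (G m) x y) q) \<in> borel_measurable M"
    and w: "\<And>x. (\<lambda>m. w m x) \<in> borel_measurable M"
    and win: "\<And>m. m \<in> space M \<Longrightarrow> w m \<in> vfields (G m)"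
  shows "(\<lambda>m. hnorm (G m) (w m)) \<in> borel_measurable M"
proof -
  obtain D :: "'a set" where D: "countable D" "\<And>U. open U \<Longrightarrow> U \<noteq> {} \<Longrightarrow> \<exists>d\<in>D. d \<in> U"
    using countable_dense_setE by blast
  let ?F = "\<lambda>m. SUP c\<in>lists (D \<times> D). 2 * lpair c (w m) - lpair c (kcomb (G m) c)"
  have eq: "hnorm (G m) (w m) = sqrt (?F m)" if "m \<in> space M" for m
  proof -
    interpret continuous_rkhs "G m" using G that .
    show ?thesis
      using hnorm_sq_eq_SUP(1)[OF D(2) win[OF that]] hnorm_nonneg[OF win[OF that]]
      by (metis real_sqrt_unique)
  qed
  have "?F \<in> borel_measurable M"
  proof (rule borel_measurable_cSUP)
    show "countable (lists (D \<times> D))" using D(1) by (intro countable_lists) auto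
    show "(\<lambda>m. 2 * lpair c (w m) - lpair c (kcomb (G m) c)) \<in> borel_measurable M" for c
      by (intro borel_measurable_diff borel_measurable_times borel_measurable_const
          borel_measurable_lpair borel_measurable_kcomb w k)
    show "bdd_above ((\<lambda>c. 2 * lpair c (w m) - lpair c (kcomb (G m) c)) ` lists (D \<times> D))"
      if "m \<in> space M" for m
    proof -
      interpret continuous_rkhs "G m" using G that .
      show ?thesis by (rule hnorm_sq_eq_SUP(2)[OF D(2) win[OF that]])
    qed
  qed
  then have "(\<lambda>m. sqrt (?F m)) \<in> borel_measurable M" by simp
  then show ?thesis using eq by (simp cong: measurable_cong)
qed

section \<open>Integrated kernels\<close>

lemma C1_field_continuous: "C1_field \<Omega> v \<Longrightarrow> continuous_on UNIV v"
  and C1_field_outside: "C1_field \<Omega> v \<Longrightarrow> x \<notin> \<Omega> \<Longrightarrow> v x = 0"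
  unfolding C1_field_def by auto

lemma C1_field_has_derivative:
  "C1_field \<Omega> v \<Longrightarrow> x \<in> \<Omega> \<Longrightarrow> (v has_derivative frechet_derivative v (at x)) (at x)"
  unfolding C1_field_def by (metis differentiableI frechet_derivative_works)

lemma C1_field_continuous_derivative:
  assumes "C1_field \<Omega> v"
  shows "continuous_on \<Omega> (\<lambda>x. frechet_derivative v (at x) h)"
proof -
  obtain v' where v': "continuous_on \<Omega> v'" "\<And>x. x \<in> \<Omega> \<Longrightarrow> (v has_derivative blinfun_apply (v' x)) (at x)"
    using assms unfolding C1_field_def by blast
  have "frechet_derivative v (at x) h = blinfun_apply (v' x) h" if "x \<in> \<Omega>" for x
    using frechet_derivative_at[OF v'(2)[OF that]] by simp
  moreover have "continuous_on \<Omega> (\<lambda>x. blinfun_apply (v' x) h)" by (intro continuous_intros v'(1))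
  ultimately show ?thesis by simp
qed

lemma norm_le_of_norm_1_inf:
  assumes "norm_1_inf \<Omega> v \<le> ennreal K" "K \<ge> 0" "x \<in> \<Omega>"
  shows "norm (v x) \<le> K" and "onorm (frechet_derivative v (at x)) \<le> K"
proof -
  have "ennreal (norm (v x)) \<le> (SUP x\<in>\<Omega>. ennreal (norm (v x)))" using assms(3) by (rule SUP_upper)
  also have "\<dots> \<le> norm_1_inf \<Omega> v" unfolding norm_1_inf_def by simp
  finally show "norm (v x) \<le> K" using assms(1,2) by (metis ennreal_le_iff order_trans)
  have "ennreal (onorm (frechet_derivative v (at x))) \<le>
      (SUP x\<in>\<Omega>. ennreal (onorm (frechet_derivative v (at x))))" using assms(3) by (rule SUP_upper)
  also have "\<dots> \<le> norm_1_inf \<Omega> v" unfolding norm_1_inf_def by simp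
  finally show "onorm (frechet_derivative v (at x)) \<le> K"
    using assms(1,2) by (metis ennreal_le_iff order_trans)
qed

text \<open>The fields vanish at the boundary, so a bound on the derivative in \<open>\<Omega>\<close> yields a global
  Lipschitz bound although \<open>\<Omega>\<close> need not be convex.\<close>

lemma C1_field_Lipschitz:
  assumes \<Omega>: "open \<Omega>" and v: "C1_field \<Omega> v" and K: "norm_1_inf \<Omega> v \<le> ennreal K" "K \<ge> 0"
  shows "norm (v x - v y) \<le> K * norm (x - y)"
proof -
  \<comment> \<open>Mean value inequality on a part of a segment. Only the open interval of
    parameters has to lie in \<open>\<Omega>\<close>, since at a boundary point \<open>v\<close> is
    merely continuous.\<close>
  have seg: "norm (v (x + T *\<^sub>R (y - x)) - v x) \<le> K * norm (y - x) * T"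
    if T: "0 \<le> T" "\<And>t. 0 < t \<Longrightarrow> t < T \<Longrightarrow> x + t *\<^sub>R (y - x) \<in> \<Omega>" for x y T
  proof (cases "T = 0")
    case False
    have "norm ((\<lambda>t. v (x + t *\<^sub>R (y - x))) T - (\<lambda>t. v (x + t *\<^sub>R (y - x))) 0)
        \<le> K * norm (y - x) * T - K * norm (y - x) * 0"
    proof (rule differentiable_bound_general[where \<phi> = "\<lambda>t. K * norm (y - x) * t" and \<phi>' = "\<lambda>_. K * norm (y - x)"
          and f' = "\<lambda>t. frechet_derivative v (at (x + t *\<^sub>R (y - x))) (y - x)"])
      show "continuous_on {0..T} (\<lambda>t. v (x + t *\<^sub>R (y - x)))"
        by (rule continuous_on_compose2[OF C1_field_continuous[OF v]]) (auto intro!: continuous_intros)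
      fix t assume t: "0 < t" "t < T"
      let ?p = "x + t *\<^sub>R (y - x)"
      have p: "?p \<in> \<Omega>" using T(2) t by simp
      have D: "(v has_derivative frechet_derivative v (at ?p)) (at ?p)"
        by (rule C1_field_has_derivative[OF v p])
      have "((\<lambda>t. x + t *\<^sub>R (y - x)) has_vector_derivative (y - x)) (at t)"
        by (auto intro!: derivative_eq_intros simp: has_vector_derivative_def)
      from vector_derivative_diff_chain_within[OF this has_derivative_at_withinI[OF D]]
      show "((\<lambda>t. v (x + t *\<^sub>R (y - x))) has_vector_derivative
          frechet_derivative v (at ?p) (y - x)) (at t)"
        by (simp add: o_def)
      have "norm (frechet_derivative v (at ?p) (y - x)) \<le>
          onorm (frechet_derivative v (at ?p)) * norm (y - x)"
        by (rule onorm[OF has_derivative_bounded_linear[OF D]])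
      also have "\<dots> \<le> K * norm (y - x)"
        by (intro mult_right_mono norm_le_of_norm_1_inf[OF K p]) simp
      finally show "norm (frechet_derivative v (at ?p) (y - x)) \<le> K * norm (y - x)" .
    qed (use False T in \<open>auto intro!: continuous_intros derivative_eq_intros
        simp: has_real_derivative_iff_has_vector_derivative[symmetric]\<close>)
    then show ?thesis by simp
  qed simp
  have outside: "norm (v x) \<le> K * norm (x - y)" if y: "y \<notin> \<Omega>" for x y
  proof (cases "x \<in> \<Omega>")
    case True
    \<comment> \<open>The parameters at which the segment is outside \<open>\<Omega>\<close> form a
      nonempty compact set; its minimum \<open>T\<close> is the first exit, where \<open>v\<close>
      is zero.\<close>
    let ?S = "{t \<in> {0..1}. x + t *\<^sub>R (y - x) \<in> - \<Omega>}"
    have "closed ?S"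
      using \<Omega> by (intro continuous_closed_preimage[unfolded vimage_def Int_def, simplified] continuous_intros) auto
    then have "compact ?S"
      by (auto simp: compact_eq_bounded_closed intro: bounded_subset[OF bounded_closed_interval[of 0 1]])
    moreover have "1 \<in> ?S" using y by simp
    ultimately obtain T where T: "T \<in> ?S" "\<And>t. t \<in> ?S \<Longrightarrow> T \<le> t"
      using compact_attains_inf[of ?S] by blast
    have "norm (v (x + T *\<^sub>R (y - x)) - v x) \<le> K * norm (y - x) * T"
    proof (rule seg)
      show "x + t *\<^sub>R (y - x) \<in> \<Omega>" if "0 < t" "t < T" for t
        using T(1) T(2)[of t] that by fastforce
    qed (use T(1) in simp)
    moreover have "v (x + T *\<^sub>R (y - x)) = 0" using C1_field_outside[OF v] T(1) by auto
    moreover have "K * norm (y - x) * T \<le> K * norm (y - x) * 1"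
      using T(1) K(2) by (intro mult_left_mono) auto
    ultimately show ?thesis by (simp add: norm_minus_commute)
  next
    case False
    then show ?thesis using C1_field_outside[OF v] K(2) by simp
  qed
  show ?thesis
  proof (cases "\<exists>t\<in>{0..1}. x + t *\<^sub>R (y - x) \<notin> \<Omega>")
    case True
    \<comment> \<open>Both endpoints are compared with the value zero at the point \<open>?z\<close>
      of the segment. The two distances add up to \<open>norm (x - y)\<close>, so the constant stays
      \<open>K\<close>.\<close>
    then obtain t where t: "0 \<le> t" "t \<le> 1" and z: "x + t *\<^sub>R (y - x) \<notin> \<Omega>" by auto
    let ?z = "x + t *\<^sub>R (y - x)"
    have *: "y - ?z = (1 - t) *\<^sub>R (y - x)" by (simp add: algebra_simps)
    have "norm (x - ?z) = t * norm (x - y)" using t by (simp add: norm_minus_commute)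
    moreover have "norm (y - ?z) = (1 - t) * norm (x - y)"
      unfolding * using t by (simp add: norm_minus_commute)
    ultimately have "norm (v x) + norm (v y) \<le> K * (t * norm (x - y)) + K * ((1 - t) * norm (x - y))"
      using outside[OF z, of x] outside[OF z, of y] by simp
    also have "\<dots> = K * norm (x - y)" by (simp add: algebra_simps)
    finally show ?thesis using norm_triangle_ineq4[of "v x" "v y"] by simp
  next
    case False
    then have "norm (v (x + 1 *\<^sub>R (y - x)) - v x) \<le> K * norm (y - x) * 1"
      by (intro seg) auto
    then show ?thesis by (simp add: norm_minus_commute)
  qed
qed

text \<open>The scales form an abstract finite measure space, to be instantiated both by the whole
  unit interval and by its half-open pieces.\<close>

locale kernel_bundle = finite_measure \<mu> for \<mu> :: "'s measure" +
  fixes \<Omega> :: "'a::euclidean_space set" and H :: "'s \<Rightarrow> 'a field_space" and M :: "'s \<Rightarrow> real"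
  assumes open_\<Omega>: "open \<Omega>"
    and hilbert_H: "s \<in> space \<mu> \<Longrightarrow> hilbert_space (H s)"
    and C1_H: "s \<in> space \<mu> \<Longrightarrow> v \<in> vfields (H s) \<Longrightarrow> C1_field \<Omega> v"
    and M_nonneg: "s \<in> space \<mu> \<Longrightarrow> 0 \<le> M s"
    and norm_1_inf_H: "s \<in> space \<mu> \<Longrightarrow> v \<in> vfields (H s) \<Longrightarrow> norm_1_inf \<Omega> v \<le> ennreal (M s * hnorm (H s) v)"
    and M_measurable [measurable]: "M \<in> borel_measurable \<mu>"
    and M_square_integrable: "integrable \<mu> (\<lambda>s. (M s)\<^sup>2)"
    and kernel_measurable_\<Omega>: "x \<in> \<Omega> \<Longrightarrow> y \<in> \<Omega> \<Longrightarrow>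
      (\<lambda>s. blinfun_apply (kernel (H s) x y) q) \<in> borel_measurable \<mu>"
begin

lemma M_hnorm_nonneg: "s \<in> space \<mu> \<Longrightarrow> v \<in> vfields (H s) \<Longrightarrow> 0 \<le> M s * hnorm (H s) v"
  using hilbert_H by (intro mult_nonneg_nonneg M_nonneg hilbert_fields.hnorm_nonneg) (auto simp: hilbert_fields_def)

lemma H_bound:
  assumes "s \<in> space \<mu>" "v \<in> vfields (H s)"
  shows "norm (v x) \<le> M s * hnorm (H s) v"
  using norm_le_of_norm_1_inf(1)[OF norm_1_inf_H[OF assms] M_hnorm_nonneg[OF assms]]
    C1_field_outside[OF C1_H[OF assms]] M_hnorm_nonneg[OF assms] by (cases "x \<in> \<Omega>") auto

lemma H_Lipschitz:
  assumes "s \<in> space \<mu>" "v \<in> vfields (H s)"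
  shows "norm (v x - v y) \<le> M s * hnorm (H s) v * norm (x - y)"
  by (rule C1_field_Lipschitz[OF open_\<Omega> C1_H[OF assms] norm_1_inf_H[OF assms] M_hnorm_nonneg[OF assms]])

lemma continuous_rkhs_H: "s \<in> space \<mu> \<Longrightarrow> continuous_rkhs (H s)"
  using hilbert_H C1_field_continuous[OF C1_H] H_bound
  by unfold_locales blast+

lemma kernel_outside:
  assumes "s \<in> space \<mu>" "x \<notin> \<Omega> \<or> y \<notin> \<Omega>"
  shows "blinfun_apply (kernel (H s) x y) q = 0"
proof -
  interpret continuous_rkhs "H s" using continuous_rkhs_H assms(1) .
  show ?thesis
    using kernel_eq_0[of x x y q] kernel_eq_0[of y x y q] C1_field_outside[OF C1_H[OF assms(1)]] assms(2) by blast
qed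

lemma kernel_measurable [measurable]: "(\<lambda>s. blinfun_apply (kernel (H s) x y) q) \<in> borel_measurable \<mu>"
proof (cases "x \<in> \<Omega> \<and> y \<in> \<Omega>")
  case False
  then have "(\<lambda>s. blinfun_apply (kernel (H s) x y) q) \<in> borel_measurable \<mu> \<longleftrightarrow>
      (\<lambda>s. 0::'a) \<in> borel_measurable \<mu>"
    by (intro measurable_cong kernel_outside) auto
  then show ?thesis by simp
qed (use kernel_measurable_\<Omega> in blast)

text \<open>The norm of a section is at most \<open>M s * norm q\<close> by duality, and evaluating
  it costs another factor \<open>M s\<close>. This is why square integrability of \<open>M\<close>
  makes the kernel integrable.\<close>

lemma kernel_bound:
  assumes "s \<in> space \<mu>"
  shows "norm (blinfun_apply (kernel (H s) x y) q) \<le> (M s)\<^sup>2 * norm q"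
    and "hnorm (H s) (\<lambda>x. blinfun_apply (kernel (H s) x y) q) \<le> M s * norm q"
proof -
  interpret continuous_rkhs "H s" using continuous_rkhs_H assms .
  define k where "k = (\<lambda>x. blinfun_apply (kernel (H s) x y) q)"
  have k: "k \<in> vfields (H s)" unfolding k_def by (rule kernel_in)
  show *: "hnorm (H s) (\<lambda>x. blinfun_apply (kernel (H s) x y) q) \<le> M s * norm q"
    unfolding k_def[symmetric]
  proof (cases "hnorm (H s) k = 0")
    case False
    have "hnorm (H s) k * hnorm (H s) k = q \<bullet> k y"
      using hnorm_sq[OF k] ip_kernel[OF k, of y q] by (simp add: power2_eq_square k_def)
    also have "\<dots> \<le> norm q * norm (k y)" by (rule norm_cauchy_schwarz)
    also have "\<dots> \<le> norm q * (M s * hnorm (H s) k)"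
      by (intro mult_left_mono H_bound assms k) auto
    finally have "hnorm (H s) k * hnorm (H s) k \<le> (M s * norm q) * hnorm (H s) k"
      by (simp add: mult_ac)
    moreover have "hnorm (H s) k > 0" using hnorm_nonneg[OF k] False by linarith
    ultimately show "hnorm (H s) k \<le> M s * norm q" by (simp only: mult_le_cancel_right_pos)
  qed (use M_nonneg assms in simp)
  have "norm (k x) \<le> M s * hnorm (H s) k" by (rule H_bound[OF assms k])
  also have "\<dots> \<le> M s * (M s * norm q)"
    using * M_nonneg[OF assms] unfolding k_def by (intro mult_left_mono)
  finally show "norm (blinfun_apply (kernel (H s) x y) q) \<le> (M s)\<^sup>2 * norm q"
    unfolding k_def by (simp add: power2_eq_square mult_ac)
qed

lemma kernel_integrable: "integrable \<mu> (\<lambda>s. blinfun_apply (kernel (H s) x y) q)"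
  by (rule Bochner_Integration.integrable_bound[of _ "\<lambda>s. (M s)\<^sup>2 * norm q"])
    (use M_square_integrable kernel_bound in auto)

lemma kcomb_integrable: "integrable \<mu> (\<lambda>s. kcomb (H s) c x)"
  unfolding kcomb_def by (induction c) (auto intro!: Bochner_Integration.integrable_add kernel_integrable)

text \<open>Pointwise measurability is the form that passes through limits and integrals; joint
  measurability and that of the norm are recovered from it for continuous fields in
  \<open>sections_iff\<close>.\<close>

definition L2_section :: "('s \<Rightarrow> 'a vfield) \<Rightarrow> bool" where
  "L2_section w \<longleftrightarrow> (\<forall>s\<in>space \<mu>. w s \<in> vfields (H s)) \<and> (\<forall>x. (\<lambda>s. w s x) \<in> borel_measurable \<mu>) \<and>
     integrable \<mu> (\<lambda>s. (hnorm (H s) (w s))\<^sup>2)"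

lemma L2_sectionD:
  assumes "L2_section w"
  shows "s \<in> space \<mu> \<Longrightarrow> w s \<in> vfields (H s)" and "(\<lambda>s. w s x) \<in> borel_measurable \<mu>"
    and "integrable \<mu> (\<lambda>s. (hnorm (H s) (w s))\<^sup>2)"
  using assms unfolding L2_section_def by auto

lemma hnorm_measurable:
  assumes "\<And>s. s \<in> space \<mu> \<Longrightarrow> w s \<in> vfields (H s)" "\<And>x. (\<lambda>s. w s x) \<in> borel_measurable \<mu>"
  shows "(\<lambda>s. hnorm (H s) (w s)) \<in> borel_measurable \<mu>"
  by (intro borel_measurable_hnorm continuous_rkhs_H kernel_measurable assms)

lemma lpair_integrable:
  assumes "\<And>x. integrable \<mu> (\<lambda>s. w s x)"
  shows "integrable \<mu> (\<lambda>s. lpair c (w s))" and "(\<integral>s. lpair c (w s) \<partial>\<mu>) = lpair c (\<lambda>x. \<integral>s. w s x \<partial>\<mu>)"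
proof -
  have "integrable \<mu> (\<lambda>s. lpair c (w s)) \<and> (\<integral>s. lpair c (w s) \<partial>\<mu>) = lpair c (\<lambda>x. \<integral>s. w s x \<partial>\<mu>)"
  proof (induction c)
    case (Cons a c)
    obtain y q where a: "a = (y, q)" by (cases a)
    have "integrable \<mu> (\<lambda>s. q \<bullet> w s y)" using assms by simp
    then show ?case using Cons assms unfolding a lpair_Cons
      by (simp add: Bochner_Integration.integral_add)
  qed simp
  then show "integrable \<mu> (\<lambda>s. lpair c (w s))" "(\<integral>s. lpair c (w s) \<partial>\<mu>) = lpair c (\<lambda>x. \<integral>s. w s x \<partial>\<mu>)"
    by auto
qed

text \<open>The squared norm is \<open>lpair c\<close> of the combination, a finite sum of kernel
  entries, hence integrable.\<close>

lemma kcomb_L2_section: "L2_section (\<lambda>s. kcomb (H s) c)"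
proof -
  have "kcomb (H s) c \<in> vfields (H s)" "(hnorm (H s) (kcomb (H s) c))\<^sup>2 = lpair c (kcomb (H s) c)"
    if "s \<in> space \<mu>" for s
  proof -
    interpret continuous_rkhs "H s" using continuous_rkhs_H that .
    show "kcomb (H s) c \<in> vfields (H s)" "(hnorm (H s) (kcomb (H s) c))\<^sup>2 = lpair c (kcomb (H s) c)"
      using hnorm_kcomb_sq by auto
  qed
  moreover have "integrable \<mu> (\<lambda>s. lpair c (kcomb (H s) c))"
    by (intro lpair_integrable kcomb_integrable)
  ultimately show ?thesis unfolding L2_section_def
    by (auto simp: borel_measurable_kcomb cong: Bochner_Integration.integrable_cong)
qed

lemma L2_section_diff:
  assumes w: "L2_section w" and w': "L2_section w'"
  shows "L2_section (\<lambda>s x. w s x - w' s x)"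
proof -
  have "(\<lambda>x. w s x - w' s x) \<in> vfields (H s)" and
    "(hnorm (H s) (\<lambda>x. w s x - w' s x))\<^sup>2 \<le> 2 * (hnorm (H s) (w s))\<^sup>2 + 2 * (hnorm (H s) (w' s))\<^sup>2"
    if "s \<in> space \<mu>" for s
  proof -
    interpret continuous_rkhs "H s" using continuous_rkhs_H that .
    show "(\<lambda>x. w s x - w' s x) \<in> vfields (H s)"
      "(hnorm (H s) (\<lambda>x. w s x - w' s x))\<^sup>2 \<le> 2 * (hnorm (H s) (w s))\<^sup>2 + 2 * (hnorm (H s) (w' s))\<^sup>2"
      using parallelogram[OF L2_sectionD(1)[OF w that] L2_sectionD(1)[OF w' that]]
        diff_in[OF L2_sectionD(1)[OF w that] L2_sectionD(1)[OF w' that]]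
        zero_le_power2[of "hnorm (H s) (\<lambda>x. w s x + w' s x)"] by (auto simp only:)
  qed
  note * = this
  moreover have "integrable \<mu> (\<lambda>s. (hnorm (H s) (\<lambda>x. w s x - w' s x))\<^sup>2)"
  proof (rule Bochner_Integration.integrable_bound)
    show "integrable \<mu> (\<lambda>s. 2 * (hnorm (H s) (w s))\<^sup>2 + 2 * (hnorm (H s) (w' s))\<^sup>2)"
      using L2_sectionD(3)[OF w] L2_sectionD(3)[OF w'] by simp
    show "(\<lambda>s. (hnorm (H s) (\<lambda>x. w s x - w' s x))\<^sup>2) \<in> borel_measurable \<mu>"
      using * L2_sectionD(2)[OF w] L2_sectionD(2)[OF w']
      by (intro borel_measurable_power hnorm_measurable borel_measurable_diff) auto
  qed (use * in auto)
  ultimately show ?thesis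
    using L2_sectionD(2)[OF w] L2_sectionD(2)[OF w'] unfolding L2_section_def by auto
qed

lemma L2_section_scale:
  assumes w: "L2_section w"
  shows "L2_section (\<lambda>s x. c *\<^sub>R w s x)"
proof -
  have "(\<lambda>x. c *\<^sub>R w s x) \<in> vfields (H s) \<and> hnorm (H s) (\<lambda>x. c *\<^sub>R w s x) = \<bar>c\<bar> * hnorm (H s) (w s)"
    if "s \<in> space \<mu>" for s
  proof -
    interpret continuous_rkhs "H s" using continuous_rkhs_H that .
    show ?thesis using scale_in hnorm_scale L2_sectionD(1)[OF w that] by blast
  qed
  then show ?thesis using L2_sectionD[OF w] unfolding L2_section_def
    by (auto simp: power_mult_distrib cong: Bochner_Integration.integrable_cong)
qed

lemma L2_section_add:
  assumes w: "L2_section w" and w': "L2_section w'"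
  shows "L2_section (\<lambda>s x. w s x + w' s x)"
  using L2_section_diff[OF w L2_section_scale[OF w', of "-1"]] by simp

text \<open>Pointwise \<open>\<bar>a * b\<bar> \<le> a^2 + b^2\<close>. The product bounds both the
  values and the Lipschitz constant of \<open>w s\<close>, so it serves as dominating function for
  integrals over the scales.\<close>

lemma M_hnorm_integrable:
  assumes w: "L2_section w"
  shows "integrable \<mu> (\<lambda>s. M s * hnorm (H s) (w s))"
proof (rule Bochner_Integration.integrable_bound)
  show "integrable \<mu> (\<lambda>s. (M s)\<^sup>2 + (hnorm (H s) (w s))\<^sup>2)"
    using M_square_integrable L2_sectionD(3)[OF w] by simp
  show "(\<lambda>s. M s * hnorm (H s) (w s)) \<in> borel_measurable \<mu>"
    by (intro borel_measurable_times M_measurable hnorm_measurable L2_sectionD[OF w])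
  have "\<bar>a * b\<bar> \<le> a\<^sup>2 + b\<^sup>2" for a b :: real
  proof -
    have "0 \<le> (\<bar>a\<bar> - \<bar>b\<bar>)\<^sup>2" by simp
    then have "2 * (\<bar>a\<bar> * \<bar>b\<bar>) \<le> a\<^sup>2 + b\<^sup>2" by (simp add: power2_diff)
    then show ?thesis using mult_nonneg_nonneg[of "\<bar>a\<bar>" "\<bar>b\<bar>"] unfolding abs_mult by linarith
  qed
  then show "AE s in \<mu>. norm (M s * hnorm (H s) (w s)) \<le> norm ((M s)\<^sup>2 + (hnorm (H s) (w s))\<^sup>2)"
    by auto
qed

lemma L2_section_integrable:
  assumes w: "L2_section w"
  shows "integrable \<mu> (\<lambda>s. w s x)"
  by (rule Bochner_Integration.integrable_bound[OF M_hnorm_integrable[OF w]])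
    (use L2_sectionD[OF w] H_bound M_hnorm_nonneg in auto)

end

text \<open>The kernel identity is assumed at all points: where one argument is outside
  \<open>\<Omega>\<close>, both kernels vanish, which \<open>integral_rkhs_piece\<close> checks.
  Continuity of the fields of \<open>HD\<close> is derived from bounded evaluation and the
  kernel.\<close>

locale integral_rkhs = kernel_bundle \<mu> \<Omega> H M
  for \<mu> :: "'s measure" and \<Omega> :: "'a::euclidean_space set" and H M +
  fixes HD :: "'a field_space"
  assumes eval_bounded_HD: "eval_bounded HD"
    and kernel_HD: "blinfun_apply (kernel HD x y) q = (\<integral>s. blinfun_apply (kernel (H s) x y) q \<partial>\<mu>)"
begin

sublocale HD: eval_bounded HD by (rule eval_bounded_HD)

lemma kcomb_HD: "kcomb HD c x = (\<integral>s. kcomb (H s) c x \<partial>\<mu>)"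
proof (induction c)
  case (Cons a c)
  obtain y q where a: "a = (y, q)" by (cases a)
  show ?case unfolding a kcomb_Cons
    by (simp add: Cons kernel_HD Bochner_Integration.integral_add kernel_integrable kcomb_integrable)
qed simp

lemma hnorm_kcomb_H_sq: "s \<in> space \<mu> \<Longrightarrow> (hnorm (H s) (kcomb (H s) c))\<^sup>2 = lpair c (kcomb (H s) c)"
  using continuous_rkhs_H eval_bounded.hnorm_kcomb_sq continuous_rkhs_def by blast

text \<open>The pairing \<open>lpair c\<close> is a finite sum and so commutes with the integral
  over scales; both squared norms are such pairings.\<close>

lemma hnorm_kcomb_HD: "(hnorm HD (kcomb HD c))\<^sup>2 = (\<integral>s. (hnorm (H s) (kcomb (H s) c))\<^sup>2 \<partial>\<mu>)"
proof -
  have "(hnorm HD (kcomb HD c))\<^sup>2 = lpair c (\<lambda>x. \<integral>s. kcomb (H s) c x \<partial>\<mu>)"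
    unfolding HD.hnorm_kcomb_sq by (simp add: kcomb_HD[abs_def])
  also have "\<dots> = (\<integral>s. lpair c (kcomb (H s) c) \<partial>\<mu>)"
    by (rule lpair_integrable(2)[symmetric]) (rule kcomb_integrable)
  also have "\<dots> = (\<integral>s. (hnorm (H s) (kcomb (H s) c))\<^sup>2 \<partial>\<mu>)"
    by (intro Bochner_Integration.integral_cong refl) (simp add: hnorm_kcomb_H_sq)
  finally show ?thesis .
qed

text \<open>\<open>two_ip_le\<close> is used in each fibre with the same list \<open>c\<close> and
  integrated; \<open>kernel_pairing_in\<close> then yields membership and the norm bound
  together.\<close>

lemma integral_in_HD:
  assumes w: "L2_section w"
  shows "(\<lambda>x. \<integral>s. w s x \<partial>\<mu>) \<in> vfields HD"
    and "(hnorm HD (\<lambda>x. \<integral>s. w s x \<partial>\<mu>))\<^sup>2 \<le> (\<integral>s. (hnorm (H s) (w s))\<^sup>2 \<partial>\<mu>)"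
proof -
  have "2 * lpair c (\<lambda>x. \<integral>s. w s x \<partial>\<mu>) - (hnorm HD (kcomb HD c))\<^sup>2
      \<le> (\<integral>s. (hnorm (H s) (w s))\<^sup>2 \<partial>\<mu>)" for c
  proof -
    have "2 * lpair c (\<lambda>x. \<integral>s. w s x \<partial>\<mu>) - (hnorm HD (kcomb HD c))\<^sup>2 =
        (\<integral>s. 2 * lpair c (w s) - (hnorm (H s) (kcomb (H s) c))\<^sup>2 \<partial>\<mu>)"
      unfolding hnorm_kcomb_HD
      using lpair_integrable[of w c] L2_section_integrable[OF w] L2_sectionD(3)[OF kcomb_L2_section]
      by simp
    also have "\<dots> \<le> (\<integral>s. (hnorm (H s) (w s))\<^sup>2 \<partial>\<mu>)"
    proof (rule integral_mono)
      show "2 * lpair c (w s) - (hnorm (H s) (kcomb (H s) c))\<^sup>2 \<le> (hnorm (H s) (w s))\<^sup>2"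
        if "s \<in> space \<mu>" for s
      proof -
        interpret continuous_rkhs "H s" using continuous_rkhs_H that .
        show ?thesis
          using two_ip_le[OF L2_sectionD(1)[OF w that] kcomb_in[of c]]
            ip_kcomb_right[OF L2_sectionD(1)[OF w that], of c] by simp
      qed
    qed (use lpair_integrable[of w c] L2_section_integrable[OF w] L2_sectionD(3)[OF kcomb_L2_section]
        L2_sectionD(3)[OF w] in simp_all)
    finally show ?thesis .
  qed
  then show "(\<lambda>x. \<integral>s. w s x \<partial>\<mu>) \<in> vfields HD"
    "(hnorm HD (\<lambda>x. \<integral>s. w s x \<partial>\<mu>))\<^sup>2 \<le> (\<integral>s. (hnorm (H s) (w s))\<^sup>2 \<partial>\<mu>)"
    using HD.kernel_pairing_in by blast+
qed

text \<open>Embedding constant of \<open>HD\<close> into bounded Lipschitz fields: by duality the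
  fibre constants combine as an \<open>L2\<close> norm over the scales.\<close>

definition "K_HD = sqrt (\<integral>s. (M s)\<^sup>2 \<partial>\<mu>)"

lemma K_HD_nonneg: "K_HD \<ge> 0" unfolding K_HD_def by simp

text \<open>If \<open>lpair c\<close> has norm at most \<open>M s * B\<close> on every
  \<open>H s\<close>, then its squared norm on \<open>HD\<close>, the integral of the squared fibre
  norms, is at most \<open>K_HD^2 * B^2\<close>. The bound is tested on the representer of the
  functional, \<open>kcomb (H s) c\<close>.\<close>

lemma lpair_bound_HD:
  assumes f: "f \<in> vfields HD" and B: "B \<ge> 0"
    and bound: "\<And>s. s \<in> space \<mu> \<Longrightarrow> lpair c (kcomb (H s) c) \<le> M s * hnorm (H s) (kcomb (H s) c) * B"
  shows "\<bar>lpair c f\<bar> \<le> K_HD * hnorm HD f * B"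
proof -
  have "(hnorm (H s) (kcomb (H s) c))\<^sup>2 \<le> (M s)\<^sup>2 * B\<^sup>2" if s: "s \<in> space \<mu>" for s
  proof -
    interpret continuous_rkhs "H s" using continuous_rkhs_H s .
    define h where "h = hnorm (H s) (kcomb (H s) c)"
    have h: "h \<ge> 0" unfolding h_def by simp
    have "h * h \<le> (M s * B) * h" using bound[OF s] hnorm_kcomb_H_sq[OF s, of c]
      by (simp add: h_def power2_eq_square mult_ac)
    then have "h \<le> M s * B" using h M_nonneg[OF s] B
      by (cases "h = 0") (auto simp: mult_le_cancel_right)
    then have "h\<^sup>2 \<le> (M s * B)\<^sup>2" using h by (rule power_mono)
    then show ?thesis by (simp add: h_def power_mult_distrib)
  qed
  then have "(hnorm HD (kcomb HD c))\<^sup>2 \<le> (\<integral>s. (M s)\<^sup>2 * B\<^sup>2 \<partial>\<mu>)"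
    unfolding hnorm_kcomb_HD
    by (intro integral_mono L2_sectionD(3)[OF kcomb_L2_section]) (use M_square_integrable in auto)
  also have "\<dots> = (K_HD * B)\<^sup>2" by (simp add: K_HD_def power_mult_distrib)
  finally have "hnorm HD (kcomb HD c) \<le> K_HD * B"
    by (rule power2_le_imp_le) (simp add: K_HD_nonneg B)
  then have "hnorm HD (kcomb HD c) * hnorm HD f \<le> K_HD * B * hnorm HD f"
    using f by (intro mult_right_mono) auto
  then show ?thesis using HD.Cauchy_Schwarz[OF HD.kcomb_in f, of c] HD.ip_kcomb[OF f, of c]
    by (simp add: mult_ac)
qed

lemma HD_bound:
  assumes f: "f \<in> vfields HD"
  shows "norm (f x) \<le> K_HD * hnorm HD f"
proof (cases "f x = 0")
  case False
  have "\<bar>lpair [(x, f x)] f\<bar> \<le> K_HD * hnorm HD f * norm (f x)"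
  proof (rule lpair_bound_HD[OF f])
    fix s assume s: "s \<in> space \<mu>"
    interpret continuous_rkhs "H s" using continuous_rkhs_H s .
    let ?k = "kcomb (H s) [(x, f x)]"
    have "lpair [(x, f x)] ?k \<le> norm (f x) * norm (?k x)"
      by (simp add: lpair_def norm_cauchy_schwarz)
    also have "\<dots> \<le> norm (f x) * (M s * hnorm (H s) ?k)" by (intro mult_left_mono H_bound s) auto
    finally show "lpair [(x, f x)] ?k \<le> M s * hnorm (H s) ?k * norm (f x)" by (simp add: mult_ac)
  qed simp
  then have "norm (f x) * norm (f x) \<le> K_HD * hnorm HD f * norm (f x)"
    by (simp add: lpair_def power2_norm_eq_inner[symmetric] power2_eq_square)
  then show ?thesis using False by (simp add: mult_le_cancel_right)
qed (use K_HD_nonneg f in simp)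

text \<open>Applied to the functional \<open>g \<mapsto> q \<bullet> (g x - g y)\<close>. The bound
  has to come from duality and not from a lift: lifts are built from density, which uses the
  continuity deduced from it.\<close>

lemma HD_Lipschitz:
  assumes f: "f \<in> vfields HD"
  shows "norm (f x - f y) \<le> K_HD * hnorm HD f * norm (x - y)"
proof (cases "f x = f y")
  case False
  define q where "q = f x - f y"
  let ?c = "[(x, q), (y, - q)]"
  have lp: "lpair ?c g = q \<bullet> (g x - g y)" for g by (simp add: lpair_def inner_diff_right)
  have "\<bar>lpair ?c f\<bar> \<le> K_HD * hnorm HD f * (norm q * norm (x - y))"
  proof (rule lpair_bound_HD[OF f])
    fix s assume s: "s \<in> space \<mu>"
    interpret continuous_rkhs "H s" using continuous_rkhs_H s .
    let ?k = "kcomb (H s) ?c"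
    have "lpair ?c ?k \<le> norm q * norm (?k x - ?k y)"
      unfolding lp by (rule norm_cauchy_schwarz)
    also have "\<dots> \<le> norm q * (M s * hnorm (H s) ?k * norm (x - y))"
      by (intro mult_left_mono H_Lipschitz s) auto
    finally show "lpair ?c ?k \<le> M s * hnorm (H s) ?k * (norm q * norm (x - y))"
      by (simp add: mult_ac)
  qed simp
  then have "norm q * norm q \<le> K_HD * hnorm HD f * norm (x - y) * norm q"
    unfolding lp q_def[symmetric]
    by (simp add: power2_norm_eq_inner[symmetric] power2_eq_square mult_ac)
  then show ?thesis using False by (simp add: q_def mult_le_cancel_right)
qed (use K_HD_nonneg f in simp)

lemma continuous_rkhs_HD: "continuous_rkhs HD"
proof unfold_locales
  show "continuous_on UNIV f" if "f \<in> vfields HD" for f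
  proof (rule lipschitz_on_continuous_on)
    show "(K_HD * hnorm HD f)-lipschitz_on UNIV f"
      using HD_Lipschitz[OF that] K_HD_nonneg that by (intro lipschitz_onI) (auto simp: dist_norm)
  qed
qed

sublocale HD: continuous_rkhs HD by (rule continuous_rkhs_HD)

text \<open>\<open>w + w'\<close> integrates to twice the field, so its energy is at least four
  times the squared norm of the field, and the parallelogram identity leaves no energy for
  \<open>w - w'\<close>.\<close>

lemma minimal_L2_section_unique:
  assumes w: "L2_section w" and w': "L2_section w'"
    and eq: "\<And>x. (\<integral>s. w s x \<partial>\<mu>) = (\<integral>s. w' s x \<partial>\<mu>)"
    and min: "(\<integral>s. (hnorm (H s) (w s))\<^sup>2 \<partial>\<mu>) \<le> (hnorm HD (\<lambda>x. \<integral>s. w s x \<partial>\<mu>))\<^sup>2"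
      "(\<integral>s. (hnorm (H s) (w' s))\<^sup>2 \<partial>\<mu>) \<le> (hnorm HD (\<lambda>x. \<integral>s. w s x \<partial>\<mu>))\<^sup>2"
  shows "AE s in \<mu>. w s = w' s"
proof -
  let ?f = "\<lambda>x. \<integral>s. w s x \<partial>\<mu>"
  define n where "n u s = (hnorm (H s) (u s))\<^sup>2" for u s
  let ?p = "\<lambda>s x. w s x + w' s x" and ?m = "\<lambda>s x. w s x - w' s x"
  have p: "L2_section ?p" and m: "L2_section ?m"
    using L2_section_add L2_section_diff w w' by auto
  have int: "integrable \<mu> (n u)" if "L2_section u" for u
    unfolding n_def by (rule L2_sectionD(3)[OF that])
  have "(\<lambda>x. \<integral>s. w s x + w' s x \<partial>\<mu>) = (\<lambda>x. 2 *\<^sub>R ?f x)"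
    using L2_section_integrable[OF w] L2_section_integrable[OF w'] eq
    by (auto simp: scaleR_2)
  then have "(hnorm HD (\<lambda>x. 2 *\<^sub>R ?f x))\<^sup>2 \<le> integral\<^sup>L \<mu> (n ?p)"
    using integral_in_HD(2)[OF p] unfolding n_def by simp
  then have "4 * (hnorm HD ?f)\<^sup>2 \<le> integral\<^sup>L \<mu> (n ?p)"
    using HD.hnorm_scale[OF integral_in_HD(1)[OF w], of 2] by (simp add: power_mult_distrib)
  moreover have "integral\<^sup>L \<mu> (n ?p) + integral\<^sup>L \<mu> (n ?m) = 2 * integral\<^sup>L \<mu> (n w) + 2 * integral\<^sup>L \<mu> (n w')"
  proof -
    have "integral\<^sup>L \<mu> (n ?p) + integral\<^sup>L \<mu> (n ?m) = (\<integral>s. n ?p s + n ?m s \<partial>\<mu>)"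
      using int[OF p] int[OF m] by simp
    also have "\<dots> = (\<integral>s. 2 * n w s + 2 * n w' s \<partial>\<mu>)"
    proof (rule Bochner_Integration.integral_cong)
      fix s assume s: "s \<in> space \<mu>"
      interpret continuous_rkhs "H s" using continuous_rkhs_H s .
      show "n ?p s + n ?m s = 2 * n w s + 2 * n w' s"
        unfolding n_def by (rule parallelogram[OF L2_sectionD(1)[OF w s] L2_sectionD(1)[OF w' s]])
    qed simp
    also have "\<dots> = 2 * integral\<^sup>L \<mu> (n w) + 2 * integral\<^sup>L \<mu> (n w')"
      using int[OF w] int[OF w'] by simp
    finally show ?thesis .
  qed
  ultimately have "integral\<^sup>L \<mu> (n ?m) \<le> 0" using min unfolding n_def by linarith
  moreover have "integral\<^sup>L \<mu> (n ?m) \<ge> 0" by (simp add: n_def)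
  ultimately have "AE s in \<mu>. n ?m s = 0"
    using integral_nonneg_eq_0_iff_AE[OF int[OF m]] by (simp add: n_def)
  then show ?thesis
    using AE_space[of \<mu>]
  proof eventually_elim
    case (elim s)
    then interpret continuous_rkhs "H s" using continuous_rkhs_H by blast
    have "?m s = (\<lambda>x. 0)"
      using elim L2_sectionD(1)[OF m] by (intro hnorm_eq_0D) (auto simp: n_def)
    then show ?case by (simp add: fun_eq_iff)
  qed
qed

end

section \<open>Lifting to square integrable families\<close>

text \<open>Summability of the increments can be checked scale by scale, almost everywhere, from an
  integral over the scales.\<close>

lemma (in hilbert_fields) summable_increments_converge:
  assumes X: "\<And>k::nat. X k \<in> vfields G"
    and sm: "summable (\<lambda>k. hnorm G (\<lambda>x. X (Suc k) x - X k x))"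
  obtains v where "v \<in> vfields G" "(\<lambda>n. hnorm G (\<lambda>x. X n x - v x)) \<longlonglongrightarrow> 0"
proof -
  let ?a = "\<lambda>k. hnorm G (\<lambda>x. X (Suc k) x - X k x)"
  have a: "0 \<le> ?a k" for k by (intro hnorm_nonneg diff_in X)
  have tele: "hnorm G (\<lambda>x. X (m + j) x - X m x) \<le> (\<Sum>k=m..<m+j. ?a k)" for m j
  proof (induction j)
    case (Suc j)
    have "hnorm G (\<lambda>x. X (m + Suc j) x - X m x) \<le> ?a (m + j) + hnorm G (\<lambda>x. X (m + j) x - X m x)"
      using hnorm_triangle_diff[OF X[of "m + Suc j"] X[of "m + j"] X[of m]] by simp
    then show ?case using Suc by simp
  qed simp
  have "\<exists>N. \<forall>m\<ge>N. \<forall>n\<ge>N. hnorm G (\<lambda>x. X m x - X n x) < e" if "e > 0" for e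
  proof -
    obtain N where N: "\<And>m n. m \<ge> N \<Longrightarrow> norm (sum ?a {m..<n}) < e"
      using sm \<open>e > 0\<close> unfolding summable_Cauchy by blast
    have *: "hnorm G (\<lambda>x. X n x - X m x) < e" if "N \<le> m" "m \<le> n" for m n
      using tele[of m "n - m"] N[OF that(1), of n] that by simp
    have "hnorm G (\<lambda>x. X m x - X n x) < e" if "N \<le> m" "N \<le> n" for m n
    proof (cases "m \<le> n")
      case True
      then show ?thesis using *[OF that(1) True] hnorm_minus_commute[OF X X, of m n] by simp
    qed (use * that in auto)
    then show ?thesis by blast
  qed
  from complete[OF X this] that show thesis by blast
qed

text \<open>Derivatives as limits along \<open>1 / (n + 1)\<close> inherit from difference quotients
  both measurability in a parameter and upper or lower Lipschitz bounds.\<close>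

lemma has_derivative_quotient_LIMSEQ:
  assumes D: "(g has_derivative D) (at x)"
  shows "(\<lambda>n. real (Suc n) *\<^sub>R (g (x + (1 / real (Suc n)) *\<^sub>R h) - g x)) \<longlonglongrightarrow> D h"
proof (cases "h = 0")
  case True
  then show ?thesis using linear_0[OF has_derivative_linear[OF D]] by simp
next
  case False
  let ?k = "\<lambda>n. (1 / real (Suc n)) *\<^sub>R h"
  have "?k \<longlonglongrightarrow> 0 *\<^sub>R h"
    by (intro tendsto_scaleR tendsto_const LIMSEQ_Suc[OF lim_1_over_n])
  then have k: "\<forall>i. ?k i \<in> UNIV - {0}" "?k \<longlonglongrightarrow> 0" using False by simp_all
  define R where "R k = norm (g (x + k) - g x - D k) / norm k" for k
  have "(R \<longlongrightarrow> 0) (at 0)"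
    using D unfolding has_derivative_at R_def[abs_def] by (rule conjunct2)
  then have "(R \<circ> ?k) \<longlonglongrightarrow> 0"
    unfolding tendsto_at_iff_sequentially using k by (elim allE[of _ ?k]) (simp only: simp_thms)
  then have "(\<lambda>n. norm (g (x + ?k n) - g x - D (?k n)) / norm (?k n)) \<longlonglongrightarrow> 0"
    by (simp only: R_def o_def)
  from tendsto_mult_right_zero[OF this, of "norm h"]
  have "(\<lambda>n. norm (real (Suc n) *\<^sub>R (g (x + ?k n) - g x) - D h)) \<longlonglongrightarrow> 0"
  proof (rule Lim_transform_eventually, intro always_eventually allI)
    fix n
    have "real (Suc n) *\<^sub>R (g (x + ?k n) - g x) - D h = real (Suc n) *\<^sub>R (g (x + ?k n) - g x - D (?k n))"
      using linear_scale[OF has_derivative_linear[OF D], of "1 / real (Suc n)" h]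
      by (simp add: scaleR_diff_right del: of_nat_Suc)
    then show "norm h * (norm (g (x + ?k n) - g x - D (?k n)) / norm (?k n)) =
        norm (real (Suc n) *\<^sub>R (g (x + ?k n) - g x) - D h)"
      using False by (simp del: of_nat_Suc)
  qed
  then show ?thesis by (rule LIM_zero_cancel[OF tendsto_norm_zero_cancel])
qed

lemma has_derivative_norm_le:
  assumes D: "(g has_derivative D) (at x)" and Lip: "\<And>y. norm (g y - g x) \<le> B * norm (y - x)"
  shows "norm (D h) \<le> B * norm h"
proof (rule LIMSEQ_le_const2[OF tendsto_norm[OF has_derivative_quotient_LIMSEQ[OF D]]], intro exI allI impI)
  fix n :: nat
  have "norm (g (x + (1 / real (Suc n)) *\<^sub>R h) - g x) \<le> B * ((1 / real (Suc n)) * norm h)"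
    using Lip[of "x + (1 / real (Suc n)) *\<^sub>R h"] by (simp del: of_nat_Suc)
  then have "real (Suc n) * norm (g (x + (1 / real (Suc n)) *\<^sub>R h) - g x) \<le> real (Suc n) * (B * ((1 / real (Suc n)) * norm h))"
    by (rule mult_left_mono) simp
  then show "norm (real (Suc n) *\<^sub>R (g (x + (1 / real (Suc n)) *\<^sub>R h) - g x)) \<le> B * norm h"
    by (simp del: of_nat_Suc)
qed

context integral_rkhs
begin

text \<open>Isometry on differences, in terms of nonnegative integrals so that Fatou's lemma and the
  exchange of sum and integral apply directly.\<close>

lemma kcomb_diff_energy:
  shows "(\<integral>\<^sup>+s. ennreal ((hnorm (H s) (\<lambda>x. kcomb (H s) c x - kcomb (H s) c' x))\<^sup>2) \<partial>\<mu>) =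
    ennreal ((hnorm HD (\<lambda>x. kcomb HD c x - kcomb HD c' x))\<^sup>2)"
proof -
  have eq: "(\<lambda>x. kcomb G c x - kcomb G c' x) = kcomb G (c @ lscale (-1) c')" for G :: "'a field_space"
    unfolding kcomb_append kcomb_lscale by simp
  show ?thesis unfolding eq hnorm_kcomb_HD
    by (intro nn_integral_eq_integral L2_sectionD(3)[OF kcomb_L2_section]) simp
qed

text \<open>The lift of \<open>f t\<close> is the limit of the lifts of kernel combinations chosen so close to \<open>f t\<close>
  that they converge in \<open>H s\<close> for almost every \<open>s\<close>; taking the first suitable combination in a fixed
  enumeration keeps the choice measurable in \<open>t\<close>.\<close>

theorem measurable_lift:
  fixes T :: "'t measure" and f :: "'t \<Rightarrow> 'a vfield"
  assumes f: "\<And>t. t \<in> space T \<Longrightarrow> f t \<in> vfields HD"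
    and f_meas: "\<And>x. (\<lambda>t. f t x) \<in> borel_measurable T"
  obtains W where "\<And>t. t \<in> space T \<Longrightarrow> L2_section (W t)"
    "\<And>t x. t \<in> space T \<Longrightarrow> (\<integral>s. W t s x \<partial>\<mu>) = f t x"
    "\<And>t. t \<in> space T \<Longrightarrow> (\<integral>s. (hnorm (H s) (W t s))\<^sup>2 \<partial>\<mu>) = (hnorm HD (f t))\<^sup>2"
    "\<And>x. (\<lambda>(t, s). W t s x) \<in> borel_measurable (T \<Otimes>\<^sub>M \<mu>)"
proof -
  obtain D :: "'a set" where D: "countable D" "\<And>U. open U \<Longrightarrow> U \<noteq> {} \<Longrightarrow> \<exists>d\<in>D. d \<in> U"
    using countable_dense_setE by blast
  define cs where "cs = from_nat_into (lists (D \<times> D))"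
  have cs: "c \<in> range cs" if "c \<in> lists (D \<times> D)" for c
    unfolding cs_def using that D(1)
    by (intro range_eqI[of _ _ "to_nat_on (lists (D \<times> D)) c"])
      (auto intro!: from_nat_into_to_nat_on[symmetric] countable_lists)
  define i where "i k t = (LEAST j. hnorm HD (\<lambda>x. kcomb HD (cs j) x - f t x) < (1/2) ^ k)" for k t
  have close: "hnorm HD (\<lambda>x. kcomb HD (cs (i k t)) x - f t x) < (1/2) ^ k" if t: "t \<in> space T" for k t
  proof -
    obtain c where "c \<in> lists (D \<times> D)" "hnorm HD (\<lambda>x. kcomb HD c x - f t x) < (1/2) ^ k"
      using HD.kcomb_dense[OF D(2) f[OF t], of "(1/2) ^ k"] by auto
    then have "\<exists>j. hnorm HD (\<lambda>x. kcomb HD (cs j) x - f t x) < (1/2) ^ k" using cs by fast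
    then show ?thesis unfolding i_def by (rule LeastI_ex)
  qed
  have [measurable]: "i k \<in> measurable T (count_space UNIV)" for k
  proof -
    have [measurable]: "(\<lambda>t. hnorm HD (\<lambda>x. kcomb HD (cs j) x - f t x)) \<in> borel_measurable T" for j
      by (intro borel_measurable_hnorm continuous_rkhs_HD borel_measurable_const
          borel_measurable_diff f_meas HD.diff_in HD.kcomb_in f)
    show ?thesis unfolding i_def by measurable
  qed
  define Gs where "Gs k t s = kcomb (H s) (cs (i k t))" for k t s
  have kcomb_meas [measurable]: "(\<lambda>s. kcomb (H s) c x) \<in> borel_measurable \<mu>" for c x
    by (intro borel_measurable_kcomb kernel_measurable)
  have Gs_meas [measurable]: "(\<lambda>(t, s). Gs k t s x) \<in> borel_measurable (T \<Otimes>\<^sub>M \<mu>)" for k x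
  proof -
    \<comment> \<open>The index takes countably many values, so it is enough to treat a fixed
      combination.\<close>
    have "(\<lambda>p. (\<lambda>j p. kcomb (H (snd p)) (cs j) x) (i k (fst p)) p) \<in> borel_measurable (T \<Otimes>\<^sub>M \<mu>)"
      by (rule measurable_compose_countable) measurable
    then show ?thesis by (simp add: Gs_def case_prod_beta)
  qed
  have H_pair: "continuous_rkhs (H (snd p))" if "p \<in> space (T \<Otimes>\<^sub>M \<mu>)" for p
    using that by (intro continuous_rkhs_H) (auto simp: space_pair_measure)
  have kernel_pair [measurable]:
    "(\<lambda>p. blinfun_apply (kernel (H (snd p)) x y) q) \<in> borel_measurable (T \<Otimes>\<^sub>M \<mu>)" for x y q
    by (rule measurable_compose[OF measurable_snd kernel_measurable])
  have Gs_in: "Gs k t s \<in> vfields (H s)" if "s \<in> space \<mu>" for k t s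
  proof -
    interpret continuous_rkhs "H s" using continuous_rkhs_H that .
    show ?thesis unfolding Gs_def by simp
  qed
  define a where "a k t s = hnorm (H s) (\<lambda>x. Gs (Suc k) t s x - Gs k t s x)" for k t s
  have a_meas [measurable]: "(\<lambda>p. a k (fst p) (snd p)) \<in> borel_measurable (T \<Otimes>\<^sub>M \<mu>)" for k
    unfolding a_def
  proof (rule borel_measurable_hnorm[OF H_pair kernel_pair])
    show "(\<lambda>p. Gs (Suc k) (fst p) (snd p) x - Gs k (fst p) (snd p) x) \<in> borel_measurable (T \<Otimes>\<^sub>M \<mu>)" for x
      using Gs_meas[of "Suc k" x] Gs_meas[of k x] by (simp add: case_prod_beta)
    show "(\<lambda>x. Gs (Suc k) (fst p) (snd p) x - Gs k (fst p) (snd p) x) \<in> vfields (H (snd p))"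
      if p: "p \<in> space (T \<Otimes>\<^sub>M \<mu>)" for p
    proof -
      interpret continuous_rkhs "H (snd p)" using H_pair p .
      show ?thesis using p by (intro diff_in Gs_in) (auto simp: space_pair_measure)
    qed
  qed
  \<comment> \<open>Taken in the extended reals, so that the set where it is finite is measurable
    jointly in \<open>t\<close> and \<open>s\<close>.\<close>
  define S where "S t s = (\<Sum>k. ennreal (a k t s))" for t s
  have S_meas [measurable]: "(\<lambda>p. S (fst p) (snd p)) \<in> borel_measurable (T \<Otimes>\<^sub>M \<mu>)"
    unfolding S_def by measurable
  \<comment> \<open>Where the increments are not summable the value is the zero field, so that
    \<open>W t s\<close> lies in \<open>H s\<close> for every \<open>s\<close> and not only almost
    everywhere.\<close>
  define W where "W t s x = (if S t s < \<infinity> then lim (\<lambda>k. Gs k t s x) else 0)" for t s x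
  have W_meas: "(\<lambda>(t, s). W t s x) \<in> borel_measurable (T \<Otimes>\<^sub>M \<mu>)" for x
  proof -
    have [measurable]: "(\<lambda>p. Gs k (fst p) (snd p) x) \<in> borel_measurable (T \<Otimes>\<^sub>M \<mu>)" for k
      using Gs_meas[of k x] by (simp add: case_prod_beta)
    show ?thesis unfolding W_def case_prod_beta by measurable
  qed
  have a_nonneg: "0 \<le> a k t s" if s: "s \<in> space \<mu>" for k t s
  proof -
    interpret continuous_rkhs "H s" using continuous_rkhs_H s .
    show ?thesis unfolding a_def by (intro hnorm_nonneg diff_in Gs_in s)
  qed
  have W_lim: "W t s \<in> vfields (H s) \<and> (\<lambda>k. hnorm (H s) (\<lambda>x. Gs k t s x - W t s x)) \<longlonglongrightarrow> 0"
    if s: "s \<in> space \<mu>" and fin: "S t s < \<infinity>" for t s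
  proof -
    interpret continuous_rkhs "H s" using continuous_rkhs_H s .
    have "summable (\<lambda>k. a k t s)"
      using fin a_nonneg[OF s] unfolding S_def by (intro summable_suminf_not_top) auto
    then obtain g where g: "g \<in> vfields (H s)" "(\<lambda>n. hnorm (H s) (\<lambda>x. Gs n t s x - g x)) \<longlonglongrightarrow> 0"
      using summable_increments_converge[of "\<lambda>k. Gs k t s"] Gs_in[OF s] unfolding a_def by blast
    have "W t s = g"
    proof
      fix x show "W t s x = g x"
        using tendsto_eval[OF Gs_in[OF s] g, of x] fin by (simp add: W_def limI)
    qed
    then show ?thesis using g by simp
  qed
  have W_in: "W t s \<in> vfields (H s)" if s: "s \<in> space \<mu>" for t s
  proof (cases "S t s < \<infinity>")
    case False
    interpret continuous_rkhs "H s" using continuous_rkhs_H s .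
    show ?thesis using False zero_in by (simp add: W_def[abs_def])
  qed (use W_lim[OF s] in blast)
  have section_meas [measurable]: "(\<lambda>s. a k t s) \<in> borel_measurable \<mu>" "(\<lambda>s. S t s) \<in> borel_measurable \<mu>"
    "(\<lambda>s. W t s x) \<in> borel_measurable \<mu>" "(\<lambda>s. Gs k t s x) \<in> borel_measurable \<mu>"
    if t: "t \<in> space T" for k t x
    using measurable_compose[OF measurable_Pair1'[OF t] a_meas] measurable_compose[OF measurable_Pair1'[OF t] S_meas]
      measurable_compose[OF measurable_Pair1'[OF t] W_meas]
    by (simp_all add: Gs_def)
  have S_fin: "AE s in \<mu>. S t s < \<infinity>" if t: "t \<in> space T" for t
  proof -
    note [measurable] = section_meas[OF t]
    have a_le: "(\<integral>\<^sup>+s. ennreal (a k t s) \<partial>\<mu>) \<le> ennreal ((1/2) ^ k * (4 + measure \<mu> (space \<mu>)))" for k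
    proof -
      let ?c = "cs (i (Suc k) t)" and ?c' = "cs (i k t)"
      have "hnorm HD (\<lambda>x. kcomb HD ?c x - kcomb HD ?c' x) \<le> 2 * (1/2) ^ k"
        using HD.hnorm_triangle_diff[OF HD.kcomb_in[of ?c] f[OF t] HD.kcomb_in[of ?c']]
          HD.hnorm_minus_commute[OF f[OF t] HD.kcomb_in[of ?c']] close[OF t, of k] close[OF t, of "Suc k"]
          zero_le_power[of "1/2::real" k] unfolding power_Suc by linarith
      then have "(hnorm HD (\<lambda>x. kcomb HD ?c x - kcomb HD ?c' x))\<^sup>2 \<le> (2 * (1/2) ^ k)\<^sup>2"
        by (intro power_mono HD.hnorm_nonneg HD.diff_in HD.kcomb_in)
      then have energy: "(\<integral>\<^sup>+s. ennreal ((a k t s)\<^sup>2) \<partial>\<mu>) \<le> ennreal ((2 * (1/2) ^ k)\<^sup>2)"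
        unfolding a_def Gs_def kcomb_diff_energy by (rule ennreal_leI)
      \<comment> \<open>The energy of the \<open>k\<close>-th increment is at most
        \<open>4 * 4^(-k)\<close>. Weighting the square by \<open>2^k\<close> trades it for a mean
        of order \<open>2^(-k)\<close>, at the price of the total mass of
        \<open>\<mu>\<close>.\<close>
      have "ennreal (a k t s) \<le> ennreal (2 ^ k) * ennreal ((a k t s)\<^sup>2) + ennreal ((1/2) ^ k)"
        if s: "s \<in> space \<mu>" for s
      proof -
        have "0 \<le> (2 ^ k * a k t s - 1)\<^sup>2" by simp
        then have "2 * (2 ^ k * a k t s) \<le> (2 ^ k)\<^sup>2 * (a k t s)\<^sup>2 + 1"
          by (simp add: power2_diff power_mult_distrib)
        moreover have "0 \<le> 2 ^ k * a k t s" using a_nonneg[OF s] by simp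
        ultimately have "2 ^ k * a k t s \<le> (2 ^ k)\<^sup>2 * (a k t s)\<^sup>2 + 1" by linarith
        then have "a k t s \<le> 2 ^ k * (a k t s)\<^sup>2 + (1/2) ^ k"
          by (simp add: field_simps power2_eq_square power_one_over)
        then show ?thesis by (simp add: ennreal_mult[symmetric] ennreal_plus[symmetric] ennreal_leI del: ennreal_plus)
      qed
      then have "(\<integral>\<^sup>+s. ennreal (a k t s) \<partial>\<mu>) \<le>
          (\<integral>\<^sup>+s. ennreal (2 ^ k) * ennreal ((a k t s)\<^sup>2) + ennreal ((1/2) ^ k) \<partial>\<mu>)"
        by (intro nn_integral_mono)
      also have "\<dots> = ennreal (2 ^ k) * (\<integral>\<^sup>+s. ennreal ((a k t s)\<^sup>2) \<partial>\<mu>) + ennreal ((1/2) ^ k) * emeasure \<mu> (space \<mu>)"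
        by (subst nn_integral_add) (auto simp: nn_integral_cmult)
      also have "\<dots> \<le> ennreal (2 ^ k) * ennreal ((2 * (1/2) ^ k)\<^sup>2) + ennreal ((1/2) ^ k) * ennreal (measure \<mu> (space \<mu>))"
        using energy by (intro add_mono mult_left_mono) (auto simp: emeasure_eq_measure)
      also have "\<dots> = ennreal (2 ^ k * (2 * (1/2) ^ k)\<^sup>2 + (1/2) ^ k * measure \<mu> (space \<mu>))"
        by (simp add: ennreal_mult ennreal_plus)
      also have "2 ^ k * (2 * (1/2) ^ k)\<^sup>2 + (1/2) ^ k * measure \<mu> (space \<mu>) = (1/2::real) ^ k * (4 + measure \<mu> (space \<mu>))"
        by (simp add: power2_eq_square power_one_over field_simps)
      finally show ?thesis .
    qed
    have sm: "summable (\<lambda>k. (1/2::real) ^ k * (4 + measure \<mu> (space \<mu>)))"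
      by (intro summable_mult2 summable_geometric) simp
    have "(\<integral>\<^sup>+s. S t s \<partial>\<mu>) = (\<Sum>k. \<integral>\<^sup>+s. ennreal (a k t s) \<partial>\<mu>)"
      unfolding S_def by (rule nn_integral_suminf) measurable
    also have "\<dots> \<le> (\<Sum>k. ennreal ((1/2) ^ k * (4 + measure \<mu> (space \<mu>))))"
      by (intro suminf_le a_le summableI)
    also have "\<dots> = ennreal (\<Sum>k. (1/2) ^ k * (4 + measure \<mu> (space \<mu>)))"
      by (rule suminf_ennreal2[OF _ sm]) simp
    also have "\<dots> < \<infinity>" by simp
    finally have "AE s in \<mu>. S t s \<noteq> \<infinity>"
      by (intro nn_integral_noteq_infinite) auto
    then show ?thesis by eventually_elim (simp add: less_top)
  qed
  \<comment> \<open>Fatou's lemma, for any \<open>c\<close>: the empty list bounds the energy of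
    \<open>W t\<close>, and the approximating lists show that \<open>W t\<close> integrates to
    \<open>f t\<close>.\<close>
  have W_energy: "(\<integral>\<^sup>+s. ennreal ((hnorm (H s) (\<lambda>x. W t s x - kcomb (H s) c x))\<^sup>2) \<partial>\<mu>)
      \<le> ennreal ((hnorm HD (\<lambda>x. f t x - kcomb HD c x))\<^sup>2)" if t: "t \<in> space T" for t c
  proof -
    note [measurable] = section_meas[OF t]
    let ?u = "\<lambda>k s. ennreal ((hnorm (H s) (\<lambda>x. Gs k t s x - kcomb (H s) c x))\<^sup>2)"
    have u_meas [measurable]: "?u k \<in> borel_measurable \<mu>" for k
    proof -
      have "(\<lambda>s. hnorm (H s) (\<lambda>x. Gs k t s x - kcomb (H s) c x)) \<in> borel_measurable \<mu>"
        unfolding Gs_def using L2_section_diff[OF kcomb_L2_section kcomb_L2_section]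
        by (intro hnorm_measurable) (auto simp: L2_section_def)
      then show ?thesis by measurable
    qed
    have "AE s in \<mu>. ennreal ((hnorm (H s) (\<lambda>x. W t s x - kcomb (H s) c x))\<^sup>2) = liminf (\<lambda>k. ?u k s)"
      using S_fin[OF t] AE_space[of \<mu>]
    proof eventually_elim
      case (elim s)
      interpret continuous_rkhs "H s" using continuous_rkhs_H elim(2) .
      have "(\<lambda>k. hnorm (H s) (\<lambda>x. (\<lambda>x. Gs k t s x - kcomb (H s) c x) x - (\<lambda>x. W t s x - kcomb (H s) c x) x)) \<longlonglongrightarrow> 0"
        using W_lim[OF elim(2,1)] by simp
      then have "(\<lambda>k. hnorm (H s) (\<lambda>x. Gs k t s x - kcomb (H s) c x)) \<longlonglongrightarrow> hnorm (H s) (\<lambda>x. W t s x - kcomb (H s) c x)"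
        by (intro tendsto_hnorm[of "\<lambda>k x. Gs k t s x - kcomb (H s) c x"] diff_in Gs_in W_in elim(2) kcomb_in)
      then have "(\<lambda>k. ?u k s) \<longlonglongrightarrow> ennreal ((hnorm (H s) (\<lambda>x. W t s x - kcomb (H s) c x))\<^sup>2)"
        by (intro tendsto_ennrealI tendsto_power)
      then show ?case by (rule lim_imp_Liminf[OF sequentially_bot, symmetric])
    qed
    then have "(\<integral>\<^sup>+s. ennreal ((hnorm (H s) (\<lambda>x. W t s x - kcomb (H s) c x))\<^sup>2) \<partial>\<mu>) =
        (\<integral>\<^sup>+s. liminf (\<lambda>k. ?u k s) \<partial>\<mu>)"
      by (rule nn_integral_cong_AE)
    also have "\<dots> \<le> liminf (\<lambda>k. \<integral>\<^sup>+s. ?u k s \<partial>\<mu>)"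
      by (rule nn_integral_liminf) measurable
    also have "\<dots> = liminf (\<lambda>k. ennreal ((hnorm HD (\<lambda>x. kcomb HD (cs (i k t)) x - kcomb HD c x))\<^sup>2))"
      unfolding Gs_def kcomb_diff_energy ..
    also have "\<dots> = ennreal ((hnorm HD (\<lambda>x. f t x - kcomb HD c x))\<^sup>2)"
    proof (rule lim_imp_Liminf)
      have "(\<lambda>k. hnorm HD (\<lambda>x. kcomb HD (cs (i k t)) x - f t x)) \<longlonglongrightarrow> 0"
      proof (rule tendsto_sandwich[of "\<lambda>_. 0" _ _ "\<lambda>k. (1/2) ^ k"])
        show "(\<lambda>k. (1/2::real) ^ k) \<longlonglongrightarrow> 0" by (rule LIMSEQ_realpow_zero) auto
        show "\<forall>\<^sub>F k in sequentially. 0 \<le> hnorm HD (\<lambda>x. kcomb HD (cs (i k t)) x - f t x)"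
          by (intro always_eventually allI HD.hnorm_nonneg HD.diff_in HD.kcomb_in f t)
        show "\<forall>\<^sub>F k in sequentially. hnorm HD (\<lambda>x. kcomb HD (cs (i k t)) x - f t x) \<le> (1/2) ^ k"
          by (intro always_eventually allI less_imp_le close t)
      qed simp
      then have "(\<lambda>k. hnorm HD (\<lambda>x. kcomb HD (cs (i k t)) x - kcomb HD c x)) \<longlonglongrightarrow> hnorm HD (\<lambda>x. f t x - kcomb HD c x)"
        by (intro HD.tendsto_hnorm[of "\<lambda>k x. kcomb HD (cs (i k t)) x - kcomb HD c x"] HD.diff_in HD.kcomb_in f t) simp
      then show "(\<lambda>k. ennreal ((hnorm HD (\<lambda>x. kcomb HD (cs (i k t)) x - kcomb HD c x))\<^sup>2)) \<longlonglongrightarrow> ennreal ((hnorm HD (\<lambda>x. f t x - kcomb HD c x))\<^sup>2)"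
        by (intro tendsto_ennrealI tendsto_power)
    qed simp
    finally show ?thesis .
  qed
  have W_L2: "L2_section (W t)" and W_le: "(\<integral>s. (hnorm (H s) (W t s))\<^sup>2 \<partial>\<mu>) \<le> (hnorm HD (f t))\<^sup>2"
    if t: "t \<in> space T" for t
  proof -
    note [measurable] = section_meas[OF t]
    have [measurable]: "(\<lambda>s. hnorm (H s) (W t s)) \<in> borel_measurable \<mu>"
      by (intro hnorm_measurable W_in) measurable
    have le: "(\<integral>\<^sup>+s. ennreal ((hnorm (H s) (W t s))\<^sup>2) \<partial>\<mu>) \<le> ennreal ((hnorm HD (f t))\<^sup>2)"
      using W_energy[OF t, of "[]"] by simp
    then have int: "integrable \<mu> (\<lambda>s. (hnorm (H s) (W t s))\<^sup>2)"
      by (intro integrableI_bounded) (auto simp: le_less_trans)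
    then show "L2_section (W t)" unfolding L2_section_def using W_in section_meas[OF t] by auto
    show "(\<integral>s. (hnorm (H s) (W t s))\<^sup>2 \<partial>\<mu>) \<le> (hnorm HD (f t))\<^sup>2"
      using le nn_integral_eq_integral[OF int] by simp
  qed
  have W_int: "(\<lambda>x. \<integral>s. W t s x \<partial>\<mu>) = f t" if t: "t \<in> space T" for t
  proof -
    let ?p = "\<lambda>x. \<integral>s. W t s x \<partial>\<mu>"
    have p: "?p \<in> vfields HD" by (rule integral_in_HD(1)[OF W_L2[OF t]])
    \<comment> \<open>The triangle inequality through the \<open>k\<close>-th combination. Since
      integration is a contraction, \<open>W_energy\<close> bounds the first of the two distances by
      the second.\<close>
    have "hnorm HD (\<lambda>x. ?p x - f t x) \<le> 2 * (1/2) ^ k" for k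
    proof -
      let ?c = "cs (i k t)"
      have d: "L2_section (\<lambda>s x. W t s x - kcomb (H s) ?c x)"
        by (intro L2_section_diff W_L2 t kcomb_L2_section)
      have c: "hnorm HD (\<lambda>x. f t x - kcomb HD ?c x) < (1/2) ^ k"
        using close[OF t, of k] HD.hnorm_minus_commute[OF HD.kcomb_in f[OF t], of ?c] by simp
      have "(\<lambda>x. ?p x - kcomb HD ?c x) = (\<lambda>x. \<integral>s. W t s x - kcomb (H s) ?c x \<partial>\<mu>)"
        using L2_section_integrable[OF W_L2[OF t]] kcomb_integrable by (simp add: kcomb_HD)
      then have "(hnorm HD (\<lambda>x. ?p x - kcomb HD ?c x))\<^sup>2 \<le>
          (\<integral>s. (hnorm (H s) (\<lambda>x. W t s x - kcomb (H s) ?c x))\<^sup>2 \<partial>\<mu>)"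
        using integral_in_HD(2)[OF d] by simp
      also have "\<dots> \<le> (hnorm HD (\<lambda>x. f t x - kcomb HD ?c x))\<^sup>2"
        using W_energy[OF t, of ?c] nn_integral_eq_integral[OF L2_sectionD(3)[OF d]] by simp
      finally have "hnorm HD (\<lambda>x. ?p x - kcomb HD ?c x) \<le> hnorm HD (\<lambda>x. f t x - kcomb HD ?c x)"
        by (rule power2_le_imp_le) (intro HD.hnorm_nonneg HD.diff_in f t HD.kcomb_in)
      then show ?thesis
        using HD.hnorm_triangle_diff[OF p HD.kcomb_in f[OF t], of ?c] c close[OF t, of k] by simp
    qed
    moreover have "(\<lambda>k. 2 * (1/2::real) ^ k) \<longlonglongrightarrow> 2 * 0"
      by (intro tendsto_mult tendsto_const LIMSEQ_realpow_zero) auto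
    ultimately have "hnorm HD (\<lambda>x. ?p x - f t x) \<le> 2 * 0"
      by (intro LIMSEQ_le_const) blast+
    then have "(\<lambda>x. ?p x - f t x) = (\<lambda>x. 0)"
      using HD.hnorm_nonneg[OF HD.diff_in[OF p f[OF t]]] by (intro HD.hnorm_eq_0D HD.diff_in p f t) simp
    then show ?thesis by (simp add: fun_eq_iff)
  qed
  show thesis
  proof (rule that[OF W_L2 _ _ W_meas])
    show "(\<integral>s. W t s x \<partial>\<mu>) = f t x" if "t \<in> space T" for t x
      using W_int[OF that] by (rule fun_cong)
    \<comment> \<open>One inequality is Fatou's lemma, the other the contractivity of
      integration.\<close>
    show "(\<integral>s. (hnorm (H s) (W t s))\<^sup>2 \<partial>\<mu>) = (hnorm HD (f t))\<^sup>2" if "t \<in> space T" for t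
      using W_le[OF that] integral_in_HD(2)[OF W_L2[OF that]] unfolding W_int[OF that] by simp
  qed
qed

text \<open>The case of a one-point parameter space.\<close>

lemma lift_HD:
  assumes "f \<in> vfields HD"
  obtains w where "L2_section w" "\<And>x. (\<integral>s. w s x \<partial>\<mu>) = f x"
proof (rule measurable_lift[of "count_space {()}" "\<lambda>_. f"])
  fix W
  assume "\<And>t. t \<in> space (count_space {()}) \<Longrightarrow> L2_section (W t)"
    "\<And>t x. t \<in> space (count_space {()}) \<Longrightarrow> (\<integral>s. W t s x \<partial>\<mu>) = f x"
  then show thesis using that[of "W ()"] by simp
qed (use assms in auto)

text \<open>Differentiation under the integral along a lift, dominated by
  \<open>M s * hnorm (H s) (w s)\<close>. The lift is what transfers regularity beyond the Lipschitz
  bound from the \<open>H s\<close> to \<open>HD\<close>.\<close>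

lemma HD_differentiable:
  assumes f: "f \<in> vfields HD"
  obtains f' where "\<And>x. x \<in> \<Omega> \<Longrightarrow> (f has_derivative f' x) (at x)"
    "\<And>h. continuous_on \<Omega> (\<lambda>x. f' x h)"
proof -
  obtain w where w: "L2_section w" and fw: "\<And>x. (\<integral>s. w s x \<partial>\<mu>) = f x" using lift_HD[OF f] by blast
  define b where "b s = M s * hnorm (H s) (w s)" for s
  have b_int: "integrable \<mu> b" unfolding b_def by (rule M_hnorm_integrable[OF w])
  have Lip: "norm (w s y - w s x) \<le> b s * norm (y - x)" if "s \<in> space \<mu>" for s x y
    unfolding b_def by (rule H_Lipschitz[OF that L2_sectionD(1)[OF w that]])
  have w_meas [measurable]: "(\<lambda>s. w s x) \<in> borel_measurable \<mu>" for x by (rule L2_sectionD(2)[OF w])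
  have w_int: "integrable \<mu> (\<lambda>s. w s x)" for x by (rule L2_section_integrable[OF w])
  define Dw where "Dw s x = frechet_derivative (w s) (at x)" for s x
  have C1: "C1_field \<Omega> (w s)" if "s \<in> space \<mu>" for s
    by (rule C1_H[OF that L2_sectionD(1)[OF w that]])
  have Dw: "(w s has_derivative Dw s x) (at x)" if "s \<in> space \<mu>" "x \<in> \<Omega>" for s x
    unfolding Dw_def by (rule C1_field_has_derivative[OF C1[OF that(1)] that(2)])
  have Dw_bound: "norm (Dw s x h) \<le> b s * norm h" if "s \<in> space \<mu>" "x \<in> \<Omega>" for s x h
    by (rule has_derivative_norm_le[OF Dw[OF that] Lip[OF that(1)]])
  have Dw_meas [measurable]: "(\<lambda>s. Dw s x h) \<in> borel_measurable \<mu>" if x: "x \<in> \<Omega>" for x h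
  proof (rule borel_measurable_LIMSEQ_metric)
    show "(\<lambda>n. real (Suc n) *\<^sub>R (w s (x + (1 / real (Suc n)) *\<^sub>R h) - w s x)) \<longlonglongrightarrow> Dw s x h"
      if "s \<in> space \<mu>" for s
      by (rule has_derivative_quotient_LIMSEQ[OF Dw[OF that x]])
  qed measurable
  have Dw_int: "integrable \<mu> (\<lambda>s. Dw s x h)" if x: "x \<in> \<Omega>" for x h
  proof (rule Bochner_Integration.integrable_bound)
    show "integrable \<mu> (\<lambda>s. b s * norm h)" using b_int by simp
    show "AE s in \<mu>. norm (Dw s x h) \<le> norm (b s * norm h)"
      using Dw_bound[OF _ x, of _ h] by (intro AE_I2) (metis abs_ge_self order_trans real_norm_def)
  qed (use Dw_meas[OF x] in simp)
  define f' where "f' x h = (\<integral>s. Dw s x h \<partial>\<mu>)" for x h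
  have Dw_linear: "linear (Dw s x)" if "s \<in> space \<mu>" "x \<in> \<Omega>" for s x
    by (rule has_derivative_linear[OF Dw[OF that]])
  show thesis
  proof (rule that[of f'])
    fix x assume x: "x \<in> \<Omega>"
    have "linear (f' x)"
    proof (rule linearI)
      show "f' x (h + k) = f' x h + f' x k" for h k
        unfolding f'_def Bochner_Integration.integral_add[OF Dw_int[OF x] Dw_int[OF x], symmetric]
        by (intro Bochner_Integration.integral_cong refl) (simp add: Dw_linear linear_add x)
      show "f' x (c *\<^sub>R h) = c *\<^sub>R f' x h" for c h
      proof -
        have "f' x (c *\<^sub>R h) = (\<integral>s. c *\<^sub>R Dw s x h \<partial>\<mu>)"
          unfolding f'_def
          by (intro Bochner_Integration.integral_cong refl) (simp add: Dw_linear linear_scale x)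
        then show ?thesis by (simp add: f'_def)
      qed
    qed
    moreover have "((\<lambda>k. norm (f (x + k) - f x - f' x k) / norm k) \<longlongrightarrow> 0) (at 0)"
      unfolding tendsto_at_iff_sequentially o_def
    proof (intro allI impI)
      fix X :: "nat \<Rightarrow> 'a" assume X: "\<forall>i. X i \<in> UNIV - {0}" "X \<longlonglongrightarrow> 0"
      \<comment> \<open>The first order remainder divided by the size of the increment: it tends to
        zero for each \<open>s\<close> and is bounded by \<open>2 * b s\<close>.\<close>
      define r where "r n s = (w s (x + X n) - w s x - Dw s x (X n)) /\<^sub>R norm (X n)" for n s
      have r_meas [measurable]: "r n \<in> borel_measurable \<mu>" for n
        unfolding r_def[abs_def] using Dw_meas[OF x] by measurable
      have "(\<lambda>n. \<integral>s. r n s \<partial>\<mu>) \<longlonglongrightarrow> (\<integral>s. 0 \<partial>\<mu>)"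
      proof (rule integral_dominated_convergence)
        show "integrable \<mu> (\<lambda>s. 2 * b s)" using b_int by simp
        show "AE s in \<mu>. (\<lambda>n. r n s) \<longlonglongrightarrow> 0"
        proof (rule AE_I2)
          fix s assume s: "s \<in> space \<mu>"
          have "((\<lambda>k. norm (w s (x + k) - w s x - Dw s x k) / norm k) \<longlongrightarrow> 0) (at 0)"
            using Dw[OF s x] unfolding has_derivative_at by (rule conjunct2)
          then have "(\<lambda>n. norm (r n s)) \<longlonglongrightarrow> 0"
            using X unfolding tendsto_at_iff_sequentially o_def r_def by (simp add: divide_inverse mult.commute)
          then show "(\<lambda>n. r n s) \<longlonglongrightarrow> 0" by (rule tendsto_norm_zero_cancel)
        qed
        show "AE s in \<mu>. norm (r n s) \<le> 2 * b s" for n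
        proof (rule AE_I2)
          fix s assume s: "s \<in> space \<mu>"
          have "norm (w s (x + X n) - w s x - Dw s x (X n)) \<le> 2 * b s * norm (X n)"
            using norm_triangle_ineq4[of "w s (x + X n) - w s x" "Dw s x (X n)"]
              Lip[OF s, of "x + X n" x] Dw_bound[OF s x, of "X n"] by simp
          then show "norm (r n s) \<le> 2 * b s"
            using X(1) by (simp add: r_def divide_inverse_commute[symmetric] pos_divide_le_eq)
        qed
      qed measurable
      moreover have "(\<integral>s. r n s \<partial>\<mu>) = (f (x + X n) - f x - f' x (X n)) /\<^sub>R norm (X n)" for n
        unfolding r_def f'_def fw[symmetric] using w_int Dw_int[OF x] by simp
      ultimately have "(\<lambda>n. (f (x + X n) - f x - f' x (X n)) /\<^sub>R norm (X n)) \<longlonglongrightarrow> 0" by simp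
      from tendsto_norm[OF this]
      show "(\<lambda>n. norm (f (x + X n) - f x - f' x (X n)) / norm (X n)) \<longlonglongrightarrow> 0"
        by (simp add: divide_inverse mult.commute)
    qed
    ultimately show "(f has_derivative f' x) (at x)"
      unfolding has_derivative_at by (simp add: linear_conv_bounded_linear)
  next
    fix h
    show "continuous_on \<Omega> (\<lambda>x. f' x h)"
    proof (rule continuous_on_sequentiallyI)
      fix X x assume X: "\<forall>n. X n \<in> \<Omega>" "x \<in> \<Omega>" "X \<longlonglongrightarrow> x"
      show "(\<lambda>n. f' (X n) h) \<longlonglongrightarrow> f' x h"
        unfolding f'_def
      proof (rule integral_dominated_convergence)
        show "(\<lambda>s. Dw s x h) \<in> borel_measurable \<mu>" "(\<lambda>s. Dw s (X n) h) \<in> borel_measurable \<mu>" for n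
          using Dw_meas X by auto
        show "integrable \<mu> (\<lambda>s. b s * norm h)" using b_int by simp
        show "AE s in \<mu>. (\<lambda>n. Dw s (X n) h) \<longlonglongrightarrow> Dw s x h"
          unfolding Dw_def using continuous_on_tendsto_compose[OF C1_field_continuous_derivative[OF C1] X(3,2)] X(1)
          by (intro AE_I2) simp
        show "AE s in \<mu>. norm (Dw s (X n) h) \<le> b s * norm h" for n
          using Dw_bound X(1) by (intro AE_I2) blast
      qed
    qed
  qed
qed

end

section \<open>Caratheodory flows\<close>

text \<open>The point \<open>x\<close> is replaced by the first member of a countable dense set
  within \<open>1 / (n + 1)\<close>. This involves only countably many functions of
  \<open>m\<close>, and continuity gives the limit.\<close>

lemma borel_measurable_Caratheodory:
  fixes f :: "'m \<Rightarrow> 'a::{metric_space, second_countable_topology} \<Rightarrow> 'b::metric_space"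
  assumes meas: "\<And>x. (\<lambda>m. f m x) \<in> borel_measurable M"
    and cont: "\<And>m. m \<in> space M \<Longrightarrow> continuous_on UNIV (f m)"
  shows "(\<lambda>(m, x). f m x) \<in> borel_measurable (M \<Otimes>\<^sub>M borel)"
proof -
  obtain D :: "'a set" where D: "countable D" "\<And>U. open U \<Longrightarrow> U \<noteq> {} \<Longrightarrow> \<exists>d\<in>D. d \<in> U"
    using countable_dense_setE by blast
  have "D \<noteq> {}" using D(2)[of UNIV] by auto
  define ds where "ds = from_nat_into D"
  have ds: "\<exists>j. dist (ds j) x < 1 / real (Suc n)" for n x
  proof -
    obtain d where "d \<in> D" "d \<in> ball x (1 / real (Suc n))"
      using D(2)[of "ball x (1 / real (Suc n))"] by auto
    then show ?thesis unfolding ds_def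
      using from_nat_into_surj[OF D(1)] by (metis dist_commute mem_ball)
  qed
  define j where "j n x = (LEAST j. dist (ds j) x < 1 / real (Suc n))" for n x
  have j: "dist (ds (j n x)) x < 1 / real (Suc n)" for n x
    unfolding j_def by (rule LeastI_ex[OF ds])
  have [measurable]: "j n \<in> measurable borel (count_space UNIV)" for n
    unfolding j_def by measurable
  have fd: "(\<lambda>p. f (fst p) (ds (j n (snd p)))) \<in> borel_measurable (M \<Otimes>\<^sub>M borel)" for n
  proof -
    have "(\<lambda>p. (\<lambda>i p. f (fst p) (ds i)) (j n (snd p)) p) \<in> borel_measurable (M \<Otimes>\<^sub>M borel)"
    proof (rule measurable_compose_countable)
      show "(\<lambda>p. f (fst p) (ds i)) \<in> borel_measurable (M \<Otimes>\<^sub>M borel)" for i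
        by (rule measurable_compose[OF measurable_fst meas])
    qed measurable
    then show ?thesis by simp
  qed
  have "(\<lambda>p. f (fst p) (snd p)) \<in> borel_measurable (M \<Otimes>\<^sub>M borel)"
  proof (rule borel_measurable_LIMSEQ_metric[OF fd])
    fix p assume p: "p \<in> space (M \<Otimes>\<^sub>M (borel :: 'a measure))"
    have "(\<lambda>n. dist (ds (j n (snd p))) (snd p)) \<longlonglongrightarrow> 0"
    proof (rule tendsto_sandwich[OF _ _ tendsto_const LIMSEQ_Suc[OF lim_1_over_n]])
      show "\<forall>\<^sub>F n in sequentially. 0 \<le> dist (ds (j n (snd p))) (snd p)" by simp
      show "\<forall>\<^sub>F n in sequentially. dist (ds (j n (snd p))) (snd p) \<le> 1 / real (Suc n)"
        by (intro always_eventually allI less_imp_le j)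
    qed
    then have "(\<lambda>n. ds (j n (snd p))) \<longlonglongrightarrow> snd p" by (rule tendsto_dist_iff[THEN iffD2])
    moreover have "isCont (f (fst p)) (snd p)"
      using cont[of "fst p"] p by (simp add: continuous_on_eq_continuous_at space_pair_measure mem_Times_iff)
    ultimately show "(\<lambda>n. f (fst p) (ds (j n (snd p)))) \<longlonglongrightarrow> f (fst p) (snd p)"
      by (rule isCont_tendsto_compose[rotated])
  qed
  then show ?thesis by (simp add: case_prod_beta)
qed

section \<open>Integrals over time intervals and comparison of increments\<close>

lemma set_integral_combine:
  fixes f :: "real \<Rightarrow> 'b::{banach, second_countable_topology}"
  assumes "a \<le> b" "b \<le> c" "set_integrable lborel {a..c} f"
  shows "(LINT r:{a..c}|lborel. f r) = (LINT r:{a..b}|lborel. f r) + (LINT r:{b..c}|lborel. f r)"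
proof -
  have "{a..c} = {a..b} \<union> {b..c}" using assms by auto
  moreover have "AE x in lborel. \<not> (x \<in> {a..b} \<and> x \<in> {b..c})"
    using AE_lborel_singleton[of b] by eventually_elim auto
  ultimately show ?thesis
    using assms(1,2) by (auto intro!: set_integral_Un_AE intro: set_integrable_subset[OF assms(3)])
qed

lemma set_integral_continuous_on:
  fixes f :: "real \<Rightarrow> 'b::euclidean_space"
  assumes "set_integrable lborel {a..b} f"
  shows "continuous_on {a..b} (\<lambda>t. LINT r:{a..t}|lborel. f r)"
proof -
  have "integral {a..t} f = (LINT r:{a..t}|lborel. f r)" if "t \<in> {a..b}" for t
    using that by (intro set_borel_integral_eq_integral(2)[symmetric] set_integrable_subset[OF assms]) auto
  from continuous_on_eq[OF indefinite_integral_continuous_1[OF set_borel_integral_eq_integral(1)[OF assms]] this]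
  show ?thesis .
qed

lemma set_integral_singleton:
  fixes f :: "real \<Rightarrow> 'b::{banach, second_countable_topology}"
  shows "(LINT r:{a..a}|lborel. f r) = 0"
  unfolding set_lebesgue_integral_def
proof (rule integral_eq_zero_AE)
  show "AE r in lborel. indicator {a..a} r *\<^sub>R f r = 0"
    using AE_lborel_singleton[of a] by eventually_elim simp
qed

lemma set_integral_norm_le:
  fixes f :: "'s \<Rightarrow> 'b::{banach, second_countable_topology}"
  assumes "set_integrable M A f" "set_integrable M A g" "\<And>x. x \<in> A \<Longrightarrow> norm (f x) \<le> g x"
  shows "norm (LINT x:A|M. f x) \<le> (LINT x:A|M. g x)"
proof (rule order_trans[OF set_integral_norm_bound[OF assms(1)]])
  have "set_integrable M A (\<lambda>x. norm (f x))"
    using integrable_norm[OF assms(1)[unfolded set_integrable_def]] by (simp add: set_integrable_def)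
  then show "(LINT x:A|M. norm (f x)) \<le> (LINT x:A|M. g x)"
    using assms(2,3) by (rule set_integral_mono)
qed

lemma set_integrable_continuous_times:
  fixes f :: "real \<Rightarrow> real" and e :: "real \<Rightarrow> real"
  assumes f: "integrable lborel f" and e: "continuous_on {a..b} e"
  shows "set_integrable lborel {a..b} (\<lambda>r. f r * e r)"
proof -
  have "bounded (e ` {a..b})" by (intro compact_imp_bounded compact_continuous_image e compact_Icc)
  then obtain B where "\<forall>x\<in>e ` {a..b}. norm x \<le> B" unfolding bounded_iff by blast
  then have B: "\<And>r. r \<in> {a..b} \<Longrightarrow> \<bar>e r\<bar> \<le> B" by simp
  have "integrable lborel (\<lambda>r. f r * (indicator {a..b} r *\<^sub>R e r))"
  proof (rule Bochner_Integration.integrable_bound)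
    show "integrable lborel (\<lambda>r. f r * B)" using f by simp
    have "(\<lambda>r. indicator {a..b} r *\<^sub>R e r) \<in> borel_measurable borel"
      by (intro borel_measurable_continuous_on_indicator e) auto
    then show "(\<lambda>r. f r * (indicator {a..b} r *\<^sub>R e r)) \<in> borel_measurable lborel"
      using f by auto
    have "norm (f r * (indicator {a..b} r *\<^sub>R e r)) \<le> norm (f r * B)" for r
    proof (cases "r \<in> {a..b}")
      case True
      then have "\<bar>e r\<bar> \<le> \<bar>B\<bar>" using B[OF True] by linarith
      then show ?thesis using True by (simp add: abs_mult mult_left_mono)
    qed simp
    then show "AE r in lborel. norm (f r * (indicator {a..b} r *\<^sub>R e r)) \<le> norm (f r * B)" by simp
  qed
  then show ?thesis unfolding set_integrable_def by (simp add: mult.left_commute)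
qed

text \<open>This replaces almost everywhere differentiation of absolutely continuous curves.\<close>

lemma increment_bound:
  fixes E :: "real \<Rightarrow> 'b::real_normed_vector"
  assumes ab: "a \<le> b" and g: "set_integrable lborel {a..b} g"
    and local: "\<And>\<tau>. a \<le> \<tau> \<Longrightarrow> \<tau> \<le> b \<Longrightarrow> \<exists>\<delta>>0. \<forall>s t. a \<le> s \<and> s \<le> \<tau> \<and> \<tau> \<le> t \<and> t \<le> b \<and> t - s < \<delta> \<longrightarrow>
      norm (E t - E s) \<le> (LINT r:{s..t}|lborel. g r)"
  shows "norm (E b - E a) \<le> (LINT r:{a..b}|lborel. g r)"
proof -
  \<comment> \<open>The bisection rule asks about all windows around a point, so \<open>P\<close> is
    made vacuous for those that leave \<open>{a..b}\<close>.\<close>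
  define P where "P s t \<longleftrightarrow> (a \<le> s \<and> t \<le> b \<longrightarrow> norm (E t - E s) \<le> (LINT r:{s..t}|lborel. g r))" for s t
  have "P a b" using ab
  proof (induction rule: Bolzano)
    case (trans s t u)
    show ?case unfolding P_def
    proof
      assume as: "a \<le> s \<and> u \<le> b"
      have "norm (E u - E s) \<le> norm (E u - E t) + norm (E t - E s)"
        using norm_triangle_ineq[of "E u - E t" "E t - E s"] by simp
      also have "\<dots> \<le> (LINT r:{t..u}|lborel. g r) + (LINT r:{s..t}|lborel. g r)"
        using trans as unfolding P_def by (intro add_mono) auto
      also have "\<dots> = (LINT r:{s..u}|lborel. g r)"
        using set_integral_combine[OF trans(3,4) set_integrable_subset[OF g, of "{s..u}"]] as by auto
      finally show "norm (E u - E s) \<le> (LINT r:{s..u}|lborel. g r)" .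
    qed
  next
    case (local \<tau>)
    then show ?case using assms(3)[of \<tau>] unfolding P_def by blast
  qed
  then show ?thesis unfolding P_def by simp
qed

text \<open>One integrable \<open>m\<close> bounds the Lipschitz constant and, up to the factor
  \<open>c\<close>, the value at the origin. In use are \<open>c = 1\<close> for fields of
  \<open>HD\<close>, sums of such constants for sums of fields, and \<open>c = 0\<close> for linear
  fields.\<close>

locale Caratheodory_field =
  fixes m :: "real \<Rightarrow> real" and c :: real and v :: "real \<Rightarrow> 'a::euclidean_space \<Rightarrow> 'a"
  assumes m_nonneg: "0 \<le> m r" and m_integrable: "integrable lborel m"
    and v_measurable: "(\<lambda>r. v r x) \<in> borel_measurable borel"
    and v_Lipschitz: "norm (v r x - v r y) \<le> m r * norm (x - y)"
    and c_nonneg: "0 \<le> c" and v_0_bound: "norm (v r 0) \<le> c * m r"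
begin

lemma v_growth: "norm (v r x) \<le> m r * (c + norm x)"
  using norm_triangle_ineq[of "v r x - v r 0" "v r 0"] v_Lipschitz[of r x 0] v_0_bound[of r]
  by (simp add: algebra_simps)

lemma v_continuous: "continuous_on UNIV (v r)"
proof (rule lipschitz_on_continuous_on)
  show "(m r)-lipschitz_on UNIV (v r)"
    using v_Lipschitz m_nonneg by (intro lipschitz_onI) (auto simp: dist_norm)
qed

lemma m_set_integrable [simp]: "set_integrable lborel {a..b} m"
  unfolding set_integrable_def using m_integrable by (intro integrable_mult_indicator) auto

lemma v_measurable_comp:
  assumes "y \<in> borel_measurable borel"
  shows "(\<lambda>r. v r (y r)) \<in> borel_measurable borel"
proof -
  have "(\<lambda>(r, x). v r x) \<in> borel_measurable (borel \<Otimes>\<^sub>M borel)"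
    by (rule borel_measurable_Caratheodory[OF v_measurable v_continuous])
  from measurable_compose[OF measurable_Pair[OF measurable_ident_sets[OF refl] assms] this]
  show ?thesis by simp
qed

lemma v_path_measurable:
  assumes y: "continuous_on {a..b} y"
  shows "(\<lambda>r. indicator {a..b} r *\<^sub>R v r (y r)) \<in> borel_measurable borel"
proof -
  have "(\<lambda>r. indicator {a..b} r *\<^sub>R y r) \<in> borel_measurable borel"
    by (intro borel_measurable_continuous_on_indicator y) auto
  from v_measurable_comp[OF this]
  have "(\<lambda>r. indicator {a..b} r *\<^sub>R v r (indicator {a..b} r *\<^sub>R y r)) \<in> borel_measurable borel"
    by (intro borel_measurable_scaleR borel_measurable_indicator) auto
  moreover have "indicator {a..b} r *\<^sub>R v r (indicator {a..b} r *\<^sub>R y r) = indicator {a..b} r *\<^sub>R v r (y r)" for r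
    by (simp split: split_indicator)
  ultimately show ?thesis by simp
qed

lemma v_path_integrable:
  assumes y: "continuous_on {a..b} y"
  shows "set_integrable lborel {a..b} (\<lambda>r. v r (y r))"
proof (rule set_integrable_bound)
  show "set_integrable lborel {a..b} (\<lambda>r. m r * (c + norm (y r)))"
    by (intro set_integrable_continuous_times m_integrable continuous_intros y)
  show "set_borel_measurable lborel {a..b} (\<lambda>r. v r (y r))"
    unfolding set_borel_measurable_def using v_path_measurable[OF y] by simp
  show "AE r in lborel. r \<in> {a..b} \<longrightarrow> norm (v r (y r)) \<le> norm (m r * (c + norm (y r)))"
    using v_growth m_nonneg c_nonneg by (intro always_eventually allI impI) (simp add: abs_mult)
qed

definition \<mu> where "\<mu> t = (LINT r:{0..t}|lborel. m r)"

text \<open>The classical constant is \<open>exp (\<mu> 1)\<close>; the two factors \<open>2\<close>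
  come from the weighted maximum in \<open>Gronwall\<close>. \<open>L\<close> depends on
  \<open>m\<close> alone, so a flow and its first variation share it.\<close>

definition L where "L = 2 * exp (2 * \<mu> 1)"

lemma \<mu>_diff: "0 \<le> s \<Longrightarrow> s \<le> t \<Longrightarrow> \<mu> t - \<mu> s = (LINT r:{s..t}|lborel. m r)"
  unfolding \<mu>_def by (subst set_integral_combine[of 0 s t]) auto

lemma \<mu>_mono:
  assumes "0 \<le> s" "s \<le> t"
  shows "\<mu> s \<le> \<mu> t"
proof -
  have "0 \<le> (LINT r:{s..t}|lborel. m r)"
    unfolding set_lebesgue_integral_def by (intro integral_nonneg_AE AE_I2) (simp add: m_nonneg)
  then show ?thesis using \<mu>_diff[OF assms] by simp
qed

lemma \<mu>_0: "\<mu> 0 = 0" unfolding \<mu>_def by (rule set_integral_singleton)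

lemma \<mu>_nonneg: "0 \<le> t \<Longrightarrow> 0 \<le> \<mu> t" using \<mu>_mono[of 0 t] \<mu>_0 by simp

lemma \<mu>_continuous: "continuous_on {0..b} \<mu>"
  unfolding \<mu>_def by (rule set_integral_continuous_on) simp

lemma L_pos: "L > 0"
  unfolding L_def by simp

lemma weight_integrable: "0 \<le> a \<Longrightarrow> set_integrable lborel {a..b} (\<lambda>r. m r * exp (2 * \<mu> r))"
  by (intro set_integrable_continuous_times m_integrable continuous_intros
      continuous_on_subset[OF \<mu>_continuous[of b]]) auto

text \<open>Equality would be the chain rule for the absolutely continuous \<open>\<mu>\<close>. The
  upper bound follows by bisection: on a short interval \<open>exp (2 * \<mu> r)\<close> is at most
  \<open>1 + e\<close> times its value at the left end, and \<open>1 + x \<le> exp x\<close> does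
  the rest.\<close>

lemma weight_bound:
  assumes "0 \<le> t"
  shows "(LINT r:{0..t}|lborel. m r * exp (2 * \<mu> r)) \<le> (exp (2 * \<mu> t) - 1) / 2"
proof -
  define F where "F t = (LINT r:{0..t}|lborel. m r * exp (2 * \<mu> r))" for t
  have "F t \<le> (1 + e) * ((exp (2 * \<mu> t) - 1) / 2)" if "e > 0" for e
  proof -
    define P where "P a b \<longleftrightarrow> (0 \<le> a \<and> b \<le> t \<longrightarrow> F b - F a \<le> (1 + e) * ((exp (2 * \<mu> b) - exp (2 * \<mu> a)) / 2))" for a b
    have "P 0 t" using assms
    proof (induction rule: Bolzano)
      case (trans a b c)
      then show ?case unfolding P_def by (auto simp: algebra_simps add_divide_distrib diff_divide_distrib)
    next
      case (local x)
      have "continuous (at x within {0..t}) (\<lambda>r. exp (2 * \<mu> r))"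
        using local \<mu>_continuous[of t] by (auto intro!: continuous_intros simp: continuous_on_eq_continuous_within)
      \<comment> \<open>The tolerance \<open>q = e / (2 + e)\<close> solves
        \<open>(1 + e) * (1 - q) = 1 + q\<close>: two values this close to the one at
        \<open>x\<close> differ by a factor of at most \<open>1 + e\<close>.\<close>
      then have "\<exists>\<delta>>0. \<forall>r\<in>{0..t}. dist r x < \<delta> \<longrightarrow> dist (exp (2 * \<mu> r)) (exp (2 * \<mu> x)) < e / (2 + e) * exp (2 * \<mu> x)"
        using \<open>e > 0\<close> unfolding continuous_within_eps_delta
        by (elim allE[of _ "e / (2 + e) * exp (2 * \<mu> x)"]) simp
      then obtain \<delta> where \<delta>: "\<delta> > 0"
        "\<And>r. r \<in> {0..t} \<Longrightarrow> dist r x < \<delta> \<Longrightarrow> dist (exp (2 * \<mu> r)) (exp (2 * \<mu> x)) < e / (2 + e) * exp (2 * \<mu> x)"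
        by blast
      have "P a b" if ab: "a \<le> x" "x \<le> b" "b - a < \<delta>" for a b
        unfolding P_def
      proof
        assume bd: "0 \<le> a \<and> b \<le> t"
        have le: "exp (2 * \<mu> r) \<le> (1 + e) * exp (2 * \<mu> a)" if "r \<in> {a..b}" for r
        proof -
          have "dist r x < \<delta>" "dist a x < \<delta>" "r \<in> {0..t}" "a \<in> {0..t}"
            using that ab bd by (auto simp: dist_real_def)
          then have near: "\<bar>exp (2 * \<mu> r) - exp (2 * \<mu> x)\<bar> < e / (2 + e) * exp (2 * \<mu> x)"
            "\<bar>exp (2 * \<mu> a) - exp (2 * \<mu> x)\<bar> < e / (2 + e) * exp (2 * \<mu> x)"
            using \<delta>(2)[of r] \<delta>(2)[of a] by (simp_all add: dist_real_def)
          have "exp (2 * \<mu> r) < (1 + e / (2 + e)) * exp (2 * \<mu> x)"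
            using near(1) unfolding distrib_right by linarith
          moreover have "(1 - e / (2 + e)) * exp (2 * \<mu> x) < exp (2 * \<mu> a)"
            using near(2) unfolding left_diff_distrib by linarith
          then have "(1 + e) * ((1 - e / (2 + e)) * exp (2 * \<mu> x)) \<le> (1 + e) * exp (2 * \<mu> a)"
            using \<open>e > 0\<close> by (intro mult_left_mono) auto
          moreover have "(1 + e) * (1 - e / (2 + e)) = 1 + e / (2 + e)"
            using \<open>e > 0\<close> by (simp add: field_simps)
          ultimately show ?thesis by (simp add: mult.assoc[symmetric])
        qed
        have "F b - F a = (LINT r:{a..b}|lborel. m r * exp (2 * \<mu> r))"
          unfolding F_def using ab bd by (subst set_integral_combine[of 0 a b]) (auto intro!: weight_integrable)
        also have "\<dots> \<le> (LINT r:{a..b}|lborel. m r * ((1 + e) * exp (2 * \<mu> a)))"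
          using bd le m_nonneg by (intro set_integral_mono weight_integrable mult_left_mono) (auto intro: set_integrable_continuous_times[OF m_integrable])
        also have "\<dots> = (1 + e) * (exp (2 * \<mu> a) * (\<mu> b - \<mu> a))"
          using \<mu>_diff[of a b] ab bd by (simp add: mult_ac)
        also have "exp (2 * \<mu> a) * (\<mu> b - \<mu> a) \<le> (exp (2 * \<mu> b) - exp (2 * \<mu> a)) / 2"
        proof -
          have "exp (2 * \<mu> a) * (1 + 2 * (\<mu> b - \<mu> a)) \<le> exp (2 * \<mu> a) * exp (2 * (\<mu> b - \<mu> a))"
            by (intro mult_left_mono exp_ge_add_one_self) simp
          also have "\<dots> = exp (2 * \<mu> b)" by (simp add: exp_add[symmetric] algebra_simps)
          finally show ?thesis by (simp add: algebra_simps)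
        qed
        finally show "F b - F a \<le> (1 + e) * ((exp (2 * \<mu> b) - exp (2 * \<mu> a)) / 2)"
          using \<open>e > 0\<close> by simp
      qed
      then show ?case using \<delta>(1) by blast
    qed
    moreover have "F 0 = 0" unfolding F_def by (rule set_integral_singleton)
    ultimately show ?thesis unfolding P_def using assms by (simp add: \<mu>_0)
  qed
  then have "F t \<le> (exp (2 * \<mu> t) - 1) / 2"
  proof -
    assume *: "\<And>e. e > 0 \<Longrightarrow> F t \<le> (1 + e) * ((exp (2 * \<mu> t) - 1) / 2)"
    define X where "X = (exp (2 * \<mu> t) - 1) / 2"
    have "X \<ge> 0" unfolding X_def using \<mu>_nonneg[OF assms] by simp
    show ?thesis unfolding X_def[symmetric]
    proof (rule field_le_epsilon)
      fix d :: real assume "d > 0"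
      have "F t \<le> (1 + d / (X + 1)) * X" using *[of "d / (X + 1)"] \<open>d > 0\<close> \<open>X \<ge> 0\<close> unfolding X_def[symmetric] by simp
      also have "\<dots> = X + d * (X / (X + 1))" by (simp add: algebra_simps)
      also have "\<dots> \<le> X + d * 1" using \<open>d > 0\<close> \<open>X \<ge> 0\<close> by (intro add_mono mult_left_mono) auto
      finally show "F t \<le> X + d" by simp
    qed
  qed
  then show ?thesis unfolding F_def .
qed

text \<open>Let \<open>S\<close> be the maximum of \<open>e t * exp (- 2 * \<mu> t)\<close>,
  attained at \<open>s\<close>. If \<open>S\<close> is positive, \<open>weight_bound\<close> bounds
  the integral at \<open>s\<close> by \<open>S / 2 * exp (2 * \<mu> s)\<close>, so
  \<open>S \<le> C + S / 2\<close>.\<close>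

lemma Gronwall:
  assumes T: "0 \<le> T" "T \<le> 1" and e: "continuous_on {0..T} e" and C: "0 \<le> C"
    and le: "\<And>t. t \<in> {0..T} \<Longrightarrow> e t \<le> C + (LINT r:{0..t}|lborel. m r * e r)"
    and t: "t \<in> {0..T}"
  shows "e t \<le> L * C"
proof -
  have "continuous_on {0..T} (\<lambda>t. e t * exp (- 2 * \<mu> t))"
    by (intro continuous_intros e \<mu>_continuous)
  then obtain s where s: "s \<in> {0..T}" "\<And>t. t \<in> {0..T} \<Longrightarrow> e t * exp (- 2 * \<mu> t) \<le> e s * exp (- 2 * \<mu> s)"
    using continuous_attains_sup[of "{0..T}" "\<lambda>t. e t * exp (- 2 * \<mu> t)"] T by auto
  define S where "S = e s * exp (- 2 * \<mu> s)"
  have eS: "e t \<le> S * exp (2 * \<mu> t)" if "t \<in> {0..T}" for t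
  proof -
    have "e t * exp (- 2 * \<mu> t) * exp (2 * \<mu> t) \<le> S * exp (2 * \<mu> t)"
      unfolding S_def by (intro mult_right_mono s that) simp
    then show ?thesis by (simp add: mult.assoc exp_add[symmetric])
  qed
  have "S \<le> 2 * C"
  proof (cases "S \<le> 0")
    case False
    have "(LINT r:{0..s}|lborel. m r * e r) \<le> (LINT r:{0..s}|lborel. S * (m r * exp (2 * \<mu> r)))"
    proof (rule set_integral_mono)
      show "set_integrable lborel {0..s} (\<lambda>r. m r * e r)"
        using s(1) by (intro set_integrable_continuous_times m_integrable continuous_on_subset[OF e]) auto
      show "set_integrable lborel {0..s} (\<lambda>r. S * (m r * exp (2 * \<mu> r)))"
        using weight_integrable[of 0 s] by simp
      show "m r * e r \<le> S * (m r * exp (2 * \<mu> r))" if "r \<in> {0..s}" for r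
      proof -
        have "m r * e r \<le> m r * (S * exp (2 * \<mu> r))" using that s(1) by (intro mult_left_mono eS m_nonneg) auto
        then show ?thesis by (simp add: mult_ac)
      qed
    qed
    also have "\<dots> = S * (LINT r:{0..s}|lborel. m r * exp (2 * \<mu> r))" by simp
    also have "\<dots> \<le> S * ((exp (2 * \<mu> s) - 1) / 2)"
      using False s(1) by (intro mult_left_mono weight_bound) auto
    finally have "e s \<le> C + S * ((exp (2 * \<mu> s) - 1) / 2)" using le[OF s(1)] by simp
    then have "e s * exp (- 2 * \<mu> s) \<le> (C + S * ((exp (2 * \<mu> s) - 1) / 2)) * exp (- 2 * \<mu> s)"
      by (intro mult_right_mono) auto
    also have "\<dots> = C * exp (- 2 * \<mu> s) + S / 2 - S / 2 * exp (- 2 * \<mu> s)"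
      by (simp add: algebra_simps exp_add[symmetric] diff_divide_distrib)
    also have "\<dots> \<le> C * 1 + S / 2"
    proof -
      have "C * exp (- 2 * \<mu> s) \<le> C * 1" using C \<mu>_nonneg[of s] s(1) by (intro mult_left_mono) auto
      moreover have "0 \<le> S / 2 * exp (- 2 * \<mu> s)" using False by simp
      ultimately show ?thesis by linarith
    qed
    finally show ?thesis unfolding S_def[symmetric] by simp
  qed (use C in simp)
  have "e t \<le> S * exp (2 * \<mu> t)" by (rule eS[OF t])
  also have "\<dots> \<le> 2 * C * exp (2 * \<mu> t)" using \<open>S \<le> 2 * C\<close> by (intro mult_right_mono) auto
  also have "\<dots> \<le> 2 * C * exp (2 * \<mu> 1)" using C t T \<mu>_mono[of t 1] by (intro mult_left_mono) auto
  finally show ?thesis by (simp add: L_def mult_ac)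
qed

text \<open>The horizon \<open>T\<close> varies because reversed flows are compared on
  \<open>{0..T}\<close>; continuity guarantees that the integral exists.\<close>

definition solution :: "real \<Rightarrow> 'a \<Rightarrow> (real \<Rightarrow> 'a) \<Rightarrow> bool" where
  "solution T x y \<longleftrightarrow> continuous_on {0..T} y \<and> (\<forall>t\<in>{0..T}. y t = x + (LINT r:{0..t}|lborel. v r (y r)))"

lemma solution_stability:
  assumes T: "0 \<le> T" "T \<le> 1" and y: "solution T x y" and y': "solution T x' y'" and t: "t \<in> {0..T}"
  shows "norm (y t - y' t) \<le> L * norm (x - x')"
proof (rule Gronwall[OF T _ _ _ t])
  have c: "continuous_on {0..T} y" "continuous_on {0..T} y'" using y y' unfolding solution_def by auto
  show "continuous_on {0..T} (\<lambda>t. norm (y t - y' t))" by (intro continuous_intros c)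
  fix t assume t: "t \<in> {0..T}"
  have ct: "continuous_on {0..t} y" "continuous_on {0..t} y'"
    using c t by (auto intro: continuous_on_subset)
  have i: "set_integrable lborel {0..t} (\<lambda>r. v r (y r) - v r (y' r))"
    using v_path_integrable[OF ct(1)] v_path_integrable[OF ct(2)] by simp
  have "y t - y' t = x - x' + (LINT r:{0..t}|lborel. v r (y r) - v r (y' r))"
    using y y' t v_path_integrable[OF ct(1)] v_path_integrable[OF ct(2)] unfolding solution_def by simp
  then have "norm (y t - y' t) \<le> norm (x - x') + norm (LINT r:{0..t}|lborel. v r (y r) - v r (y' r))"
    by (simp add: norm_triangle_ineq)
  also have "norm (LINT r:{0..t}|lborel. v r (y r) - v r (y' r)) \<le> (LINT r:{0..t}|lborel. m r * norm (y r - y' r))"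
    by (intro set_integral_norm_le i set_integrable_continuous_times m_integrable continuous_intros ct v_Lipschitz)
  finally show "norm (y t - y' t) \<le> norm (x - x') + (LINT r:{0..t}|lborel. m r * norm (y r - y' r))" by simp
qed simp

lemma solution_unique:
  assumes "0 \<le> T" "T \<le> 1" "solution T x y" "solution T x y'" "t \<in> {0..T}"
  shows "y t = y' t"
  using solution_stability[OF assms] by simp

lemma solution_subset: "solution T x y \<Longrightarrow> S \<le> T \<Longrightarrow> solution S x y"
  unfolding solution_def by (auto intro: continuous_on_subset)

text \<open>Picard iteration contracts with factor \<open>1/2\<close> on the whole time interval
  once curves are measured with the weight \<open>exp (- 2 * \<mu> t)\<close>.\<close>

theorem solution_exists: "\<exists>y. solution 1 x y"
proof -
  \<comment> \<open>The weight is put into the unknown: \<open>g\<close> is the rescaled deviation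
    from \<open>x\<close>, so the plain supremum norm of \<open>g\<close> is the weighted norm of
    the curve.\<close>
  define Y where "Y g r = x + exp (2 * \<mu> r) *\<^sub>R apply_bcontfun g r" for g :: "real \<Rightarrow>\<^sub>C 'a" and r
  have Yc: "continuous_on {0..1} (Y g)" for g
    unfolding Y_def by (intro continuous_intros \<mu>_continuous continuous_on_apply_bcontfun)
  define F where "F g t = exp (- 2 * \<mu> t) *\<^sub>R (LINT r:{0..t}|lborel. v r (Y g r))" for g t
  have Fc: "continuous_on {0..1} (F g)" for g
    unfolding F_def
    by (intro continuous_intros \<mu>_continuous set_integral_continuous_on v_path_integrable Yc)
  \<comment> \<open>The complete space consists of functions on the whole line, so the image curve
    is extended from \<open>{0..1}\<close> by clamping the time.\<close>
  have "\<exists>h :: real \<Rightarrow>\<^sub>C 'a. (\<forall>t\<in>{0..1}. apply_bcontfun h t = F g t) \<and> (\<forall>t. apply_bcontfun h t = F g (clamp 0 1 t))" for g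
    using continuous_on_cbox_bcontfunE[of 0 1 "F g"] Fc by (metis box_real(2))
  then obtain \<Phi> where \<Phi>: "\<And>g t. t \<in> {0..1} \<Longrightarrow> apply_bcontfun (\<Phi> g) t = F g t"
    "\<And>g t. apply_bcontfun (\<Phi> g) t = F g (clamp 0 1 t)" by metis
  have "dist (\<Phi> g) (\<Phi> h) \<le> 1/2 * dist g h" for g h
  proof (rule dist_bound)
    fix t'
    define t :: real where "t = clamp 0 1 t'"
    have t: "t \<in> {0..1}" unfolding t_def using clamp_in_interval[of 0 1 t'] by auto
    have sub: "continuous_on {0..t} (Y g)" for g
      by (rule continuous_on_subset[OF Yc]) (use t in auto)
    have "norm (LINT r:{0..t}|lborel. v r (Y g r) - v r (Y h r)) \<le> (LINT r:{0..t}|lborel. dist g h * (m r * exp (2 * \<mu> r)))"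
    proof (rule set_integral_norm_le)
      show "set_integrable lborel {0..t} (\<lambda>r. v r (Y g r) - v r (Y h r))"
        using v_path_integrable[OF sub[of g]] v_path_integrable[OF sub[of h]] by simp
      show "set_integrable lborel {0..t} (\<lambda>r. dist g h * (m r * exp (2 * \<mu> r)))"
        using weight_integrable[of 0 t] by simp
      fix r
      have "norm (v r (Y g r) - v r (Y h r)) \<le> m r * norm (Y g r - Y h r)" by (rule v_Lipschitz)
      also have "norm (Y g r - Y h r) = exp (2 * \<mu> r) * dist (apply_bcontfun g r) (apply_bcontfun h r)"
        by (simp add: Y_def dist_norm scaleR_diff_right[symmetric])
      also have "m r * \<dots> \<le> m r * (exp (2 * \<mu> r) * dist g h)"
        by (intro mult_left_mono m_nonneg dist_bounded) simp
      finally show "norm (v r (Y g r) - v r (Y h r)) \<le> dist g h * (m r * exp (2 * \<mu> r))" by (simp add: mult_ac)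
    qed
    also have "\<dots> = dist g h * (LINT r:{0..t}|lborel. m r * exp (2 * \<mu> r))" by simp
    also have "\<dots> \<le> dist g h * ((exp (2 * \<mu> t) - 1) / 2)"
      using t by (intro mult_left_mono weight_bound) auto
    also have "\<dots> \<le> dist g h * (exp (2 * \<mu> t) / 2)" by (intro mult_left_mono) auto
    finally have *: "norm (LINT r:{0..t}|lborel. v r (Y g r) - v r (Y h r)) \<le> dist g h * (exp (2 * \<mu> t) / 2)" .
    have "dist (apply_bcontfun (\<Phi> g) t') (apply_bcontfun (\<Phi> h) t') =
        exp (- 2 * \<mu> t) * norm (LINT r:{0..t}|lborel. v r (Y g r) - v r (Y h r))"
      using v_path_integrable[OF sub[of g]] v_path_integrable[OF sub[of h]]
      unfolding \<Phi>(2) t_def[symmetric] F_def dist_norm by (simp add: scaleR_diff_right[symmetric])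
    also have "\<dots> \<le> exp (- 2 * \<mu> t) * (dist g h * (exp (2 * \<mu> t) / 2))"
      by (intro mult_left_mono *) simp
    also have "\<dots> = 1/2 * dist g h" by (simp add: field_simps exp_minus)
    finally show "dist (apply_bcontfun (\<Phi> g) t') (apply_bcontfun (\<Phi> h) t') \<le> 1/2 * dist g h" .
  qed
  then obtain g where g: "\<Phi> g = g" using banach_fix_type[of "1/2" \<Phi>] by auto
  have "Y g t = x + (LINT r:{0..t}|lborel. v r (Y g r))" if "t \<in> {0..1}" for t
  proof -
    have "apply_bcontfun g t = exp (- 2 * \<mu> t) *\<^sub>R (LINT r:{0..t}|lborel. v r (Y g r))"
      using \<Phi>(1)[OF that, of g] unfolding g F_def .
    then show ?thesis unfolding Y_def[of g t] by (simp add: exp_add[symmetric])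
  qed
  then show ?thesis unfolding solution_def using Yc by blast
qed

text \<open>Chosen separately for each starting point; uniqueness identifies it on
  \<open>{0..1}\<close> with any other solution, in particular with \<open>flow\<close> in
  \<open>flow_eq_fl\<close>.\<close>

definition fl :: "real \<Rightarrow> 'a \<Rightarrow> 'a" where "fl t x = (SOME y. solution 1 x y) t"

lemma fl_solution: "solution 1 x (\<lambda>t. fl t x)"
  unfolding fl_def using someI_ex[OF solution_exists] by simp

lemma fl_eqI: "T \<le> 1 \<Longrightarrow> solution T x y \<Longrightarrow> t \<in> {0..T} \<Longrightarrow> fl t x = y t"
  using solution_unique[of T x "\<lambda>t. fl t x" y t] solution_subset[OF fl_solution, of T x] by simp

lemma fl_integral: "t \<in> {0..1} \<Longrightarrow> fl t x = x + (LINT r:{0..t}|lborel. v r (fl r x))"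
  using fl_solution[of x] unfolding solution_def by auto

lemma fl_continuous_time: "continuous_on {0..1} (\<lambda>t. fl t x)"
  using fl_solution[of x] unfolding solution_def by auto

lemma fl_path_integrable: "0 \<le> a \<Longrightarrow> b \<le> 1 \<Longrightarrow> set_integrable lborel {a..b} (\<lambda>r. v r (fl r x))"
  by (intro v_path_integrable continuous_on_subset[OF fl_continuous_time]) auto

lemma fl_diff:
  assumes "0 \<le> s" "s \<le> t" "t \<le> 1"
  shows "fl t x - fl s x = (LINT r:{s..t}|lborel. v r (fl r x))"
  using fl_integral[of t x] fl_integral[of s x] assms
    set_integral_combine[OF assms(1,2) fl_path_integrable[of 0 t x]] by simp

lemma fl_Lipschitz: "t \<in> {0..1} \<Longrightarrow> norm (fl t x - fl t y) \<le> L * norm (x - y)"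
  by (rule solution_stability[of 1, OF _ _ fl_solution fl_solution]) auto

text \<open>The Lipschitz bound in space is uniform in time, so continuity in time for fixed
  \<open>x\<close> suffices.\<close>

lemma fl_continuous: "continuous_on ({0..1} \<times> UNIV) (\<lambda>(t, x). fl t x)"
proof (rule continuous_on_sequentiallyI)
  fix X :: "nat \<Rightarrow> real \<times> 'a" and p assume X: "\<forall>n. X n \<in> {0..1} \<times> UNIV" "p \<in> {0..1} \<times> UNIV" "X \<longlonglongrightarrow> p"
  obtain t x where p: "p = (t, x)" by (cases p)
  have lim: "(\<lambda>n. fst (X n)) \<longlonglongrightarrow> t" "(\<lambda>n. snd (X n)) \<longlonglongrightarrow> x"
    using tendsto_fst[OF X(3)] tendsto_snd[OF X(3)] p by auto
  have in1: "fst (X n) \<in> {0..1}" for n using X(1) by (metis mem_Times_iff)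
  have 1: "(\<lambda>n. fl (fst (X n)) x) \<longlonglongrightarrow> fl t x"
    using continuous_on_tendsto_compose[OF fl_continuous_time lim(1)] in1 X(2) p by auto
  have 2: "(\<lambda>n. fl (fst (X n)) (snd (X n)) - fl (fst (X n)) x) \<longlonglongrightarrow> 0"
  proof (rule Lim_null_comparison)
    show "\<forall>\<^sub>F n in sequentially. norm (fl (fst (X n)) (snd (X n)) - fl (fst (X n)) x) \<le> L * norm (snd (X n) - x)"
      using fl_Lipschitz[OF in1] by (intro always_eventually allI)
    show "(\<lambda>n. L * norm (snd (X n) - x)) \<longlonglongrightarrow> 0"
      using lim(2) by (intro tendsto_mult_right_zero tendsto_norm_zero LIM_zero)
  qed
  show "(\<lambda>n. case X n of (t, x) \<Rightarrow> fl t x) \<longlonglongrightarrow> (case p of (t, x) \<Rightarrow> fl t x)"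
    using tendsto_add[OF 1 2] by (simp add: p case_prod_beta)
qed

end

section \<open>Inverse and derivative of flows\<close>

lemma set_integral_reflect:
  fixes f :: "real \<Rightarrow> 'b::{banach, second_countable_topology}"
  shows "(LINT r:{T - b..T - a}|lborel. f (T - r)) = (LINT r:{a..b}|lborel. f r)"
proof -
  have "(LINT r:{a..b}|lborel. f r) = (\<integral>r. indicator {a..b} (T + (-1) * r) *\<^sub>R f (T + (-1) * r) \<partial>lborel)"
    unfolding set_lebesgue_integral_def by (subst lborel_integral_real_affine[of "-1" _ T]) auto
  also have "\<dots> = (LINT r:{T - b..T - a}|lborel. f (T - r))"
    unfolding set_lebesgue_integral_def
    by (intro Bochner_Integration.integral_cong refl) (auto simp: indicator_def)
  finally show ?thesis by simp
qed

lemma set_integral_dominated_LIMSEQ: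
  fixes f :: "nat \<Rightarrow> 's \<Rightarrow> 'b::{banach, second_countable_topology}"
  assumes "\<And>n. set_borel_measurable M A (f n)" "set_borel_measurable M A g" "set_integrable M A w"
    and "\<And>x. x \<in> A \<Longrightarrow> (\<lambda>n. f n x) \<longlonglongrightarrow> g x" "\<And>n x. x \<in> A \<Longrightarrow> norm (f n x) \<le> w x"
  shows "(\<lambda>n. LINT x:A|M. f n x) \<longlonglongrightarrow> (LINT x:A|M. g x)"
  unfolding set_lebesgue_integral_def
proof (rule integral_dominated_convergence)
  show "AE x in M. (\<lambda>n. indicator A x *\<^sub>R f n x) \<longlonglongrightarrow> indicator A x *\<^sub>R g x"
    using assms(4) by (intro AE_I2) (auto split: split_indicator)
  show "AE x in M. norm (indicator A x *\<^sub>R f n x) \<le> indicator A x *\<^sub>R w x" for n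
    using assms(5) by (intro AE_I2) (auto split: split_indicator)
qed (use assms(1-3) in \<open>auto simp: set_borel_measurable_def set_integrable_def\<close>)

context Caratheodory_field
begin

lemma fl_0: "fl 0 x = x"
  using fl_integral[of 0 x] unfolding set_integral_singleton by simp

text \<open>The inverse is the flow of the time-reversed field. Its Lipschitz constant is the one of
  the forward flow, uniformly in \<open>T\<close>.\<close>

lemma fl_inverse:
  assumes T: "0 \<le> T" "T \<le> 1"
  obtains \<rho> where "\<And>z. fl T (\<rho> z) = z" "\<And>x. \<rho> (fl T x) = x"
    "\<And>z w. norm (\<rho> z - \<rho> w) \<le> L * norm (z - w)"
proof -
  \<comment> \<open>The cut-off to \<open>{0..T}\<close> keeps the total mass of \<open>mT\<close>
    at \<open>\<mu> T\<close>, hence \<open>rev.L \<le> L\<close>.\<close>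
  define mT where "mT r = indicator {0..T} r * m (T - r)" for r
  define vT where "vT r x = (if r \<in> {0..T} then - v (T - r) x else 0)" for r x
  interpret rev: Caratheodory_field mT c vT
  proof
    have "integrable lborel (\<lambda>r. m (T + (-1) * r))"
      by (rule lborel_integrable_real_affine[OF m_integrable]) simp
    then have "integrable lborel (\<lambda>r. indicator {0..T} r *\<^sub>R m (T - r))"
      by (intro integrable_mult_indicator) auto
    then show "integrable lborel mT" unfolding mT_def by simp
    have "(\<lambda>r. v (T - r) x) \<in> borel_measurable borel" for x
      by (rule measurable_compose[OF _ v_measurable]) simp
    then show "(\<lambda>r. vT r x) \<in> borel_measurable borel" for x
      unfolding vT_def by (intro measurable_If) auto
  qed (use m_nonneg v_Lipschitz c_nonneg v_0_bound in
      \<open>auto simp: mT_def vT_def norm_minus_commute\<close>)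
  have Lle: "rev.L \<le> L"
  proof -
    have "rev.\<mu> 1 = (LINT r:{T - T..T - 0}|lborel. m (T - r))"
      unfolding rev.\<mu>_def mT_def set_lebesgue_integral_def using T
      by (intro Bochner_Integration.integral_cong refl) (auto simp: indicator_def)
    also have "\<dots> = \<mu> T" unfolding \<mu>_def by (rule set_integral_reflect)
    finally show ?thesis unfolding rev.L_def L_def using \<mu>_mono[of T 1] T by simp
  qed
  have 1: "rev.fl T (fl T x) = x" for x
  proof -
    have "rev.solution T (fl T x) (\<lambda>r. fl (T - r) x)"
      unfolding rev.solution_def
    proof (intro conjI ballI)
      show "continuous_on {0..T} (\<lambda>r. fl (T - r) x)"
        using T by (intro continuous_on_compose2[OF fl_continuous_time]) (auto intro!: continuous_intros)
      fix s assume s: "s \<in> {0..T}"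
      have "(LINT r:{0..s}|lborel. vT r (fl (T - r) x)) = (LINT r:{0..s}|lborel. - v (T - r) (fl (T - r) x))"
        using s by (intro set_lebesgue_integral_cong) (auto simp: vT_def)
      also have "\<dots> = - (LINT r:{T - T..T - (T - s)}|lborel. v (T - r) (fl (T - r) x))"
        by (simp add: set_lebesgue_integral_def)
      also have "\<dots> = - (LINT r:{T - s..T}|lborel. v r (fl r x))"
        unfolding set_integral_reflect[where f = "\<lambda>r. v r (fl r x)"] ..
      also have "\<dots> = - (fl T x - fl (T - s) x)"
        using s T by (subst fl_diff) auto
      finally show "fl (T - s) x = fl T x + (LINT r:{0..s}|lborel. vT r (fl (T - r) x))" by simp
    qed
    from rev.fl_eqI[OF T(2) this, of T] show ?thesis using T by (simp add: fl_0)
  qed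
  have 2: "fl T (rev.fl T z) = z" for z
  proof -
    have "solution T (rev.fl T z) (\<lambda>r. rev.fl (T - r) z)"
      unfolding solution_def
    proof (intro conjI ballI)
      show "continuous_on {0..T} (\<lambda>r. rev.fl (T - r) z)"
        using T by (intro continuous_on_compose2[OF rev.fl_continuous_time]) (auto intro!: continuous_intros)
      fix s assume s: "s \<in> {0..T}"
      have "(LINT r:{0..s}|lborel. v r (rev.fl (T - r) z)) =
          (LINT r:{T - s..T - 0}|lborel. v (T - r) (rev.fl (T - (T - r)) z))"
        by (rule set_integral_reflect[symmetric])
      also have "\<dots> = (LINT r:{T - s..T}|lborel. - vT r (rev.fl r z))"
        unfolding diff_zero using s by (intro set_lebesgue_integral_cong) (auto simp: vT_def)
      also have "\<dots> = - (rev.fl T z - rev.fl (T - s) z)"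
        using s T by (subst rev.fl_diff) (auto simp: set_lebesgue_integral_def)
      finally show "rev.fl (T - s) z = rev.fl T z + (LINT r:{0..s}|lborel. v r (rev.fl (T - r) z))" by simp
    qed
    from fl_eqI[OF T(2) this, of T] show ?thesis using T by (simp add: rev.fl_0)
  qed
  have "norm (rev.fl T z - rev.fl T w) \<le> L * norm (z - w)" for z w
    using rev.fl_Lipschitz[of T z w] T Lle mult_right_mono[OF Lle, of "norm (z - w)"] by simp
  with 1 2 that show thesis by blast
qed

lemma bij_fl: "t \<in> {0..1} \<Longrightarrow> bij (fl t)"
  by (rule fl_inverse[of t]) (auto intro: bij_betw_byWitness[where A = UNIV and A' = UNIV, unfolded])

lemma fl_inv_Lipschitz:
  assumes "t \<in> {0..1}"
  shows "norm (inv (fl t) z - inv (fl t) w) \<le> L * norm (z - w)"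
proof (rule fl_inverse[of t])
  fix \<rho> assume \<rho>: "\<And>z. fl t (\<rho> z) = z" "\<And>x. \<rho> (fl t x) = x" "\<And>z w. norm (\<rho> z - \<rho> w) \<le> L * norm (z - w)"
  have "inv (fl t) = \<rho>" by (rule inv_equality) (use \<rho> in auto)
  then show ?thesis using \<rho> by simp
qed (use assms in auto)

lemma fl_inv [simp]: "t \<in> {0..1} \<Longrightarrow> fl t (inv (fl t) z) = z"
  and inv_fl [simp]: "t \<in> {0..1} \<Longrightarrow> inv (fl t) (fl t x) = x"
  using bij_fl by (auto simp: bij_is_surj surj_f_inv_f bij_is_inj inv_f_f)

text \<open>In the limit of small increments this lower bound makes the derivative of the flow
  invertible.\<close>

lemma fl_expansive: "t \<in> {0..1} \<Longrightarrow> norm (x - y) \<le> L * norm (fl t x - fl t y)"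
  using fl_inv_Lipschitz[of t "fl t x" "fl t y"] by simp

text \<open>Each inverse is \<open>L\<close>-Lipschitz, so it suffices to follow one preimage
  \<open>q\<close> under the forward flow, which is continuous in time.\<close>

lemma fl_inv_continuous: "continuous_on ({0..1} \<times> UNIV) (\<lambda>(t, z). inv (fl t) z)"
proof (rule continuous_on_sequentiallyI)
  fix X :: "nat \<Rightarrow> real \<times> 'a" and p assume X: "\<forall>n. X n \<in> {0..1} \<times> UNIV" "p \<in> {0..1} \<times> UNIV" "X \<longlonglongrightarrow> p"
  obtain t z where p: "p = (t, z)" by (cases p)
  have lim: "(\<lambda>n. fst (X n)) \<longlonglongrightarrow> t" "(\<lambda>n. snd (X n)) \<longlonglongrightarrow> z"
    using tendsto_fst[OF X(3)] tendsto_snd[OF X(3)] p by auto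
  have in1: "fst (X n) \<in> {0..1}" for n using X(1) by (metis mem_Times_iff)
  have t: "t \<in> {0..1}" using X(2) p by simp
  define q where "q = inv (fl t) z"
  have "(\<lambda>n. inv (fl (fst (X n))) (snd (X n)) - q) \<longlonglongrightarrow> 0"
  proof (rule Lim_null_comparison)
    have "norm (inv (fl (fst (X n))) (snd (X n)) - q) \<le> L * norm (snd (X n) - fl (fst (X n)) q)" for n
      using fl_inv_Lipschitz[OF in1, of n "snd (X n)" "fl (fst (X n)) q"] inv_fl[OF in1] by simp
    then show "\<forall>\<^sub>F n in sequentially. norm (inv (fl (fst (X n))) (snd (X n)) - q) \<le> L * norm (snd (X n) - fl (fst (X n)) q)"
      by (intro always_eventually allI)
    have "(\<lambda>n. fl (fst (X n)) q) \<longlonglongrightarrow> fl t q"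
      using continuous_on_tendsto_compose[OF fl_continuous_time lim(1) t] in1 by auto
    then have "(\<lambda>n. snd (X n) - fl (fst (X n)) q) \<longlonglongrightarrow> z - fl t q" by (intro tendsto_diff lim(2))
    then have "(\<lambda>n. snd (X n) - fl (fst (X n)) q) \<longlonglongrightarrow> 0" using t by (simp add: q_def)
    then show "(\<lambda>n. L * norm (snd (X n) - fl (fst (X n)) q)) \<longlonglongrightarrow> 0"
      by (intro tendsto_mult_right_zero tendsto_norm_zero)
  qed
  then have "(\<lambda>n. inv (fl (fst (X n))) (snd (X n))) \<longlonglongrightarrow> q" by (rule LIM_zero_cancel)
  then show "(\<lambda>n. case X n of (t, z) \<Rightarrow> inv (fl t) z) \<longlonglongrightarrow> (case p of (t, z) \<Rightarrow> inv (fl t) z)"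
    by (simp add: p q_def case_prod_beta)
qed

end

text \<open>Derivatives are given on the open set only; across its boundary the fields are
  Lipschitz. Continuity of the derivative is tested on vectors, the form delivered by
  \<open>HD_differentiable\<close>.\<close>

locale C1_Caratheodory_field = Caratheodory_field m c v
  for m :: "real \<Rightarrow> real" and c :: real and v :: "real \<Rightarrow> 'a::euclidean_space \<Rightarrow> 'a" +
  fixes \<Omega> :: "'a set" and v' :: "real \<Rightarrow> 'a \<Rightarrow> 'a \<Rightarrow> 'a"
  assumes open_\<Omega>: "open \<Omega>"
    and v_outside: "x \<notin> \<Omega> \<Longrightarrow> v r x = 0"
    and v_derivative: "x \<in> \<Omega> \<Longrightarrow> (v r has_derivative v' r x) (at x)"
    and v'_continuous: "continuous_on \<Omega> (\<lambda>x. v' r x h)"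
begin

lemma v'_bound: "x \<in> \<Omega> \<Longrightarrow> norm (v' r x h) \<le> m r * norm h"
  by (rule has_derivative_norm_le[OF v_derivative]) (auto intro: v_Lipschitz)

lemma v'_linear: "x \<in> \<Omega> \<Longrightarrow> linear (v' r x)"
  by (rule has_derivative_linear[OF v_derivative])

lemma fl_outside: "x \<notin> \<Omega> \<Longrightarrow> t \<in> {0..1} \<Longrightarrow> fl t x = x"
  by (rule fl_eqI[of 1]) (auto simp: solution_def v_outside set_lebesgue_integral_def)

text \<open>Points outside \<open>\<Omega>\<close> are at rest and \<open>fl t\<close> is injective,
  so no orbit enters or leaves \<open>\<Omega>\<close>.\<close>

lemma fl_in_iff [simp]:
  assumes t: "t \<in> {0..1}"
  shows "fl t x \<in> \<Omega> \<longleftrightarrow> x \<in> \<Omega>"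
  using fl_outside[OF _ t] inv_fl[OF t] by metis

text \<open>\<open>Z x\<close> is the equation of first variation along the orbit of \<open>x\<close>, and its flow \<open>J t x\<close> is the
  derivative of \<open>fl t\<close> at \<open>x\<close>.\<close>

definition Z where "Z x r a = (if r \<in> {0..1} then v' r (fl r x) a else 0)"

text \<open>The linearised field is Lipschitz with the same \<open>m\<close>, so the flow estimates
  hold with the same \<open>L\<close>. Measurability in time comes from difference quotients of
  \<open>v\<close> along the orbit.\<close>

lemma variation: assumes x: "x \<in> \<Omega>" shows "Caratheodory_field m 0 (Z x)"
proof
  show "(\<lambda>r. Z x r a) \<in> borel_measurable borel" for a
  proof (rule borel_measurable_LIMSEQ_metric)
    let ?q = "\<lambda>n r. real (Suc n) *\<^sub>R (indicator {0..1} r *\<^sub>R v r (fl r x + (1 / real (Suc n)) *\<^sub>R a) - indicator {0..1} r *\<^sub>R v r (fl r x))"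
    have "(\<lambda>r. indicator {0..1} r *\<^sub>R v r (fl r x + (1 / real (Suc n)) *\<^sub>R a)) \<in> borel_measurable borel"
      "(\<lambda>r. indicator {0..1} r *\<^sub>R v r (fl r x)) \<in> borel_measurable borel" for n
      by (intro v_path_measurable continuous_intros fl_continuous_time)+
    then show "?q n \<in> borel_measurable borel" for n
      by (intro borel_measurable_scaleR[OF borel_measurable_const borel_measurable_diff])
    show "(\<lambda>n. ?q n r) \<longlonglongrightarrow> Z x r a" for r
    proof (cases "r \<in> {0..1}")
      case True
      then have "fl r x \<in> \<Omega>" using x by simp
      from has_derivative_quotient_LIMSEQ[OF v_derivative[OF this, of r], of a] show ?thesis
        using True by (simp add: Z_def)
    qed (auto simp: Z_def)
  qed
  show "norm (Z x r a - Z x r b) \<le> m r * norm (a - b)" for r a b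
  proof (cases "r \<in> {0..1}")
    case True
    then have "fl r x \<in> \<Omega>" using x by simp
    then show ?thesis using v'_bound[of "fl r x" r "a - b"] v'_linear[of "fl r x" r] True
      by (simp add: Z_def linear_diff)
  qed (use m_nonneg in \<open>auto simp: Z_def\<close>)
  show "norm (Z x r 0) \<le> 0 * m r" for r
  proof (cases "r \<in> {0..1}")
    case True
    then have "fl r x \<in> \<Omega>" using x by simp
    then show ?thesis using v'_linear[of "fl r x" r] by (simp add: Z_def linear_0)
  qed (auto simp: Z_def)
qed (use m_nonneg m_integrable in auto)

definition J where "J t x h = Caratheodory_field.fl (Z x) t h"

context
  fixes x assumes x: "x \<in> \<Omega>"
begin

interpretation var: Caratheodory_field m 0 "Z x" by (rule variation[OF x])

lemma J_continuous_time: "continuous_on {0..1} (\<lambda>t. J t x h)"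
  unfolding J_def by (rule var.fl_continuous_time)

lemma J_path_integrable: "continuous_on {0..1} y \<Longrightarrow> set_integrable lborel {0..1} (\<lambda>r. Z x r (y r))"
  by (rule var.v_path_integrable)

lemma J_integral: "t \<in> {0..1} \<Longrightarrow> J t x h = h + (LINT r:{0..t}|lborel. Z x r (J r x h))"
  unfolding J_def by (rule var.fl_integral)

lemma J_bound: "t \<in> {0..1} \<Longrightarrow> norm (J t x h) \<le> L * norm h"
proof -
  assume t: "t \<in> {0..1}"
  have "J t x 0 = 0" unfolding J_def
    by (rule var.fl_eqI[of 1]) (use t var.v_0_bound in \<open>auto simp: var.solution_def set_lebesgue_integral_def\<close>)
  then show ?thesis using var.fl_Lipschitz[OF t, of h 0] unfolding J_def by simp
qed

lemma Z_linear: "linear (Z x r)"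
proof (cases "r \<in> {0..1}")
  case True
  then have "Z x r = v' r (fl r x)" by (auto simp: Z_def fun_eq_iff)
  then show ?thesis using v'_linear[of "fl r x" r] x True by simp
next
  case False
  then have "Z x r = (\<lambda>_. 0)" by (auto simp: Z_def fun_eq_iff)
  then show ?thesis by (simp add: linear_iff)
qed

lemma J_linear:
  assumes t: "t \<in> {0..1}"
  shows "linear (J t x)"
proof (rule linearI)
  show "J t x (h + k) = J t x h + J t x k" for h k
    unfolding J_def
  proof (rule var.fl_eqI[of 1])
    show "var.solution 1 (h + k) (\<lambda>t. var.fl t h + var.fl t k)"
      unfolding var.solution_def
    proof (intro conjI ballI continuous_intros var.fl_continuous_time)
      fix t :: real assume t: "t \<in> {0..1}"
      have "set_integrable lborel {0..t} (\<lambda>r. Z x r (var.fl r h))" for h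
        using var.fl_path_integrable t by simp
      then show "var.fl t h + var.fl t k = h + k + (LINT r:{0..t}|lborel. Z x r (var.fl r h + var.fl r k))"
        unfolding linear_add[OF Z_linear] var.fl_integral[OF t, of h] var.fl_integral[OF t, of k] by simp
    qed
  qed (use t in auto)
  show "J t x (a *\<^sub>R h) = a *\<^sub>R J t x h" for a h
    unfolding J_def
  proof (rule var.fl_eqI[of 1])
    show "var.solution 1 (a *\<^sub>R h) (\<lambda>t. a *\<^sub>R var.fl t h)"
      unfolding var.solution_def
    proof (intro conjI ballI continuous_intros var.fl_continuous_time)
      fix t :: real assume t: "t \<in> {0..1}"
      show "a *\<^sub>R var.fl t h = a *\<^sub>R h + (LINT r:{0..t}|lborel. Z x r (a *\<^sub>R var.fl r h))"
        unfolding linear_scale[OF Z_linear] var.fl_integral[OF t, of h] by (simp add: scaleR_add_right)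
    qed
  qed (use t in auto)
qed

text \<open>Gronwall for the linearised equation with source \<open>R\<close>. The source is a first
  order remainder in \<open>fl_derivative\<close> and a change of base point in
  \<open>J_increment_space\<close>.\<close>

lemma variation_Gronwall:
  assumes D: "continuous_on {0..1} D" and R: "set_integrable lborel {0..1} R"
    and eq: "\<And>t. t \<in> {0..1} \<Longrightarrow> D t = (LINT r:{0..t}|lborel. R r + Z x r (D r))"
    and t: "t \<in> {0..1}"
  shows "norm (D t) \<le> L * (LINT r:{0..1}|lborel. norm (R r))"
proof (rule Gronwall[of 1 "\<lambda>t. norm (D t)" "LINT r:{0..1}|lborel. norm (R r)" t])
  have nR: "set_integrable lborel {0..1} (\<lambda>r. norm (R r))"
    using integrable_norm[OF R[unfolded set_integrable_def]] by (simp add: set_integrable_def)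
  show "continuous_on {0..1} (\<lambda>t. norm (D t))" by (intro continuous_intros D)
  show "0 \<le> (LINT r:{0..1}|lborel. norm (R r))"
    unfolding set_lebesgue_integral_def by (intro integral_nonneg_AE AE_I2) simp
  fix t :: real assume t: "t \<in> {0..1}"
  have i: "set_integrable lborel {0..t} R" "set_integrable lborel {0..t} (\<lambda>r. norm (R r))"
    "set_integrable lborel {0..t} (\<lambda>r. Z x r (D r))" "set_integrable lborel {0..t} (\<lambda>r. m r * norm (D r))"
    "set_integrable lborel {t..1} (\<lambda>r. norm (R r))"
    using t by (auto intro: set_integrable_subset[OF R] set_integrable_subset[OF nR]
      set_integrable_subset[OF J_path_integrable[OF D]] intro!: set_integrable_continuous_times m_integrable
      continuous_intros continuous_on_subset[OF D])
  have "norm (D t) \<le> (LINT r:{0..t}|lborel. norm (R r) + m r * norm (D r))"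
    unfolding eq[OF t]
  proof (rule set_integral_norm_le)
    show "norm (R r + Z x r (D r)) \<le> norm (R r) + m r * norm (D r)" for r
      using norm_triangle_ineq[of "R r" "Z x r (D r)"] var.v_growth[of r "D r"] by simp
  qed (use i in auto)
  also have "\<dots> = (LINT r:{0..t}|lborel. norm (R r)) + (LINT r:{0..t}|lborel. m r * norm (D r))"
    using i by simp
  also have "(LINT r:{0..t}|lborel. norm (R r)) \<le> (LINT r:{0..1}|lborel. norm (R r))"
  proof -
    have "0 \<le> (LINT r:{t..1}|lborel. norm (R r))"
      unfolding set_lebesgue_integral_def by (intro integral_nonneg_AE AE_I2) simp
    then show ?thesis using set_integral_combine[of 0 t 1, OF _ _ nR] t by simp
  qed
  finally show "norm (D t) \<le> (LINT r:{0..1}|lborel. norm (R r)) + (LINT r:{0..t}|lborel. m r * norm (D r))" by simp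
qed (use t in auto)

text \<open>The difference \<open>k\<close> of two orbits solves the linearised equation up to the
  remainder \<open>R\<close>. Divided by the size of the initial increment, \<open>R\<close> tends
  to zero at each time and is dominated by \<open>2 * L * m\<close>.\<close>

lemma fl_derivative:
  assumes t: "t \<in> {0..1}"
  shows "(fl t has_derivative J t x) (at x)"
proof -
  have "((\<lambda>k. norm (fl t (x + k) - fl t x - J t x k) / norm k) \<longlongrightarrow> 0) (at 0)"
    unfolding tendsto_at_iff_sequentially o_def
  proof (intro allI impI)
    fix X :: "nat \<Rightarrow> 'a" assume X: "\<forall>i. X i \<in> UNIV - {0}" "X \<longlonglongrightarrow> 0"
    define k where "k n r = fl r (x + X n) - fl r x" for n r
    define R where "R n r = v r (fl r (x + X n)) - v r (fl r x) - Z x r (k n r)" for n r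
    have kc: "continuous_on {0..1} (k n)" for n
      unfolding k_def by (intro continuous_intros fl_continuous_time)
    have k_le: "norm (k n r) \<le> L * norm (X n)" if "r \<in> {0..1}" for n r
      using fl_Lipschitz[OF that, of "x + X n" x] by (simp add: k_def)
    have R_int: "set_integrable lborel {0..1} (R n)" for n
      unfolding R_def by (intro set_integral_diff fl_path_integrable J_path_integrable kc) auto
    have R_bound: "norm (R n r) \<le> 2 * m r * norm (k n r)" for n r
      using norm_triangle_ineq4[of "v r (fl r (x + X n)) - v r (fl r x)" "Z x r (k n r)"]
        v_Lipschitz[of r "fl r (x + X n)" "fl r x"] var.v_growth[of r "k n r"]
      by (simp add: R_def k_def)
    have est: "norm (k n t - J t x (X n)) \<le> L * (LINT r:{0..1}|lborel. norm (R n r))" for n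
    proof (rule variation_Gronwall[OF _ R_int _ t])
      show "continuous_on {0..1} (\<lambda>t. k n t - J t x (X n))"
        by (intro continuous_intros kc J_continuous_time)
      fix t :: real assume t: "t \<in> {0..1}"
      have i: "set_integrable lborel {0..t} (\<lambda>r. v r (fl r (x + X n)))" "set_integrable lborel {0..t} (\<lambda>r. v r (fl r x))"
        using t fl_path_integrable by auto
      have j: "set_integrable lborel {0..t} (\<lambda>r. Z x r (J r x (X n)))"
        using t by (auto intro: set_integrable_subset[OF J_path_integrable[OF J_continuous_time]])
      have "k n t - J t x (X n) = (LINT r:{0..t}|lborel. v r (fl r (x + X n)) - v r (fl r x) - Z x r (J r x (X n)))"
        unfolding k_def fl_integral[OF t, of "x + X n"] fl_integral[OF t, of x] J_integral[OF t]
        using i j by (simp add: set_integral_diff)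
      also have "\<dots> = (LINT r:{0..t}|lborel. R n r + Z x r (k n r - J r x (X n)))"
        by (simp add: R_def linear_diff[OF Z_linear])
      finally show "k n t - J t x (X n) = (LINT r:{0..t}|lborel. R n r + Z x r (k n r - J r x (X n)))" .
    qed
    have "(\<lambda>n. LINT r:{0..1}|lborel. norm (R n r) / norm (X n)) \<longlonglongrightarrow> (LINT r:{0..1::real}|lborel. 0)"
    proof (rule set_integral_dominated_LIMSEQ)
      show "set_borel_measurable lborel {0..1} (\<lambda>r. norm (R n r) / norm (X n))" for n
      proof -
        have "(\<lambda>r. norm (indicator {0..1} r *\<^sub>R R n r) / norm (X n)) \<in> borel_measurable lborel"
          using R_int[of n] unfolding set_integrable_def by measurable
        then show ?thesis unfolding set_borel_measurable_def by (simp add: mult_ac)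
      qed
      show "set_integrable lborel {0..1} (\<lambda>r. 2 * L * m r)" using m_set_integrable by simp
      fix r :: real assume r: "r \<in> {0..1}"
      show "norm (norm (R n r) / norm (X n)) \<le> 2 * L * m r" for n
      proof -
        have "norm (R n r) \<le> 2 * m r * (L * norm (X n))"
          using R_bound[of n r] mult_left_mono[OF k_le[OF r, of n], of "2 * m r"] m_nonneg[of r] by simp
        then show ?thesis using X(1) by (simp add: pos_divide_le_eq mult_ac)
      qed
      have xr: "fl r x \<in> \<Omega>" using r x by simp
      \<comment> \<open>The limit that defines the derivative excludes the increment zero;
        injectivity of the flow keeps \<open>k n r\<close> nonzero.\<close>
      have k0: "k n r \<noteq> 0" for n
        using injD[OF bij_is_inj[OF bij_fl[OF r]], of "x + X n" x] X(1) by (auto simp: k_def)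
      have "(\<lambda>n. L * norm (X n)) \<longlonglongrightarrow> 0"
        using X(2) by (intro tendsto_mult_right_zero tendsto_norm_zero)
      then have "(\<lambda>n. k n r) \<longlonglongrightarrow> 0"
        by (rule Lim_null_comparison[rotated]) (use k_le[OF r] in simp)
      moreover define Q where "Q k = norm (v r (fl r x + k) - v r (fl r x) - v' r (fl r x) k) / norm k" for k
      have "(Q \<longlongrightarrow> 0) (at 0)"
        using v_derivative[OF xr, of r] unfolding has_derivative_at Q_def[abs_def] by (rule conjunct2)
      ultimately have "(Q \<circ> (\<lambda>n. k n r)) \<longlonglongrightarrow> 0"
        unfolding tendsto_at_iff_sequentially using k0 by simp
      then have "(\<lambda>n. L * Q (k n r)) \<longlonglongrightarrow> 0"
        unfolding o_def by (rule tendsto_mult_right_zero)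
      then show "(\<lambda>n. norm (R n r) / norm (X n)) \<longlonglongrightarrow> 0"
      proof (rule tendsto_sandwich[rotated 3])
        show "\<forall>\<^sub>F n in sequentially. norm (R n r) / norm (X n) \<le> L * Q (k n r)"
        proof (intro always_eventually allI)
          fix n
          have "R n r = v r (fl r x + k n r) - v r (fl r x) - v' r (fl r x) (k n r)"
            using r by (simp add: R_def Z_def k_def)
          then have "norm (R n r) = Q (k n r) * norm (k n r)" using k0[of n] by (simp add: Q_def)
          also have "\<dots> \<le> Q (k n r) * (L * norm (X n))"
            by (intro mult_left_mono k_le r) (simp add: Q_def)
          finally show "norm (R n r) / norm (X n) \<le> L * Q (k n r)"
            using X(1) by (simp add: pos_divide_le_eq mult_ac)
        qed
      qed auto
    qed (simp add: set_borel_measurable_def)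
    then have "(\<lambda>n. L * (LINT r:{0..1}|lborel. norm (R n r) / norm (X n))) \<longlonglongrightarrow> 0"
      by (intro tendsto_mult_right_zero) (simp add: set_lebesgue_integral_def)
    then show "(\<lambda>n. norm (fl t (x + X n) - fl t x - J t x (X n)) / norm (X n)) \<longlonglongrightarrow> 0"
    proof (rule tendsto_sandwich[rotated 3])
      show "\<forall>\<^sub>F n in sequentially. norm (fl t (x + X n) - fl t x - J t x (X n)) / norm (X n) \<le>
          L * (LINT r:{0..1}|lborel. norm (R n r) / norm (X n))"
        using est X(1) unfolding k_def
        by (intro always_eventually allI) (simp add: divide_right_mono)
    qed auto
  qed
  then show ?thesis
    unfolding has_derivative_at using J_linear[OF t] by (simp add: linear_conv_bounded_linear)
qed

text \<open>The limit of \<open>fl_expansive\<close> along difference quotients. In finite dimension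
  it yields bijectivity.\<close>

lemma J_expansive:
  assumes t: "t \<in> {0..1}"
  shows "norm h \<le> L * norm (J t x h)"
proof (rule LIMSEQ_le_const)
  show "(\<lambda>n. L * norm (real (Suc n) *\<^sub>R (fl t (x + (1 / real (Suc n)) *\<^sub>R h) - fl t x))) \<longlonglongrightarrow> L * norm (J t x h)"
    by (intro tendsto_intros has_derivative_quotient_LIMSEQ fl_derivative t)
  have "norm h \<le> L * norm (real (Suc n) *\<^sub>R (fl t (x + (1 / real (Suc n)) *\<^sub>R h) - fl t x))" for n
  proof -
    have "norm ((1 / real (Suc n)) *\<^sub>R h) \<le> L * norm (fl t (x + (1 / real (Suc n)) *\<^sub>R h) - fl t x)"
      using fl_expansive[OF t, of "x + (1 / real (Suc n)) *\<^sub>R h" x] by simp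
    then have "real (Suc n) * norm ((1 / real (Suc n)) *\<^sub>R h) \<le> real (Suc n) * (L * norm (fl t (x + (1 / real (Suc n)) *\<^sub>R h) - fl t x))"
      by (rule mult_left_mono) simp
    then show ?thesis by (simp add: mult_ac del: of_nat_Suc)
  qed
  then show "\<exists>N. \<forall>n\<ge>N. norm h \<le> L * norm (real (Suc n) *\<^sub>R (fl t (x + (1 / real (Suc n)) *\<^sub>R h) - fl t x))"
    by blast
qed

lemma bij_J:
  assumes t: "t \<in> {0..1}"
  shows "bij (J t x)"
proof -
  have "inj (J t x)"
    using J_expansive[OF t] by (intro linear_injective_0[OF J_linear[OF t], THEN iffD2]) (metis mult_zero_right norm_le_zero_iff norm_zero)
  then show ?thesis using linear_injective_imp_surjective[OF J_linear[OF t]] by (simp add: bij_def)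
qed

end

text \<open>The bound \<open>C n\<close> is uniform in time, as joint continuity in \<open>t\<close>
  and \<open>x\<close> requires.\<close>

lemma J_increment_space:
  assumes x: "x \<in> \<Omega>" and X: "\<And>n. X n \<in> \<Omega>" "X \<longlonglongrightarrow> x"
  obtains C :: "nat \<Rightarrow> real" where "C \<longlonglongrightarrow> 0"
    "\<And>n t. t \<in> {0..1} \<Longrightarrow> norm (J t (X n) h - J t x h) \<le> C n"
proof
  \<comment> \<open>Both linear fields are evaluated on the same curve \<open>J r x h\<close>, so
    that \<open>R\<close> does not involve the moving solution \<open>J r (X n) h\<close>.\<close>
  define R where "R n r = Z (X n) r (J r x h) - Z x r (J r x h)" for n r
  have R_int: "set_integrable lborel {0..1} (R n)" for n
    unfolding R_def by (intro set_integral_diff J_path_integrable J_continuous_time x X)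
  show "norm (J t (X n) h - J t x h) \<le> L * (LINT r:{0..1}|lborel. norm (R n r))"
    if t: "t \<in> {0..1}" for n t
  proof (rule variation_Gronwall[OF X(1) _ R_int _ t])
    show "continuous_on {0..1} (\<lambda>t. J t (X n) h - J t x h)"
      by (intro continuous_intros J_continuous_time x X)
    fix t :: real assume t: "t \<in> {0..1}"
    have i: "set_integrable lborel {0..t} (\<lambda>r. Z (X n) r (J r (X n) h))"
      "set_integrable lborel {0..t} (\<lambda>r. Z x r (J r x h))"
      using t by (auto intro: set_integrable_subset[OF J_path_integrable[OF _ J_continuous_time]] x X)
    have "J t (X n) h - J t x h = (LINT r:{0..t}|lborel. Z (X n) r (J r (X n) h) - Z x r (J r x h))"
      unfolding J_integral[OF x t] J_integral[OF X(1) t] using i by simp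
    then show "J t (X n) h - J t x h = (LINT r:{0..t}|lborel. R n r + Z (X n) r (J r (X n) h - J r x h))"
      by (simp add: R_def linear_diff[OF Z_linear[OF X(1)]])
  qed
  have "(\<lambda>n. LINT r:{0..1}|lborel. norm (R n r)) \<longlonglongrightarrow> (LINT r:{0..1::real}|lborel. 0)"
  proof (rule set_integral_dominated_LIMSEQ)
    show "set_borel_measurable lborel {0..1} (\<lambda>r. norm (R n r))" for n
      using integrable_norm[OF R_int[of n, unfolded set_integrable_def]]
      by (simp add: set_borel_measurable_def borel_measurable_integrable)
    show "set_integrable lborel {0..1} (\<lambda>r. 2 * (L * norm h) * m r)" using m_set_integrable by simp
    fix r :: real assume r: "r \<in> {0..1}"
    have J: "norm (J r x h) \<le> L * norm h" by (rule J_bound[OF x r])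
    show "norm (norm (R n r)) \<le> 2 * (L * norm h) * m r" for n
    proof -
      have "norm (R n r) \<le> norm (Z (X n) r (J r x h)) + norm (Z x r (J r x h))"
        unfolding R_def by (rule norm_triangle_ineq4)
      also have "\<dots> \<le> m r * norm (J r x h) + m r * norm (J r x h)"
        using r x X(1)[of n] v'_bound[of "fl r (X n)" r] v'_bound[of "fl r x" r]
        by (intro add_mono) (auto simp: Z_def)
      also have "\<dots> \<le> m r * (L * norm h) + m r * (L * norm h)"
        by (intro add_mono mult_left_mono J m_nonneg)
      finally show ?thesis by (simp add: mult_ac)
    qed
    have "(\<lambda>n. fl r (X n)) \<longlonglongrightarrow> fl r x"
    proof (rule LIM_zero_cancel, rule Lim_null_comparison)
      show "\<forall>\<^sub>F n in sequentially. norm (fl r (X n) - fl r x) \<le> L * norm (X n - x)"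
        using fl_Lipschitz[OF r] by (intro always_eventually allI)
      show "(\<lambda>n. L * norm (X n - x)) \<longlonglongrightarrow> 0"
        using X(2) by (intro tendsto_mult_right_zero tendsto_norm_zero LIM_zero)
    qed
    then have "(\<lambda>n. v' r (fl r (X n)) (J r x h)) \<longlonglongrightarrow> v' r (fl r x) (J r x h)"
      using r x X(1) by (intro continuous_on_tendsto_compose[OF v'_continuous]) auto
    then have "(\<lambda>n. R n r) \<longlonglongrightarrow> 0"
      unfolding R_def Z_def using r by (simp add: LIM_zero)
    then show "(\<lambda>n. norm (R n r)) \<longlonglongrightarrow> 0" by (rule tendsto_norm_zero)
  qed (simp add: set_borel_measurable_def)
  then show "(\<lambda>n. L * (LINT r:{0..1}|lborel. norm (R n r))) \<longlonglongrightarrow> 0"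
    by (intro tendsto_mult_right_zero) (simp add: set_lebesgue_integral_def)
qed

lemma J_continuous: "continuous_on ({0..1} \<times> \<Omega>) (\<lambda>(t, x). J t x h)"
proof (rule continuous_on_sequentiallyI)
  fix X :: "nat \<Rightarrow> real \<times> 'a" and p assume X: "\<forall>n. X n \<in> {0..1} \<times> \<Omega>" "p \<in> {0..1} \<times> \<Omega>" "X \<longlonglongrightarrow> p"
  obtain t x where p: "p = (t, x)" by (cases p)
  have lim: "(\<lambda>n. fst (X n)) \<longlonglongrightarrow> t" "(\<lambda>n. snd (X n)) \<longlonglongrightarrow> x"
    using tendsto_fst[OF X(3)] tendsto_snd[OF X(3)] p by auto
  have in1: "fst (X n) \<in> {0..1}" and in2: "snd (X n) \<in> \<Omega>" for n using X(1) by (metis mem_Times_iff)+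
  have x: "x \<in> \<Omega>" and t: "t \<in> {0..1}" using X(2) p by auto
  have 1: "(\<lambda>n. J (fst (X n)) x h) \<longlonglongrightarrow> J t x h"
    using continuous_on_tendsto_compose[OF J_continuous_time[OF x] lim(1) t] in1 by auto
  obtain C where C: "C \<longlonglongrightarrow> 0" "\<And>n t. t \<in> {0..1} \<Longrightarrow> norm (J t (snd (X n)) h - J t x h) \<le> C n"
    using J_increment_space[OF x in2 lim(2)] by blast
  have 2: "(\<lambda>n. J (fst (X n)) (snd (X n)) h - J (fst (X n)) x h) \<longlonglongrightarrow> 0"
    by (rule Lim_null_comparison[OF _ C(1)]) (intro always_eventually allI C(2) in1)
  show "(\<lambda>n. case X n of (t, x) \<Rightarrow> J t x h) \<longlonglongrightarrow> (case p of (t, x) \<Rightarrow> J t x h)"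
    using tendsto_add[OF 1 2] by (simp add: p case_prod_beta)
qed

text \<open>Continuity for each fixed vector becomes closeness in operator norm by summing over the
  finite basis, hence the division of \<open>e\<close> by the dimension.\<close>

lemma J_near:
  assumes \<tau>: "\<tau> \<in> {0..1}" and p: "p \<in> \<Omega>" and e: "e > 0"
  obtains \<delta> where "\<delta> > 0" "ball p \<delta> \<subseteq> \<Omega>"
    "\<And>r x h. r \<in> {0..1} \<Longrightarrow> \<bar>r - \<tau>\<bar> < \<delta> \<Longrightarrow> x \<in> ball p \<delta> \<Longrightarrow> norm (J r x h - J \<tau> p h) \<le> e * norm h"
proof -
  define e' where "e' = e / real DIM('a)"
  have "e' > 0" unfolding e'_def using e by simp
  have "\<exists>d>0. \<forall>r\<in>{0..1}. \<forall>x\<in>\<Omega>. dist (r, x) (\<tau>, p) < d \<longrightarrow> norm (J r x b - J \<tau> p b) \<le> e'" for b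
  proof -
    obtain d where "d > 0" "\<And>q. q \<in> {0..1} \<times> \<Omega> \<Longrightarrow> dist q (\<tau>, p) < d \<Longrightarrow>
        dist (case q of (t, x) \<Rightarrow> J t x b) (case (\<tau>, p) of (t, x) \<Rightarrow> J t x b) < e'"
      using J_continuous[of b, unfolded continuous_on_iff] \<tau> p \<open>e' > 0\<close> by (metis mem_Times_iff fst_conv snd_conv)
    then show ?thesis by (intro exI[of _ d]) (force simp: dist_norm)
  qed
  then obtain d where d: "\<And>b. d b > 0"
    "\<And>b r x. r \<in> {0..1} \<Longrightarrow> x \<in> \<Omega> \<Longrightarrow> dist (r, x) (\<tau>, p) < d b \<Longrightarrow> norm (J r x b - J \<tau> p b) \<le> e'"
    by metis
  obtain d0 where d0: "d0 > 0" "ball p d0 \<subseteq> \<Omega>" using open_\<Omega> p open_contains_ball by blast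
  define \<delta> where "\<delta> = min d0 (Min (d ` Basis) / 2)"
  have "Min (d ` Basis) > 0" using d(1) by simp
  show thesis
  proof (rule that[of \<delta>])
    show "\<delta> > 0" unfolding \<delta>_def using d0(1) \<open>Min (d ` Basis) > 0\<close> by simp
    show sub: "ball p \<delta> \<subseteq> \<Omega>" using d0(2) unfolding \<delta>_def by auto
    fix r x h assume r: "r \<in> {0..1}" "\<bar>r - \<tau>\<bar> < \<delta>" and x: "x \<in> ball p \<delta>"
    have x\<Omega>: "x \<in> \<Omega>" using x sub by auto
    have "norm (J r x b - J \<tau> p b) \<le> e'" if b: "b \<in> Basis" for b
    proof (rule d(2)[OF r(1) x\<Omega>])
      have "dist (r, x) (\<tau>, p) \<le> \<bar>r - \<tau>\<bar> + dist x p"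
        unfolding dist_Pair_Pair using sqrt_sum_squares_le_sum_abs[of "dist r \<tau>" "dist x p"]
        by (simp add: dist_real_def)
      also have "\<dots> < Min (d ` Basis)"
      proof -
        have "\<bar>r - \<tau>\<bar> < Min (d ` Basis) / 2" "dist x p < Min (d ` Basis) / 2"
          using r(2) x unfolding \<delta>_def by (auto simp only: dist_commute mem_ball min_less_iff_conj)
        then show ?thesis by linarith
      qed
      also have "\<dots> \<le> d b" using b by simp
      finally show "dist (r, x) (\<tau>, p) < d b" .
    qed
    moreover have "linear (\<lambda>h. J r x h - J \<tau> p h)"
      using J_linear[OF x\<Omega> r(1)] J_linear[OF p \<tau>] by (rule linear_compose_sub)
    from linear_sum[OF this, of "\<lambda>b. (h \<bullet> b) *\<^sub>R b" Basis] linear_scale[OF this]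
    have "J r x h - J \<tau> p h = (\<Sum>b\<in>Basis. (h \<bullet> b) *\<^sub>R (J r x b - J \<tau> p b))"
      by (simp only: euclidean_representation)
    moreover have "norm (\<Sum>b\<in>Basis. (h \<bullet> b) *\<^sub>R (J r x b - J \<tau> p b)) \<le> (\<Sum>b\<in>(Basis::'a set). norm h * e')"
      using calculation(1) by (intro sum_norm_le) (auto intro!: mult_mono Basis_le_norm)
    ultimately have "norm (J r x h - J \<tau> p h) \<le> (\<Sum>b\<in>(Basis::'a set). norm h * e')" by simp
    then show "norm (J r x h - J \<tau> p h) \<le> e * norm h" by (simp add: e'_def mult.commute)
  qed
qed

text \<open>Mean value inequality for \<open>fl r - J \<tau> p\<close> on a ball. The single map
  \<open>J \<tau> p\<close> serves all nearby times and pairs of points; an ordinary derivative at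
  \<open>p\<close> would not control increments of moving curves.\<close>

lemma fl_strict_derivative:
  assumes \<tau>: "\<tau> \<in> {0..1}" and p: "p \<in> \<Omega>" and e: "e > 0"
  obtains \<delta> where "\<delta> > 0" "\<And>r x y. r \<in> {0..1} \<Longrightarrow> \<bar>r - \<tau>\<bar> < \<delta> \<Longrightarrow> x \<in> ball p \<delta> \<Longrightarrow> y \<in> ball p \<delta> \<Longrightarrow>
    norm (fl r x - fl r y - J \<tau> p (x - y)) \<le> e * norm (x - y)"
proof -
  obtain \<delta> where \<delta>: "\<delta> > 0" "ball p \<delta> \<subseteq> \<Omega>"
    "\<And>r x h. r \<in> {0..1} \<Longrightarrow> \<bar>r - \<tau>\<bar> < \<delta> \<Longrightarrow> x \<in> ball p \<delta> \<Longrightarrow> norm (J r x h - J \<tau> p h) \<le> e * norm h"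
    using J_near[OF assms] by blast
  have lin: "linear (J \<tau> p)" by (rule J_linear[OF p \<tau>])
  show thesis
  proof (rule that[OF \<delta>(1)])
    fix r x y assume r: "r \<in> {0..1}" "\<bar>r - \<tau>\<bar> < \<delta>" and xy: "x \<in> ball p \<delta>" "y \<in> ball p \<delta>"
    have "norm ((\<lambda>x. fl r x - J \<tau> p x) x - (\<lambda>x. fl r x - J \<tau> p x) y) \<le> e * norm (x - y)"
    proof (rule differentiable_bound[OF convex_ball[of p \<delta>] _ _ xy])
      fix z assume z: "z \<in> ball p \<delta>"
      then have z\<Omega>: "z \<in> \<Omega>" using \<delta>(2) by auto
      have "((\<lambda>x. fl r x - J \<tau> p x) has_derivative (\<lambda>h. J r z h - J \<tau> p h)) (at z)"
        by (intro has_derivative_diff fl_derivative[OF z\<Omega> r(1)] linear_imp_has_derivative lin)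
      then show "((\<lambda>x. fl r x - J \<tau> p x) has_derivative (\<lambda>h. J r z h - J \<tau> p h)) (at z within ball p \<delta>)"
        by (rule has_derivative_at_withinI)
      show "onorm (\<lambda>h. J r z h - J \<tau> p h) \<le> e" by (intro onorm_le \<delta>(3) r z)
    qed
    then show "norm (fl r x - fl r y - J \<tau> p (x - y)) \<le> e * norm (x - y)"
      by (simp add: linear_diff[OF lin] algebra_simps)
  qed
qed

text \<open>\<open>B t x\<close> is the derivative of the inverse flow at \<open>fl t x\<close>.\<close>

definition B where "B t x = inv (J t x)"

lemma B_facts:
  assumes t: "t \<in> {0..1}" and x: "x \<in> \<Omega>"
  shows J_B [simp]: "J t x (B t x a) = a" and B_J [simp]: "B t x (J t x h) = h"
    and B_linear: "linear (B t x)" and B_bound: "norm (B t x a) \<le> L * norm a"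
proof -
  show 1: "J t x (B t x a) = a" for a
    unfolding B_def by (rule surj_f_inv_f[OF bij_is_surj[OF bij_J[OF x t]]])
  show "B t x (J t x h) = h"
    unfolding B_def by (rule inv_f_f[OF bij_is_inj[OF bij_J[OF x t]]])
  show "linear (B t x)"
  proof (rule linearI)
    have inj: "J t x a = J t x b \<Longrightarrow> a = b" for a b
      by (rule injD[OF bij_is_inj[OF bij_J[OF x t]]])
    show "B t x (a + b) = B t x a + B t x b" for a b
      by (rule inj) (simp add: 1 linear_add[OF J_linear[OF x t]])
    show "B t x (k *\<^sub>R a) = k *\<^sub>R B t x a" for k a
      by (rule inj) (simp add: 1 linear_scale[OF J_linear[OF x t]])
  qed
  show "norm (B t x a) \<le> L * norm a" using J_expansive[OF x t, of "B t x a"] 1 by simp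
qed

text \<open>The error for the inverse is \<open>- B \<tau> p\<close> applied to the error of the
  forward flow at the preimages.\<close>

lemma fl_inv_strict_derivative:
  assumes \<tau>: "\<tau> \<in> {0..1}" and p: "p \<in> \<Omega>" and e: "e > 0"
  obtains \<delta> where "\<delta> > 0" "\<And>r x y. r \<in> {0..1} \<Longrightarrow> \<bar>r - \<tau>\<bar> < \<delta> \<Longrightarrow> x \<in> ball (fl \<tau> p) \<delta> \<Longrightarrow> y \<in> ball (fl \<tau> p) \<delta> \<Longrightarrow>
    norm (inv (fl r) x - inv (fl r) y - B \<tau> p (x - y)) \<le> e * norm (x - y)"
proof -
  \<comment> \<open>One factor \<open>L\<close> is the bound of \<open>B \<tau> p\<close>, the other
    the Lipschitz constant of the inverse flow.\<close>
  define e' where "e' = e / (L * L)"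
  have "e' > 0" unfolding e'_def using e L_pos by simp
  from fl_strict_derivative[OF \<tau> p this] obtain \<delta> where \<delta>: "\<delta> > 0"
    "\<And>r x y. r \<in> {0..1} \<Longrightarrow> \<bar>r - \<tau>\<bar> < \<delta> \<Longrightarrow> x \<in> ball p \<delta> \<Longrightarrow> y \<in> ball p \<delta> \<Longrightarrow>
      norm (fl r x - fl r y - J \<tau> p (x - y)) \<le> e' * norm (x - y)" by blast
  obtain d where d: "d > 0" "\<And>q. q \<in> {0..1} \<times> UNIV \<Longrightarrow> dist q (\<tau>, fl \<tau> p) < d \<Longrightarrow>
      dist (case q of (t, z) \<Rightarrow> inv (fl t) z) (case (\<tau>, fl \<tau> p) of (t, z) \<Rightarrow> inv (fl t) z) < \<delta>"
    using fl_inv_continuous[unfolded continuous_on_iff] \<tau> \<delta>(1) by (metis mem_Times_iff fst_conv snd_conv UNIV_I)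
  have near: "inv (fl r) x \<in> ball p \<delta>" if "r \<in> {0..1}" "\<bar>r - \<tau>\<bar> < d / 2" "x \<in> ball (fl \<tau> p) (d / 2)" for r x
  proof -
    have "dist (r, x) (\<tau>, fl \<tau> p) \<le> \<bar>r - \<tau>\<bar> + dist x (fl \<tau> p)"
      unfolding dist_Pair_Pair using sqrt_sum_squares_le_sum_abs[of "dist r \<tau>" "dist x (fl \<tau> p)"]
      by (simp add: dist_real_def)
    also have "\<dots> < d" using that by (auto simp: dist_commute)
    finally show ?thesis using d(2)[of "(r, x)"] that(1) \<tau> by (simp add: dist_commute)
  qed
  show thesis
  proof (rule that[of "min \<delta> (d / 2)"])
    show "min \<delta> (d / 2) > 0" using \<delta>(1) d(1) by simp
    fix r x y assume r: "r \<in> {0..1}" "\<bar>r - \<tau>\<bar> < min \<delta> (d / 2)"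
      and xy: "x \<in> ball (fl \<tau> p) (min \<delta> (d / 2))" "y \<in> ball (fl \<tau> p) (min \<delta> (d / 2))"
    define x' y' where "x' = inv (fl r) x" and "y' = inv (fl r) y"
    have "\<bar>r - \<tau>\<bar> < d / 2" "x \<in> ball (fl \<tau> p) (d / 2)" "y \<in> ball (fl \<tau> p) (d / 2)"
      using r(2) xy by auto
    then have xy': "x' \<in> ball p \<delta>" "y' \<in> ball p \<delta>"
      unfolding x'_def y'_def using near[OF r(1), of x] near[OF r(1), of y] by simp_all
    have eq: "fl r x' = x" "fl r y' = y" unfolding x'_def y'_def using r by auto
    have "x' - y' - B \<tau> p (x - y) = - B \<tau> p (fl r x' - fl r y' - J \<tau> p (x' - y'))"
      using \<tau> p by (simp add: eq linear_diff[OF B_linear[OF \<tau> p]])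
    then have "norm (x' - y' - B \<tau> p (x - y)) \<le> L * norm (fl r x' - fl r y' - J \<tau> p (x' - y'))"
      using B_bound[OF \<tau> p] by simp
    also have "\<dots> \<le> L * (e' * norm (x' - y'))"
      using \<delta>(2)[OF r(1) _ xy'] r(2) L_pos by (intro mult_left_mono) auto
    also have "norm (x' - y') \<le> L * norm (x - y)"
      unfolding x'_def y'_def by (rule fl_inv_Lipschitz[OF r(1)])
    then have "L * (e' * norm (x' - y')) \<le> L * (e' * (L * norm (x - y)))"
      using L_pos \<open>e' > 0\<close> by (intro mult_left_mono) auto
    also have "\<dots> = e * norm (x - y)" using L_pos by (simp add: e'_def)
    finally show "norm (inv (fl r) x - inv (fl r) y - B \<tau> p (x - y)) \<le> e * norm (x - y)"
      unfolding x'_def y'_def .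
  qed
qed

lemma fl_inv_derivative:
  assumes t: "t \<in> {0..1}" and x: "x \<in> \<Omega>"
  shows "(inv (fl t) has_derivative B t x) (at (fl t x))"
  unfolding has_derivative_at_alt
proof (intro conjI allI impI)
  show "bounded_linear (B t x)" using B_linear[OF t x] by (simp add: linear_conv_bounded_linear)
  fix e :: real assume "e > 0"
  from fl_inv_strict_derivative[OF t x this] obtain \<delta> where \<delta>: "\<delta> > 0"
    "\<And>r y z. r \<in> {0..1} \<Longrightarrow> \<bar>r - t\<bar> < \<delta> \<Longrightarrow> y \<in> ball (fl t x) \<delta> \<Longrightarrow> z \<in> ball (fl t x) \<delta> \<Longrightarrow>
    norm (inv (fl r) y - inv (fl r) z - B t x (y - z)) \<le> e * norm (y - z)" by blast
  show "\<exists>d>0. \<forall>y. norm (y - fl t x) < d \<longrightarrow>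
      norm (inv (fl t) y - inv (fl t) (fl t x) - B t x (y - fl t x)) \<le> e * norm (y - fl t x)"
    using \<delta>(1) \<delta>(2)[OF t, of _ "fl t x"] by (intro exI[of _ \<delta>]) (auto simp: dist_norm norm_minus_commute)
qed

text \<open>Resolvent identity: up to sign, the difference of the inverses is \<open>B r x\<close>
  after the difference of the \<open>J\<close> after \<open>B \<tau> p\<close>. Bounding the outer
  maps costs \<open>L * L\<close>.\<close>

lemma B_near:
  assumes \<tau>: "\<tau> \<in> {0..1}" and p: "p \<in> \<Omega>" and e: "e > 0"
  obtains \<delta> where "\<delta> > 0" "ball p \<delta> \<subseteq> \<Omega>"
    "\<And>r x a. r \<in> {0..1} \<Longrightarrow> \<bar>r - \<tau>\<bar> < \<delta> \<Longrightarrow> x \<in> ball p \<delta> \<Longrightarrow> norm (B r x a - B \<tau> p a) \<le> e * norm a"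
proof -
  define e' where "e' = e / (L * L)"
  have "e' > 0" unfolding e'_def using e L_pos by simp
  from J_near[OF \<tau> p this] obtain \<delta> where \<delta>: "\<delta> > 0" "ball p \<delta> \<subseteq> \<Omega>"
    "\<And>r x h. r \<in> {0..1} \<Longrightarrow> \<bar>r - \<tau>\<bar> < \<delta> \<Longrightarrow> x \<in> ball p \<delta> \<Longrightarrow> norm (J r x h - J \<tau> p h) \<le> e' * norm h"
    by blast
  show thesis
  proof (rule that[OF \<delta>(1,2)])
    fix r x a assume r: "r \<in> {0..1}" "\<bar>r - \<tau>\<bar> < \<delta>" and x: "x \<in> ball p \<delta>"
    have x\<Omega>: "x \<in> \<Omega>" using x \<delta>(2) by auto
    define h where "h = B \<tau> p a"
    have "B r x a - B \<tau> p a = - B r x (J r x h - J \<tau> p h)"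
      using r x\<Omega> \<tau> p by (simp add: h_def linear_diff[OF B_linear[OF r(1) x\<Omega>]])
    then have "norm (B r x a - B \<tau> p a) \<le> L * norm (J r x h - J \<tau> p h)"
      using B_bound[OF r(1) x\<Omega>] by simp
    also have "\<dots> \<le> L * (e' * norm h)" using \<delta>(3)[OF r x] L_pos by (intro mult_left_mono) auto
    also have "\<dots> \<le> L * (e' * (L * norm a))"
      using B_bound[OF \<tau> p] L_pos \<open>e' > 0\<close> unfolding h_def by (intro mult_left_mono) auto
    also have "\<dots> = e * norm a" using L_pos by (simp add: e'_def)
    finally show "norm (B r x a - B \<tau> p a) \<le> e * norm a" .
  qed
qed

end

section \<open>Flows of semidirect products\<close>

lemma set_integral_linear:
  fixes f :: "'s \<Rightarrow> 'a::euclidean_space" and T :: "'a \<Rightarrow> 'b::euclidean_space"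
  assumes T: "linear T" and f: "set_integrable M A f"
  shows "set_integrable M A (\<lambda>x. T (f x))" and "(LINT x:A|M. T (f x)) = T (LINT x:A|M. f x)"
proof -
  have bl: "bounded_linear T" using T by (simp add: linear_conv_bounded_linear)
  have eq: "indicator A x *\<^sub>R T (f x) = T (indicator A x *\<^sub>R f x)" for x
    using linear_scale[OF T] by simp
  show "set_integrable M A (\<lambda>x. T (f x))"
    unfolding set_integrable_def eq by (rule integrable_bounded_linear[OF bl f[unfolded set_integrable_def]])
  show "(LINT x:A|M. T (f x)) = T (LINT x:A|M. f x)"
    unfolding set_lebesgue_integral_def eq
    by (rule integral_bounded_linear[OF bl f[unfolded set_integrable_def]])
qed

text \<open>Two independent times, since below a flow is taken at one time and its argument on a
  curve at another.\<close>

lemma two_time_window: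
  fixes f :: "real \<Rightarrow> real \<Rightarrow> 'b::real_normed_vector"
  assumes f: "continuous_on ({0..1} \<times> {0..1}) (\<lambda>(r, s). f r s)" and \<sigma>: "\<sigma> \<in> {0..1}" and e: "e > 0"
  obtains \<delta> where "\<delta> > 0" "\<And>r s. r \<in> {0..1} \<Longrightarrow> s \<in> {0..1} \<Longrightarrow> \<bar>r - \<sigma>\<bar> < \<delta> \<Longrightarrow> \<bar>s - \<sigma>\<bar> < \<delta> \<Longrightarrow>
    norm (f r s - f \<sigma> \<sigma>) < e"
proof -
  obtain d where d: "d > 0" "\<And>q. q \<in> {0..1} \<times> {0..1} \<Longrightarrow> dist q (\<sigma>, \<sigma>) < d \<Longrightarrow>
      dist (case q of (r, s) \<Rightarrow> f r s) (case (\<sigma>, \<sigma>) of (r, s) \<Rightarrow> f r s) < e"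
    using f[unfolded continuous_on_iff] \<sigma> e by (metis mem_Times_iff fst_conv snd_conv)
  show thesis
  proof (rule that[of "d / 2"])
    show "d / 2 > 0" using d(1) by simp
    fix r s assume rs: "r \<in> {0..1}" "s \<in> {0..1}" "\<bar>r - \<sigma>\<bar> < d / 2" "\<bar>s - \<sigma>\<bar> < d / 2"
    have "dist (r, s) (\<sigma>, \<sigma>) \<le> \<bar>r - \<sigma>\<bar> + \<bar>s - \<sigma>\<bar>"
      unfolding dist_Pair_Pair using sqrt_sum_squares_le_sum_abs[of "dist r \<sigma>" "dist s \<sigma>"]
      by (simp add: dist_real_def)
    also have "\<dots> < d" using rs by linarith
    finally show "norm (f r s - f \<sigma> \<sigma>) < e" using d(2)[of "(r, s)"] rs by (simp add: dist_norm)
  qed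
qed

lemma is_flow_cong:
  assumes "\<And>r. r \<in> {0..1} \<Longrightarrow> w r = w' r"
  shows "is_flow w \<phi> \<longleftrightarrow> is_flow w' \<phi>"
proof -
  have "set_integrable lborel {0..t} (\<lambda>r. w r (\<phi> r x)) = set_integrable lborel {0..t} (\<lambda>r. w' r (\<phi> r x)) \<and>
      (LINT r:{0..t}|lborel. w r (\<phi> r x)) = (LINT r:{0..t}|lborel. w' r (\<phi> r x))" if "t \<in> {0..1}" for t x
    using that assms by (intro conjI set_integrable_cong set_lebesgue_integral_cong) auto
  note * = this[THEN conjunct1] this[THEN conjunct2]
  show ?thesis unfolding is_flow_def
    by (intro arg_cong[where f = All] ext ball_cong refl) (simp only: *)
qed

lemma flow_cong:
  assumes "\<And>r. r \<in> {0..1} \<Longrightarrow> w r = w' r"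
  shows "flow w = flow w'"
proof -
  have "is_flow w = is_flow w'" by (intro ext is_flow_cong assms)
  then show ?thesis unfolding flow_def by simp
qed

text \<open>Whatever \<open>flow\<close> picks has continuous orbits, because they are indefinite
  integrals; so uniqueness of solutions applies to it.\<close>

lemma (in Caratheodory_field) flow_eq_fl:
  assumes t: "t \<in> {0..1}"
  shows "flow v t = fl t"
proof -
  have "is_flow v fl"
    unfolding is_flow_def using fl_path_integrable[of 0] fl_integral by auto
  then have fl: "is_flow v (flow v)" unfolding flow_def by (rule someI[of "is_flow v"])
  show ?thesis
  proof
    fix x
    have int: "set_integrable lborel {0..1} (\<lambda>r. v r (flow v r x))"
      and eq: "\<And>t. t \<in> {0..1} \<Longrightarrow> flow v t x = x + (LINT r:{0..t}|lborel. v r (flow v r x))"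
      using fl unfolding is_flow_def by auto
    have "continuous_on {0..1} (\<lambda>t. flow v t x)"
      using continuous_on_add[OF continuous_on_const set_integral_continuous_on[OF int], of x]
      by (rule continuous_on_eq) (use eq in auto)
    then have "solution 1 x (\<lambda>t. flow v t x)" unfolding solution_def using eq by blast
    from fl_eqI[OF order_refl this t] show "flow v t x = fl t x" by simp
  qed
qed

text \<open>\<open>V\<close> stands for the sum of the fields already composed and \<open>U\<close>
  for the next one; the sublocale \<open>W\<close> carries the flow of their sum.\<close>

locale composed_fields =
  V: C1_Caratheodory_field mV cV V \<Omega> V' + U: C1_Caratheodory_field mU cU U \<Omega> U'
  for mV cV and V :: "real \<Rightarrow> 'a::euclidean_space \<Rightarrow> 'a" and \<Omega> V' mU cU U U'
begin

sublocale W: C1_Caratheodory_field "\<lambda>r. mV r + mU r" "cV + cU" "\<lambda>r x. V r x + U r x" \<Omega> "\<lambda>r x h. V' r x h + U' r x h"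
proof
  show "integrable lborel (\<lambda>r. mV r + mU r)" using V.m_integrable U.m_integrable by simp
  show "(\<lambda>r. V r x + U r x) \<in> borel_measurable borel" for x
    by (intro borel_measurable_add V.v_measurable U.v_measurable)
  show "norm (V r x + U r x - (V r y + U r y)) \<le> (mV r + mU r) * norm (x - y)" for r x y
    using norm_triangle_ineq[of "V r x - V r y" "U r x - U r y"] V.v_Lipschitz[of r x y] U.v_Lipschitz[of r x y]
    by (simp add: algebra_simps)
  show "norm (V r 0 + U r 0) \<le> (cV + cU) * (mV r + mU r)" for r
  proof -
    have "0 \<le> cV * mU r" "0 \<le> cU * mV r"
      using V.c_nonneg U.c_nonneg V.m_nonneg U.m_nonneg by auto
    then show ?thesis using norm_triangle_ineq[of "V r 0" "U r 0"] V.v_0_bound[of r] U.v_0_bound[of r]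
      by (simp add: algebra_simps)
  qed
qed (use V.m_nonneg U.m_nonneg V.c_nonneg U.c_nonneg V.open_\<Omega> V.v_outside U.v_outside
    V.v_derivative U.v_derivative V.v'_continuous U.v'_continuous in
    \<open>auto intro!: has_derivative_add continuous_on_add\<close>)

text \<open>The field that drives the next factor, written with \<open>B\<close> so that the bounds
  for the inverse derivative apply; \<open>Ad_eq_w\<close> identifies it with
  \<open>Ad\<close>.\<close>

definition w where "w r x = (if x \<in> \<Omega> then V.B r x (U r (V.fl r x)) else 0)"

lemma Ad_eq_w: "r \<in> {0..1} \<Longrightarrow> Ad \<Omega> (inv (V.fl r)) (U r) = w r"
  using frechet_derivative_at[OF V.fl_inv_derivative[of r]] inv_inv_eq[OF V.bij_fl[of r]]
  by (auto simp: Ad_def w_def fun_eq_iff)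

lemma w_bound:
  assumes r: "r \<in> {0..1}"
  shows "norm (w r x) \<le> V.L * norm (U r (V.fl r x))"
  using V.B_bound[OF r] V.L_pos by (simp add: w_def)

text \<open>This is \<open>\<psi>\<inverse> \<circ> \<Phi>\<close>, the factor that turns the flow
  of \<open>V\<close> into that of \<open>V + U\<close>.\<close>

definition C where "C t x = inv (V.fl t) (W.fl t x)"

lemma V_fl_C: "t \<in> {0..1} \<Longrightarrow> V.fl t (C t x) = W.fl t x"
  unfolding C_def by simp

lemma C_in_iff: "t \<in> {0..1} \<Longrightarrow> C t x \<in> \<Omega> \<longleftrightarrow> x \<in> \<Omega>"
  using V.fl_in_iff[of t "C t x"] V_fl_C[of t x] W.fl_in_iff[of t x] by simp

lemma C_continuous: "continuous_on {0..1} (\<lambda>t. C t x)"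
proof -
  have "continuous_on {0..1} (\<lambda>t. (t, W.fl t x))" by (intro continuous_intros W.fl_continuous_time)
  from continuous_on_compose2[OF V.fl_inv_continuous this] show ?thesis by (auto simp: C_def)
qed

lemma w_along_C:
  assumes "t \<in> {0..1}" "x \<in> \<Omega>"
  shows "w t (C t x) = V.B t (C t x) (U t (W.fl t x))"
  using assms by (simp add: w_def C_in_iff V_fl_C)

lemma w_along_C_integrable:
  assumes x: "x \<in> \<Omega>"
  shows "set_integrable lborel {0..1} (\<lambda>r. w r (C r x))"
proof (rule set_integrable_bound)
  define z where "z r = W.fl r x" for r
  have zc: "continuous_on {0..1} z" unfolding z_def by (rule W.fl_continuous_time)
  have Uz: "set_integrable lborel {0..1} (\<lambda>r. U r (z r))" by (rule U.v_path_integrable[OF zc])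
  then show "set_integrable lborel {0..1} (\<lambda>r. V.L *\<^sub>R U r (z r))" by simp
  show "AE r in lborel. r \<in> {0..1} \<longrightarrow> norm (w r (C r x)) \<le> norm (V.L *\<^sub>R U r (z r))"
  proof (intro always_eventually allI impI)
    fix r :: real assume r: "r \<in> {0..1}"
    show "norm (w r (C r x)) \<le> norm (V.L *\<^sub>R U r (z r))"
      using w_bound[OF r, of "C r x"] V.L_pos unfolding V_fl_C[OF r] z_def by simp
  qed
  \<comment> \<open>The inverse flow, cut off to times in \<open>{0..1}\<close>, as a Borel function
    of time and point.\<close>
  define G where "G p = indicator ({0..1} \<times> UNIV) p *\<^sub>R (case p of (t, a) \<Rightarrow> inv (V.fl t) a)" for p :: "real \<times> 'a"
  have "G \<in> borel_measurable borel"
    unfolding G_def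
    by (rule borel_measurable_continuous_on_indicator[OF _ V.fl_inv_continuous])
      (auto intro!: borel_closed closed_Times)
  then have G: "G \<in> borel_measurable (borel \<Otimes>\<^sub>M borel)" by (simp add: borel_prod)
  \<comment> \<open>Difference quotients of the inverse flow in the direction
    \<open>U r (z r)\<close>. Their limit is \<open>w\<close> along the curve, which is therefore
    measurable in time.\<close>
  define f where "f n r = real (Suc n) *\<^sub>R
    (G (r, indicator {0..1} r *\<^sub>R z r + (1 / real (Suc n)) *\<^sub>R (indicator {0..1} r *\<^sub>R U r (z r))) -
     G (r, indicator {0..1} r *\<^sub>R z r))" for n r
  have "(\<lambda>r. indicator {0..1} r *\<^sub>R z r) \<in> borel_measurable borel"
    by (intro borel_measurable_continuous_on_indicator zc) auto
  moreover have "(\<lambda>r. indicator {0..1} r *\<^sub>R U r (z r)) \<in> borel_measurable borel"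
    by (rule U.v_path_measurable[OF zc])
  ultimately have f_meas: "f n \<in> borel_measurable borel" for n
    unfolding f_def
    by (intro borel_measurable_scaleR[OF borel_measurable_const] borel_measurable_diff
      measurable_compose[OF measurable_Pair G] measurable_ident_sets refl borel_measurable_add
      borel_measurable_const)
  have "(\<lambda>r. indicator {0..1} r *\<^sub>R w r (C r x)) \<in> borel_measurable borel"
  proof (rule borel_measurable_LIMSEQ_metric[OF f_meas])
    fix r :: real
    show "(\<lambda>n. f n r) \<longlonglongrightarrow> indicator {0..1} r *\<^sub>R w r (C r x)"
    proof (cases "r \<in> {0..1}")
      case True
      have C: "C r x \<in> \<Omega>" using C_in_iff True x by simp
      have "(inv (V.fl r) has_derivative V.B r (C r x)) (at (z r))"
        using V.fl_inv_derivative[OF True C] V_fl_C[OF True] by (simp add: z_def)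
      from has_derivative_quotient_LIMSEQ[OF this, of "U r (z r)"]
      show ?thesis using True x by (simp add: f_def G_def w_along_C z_def)
    next
      case False
      then show ?thesis by (auto simp: f_def G_def)
    qed
  qed
  then show "set_borel_measurable lborel {0..1} (\<lambda>r. w r (C r x))"
    unfolding set_borel_measurable_def by simp
qed

text \<open>Formally this is the chain rule for \<open>inv (V.fl t) (W.fl t x)\<close>, in which the
  contributions of \<open>V\<close> cancel. It is carried out on increments: over a short window the
  defect \<open>E\<close> of the integral equation changes by at most \<open>e\<close> times the
  integral of \<open>g\<close>.\<close>

lemma C_integral:
  assumes x: "x \<in> \<Omega>" and T: "T \<in> {0..1}"
  shows "C T x = x + (LINT r:{0..T}|lborel. w r (C r x))"
proof -
  define y where "y t = C t x" for t
  define z where "z t = W.fl t x" for t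
  have yc: "continuous_on {0..1} y" unfolding y_def by (rule C_continuous)
  have zc: "continuous_on {0..1} z" unfolding z_def by (rule W.fl_continuous_time)
  have y\<Omega>: "y t \<in> \<Omega>" if "t \<in> {0..1}" for t unfolding y_def using C_in_iff[OF that] x by simp
  have \<psi>y: "V.fl t (y t) = z t" if "t \<in> {0..1}" for t unfolding y_def z_def by (rule V_fl_C[OF that])
  have wy: "w t (y t) = V.B t (y t) (U t (z t))" if "t \<in> {0..1}" for t
    unfolding y_def z_def by (rule w_along_C[OF that x])
  have w_int: "set_integrable lborel {0..1} (\<lambda>r. w r (y r))"
    unfolding y_def by (rule w_along_C_integrable[OF x])
  define g where "g r = mV r + norm (U r (z r))" for r
  have nU: "set_integrable lborel {0..1} (\<lambda>r. norm (U r (z r)))"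
    using integrable_norm[OF U.v_path_integrable[OF zc, unfolded set_integrable_def]]
    by (simp add: set_integrable_def)
  have g_int: "set_integrable lborel {a..b} g" if "0 \<le> a" "b \<le> 1" for a b
    unfolding g_def using that by (intro set_integral_add(1) V.m_set_integrable set_integrable_subset[OF nU]) auto
  define E where "E t = y t - (LINT r:{0..t}|lborel. w r (y r))" for t
  have bound: "norm (E T - E 0) \<le> e * (LINT r:{0..T}|lborel. g r)" if e: "e > 0" for e
  proof -
    have "norm (E T - E 0) \<le> (LINT r:{0..T}|lborel. e * g r)"
    proof (rule increment_bound)
      show "0 \<le> T" using T by simp
      show "set_integrable lborel {0..T} (\<lambda>r. e * g r)" using g_int[of 0 T] T by simp
      fix \<tau> assume "0 \<le> \<tau>" "\<tau> \<le> T"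
      then have \<tau>: "\<tau> \<in> {0..1}" using T by simp
      \<comment> \<open>\<open>e1 * (V.L + 2) \<le> e\<close> absorbs both linearisation errors, and
        \<open>e1 \<le> 1\<close> is for the bound of \<open>a\<close> by the integral of
        \<open>g\<close>.\<close>
      define e1 where "e1 = min 1 (e / (V.L + 2))"
      have e1: "e1 > 0" "e1 \<le> 1" and "e1 \<le> e / (V.L + 2)"
        unfolding e1_def using e V.L_pos by auto
      then have e1L: "e1 * (V.L + 2) \<le> e" using V.L_pos by (simp add: pos_le_divide_eq)
      obtain \<delta>1 where \<delta>1: "\<delta>1 > 0" "\<And>r p q. r \<in> {0..1} \<Longrightarrow> \<bar>r - \<tau>\<bar> < \<delta>1 \<Longrightarrow> p \<in> ball (V.fl \<tau> (y \<tau>)) \<delta>1 \<Longrightarrow> q \<in> ball (V.fl \<tau> (y \<tau>)) \<delta>1 \<Longrightarrow>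
          norm (inv (V.fl r) p - inv (V.fl r) q - V.B \<tau> (y \<tau>) (p - q)) \<le> e1 * norm (p - q)"
        by (rule V.fl_inv_strict_derivative[OF \<tau> y\<Omega>[OF \<tau>] e1(1)]) (rule that; assumption)
      obtain \<delta>2 where \<delta>2: "\<delta>2 > 0" "\<And>r p a. r \<in> {0..1} \<Longrightarrow> \<bar>r - \<tau>\<bar> < \<delta>2 \<Longrightarrow> p \<in> ball (y \<tau>) \<delta>2 \<Longrightarrow>
          norm (V.B r p a - V.B \<tau> (y \<tau>) a) \<le> e1 * norm a"
        by (rule V.B_near[OF \<tau> y\<Omega>[OF \<tau>] e1(1)]) (rule that; assumption)
      obtain \<delta>3 where \<delta>3: "\<delta>3 > 0" "\<And>r s. r \<in> {0..1} \<Longrightarrow> s \<in> {0..1} \<Longrightarrow> \<bar>r - \<tau>\<bar> < \<delta>3 \<Longrightarrow> \<bar>s - \<tau>\<bar> < \<delta>3 \<Longrightarrow>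
          norm (V.fl r (y s) - V.fl \<tau> (y \<tau>)) < min \<delta>1 (e1 / 2)"
      proof (rule two_time_window[OF _ \<tau>, of "\<lambda>r s. V.fl r (y s)" "min \<delta>1 (e1 / 2)"])
        have "continuous_on ({0..1} \<times> {0..1}) (\<lambda>p. (fst p, y (snd p)))"
          by (intro continuous_intros continuous_on_compose2[OF yc]) auto
        from continuous_on_compose2[OF V.fl_continuous this]
        show "continuous_on ({0..1} \<times> {0..1}) (\<lambda>(r, s). V.fl r (y s))"
          by (simp add: case_prod_beta image_subset_iff)
      qed (use \<delta>1(1) e1(1) that in auto)
      obtain \<delta>4 where \<delta>4: "\<delta>4 > 0" "\<And>r s. r \<in> {0..1} \<Longrightarrow> s \<in> {0..1} \<Longrightarrow> \<bar>r - \<tau>\<bar> < \<delta>4 \<Longrightarrow> \<bar>s - \<tau>\<bar> < \<delta>4 \<Longrightarrow>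
          norm (y s - y \<tau>) < \<delta>2"
      proof (rule two_time_window[OF _ \<tau>, of "\<lambda>r s. y s" \<delta>2])
        show "continuous_on ({0..1} \<times> {0..1}) (\<lambda>(r::real, s). y s)"
          unfolding case_prod_beta by (intro continuous_on_compose2[OF yc] continuous_intros) auto
      qed (use \<delta>2(1) that in auto)
      define \<delta> where "\<delta> = min (min \<delta>1 \<delta>2) (min \<delta>3 \<delta>4)"
      show "\<exists>\<delta>>0. \<forall>s t. 0 \<le> s \<and> s \<le> \<tau> \<and> \<tau> \<le> t \<and> t \<le> T \<and> t - s < \<delta> \<longrightarrow>
          norm (E t - E s) \<le> (LINT r:{s..t}|lborel. e * g r)"
      proof (intro exI[of _ \<delta>] conjI allI impI)
        show "\<delta> > 0" unfolding \<delta>_def using \<delta>1(1) \<delta>2(1) \<delta>3(1) \<delta>4(1) by simp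
        fix s t assume st: "0 \<le> s \<and> s \<le> \<tau> \<and> \<tau> \<le> t \<and> t \<le> T \<and> t - s < \<delta>"
        have in01: "r \<in> {0..1}" and near: "\<bar>r - \<tau>\<bar> < \<delta>" if "r \<in> {s..t}" for r
          using that st T by auto
        have s: "s \<in> {s..t}" and t: "t \<in> {s..t}" and st1: "0 \<le> s" "s \<le> t" "t \<le> 1" using st T by auto
        let ?B\<tau> = "V.B \<tau> (y \<tau>)"
        have B\<tau>: "linear ?B\<tau>" by (rule V.B_linear[OF \<tau> y\<Omega>[OF \<tau>]])
        have \<psi>_near: "norm (V.fl r (y q) - V.fl \<tau> (y \<tau>)) < min \<delta>1 (e1 / 2)" if "r \<in> {s..t}" "q \<in> {s..t}" for r q
          using \<delta>3(2)[OF in01[OF that(1)] in01[OF that(2)]] near[OF that(1)] near[OF that(2)] unfolding \<delta>_def by simp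
        have B_near: "norm (V.B r (y r) a - ?B\<tau> a) \<le> e1 * norm a" if r: "r \<in> {s..t}" for r a
        proof (rule \<delta>2(2)[OF in01[OF r]])
          show "\<bar>r - \<tau>\<bar> < \<delta>2" using near[OF r] unfolding \<delta>_def by simp
          have "norm (y r - y \<tau>) < \<delta>2"
            using \<delta>4(2)[OF in01[OF r] in01[OF r]] near[OF r] unfolding \<delta>_def by simp
          then show "y r \<in> ball (y \<tau>) \<delta>2" by (simp add: dist_norm norm_minus_commute)
        qed
        \<comment> \<open>How far the orbit \<open>z\<close> has moved from the pure
          \<open>V\<close>-orbit that passes through the same point \<open>z s\<close> at time
          \<open>s\<close>. The driving term is \<open>U\<close> plus the small difference
          \<open>I\<close> of \<open>V\<close> at two nearby points.\<close>
        define a where "a = z t - V.fl t (y s)"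
        define I where "I r = V r (z r) - V r (V.fl r (y s))" for r
        have V_int: "set_integrable lborel {s..t} (\<lambda>r. V r (z r))" "set_integrable lborel {s..t} (\<lambda>r. V r (V.fl r (y s)))"
          and U_int: "set_integrable lborel {s..t} (\<lambda>r. U r (z r))"
          by (intro V.v_path_integrable U.v_path_integrable continuous_on_subset[OF zc]
            continuous_on_subset[OF V.fl_continuous_time]; use st1 in auto)+
        have I_int: "set_integrable lborel {s..t} I" unfolding I_def using V_int by simp
        then have IU: "set_integrable lborel {s..t} (\<lambda>r. I r + U r (z r))"
          using U_int by (rule set_integral_add(1))
        have "a = (z t - z s) - (V.fl t (y s) - V.fl s (y s))"
          using \<psi>y[OF in01[OF s]] by (simp add: a_def)
        also have "\<dots> = (LINT r:{s..t}|lborel. V r (z r) + U r (z r)) - (LINT r:{s..t}|lborel. V r (V.fl r (y s)))"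
          unfolding z_def W.fl_diff[OF st1] V.fl_diff[OF st1] ..
        also have "\<dots> = (LINT r:{s..t}|lborel. I r + U r (z r))"
          unfolding I_def using V_int U_int by simp
        finally have a_eq: "a = (LINT r:{s..t}|lborel. I r + U r (z r))" .
        have I_le: "norm (I r) \<le> e1 * mV r" if r: "r \<in> {s..t}" for r
        proof -
          have "norm (z r - V.fl r (y s)) \<le> e1"
            using \<psi>_near[OF r r] \<psi>_near[OF r s] \<psi>y[OF in01[OF r]]
              norm_triangle_ineq4[of "z r - V.fl \<tau> (y \<tau>)" "V.fl r (y s) - V.fl \<tau> (y \<tau>)"] by simp
          then have "mV r * norm (z r - V.fl r (y s)) \<le> mV r * e1" by (intro mult_left_mono V.m_nonneg)
          then show ?thesis using V.v_Lipschitz[of r "z r" "V.fl r (y s)"] by (simp add: I_def mult.commute)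
        qed
        have a_le: "norm a \<le> (LINT r:{s..t}|lborel. g r)"
          unfolding a_eq
        proof (rule set_integral_norm_le)
          show "norm (I r + U r (z r)) \<le> g r" if r: "r \<in> {s..t}" for r
          proof -
            have "e1 * mV r \<le> 1 * mV r" by (intro mult_right_mono e1 V.m_nonneg)
            then show ?thesis using norm_triangle_ineq[of "I r" "U r (z r)"] I_le[OF r] by (simp add: g_def)
          qed
        qed (use I_int U_int g_int st1 in auto)
        have wi: "set_integrable lborel {s..t} (\<lambda>r. w r (y r))"
          using st1 by (intro set_integrable_subset[OF w_int]) auto
        \<comment> \<open>Strict differentiability of the inverse flow replaces
          \<open>y t - y s\<close> by a fixed linear map applied to \<open>a\<close>.\<close>
        have 1: "norm (y t - y s - ?B\<tau> a) \<le> e1 * norm a"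
        proof -
          have tt: "t \<in> {0..1}" by (rule in01[OF t])
          have "norm (inv (V.fl t) (V.fl t (y t)) - inv (V.fl t) (V.fl t (y s)) - ?B\<tau> (V.fl t (y t) - V.fl t (y s)))
              \<le> e1 * norm (V.fl t (y t) - V.fl t (y s))"
          proof (rule \<delta>1(2)[OF tt])
            show "\<bar>t - \<tau>\<bar> < \<delta>1" using near[OF t] unfolding \<delta>_def by simp
            show "V.fl t (y t) \<in> ball (V.fl \<tau> (y \<tau>)) \<delta>1" "V.fl t (y s) \<in> ball (V.fl \<tau> (y \<tau>)) \<delta>1"
              using \<psi>_near[OF t t] \<psi>_near[OF t s] by (simp_all add: dist_norm norm_minus_commute)
          qed
          then show ?thesis using \<psi>y[OF tt] unfolding V.inv_fl[OF tt] by (simp add: a_def)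
        qed
        \<comment> \<open>The map frozen at \<open>\<tau>\<close> is exchanged for the one at the
          current time and point, and \<open>I\<close> is counted as an error.\<close>
        have 2: "norm (?B\<tau> a - (LINT r:{s..t}|lborel. w r (y r))) \<le> (LINT r:{s..t}|lborel. e1 * (V.L + 1) * g r)"
        proof -
          have eq: "?B\<tau> a - (LINT r:{s..t}|lborel. w r (y r)) = (LINT r:{s..t}|lborel. ?B\<tau> (I r + U r (z r)) - w r (y r))"
            unfolding a_eq set_integral_linear(2)[OF B\<tau> IU, symmetric]
            by (rule set_integral_diff(2)[OF set_integral_linear(1)[OF B\<tau> IU] wi, symmetric])
          show ?thesis
            unfolding eq
          proof (rule set_integral_norm_le)
            show "set_integrable lborel {s..t} (\<lambda>r. ?B\<tau> (I r + U r (z r)) - w r (y r))"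
              by (rule set_integral_diff(1)[OF set_integral_linear(1)[OF B\<tau> IU] wi])
            show "set_integrable lborel {s..t} (\<lambda>r. e1 * (V.L + 1) * g r)" using g_int st1 by simp
            fix r assume r: "r \<in> {s..t}"
            have "?B\<tau> (I r + U r (z r)) - w r (y r) = ?B\<tau> (I r) - (V.B r (y r) (U r (z r)) - ?B\<tau> (U r (z r)))"
              using wy[OF in01[OF r]] by (simp add: linear_add[OF B\<tau>])
            then have "norm (?B\<tau> (I r + U r (z r)) - w r (y r)) \<le> norm (?B\<tau> (I r)) + norm (V.B r (y r) (U r (z r)) - ?B\<tau> (U r (z r)))"
              by (simp only: norm_triangle_ineq4)
            also have "\<dots> \<le> V.L * (e1 * mV r) + e1 * norm (U r (z r))"
              using V.L_pos
              by (intro add_mono B_near[OF r] order_trans[OF V.B_bound[OF \<tau> y\<Omega>[OF \<tau>]] mult_left_mono[OF I_le[OF r]]]) simp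
            also have "\<dots> \<le> e1 * (V.L + 1) * g r"
            proof -
              have "0 \<le> e1 * mV r" "0 \<le> e1 * (V.L * norm (U r (z r)))"
                using e1(1) V.m_nonneg V.L_pos by auto
              then show ?thesis by (simp add: g_def algebra_simps)
            qed
            finally show "norm (?B\<tau> (I r + U r (z r)) - w r (y r)) \<le> e1 * (V.L + 1) * g r" .
          qed
        qed
        have "set_integrable lborel {0..t} (\<lambda>r. w r (y r))"
          using st1 by (intro set_integrable_subset[OF w_int]) auto
        note comb = set_integral_combine[OF st1(1,2) this]
        have "E t - E s = (y t - y s - ?B\<tau> a) + (?B\<tau> a - (LINT r:{s..t}|lborel. w r (y r)))"
          unfolding E_def comb by simp
        then have "norm (E t - E s) \<le> norm (y t - y s - ?B\<tau> a) + norm (?B\<tau> a - (LINT r:{s..t}|lborel. w r (y r)))"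
          by (simp only: norm_triangle_ineq)
        also have "\<dots> \<le> e1 * (LINT r:{s..t}|lborel. g r) + e1 * (V.L + 1) * (LINT r:{s..t}|lborel. g r)"
          using 1 2[unfolded set_integral_mult_right] mult_left_mono[OF a_le less_imp_le[OF e1(1)]] by linarith
        also have "\<dots> = e1 * (V.L + 2) * (LINT r:{s..t}|lborel. g r)" by (simp add: algebra_simps)
        also have "\<dots> \<le> e * (LINT r:{s..t}|lborel. g r)"
          using e1L norm_ge_zero[of a] a_le by (intro mult_right_mono) linarith+
        finally show "norm (E t - E s) \<le> (LINT r:{s..t}|lborel. e * g r)" by simp
      qed
    qed
    then show ?thesis by simp
  qed
  have "norm (E T - E 0) \<le> 0"
  proof (rule field_le_epsilon)
    fix d :: real assume d: "d > 0"
    define X where "X = (LINT r:{0..T}|lborel. g r)"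
    have "X \<ge> 0" unfolding X_def g_def set_lebesgue_integral_def
      using V.m_nonneg by (intro integral_nonneg_AE AE_I2) simp
    have "norm (E T - E 0) \<le> d / (X + 1) * X"
      using bound[of "d / (X + 1)"] d \<open>X \<ge> 0\<close> unfolding X_def[symmetric] by simp
    also have "\<dots> \<le> d" using d \<open>X \<ge> 0\<close> by (simp add: field_simps)
    finally show "norm (E T - E 0) \<le> 0 + d" by simp
  qed
  moreover have "E 0 = x"
    unfolding E_def set_integral_singleton y_def C_def by (simp add: V.fl_0[abs_def] W.fl_0 id_def[symmetric])
  ultimately show ?thesis by (simp add: E_def y_def algebra_simps)
qed

text \<open>A curve \<open>y\<close> driven by \<open>w\<close> is pulled back to \<open>h t = \<Phi>\<^sub>t\<inverse> (\<psi>\<^sub>t (y t))\<close>, which is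
  locally constant while \<open>y\<close> stays in \<open>\<Omega>\<close>. So \<open>y\<close> cannot reach the boundary, where \<open>w\<close> is
  not Lipschitz.\<close>

lemma pullback_locally_constant:
  assumes yc: "continuous_on {0..1} y"
    and w_int: "set_integrable lborel {0..1} (\<lambda>r. w r (y r))"
    and y_diff: "\<And>s t. 0 \<le> s \<Longrightarrow> s \<le> t \<Longrightarrow> t \<le> 1 \<Longrightarrow> y t - y s = (LINT r:{s..t}|lborel. w r (y r))"
    and ab: "0 \<le> a" "a \<le> b" "b \<le> 1" and y\<Omega>: "\<And>t. t \<in> {a..b} \<Longrightarrow> y t \<in> \<Omega>"
  shows "inv (W.fl b) (V.fl b (y b)) = inv (W.fl a) (V.fl a (y a))"
proof -
  define h where "h t = inv (W.fl t) (V.fl t (y t))" for t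
  have \<Phi>h: "W.fl t (h t) = V.fl t (y t)" if "t \<in> {0..1}" for t unfolding h_def using that by simp
  have \<psi>yc: "continuous_on ({0..1} \<times> {0..1}) (\<lambda>(r, s). V.fl r (y s))"
  proof -
    have "continuous_on ({0..1} \<times> {0..1}) (\<lambda>p. (fst p, y (snd p)))"
      by (intro continuous_intros continuous_on_compose2[OF yc]) auto
    from continuous_on_compose2[OF V.fl_continuous this]
    show ?thesis by (simp add: case_prod_beta image_subset_iff)
  qed
  have hc: "continuous_on {0..1} h"
  proof -
    have "continuous_on {0..1} (\<lambda>t. (t, y t))" by (intro continuous_intros yc)
    from continuous_on_compose2[OF V.fl_continuous this]
    have "continuous_on {0..1} (\<lambda>t. V.fl t (y t))" by (simp add: image_subset_iff)
    then have "continuous_on {0..1} (\<lambda>t. (t, V.fl t (y t)))" by (intro continuous_intros)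
    from continuous_on_compose2[OF W.fl_inv_continuous this]
    show ?thesis by (simp add: h_def[abs_def] image_subset_iff)
  qed
  have \<Phi>hc: "continuous_on ({0..1} \<times> {0..1}) (\<lambda>(r, s). W.fl r (h s))"
  proof -
    have "continuous_on ({0..1} \<times> {0..1}) (\<lambda>p. (fst p, h (snd p)))"
      by (intro continuous_intros continuous_on_compose2[OF hc]) auto
    from continuous_on_compose2[OF W.fl_continuous this]
    show ?thesis by (simp add: case_prod_beta image_subset_iff)
  qed
  \<comment> \<open>The derivative of the \<open>V\<close>-flow maps \<open>w\<close> back to
    \<open>U\<close>; this is where \<open>y\<close> has to lie in \<open>\<Omega>\<close>.\<close>
  have wy: "V.J r (y r) (w r (y r)) = U r (V.fl r (y r))" if "r \<in> {a..b}" for r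
    using y\<Omega>[OF that] that ab by (simp add: w_def)
  define g where "g r = mV r + mU r + norm (w r (y r))" for r
  have nw: "set_integrable lborel {0..1} (\<lambda>r. norm (w r (y r)))"
    using integrable_norm[OF w_int[unfolded set_integrable_def]] by (simp add: set_integrable_def)
  have g_int: "set_integrable lborel {s..t} g" if "0 \<le> s" "t \<le> 1" for s t
    unfolding g_def using that
    by (intro set_integral_add(1) V.m_set_integrable U.m_set_integrable set_integrable_subset[OF nw]) auto
  have bound: "norm (h b - h a) \<le> e * (LINT r:{a..b}|lborel. g r)" if e: "e > 0" for e
  proof -
    have "norm (h b - h a) \<le> (LINT r:{a..b}|lborel. e * g r)"
    proof (rule increment_bound[OF ab(2)])
      show "set_integrable lborel {a..b} (\<lambda>r. e * g r)" using g_int[of a b] ab by simp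
      fix \<tau> assume \<tau>ab: "a \<le> \<tau>" "\<tau> \<le> b"
      then have \<tau>: "\<tau> \<in> {0..1}" and y\<tau>: "y \<tau> \<in> \<Omega>" using ab y\<Omega> by auto
      \<comment> \<open>A factor \<open>W.L\<close> for the inverse of the flow of \<open>W\<close>,
        and \<open>2\<close> for the two errors \<open>A\<close> and \<open>D\<close>.\<close>
      define e1 where "e1 = e / (2 * W.L)"
      have e1: "e1 > 0" unfolding e1_def using e W.L_pos by simp
      then have half_pos: "e1 / 2 > 0" by simp
      obtain \<delta>1 where \<delta>1: "\<delta>1 > 0" "\<And>r p q. r \<in> {0..1} \<Longrightarrow> \<bar>r - \<tau>\<bar> < \<delta>1 \<Longrightarrow> p \<in> ball (y \<tau>) \<delta>1 \<Longrightarrow> q \<in> ball (y \<tau>) \<delta>1 \<Longrightarrow>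
          norm (V.fl r p - V.fl r q - V.J \<tau> (y \<tau>) (p - q)) \<le> e1 * norm (p - q)"
        by (rule V.fl_strict_derivative[OF \<tau> y\<tau> e1]) (rule that; assumption)
      obtain \<delta>2 where \<delta>2: "\<delta>2 > 0" "\<And>r p k. r \<in> {0..1} \<Longrightarrow> \<bar>r - \<tau>\<bar> < \<delta>2 \<Longrightarrow> p \<in> ball (y \<tau>) \<delta>2 \<Longrightarrow>
          norm (V.J r p k - V.J \<tau> (y \<tau>) k) \<le> e1 * norm k"
        by (rule V.J_near[OF \<tau> y\<tau> e1]) (rule that; assumption)
      obtain \<delta>3 where \<delta>3: "\<delta>3 > 0" "\<And>r s. r \<in> {0..1} \<Longrightarrow> s \<in> {0..1} \<Longrightarrow> \<bar>r - \<tau>\<bar> < \<delta>3 \<Longrightarrow> \<bar>s - \<tau>\<bar> < \<delta>3 \<Longrightarrow>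
          norm (V.fl r (y s) - V.fl \<tau> (y \<tau>)) < e1 / 2"
        by (rule two_time_window[OF \<psi>yc \<tau> half_pos]) (rule that; assumption)
      obtain \<delta>4 where \<delta>4: "\<delta>4 > 0" "\<And>r s. r \<in> {0..1} \<Longrightarrow> s \<in> {0..1} \<Longrightarrow> \<bar>r - \<tau>\<bar> < \<delta>4 \<Longrightarrow> \<bar>s - \<tau>\<bar> < \<delta>4 \<Longrightarrow>
          norm (y s - y \<tau>) < min \<delta>1 \<delta>2"
      proof (rule two_time_window[OF _ \<tau>, of "\<lambda>r s. y s" "min \<delta>1 \<delta>2"])
        show "continuous_on ({0..1} \<times> {0..1}) (\<lambda>(r::real, s). y s)"
          unfolding case_prod_beta by (intro continuous_on_compose2[OF yc] continuous_intros) auto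
      qed (use \<delta>1(1) \<delta>2(1) that in auto)
      obtain \<delta>5 where \<delta>5: "\<delta>5 > 0" "\<And>r s. r \<in> {0..1} \<Longrightarrow> s \<in> {0..1} \<Longrightarrow> \<bar>r - \<tau>\<bar> < \<delta>5 \<Longrightarrow> \<bar>s - \<tau>\<bar> < \<delta>5 \<Longrightarrow>
          norm (W.fl r (h s) - W.fl \<tau> (h \<tau>)) < e1 / 2"
        by (rule two_time_window[OF \<Phi>hc \<tau> half_pos]) (rule that; assumption)
      define \<delta> where "\<delta> = min (min \<delta>1 \<delta>2) (min \<delta>3 (min \<delta>4 \<delta>5))"
      show "\<exists>\<delta>>0. \<forall>s t. a \<le> s \<and> s \<le> \<tau> \<and> \<tau> \<le> t \<and> t \<le> b \<and> t - s < \<delta> \<longrightarrow>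
          norm (h t - h s) \<le> (LINT r:{s..t}|lborel. e * g r)"
      proof (intro exI[of _ \<delta>] conjI allI impI)
        show "\<delta> > 0" unfolding \<delta>_def using \<delta>1(1) \<delta>2(1) \<delta>3(1) \<delta>4(1) \<delta>5(1) by simp
        fix s t assume st: "a \<le> s \<and> s \<le> \<tau> \<and> \<tau> \<le> t \<and> t \<le> b \<and> t - s < \<delta>"
        have in01: "r \<in> {0..1}" and near: "\<bar>r - \<tau>\<bar> < \<delta>" and inab: "r \<in> {a..b}" if "r \<in> {s..t}" for r
          using that st ab by auto
        have s: "s \<in> {s..t}" and t: "t \<in> {s..t}" and st1: "0 \<le> s" "s \<le> t" "t \<le> 1" using st ab by auto
        have near': "\<bar>r - \<tau>\<bar> < \<delta>1" "\<bar>r - \<tau>\<bar> < \<delta>2" "\<bar>r - \<tau>\<bar> < \<delta>3" "\<bar>r - \<tau>\<bar> < \<delta>4" "\<bar>r - \<tau>\<bar> < \<delta>5" if "r \<in> {s..t}" for r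
          using near[OF that] unfolding \<delta>_def by auto
        have \<psi>_near: "norm (V.fl r (y q) - V.fl \<tau> (y \<tau>)) < e1 / 2" if "r \<in> {s..t}" "q \<in> {s..t}" for r q
          by (intro \<delta>3(2) in01 near' that)
        have \<Phi>_near: "norm (W.fl r (h q) - V.fl \<tau> (y \<tau>)) < e1 / 2" if "r \<in> {s..t}" "q \<in> {s..t}" for r q
          unfolding \<Phi>h[OF \<tau>, symmetric] by (intro \<delta>5(2) in01 near' that)
        have y_near: "y r \<in> ball (y \<tau>) \<delta>1" "y r \<in> ball (y \<tau>) \<delta>2" if "r \<in> {s..t}" for r
          using \<delta>4(2)[OF in01 in01 near'(4) near'(4), OF that that that that] by (auto simp: dist_norm norm_minus_commute)
        let ?J = "V.J \<tau> (y \<tau>)"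
        have J: "linear ?J" by (rule V.J_linear[OF y\<tau> \<tau>])
        have wi: "set_integrable lborel {s..t} (\<lambda>r. w r (y r))"
          using st1 by (intro set_integrable_subset[OF w_int]) auto
        have nwi: "set_integrable lborel {s..t} (\<lambda>r. norm (w r (y r)))"
          using st1 by (intro set_integrable_subset[OF nw]) auto
        have V_int: "set_integrable lborel {s..t} (\<lambda>r. V r (V.fl r (y s)))"
          and W_int: "set_integrable lborel {s..t} (\<lambda>r. V r (W.fl r (h s)) + U r (W.fl r (h s)))"
          using V.fl_path_integrable[of s t] W.fl_path_integrable[of s t] st1 by auto
        \<comment> \<open>\<open>h t - h s\<close> is read off from \<open>V.fl t (y t)\<close> and
          \<open>W.fl t (h s)\<close>; the corresponding curves coincide at time \<open>s\<close>.
          \<open>A\<close> is the error of linearising the flow of \<open>V\<close>, and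
          \<open>D\<close> the remaining difference of velocities.\<close>
        define A where "A = V.fl t (y t) - V.fl t (y s) - ?J (y t - y s)"
        define D where "D r = ?J (w r (y r)) + V r (V.fl r (y s)) - (V r (W.fl r (h s)) + U r (W.fl r (h s)))" for r
        have D_int: "set_integrable lborel {s..t} D"
          unfolding D_def by (intro set_integral_add(1) set_integral_diff(1) set_integral_linear(1)[OF J] wi V_int W_int)
        have "V.fl t (y t) - W.fl t (h s) =
            A + (?J (y t - y s) + (V.fl t (y s) - V.fl s (y s)) - (W.fl t (h s) - W.fl s (h s)))"
          using \<Phi>h[OF in01[OF s]] by (simp add: A_def)
        also have "?J (y t - y s) + (V.fl t (y s) - V.fl s (y s)) - (W.fl t (h s) - W.fl s (h s)) = (LINT r:{s..t}|lborel. D r)"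
          unfolding y_diff[OF st1] V.fl_diff[OF st1] W.fl_diff[OF st1] D_def
            set_integral_linear(2)[OF J wi, symmetric]
            set_integral_diff(2)[OF set_integral_add(1)[OF set_integral_linear(1)[OF J wi] V_int] W_int]
            set_integral_add(2)[OF set_integral_linear(1)[OF J wi] V_int] ..
        finally have eq: "V.fl t (y t) - W.fl t (h s) = A + (LINT r:{s..t}|lborel. D r)" .
        have "norm (y t - y s) \<le> (LINT r:{s..t}|lborel. norm (w r (y r)))"
          unfolding y_diff[OF st1] by (rule set_integral_norm_bound[OF wi])
        also have "\<dots> \<le> (LINT r:{s..t}|lborel. g r)"
          using V.m_nonneg U.m_nonneg by (intro set_integral_mono nwi g_int st1) (auto simp: g_def)
        finally have y_le: "norm (y t - y s) \<le> (LINT r:{s..t}|lborel. g r)" .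
        have A_le: "norm A \<le> e1 * norm (y t - y s)"
          unfolding A_def by (rule \<delta>1(2)[OF in01[OF t] near'(1)[OF t] y_near(1)[OF t] y_near(1)[OF s]])
        have D_le: "norm (LINT r:{s..t}|lborel. D r) \<le> (LINT r:{s..t}|lborel. e1 * g r)"
        proof (rule set_integral_norm_le[OF D_int])
          show "set_integrable lborel {s..t} (\<lambda>r. e1 * g r)" using g_int st1 by simp
          fix r assume r: "r \<in> {s..t}"
          have close: "norm (p - q) \<le> e1" if "norm (p - V.fl \<tau> (y \<tau>)) < e1 / 2" "norm (q - V.fl \<tau> (y \<tau>)) < e1 / 2" for p q
            using that norm_triangle_ineq4[of "p - V.fl \<tau> (y \<tau>)" "q - V.fl \<tau> (y \<tau>)"] by simp
          \<comment> \<open>Three errors: the derivative frozen at \<open>\<tau>\<close>, and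
            \<open>U\<close> and \<open>V\<close> taken at two nearby points.\<close>
          define d1 d2 d3 where "d1 = V.J r (y r) (w r (y r)) - ?J (w r (y r))"
            and "d2 = U r (V.fl r (y r)) - U r (W.fl r (h s))"
            and "d3 = V r (V.fl r (y s)) - V r (W.fl r (h s))"
          have "norm d1 \<le> e1 * norm (w r (y r))"
            unfolding d1_def by (rule \<delta>2(2)[OF in01[OF r] near'(2)[OF r] y_near(2)[OF r]])
          moreover have "norm d2 \<le> mU r * e1"
            unfolding d2_def by (rule order_trans[OF U.v_Lipschitz mult_left_mono[OF close[OF \<psi>_near[OF r r] \<Phi>_near[OF r s]] U.m_nonneg]])
          moreover have "norm d3 \<le> mV r * e1"
            unfolding d3_def by (rule order_trans[OF V.v_Lipschitz mult_left_mono[OF close[OF \<psi>_near[OF r s] \<Phi>_near[OF r s]] V.m_nonneg]])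
          moreover have "norm (D r) \<le> norm d1 + norm d2 + norm d3"
          proof -
            have "D r = (d2 + d3) - d1"
              unfolding D_def d1_def d2_def d3_def wy[OF inab[OF r]] by simp
            then show ?thesis using norm_triangle_ineq4[of "d2 + d3" d1] norm_triangle_ineq[of d2 d3] by simp
          qed
          ultimately show "norm (D r) \<le> e1 * g r" unfolding g_def distrib_left by (simp add: mult.commute)
        qed
        have "h t - h s = inv (W.fl t) (V.fl t (y t)) - inv (W.fl t) (W.fl t (h s))"
          using in01[OF t] by (simp add: h_def)
        then have "norm (h t - h s) \<le> W.L * norm (V.fl t (y t) - W.fl t (h s))"
          using W.fl_inv_Lipschitz[OF in01[OF t]] by simp
        also have "norm (V.fl t (y t) - W.fl t (h s)) \<le> 2 * e1 * (LINT r:{s..t}|lborel. g r)"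
          unfolding eq using norm_triangle_ineq[of A "LINT r:{s..t}|lborel. D r"] A_le D_le[unfolded set_integral_mult_right]
            mult_left_mono[OF y_le less_imp_le[OF e1]] by linarith
        then have "W.L * norm (V.fl t (y t) - W.fl t (h s)) \<le> W.L * (2 * e1 * (LINT r:{s..t}|lborel. g r))"
          using W.L_pos by (intro mult_left_mono) auto
        also have "\<dots> = (LINT r:{s..t}|lborel. e * g r)" using W.L_pos by (simp add: e1_def)
        finally show "norm (h t - h s) \<le> (LINT r:{s..t}|lborel. e * g r)" .
      qed
    qed
    then show ?thesis by simp
  qed
  have "norm (h b - h a) \<le> 0"
  proof (rule field_le_epsilon)
    fix d :: real assume d: "d > 0"
    define X where "X = (LINT r:{a..b}|lborel. g r)"
    have "X \<ge> 0" unfolding X_def g_def set_lebesgue_integral_def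
      using V.m_nonneg U.m_nonneg by (intro integral_nonneg_AE AE_I2) simp
    have "norm (h b - h a) \<le> d / (X + 1) * X"
      using bound[of "d / (X + 1)"] d \<open>X \<ge> 0\<close> unfolding X_def[symmetric] by simp
    also have "\<dots> \<le> d" using d \<open>X \<ge> 0\<close> by (simp add: field_simps)
    finally show "norm (h b - h a) \<le> 0 + d" by simp
  qed
  then show ?thesis by (simp add: h_def)
qed

text \<open>Let \<open>h\<close> be the pullback of \<open>y\<close> by the flow of
  \<open>W\<close>. If \<open>y\<close> meets \<open>\<Omega>\<close> at time \<open>s\<close>, the
  set where \<open>h\<close> equals \<open>h s\<close> is open and closed in \<open>{0..1}\<close>,
  so \<open>h\<close> is constant and equal to \<open>x\<close>.\<close>

lemma w_integral_curve_unique: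
  assumes y: "\<And>t. t \<in> {0..1} \<Longrightarrow> set_integrable lborel {0..t} (\<lambda>r. w r (y r)) \<and>
      y t = x + (LINT r:{0..t}|lborel. w r (y r))"
    and t: "t \<in> {0..1}"
  shows "y t = C t x"
proof -
  have w_int: "set_integrable lborel {0..1} (\<lambda>r. w r (y r))" using y[of 1] by simp
  have yc: "continuous_on {0..1} y"
    using continuous_on_add[OF continuous_on_const set_integral_continuous_on[OF w_int], of x]
    by (rule continuous_on_eq) (use y in auto)
  have y_diff: "y t - y s = (LINT r:{s..t}|lborel. w r (y r))" if st: "0 \<le> s" "s \<le> t" "t \<le> 1" for s t
  proof -
    have "set_integrable lborel {0..t} (\<lambda>r. w r (y r))" using y[of t] st by simp
    from set_integral_combine[OF st(1,2) this] show ?thesis using y[of t] y[of s] st by simp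
  qed
  have y0: "y 0 = x" using y[of 0] unfolding set_integral_singleton by simp
  define h where "h t = inv (W.fl t) (V.fl t (y t))" for t
  have \<Phi>h: "W.fl t (h t) = V.fl t (y t)" if "t \<in> {0..1}" for t unfolding h_def using that by simp
  have h\<Omega>: "h t \<in> \<Omega> \<longleftrightarrow> y t \<in> \<Omega>" if t: "t \<in> {0..1}" for t
    using W.fl_in_iff[OF t, of "h t"] V.fl_in_iff[OF t, of "y t"] \<Phi>h[OF t] by simp
  have hc: "continuous_on {0..1} h"
  proof -
    have "continuous_on {0..1} (\<lambda>t. (t, y t))" by (intro continuous_intros yc)
    from continuous_on_compose2[OF V.fl_continuous this]
    have "continuous_on {0..1} (\<lambda>t. V.fl t (y t))" by (simp add: image_subset_iff)
    then have "continuous_on {0..1} (\<lambda>t. (t, V.fl t (y t)))" by (intro continuous_intros)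
    from continuous_on_compose2[OF W.fl_inv_continuous this]
    show ?thesis by (simp add: h_def[abs_def] image_subset_iff)
  qed
  have yV: "y t = inv (V.fl t) (W.fl t (h t))" if t: "t \<in> {0..1}" for t
    using \<Phi>h[OF t] V.inv_fl[OF t, of "y t"] by simp
  show ?thesis
  proof (cases "\<exists>s\<in>{0..1}. y s \<in> \<Omega>")
    case False
    \<comment> \<open>A curve that never meets \<open>\<Omega>\<close> has zero velocity and stays
      at \<open>x\<close>.\<close>
    then have "w r (y r) = 0" if "r \<in> {0..t}" for r using that t by (auto simp: w_def)
    then have "(LINT r:{0..t}|lborel. w r (y r)) = (LINT r:{0..t}|lborel. 0)"
      by (intro set_lebesgue_integral_cong) auto
    then have "y t = x" using y[OF t] by (simp add: set_lebesgue_integral_def)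
    moreover have "x \<notin> \<Omega>" using False y0 by force
    then have "C t x = x"
      using V.fl_outside[OF _ t, of x] W.fl_outside[OF _ t, of x] V.inv_fl[OF t, of x] by (simp add: C_def)
    ultimately show ?thesis by simp
  next
    case True
    then obtain s where s: "s \<in> {0..1}" "y s \<in> \<Omega>" by blast
    \<comment> \<open>The value \<open>h s\<close> lies in \<open>\<Omega>\<close> and flows
      preserve \<open>\<Omega>\<close>, so \<open>y\<close> is in \<open>\<Omega>\<close> at all
      times of this set; openness then follows from
      \<open>pullback_locally_constant\<close>.\<close>
    define S where "S = {t \<in> {0..1}. h t = h s}"
    have clS: "closedin (top_of_set {0..1}) S"
      using continuous_closedin_preimage_constant[OF hc, of "h s"] by (simp add: S_def)
    have opS: "openin (top_of_set {0..1}) S"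
      unfolding openin_euclidean_subtopology_iff
    proof (intro conjI ballI)
      show "S \<subseteq> {0..1}" by (auto simp: S_def)
      fix \<tau> assume "\<tau> \<in> S"
      then have \<tau>: "\<tau> \<in> {0..1}" and h\<tau>: "h \<tau> = h s" by (auto simp: S_def)
      then have "y \<tau> \<in> \<Omega>" using h\<Omega> s by metis
      then obtain \<eta> where \<eta>: "\<eta> > 0" "ball (y \<tau>) \<eta> \<subseteq> \<Omega>" using V.open_\<Omega> open_contains_ball by blast
      obtain \<delta> where \<delta>: "\<delta> > 0" "\<And>t. t \<in> {0..1} \<Longrightarrow> dist t \<tau> < \<delta> \<Longrightarrow> dist (y t) (y \<tau>) < \<eta>"
        using yc[unfolded continuous_on_iff] \<tau> \<eta>(1) by metis
      have const: "h b = h a" if "a \<in> {0..1}" "b \<in> {0..1}" "a \<le> b" "dist a \<tau> < \<delta>" "dist b \<tau> < \<delta>" for a b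
        unfolding h_def
      proof (rule pullback_locally_constant[OF yc w_int y_diff])
        fix t assume t: "t \<in> {a..b}"
        then have "dist t \<tau> < \<delta>" using that by (auto simp: dist_real_def)
        then have "y t \<in> ball (y \<tau>) \<eta>" using \<delta>(2)[of t] that t by (auto simp: dist_commute)
        then show "y t \<in> \<Omega>" using \<eta>(2) by auto
      qed (use that in auto)
      show "\<exists>e>0. \<forall>t\<in>{0..1}. dist t \<tau> < e \<longrightarrow> t \<in> S"
      proof (intro exI[of _ \<delta>] conjI ballI impI)
        fix t :: real assume t: "t \<in> {0..1}" "dist t \<tau> < \<delta>"
        have "h t = h \<tau>" using const[of t \<tau>] const[of \<tau> t] t \<tau> \<delta>(1) by (cases "t \<le> \<tau>") auto
        then show "t \<in> S" using t h\<tau> by (simp add: S_def)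
      qed (rule \<delta>(1))
    qed
    have "S \<noteq> {}" using s unfolding S_def by blast
    moreover have "\<forall>T. openin (top_of_set {0..1::real}) T \<and> closedin (top_of_set {0..1}) T \<longrightarrow> T = {} \<or> T = {0..1}"
      using connected_Icc[of 0 "1::real"] by (simp only: connected_clopen)
    from spec[OF this, of S] have "S = {} \<or> S = {0..1}" using clS opS by (simp only: simp_thms)
    ultimately have "S = {0..1}" by (simp only: simp_thms)
    then have "r \<in> S" if "r \<in> {0..1}" for r using that by (simp only:)
    then have hs: "h r = h s" if "r \<in> {0..1}" for r using that unfolding S_def by blast
    have "h t = h 0" using hs[OF t] hs[of 0] by simp
    moreover have "h 0 = x"
      unfolding h_def y0 using W.inv_fl[of 0 x] by (simp add: V.fl_0 W.fl_0)
    ultimately show ?thesis using yV[OF t] by (simp add: C_def)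
  qed
qed

text \<open>\<open>C_integral\<close> shows that a flow exists, so \<open>flow\<close> really
  selects one, and \<open>w_integral_curve_unique\<close> identifies the selected one.\<close>

theorem flow_Ad:
  assumes w': "\<And>r. r \<in> {0..1} \<Longrightarrow> w' r = w r" and t: "t \<in> {0..1}"
  shows "flow w' t = C t"
proof -
  have eq: "is_flow w' \<phi> \<longleftrightarrow> is_flow w \<phi>" for \<phi> by (rule is_flow_cong[OF w'])
  \<comment> \<open>The equation concerns times in \<open>{0..1}\<close>; elsewhere the identity is
    a default value.\<close>
  have "is_flow w (\<lambda>t x. if t \<in> {0..1} then C t x else x)"
    unfolding is_flow_def
  proof (intro allI ballI)
    fix x and t :: real assume t: "t \<in> {0..1}"
    have "set_integrable lborel {0..t} (\<lambda>r. w r (C r x)) \<and> C t x = x + (LINT r:{0..t}|lborel. w r (C r x))"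
    proof (cases "x \<in> \<Omega>")
      case True
      then show ?thesis
        using C_integral[OF True t] set_integrable_subset[OF w_along_C_integrable[OF True], of "{0..t}"] t by auto
    next
      case False
      then have Cx: "C r x = x" if "r \<in> {0..1}" for r
        using V.fl_outside[OF _ that, of x] W.fl_outside[OF _ that, of x] V.inv_fl[OF that, of x] by (simp add: C_def)
      have "set_integrable lborel {0..t} (\<lambda>r. w r (C r x)) = set_integrable lborel {0..t} (\<lambda>r. 0::'a)"
        "(LINT r:{0..t}|lborel. w r (C r x)) = (LINT r:{0..t}|lborel. 0::'a)"
        using t Cx False by (intro set_integrable_cong set_lebesgue_integral_cong; auto simp: w_def)+
      then show ?thesis using Cx[OF t] by (simp add: set_integrable_def set_lebesgue_integral_def)
    qed
    moreover have "set_integrable lborel {0..t} (\<lambda>r. w r (if r \<in> {0..1} then C r x else x)) = set_integrable lborel {0..t} (\<lambda>r. w r (C r x))"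
      "(LINT r:{0..t}|lborel. w r (if r \<in> {0..1} then C r x else x)) = (LINT r:{0..t}|lborel. w r (C r x))"
      using t by (intro set_integrable_cong set_lebesgue_integral_cong; auto)+
    ultimately show "set_integrable lborel {0..t} (\<lambda>r. w r (if r \<in> {0..1} then C r x else x)) \<and>
        (if t \<in> {0..1} then C t x else x) = x + (LINT r:{0..t}|lborel. w r (if r \<in> {0..1} then C r x else x))"
      using t by simp
  qed
  then have "is_flow w' (\<lambda>t x. if t \<in> {0..1} then C t x else x)" by (rule eq[THEN iffD2])
  then have "is_flow w' (flow w')" unfolding flow_def by (rule someI[of "is_flow w'"])
  then have fl: "is_flow w (flow w')" by (rule eq[THEN iffD1])
  show ?thesis
  proof
    fix x
    show "flow w' t x = C t x"
      by (rule w_integral_curve_unique[OF _ t]) (use fl in \<open>simp add: is_flow_def\<close>)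
  qed
qed

end

section \<open>Kernels over intervals\<close>

lemma measurable_lborel_restrict [simp]:
  "measurable (restrict_space lborel I) N = measurable (restrict_space borel I) N"
  by (rule measurable_cong_sets) (simp_all add: sets_restrict_space)

text \<open>The definitions use restricted Borel spaces on products, Fubini arguments use products
  of restricted measures; this lemma and the next translate between them.\<close>

lemma borel_measurable_restrict_prod_to_pair:
  fixes f :: "real \<times> real \<Rightarrow> 'b::topological_space"
  assumes "f \<in> borel_measurable (restrict_space borel (I \<times> J))"
  shows "f \<in> borel_measurable (restrict_space lborel I \<Otimes>\<^sub>M restrict_space lborel J)"
proof (rule measurable_compose[where f = "\<lambda>p. p" and N = "restrict_space borel (I \<times> J)"])
  have "(\<lambda>p. (fst p, snd p)) \<in> restrict_space lborel I \<Otimes>\<^sub>M restrict_space lborel J \<rightarrow>\<^sub>M borel \<Otimes>\<^sub>M borel"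
    by (intro measurable_Pair measurable_compose[OF measurable_fst] measurable_compose[OF measurable_snd])
      (auto intro: measurable_restrict_space1)
  then show "(\<lambda>p. p) \<in> restrict_space lborel I \<Otimes>\<^sub>M restrict_space lborel J \<rightarrow>\<^sub>M restrict_space borel (I \<times> J)"
    by (intro measurable_restrict_space2) (auto simp: borel_prod space_pair_measure space_restrict_space)
qed (rule assms)

lemma borel_measurable_pair_to_restrict_prod:
  fixes f :: "real \<times> real \<Rightarrow> 'b::topological_space"
  assumes "f \<in> borel_measurable (restrict_space lborel I \<Otimes>\<^sub>M restrict_space lborel J)"
  shows "f \<in> borel_measurable (restrict_space borel (I \<times> J))"
proof (rule measurable_compose[where f = "\<lambda>p. p" and N = "restrict_space lborel I \<Otimes>\<^sub>M restrict_space lborel J"])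
  have 1: "fst \<in> restrict_space borel (I \<times> J) \<rightarrow>\<^sub>M restrict_space lborel I"
    by (rule measurable_restrict_space2)
      (auto simp: space_restrict_space intro!: measurable_restrict_space1 borel_measurable_continuous_onI continuous_intros)
  have 2: "snd \<in> restrict_space borel (I \<times> J) \<rightarrow>\<^sub>M restrict_space lborel J"
    by (rule measurable_restrict_space2)
      (auto simp: space_restrict_space intro!: measurable_restrict_space1 borel_measurable_continuous_onI continuous_intros)
  show "(\<lambda>p. p) \<in> restrict_space borel (I \<times> J) \<rightarrow>\<^sub>M restrict_space lborel I \<Otimes>\<^sub>M restrict_space lborel J"
    using measurable_Pair[OF 1 2] by simp
qed (rule assms)

text \<open>The Caratheodory criterion, applied after extending the family by zero to all real
  parameters.\<close>

lemma borel_measurable_joint: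
  fixes u :: "real \<Rightarrow> 'a::euclidean_space \<Rightarrow> 'a"
  assumes meas: "\<And>x. (\<lambda>s. u s x) \<in> borel_measurable (restrict_space borel {0..1})"
    and cont: "\<And>s. s \<in> {0..1} \<Longrightarrow> continuous_on UNIV (u s)"
  shows "(\<lambda>(s, x). u s x) \<in> borel_measurable (restrict_space borel ({0..1} \<times> \<Omega>))"
proof -
  define f where "f s x = indicator {0..1} s *\<^sub>R u s x" for s x
  have "(\<lambda>s. f s x) \<in> borel_measurable borel" for x
    using meas[of x] unfolding f_def by (simp add: borel_measurable_restrict_space_iff)
  moreover have "continuous_on UNIV (f s)" for s
    unfolding f_def using cont[of s] by (cases "s \<in> {0..1}") (auto intro!: continuous_intros)
  ultimately have "(\<lambda>(s, x). f s x) \<in> borel_measurable (borel \<Otimes>\<^sub>M borel)"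
    by (rule borel_measurable_Caratheodory)
  then have "(\<lambda>(s, x). f s x) \<in> borel_measurable (restrict_space borel ({0..1} \<times> \<Omega>))"
    by (intro measurable_restrict_space1) (simp add: borel_prod)
  then show ?thesis
    by (rule measurable_cong[THEN iffD1, rotated]) (auto simp: f_def space_restrict_space)
qed

lemma integrable_restrict_iff: "I \<in> sets borel \<Longrightarrow> integrable (restrict_space lborel I) f \<longleftrightarrow> set_integrable lborel I f"
  for f :: "real \<Rightarrow> 'b::{banach, second_countable_topology}"
  unfolding set_integrable_def by (rule integrable_restrict_space) simp

lemma integral_restrict: "I \<in> sets borel \<Longrightarrow> integral\<^sup>L (restrict_space lborel I) f = (LINT s:I|lborel. f s)"
  for f :: "real \<Rightarrow> 'b::{banach, second_countable_topology}"
  unfolding set_lebesgue_integral_def by (rule integral_restrict_space) simp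

text \<open>The closed scale intervals of the problem share endpoints, while the pieces used in the
  proof are half-open and disjoint. The difference is a null set.\<close>

lemma set_integral_left_open:
  fixes f :: "real \<Rightarrow> 'b::{banach, second_countable_topology}"
  assumes f: "f \<in> borel_measurable (restrict_space borel {a..b})"
  shows "(LINT s:{a<..b}|lborel. f s) = (LINT s:{a..b}|lborel. f s)"
proof (rule set_integral_cong_set)
  have "f \<in> borel_measurable (restrict_space borel {a<..b})"
    by (rule measurable_restrict_mono[OF f]) auto
  then show "set_borel_measurable lborel {a<..b} f"
    by (simp add: set_borel_measurable_def borel_measurable_restrict_space_iff)
  show "set_borel_measurable lborel {a..b} f"
    using f by (simp add: set_borel_measurable_def borel_measurable_restrict_space_iff)
  show "AE s in lborel. (s \<in> {a..b}) = (s \<in> {a<..b})"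
    using AE_lborel_singleton[of a] by eventually_elim auto
qed

text \<open>A single \<open>M\<close> is obtained for all subsets, so that the structures on the
  pieces and on the whole interval share it.\<close>

lemma kernel_bundle_restrict:
  fixes H :: "real \<Rightarrow> 'a::euclidean_space field_space"
  assumes \<Omega>: "open \<Omega>" and ab: "admissible_bundle \<Omega> H"
  obtains M where "\<And>I. I \<in> sets borel \<Longrightarrow> I \<subseteq> {0..1} \<Longrightarrow> kernel_bundle (restrict_space lborel I) \<Omega> H M"
proof -
  obtain M where M: "\<And>s. s \<in> {0..1} \<Longrightarrow> M s > 0"
      "\<And>s v. s \<in> {0..1} \<Longrightarrow> v \<in> vfields (H s) \<Longrightarrow> norm_1_inf \<Omega> v \<le> ennreal (M s * hnorm (H s) v)"
      "M \<in> borel_measurable (restrict_space borel {0..1})"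
      "set_integrable lborel {0..1} (\<lambda>s. (M s)\<^sup>2)"
    using ab unfolding admissible_bundle_def by blast
  have adm: "\<And>s. s \<in> {0..1} \<Longrightarrow> admissible_rkhs \<Omega> (H s)"
    and km: "(\<lambda>(s, x, y). kernel (H s) x y) \<in> borel_measurable (restrict_space borel ({0..1} \<times> \<Omega> \<times> \<Omega>))"
    using ab unfolding admissible_bundle_def by auto
  show thesis
  proof (rule that[of M])
    fix I :: "real set" assume I: "I \<in> sets borel" "I \<subseteq> {0..1}"
    have in01: "s \<in> {0..1}" if "s \<in> space (restrict_space lborel I)" for s
      using that I by (auto simp: space_restrict_space)
    show "kernel_bundle (restrict_space lborel I) \<Omega> H M"
    proof (intro kernel_bundle.intro kernel_bundle_axioms.intro finite_measureI)
      have "emeasure lborel I \<le> emeasure lborel {0..1::real}" using I by (intro emeasure_mono) auto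
      also have "\<dots> < \<infinity>" by simp
      finally show "emeasure (restrict_space lborel I) (space (restrict_space lborel I)) \<noteq> \<infinity>"
        using I by (simp add: emeasure_restrict_space space_restrict_space)
      show "open \<Omega>" by fact
      show "hilbert_space (H s)" if "s \<in> space (restrict_space lborel I)" for s
        using adm[OF in01[OF that]] unfolding admissible_rkhs_def by blast
      show "C1_field \<Omega> v" if "s \<in> space (restrict_space lborel I)" "v \<in> vfields (H s)" for s v
        using adm[OF in01[OF that(1)]] that(2) unfolding admissible_rkhs_def by blast
      show "0 \<le> M s" if "s \<in> space (restrict_space lborel I)" for s
        using M(1)[OF in01[OF that]] by simp
      show "norm_1_inf \<Omega> v \<le> ennreal (M s * hnorm (H s) v)"
        if "s \<in> space (restrict_space lborel I)" "v \<in> vfields (H s)" for s v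
        by (rule M(2)[OF in01[OF that(1)] that(2)])
      show "M \<in> borel_measurable (restrict_space lborel I)"
        using measurable_restrict_mono[OF M(3) I(2)] by simp
      show "integrable (restrict_space lborel I) (\<lambda>s. (M s)\<^sup>2)"
        unfolding integrable_restrict_iff[OF I(1)] using set_integrable_subset[OF M(4)] I by simp
      fix x y q :: 'a assume xy: "x \<in> \<Omega>" "y \<in> \<Omega>"
      have "(\<lambda>s. (s, x, y)) \<in> restrict_space borel {0..1} \<rightarrow>\<^sub>M restrict_space borel ({0..1} \<times> \<Omega> \<times> \<Omega>)"
      proof (rule measurable_restrict_space2)
        show "(\<lambda>s. (s, x, y)) \<in> space (restrict_space borel {0..1}) \<rightarrow> {0..1} \<times> \<Omega> \<times> \<Omega>"
          using xy by (auto simp: space_restrict_space)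
        show "(\<lambda>s. (s, x, y)) \<in> restrict_space borel {0..1} \<rightarrow>\<^sub>M borel"
          by (intro measurable_restrict_space1 borel_measurable_continuous_onI continuous_intros)
      qed
      from measurable_compose[OF this km]
      have "(\<lambda>s. kernel (H s) x y) \<in> borel_measurable (restrict_space borel {0..1})" by simp
      moreover have "(\<lambda>k. blinfun_apply k q) \<in> borel_measurable borel"
        by (intro borel_measurable_continuous_onI continuous_intros)
      ultimately have "(\<lambda>s. blinfun_apply (kernel (H s) x y) q) \<in> borel_measurable (restrict_space borel {0..1})"
        by (rule measurable_compose)
      from measurable_restrict_mono[OF this I(2)]
      show "(\<lambda>s. blinfun_apply (kernel (H s) x y) q) \<in> borel_measurable (restrict_space lborel I)" by simp
    qed
  qed
qed

text \<open>The hypothesis gives the kernel on \<open>\<Omega> \<times> \<Omega>\<close> and for the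
  closed interval, the conclusion concerns all points and the half-open one. Linearity of the
  integral in \<open>q\<close> makes the \<open>Blinfun\<close> in \<open>integral_kernel\<close>
  meaningful.\<close>

lemma integral_rkhs_piece:
  fixes H :: "real \<Rightarrow> 'a::euclidean_space field_space"
  assumes ab: "\<And>I. I \<in> sets borel \<Longrightarrow> I \<subseteq> {0..1} \<Longrightarrow> kernel_bundle (restrict_space lborel I) \<Omega> H M"
    and ab01: "0 \<le> a" "b \<le> 1" and HD: "rkhs_with_kernel \<Omega> (integral_kernel H {a..b}) HD"
  shows "integral_rkhs (restrict_space lborel {a<..b}) \<Omega> H M HD"
proof -
  interpret C: kernel_bundle "restrict_space lborel {a..b}" \<Omega> H M by (rule ab) (use ab01 in auto)
  interpret P: kernel_bundle "restrict_space lborel {a<..b}" \<Omega> H M by (rule ab) (use ab01 in auto)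
  have rk: "rkhs \<Omega> HD" and ker: "\<And>x y. x \<in> \<Omega> \<Longrightarrow> y \<in> \<Omega> \<Longrightarrow> kernel HD x y = integral_kernel H {a..b} x y"
    using HD unfolding rkhs_with_kernel_def by auto
  interpret HD: eval_bounded HD
  proof
    show "hilbert_space HD" using rk unfolding rkhs_def by blast
    show "\<exists>C. \<forall>v\<in>vfields HD. norm (v x) \<le> C * hnorm HD v" for x
    proof (cases "x \<in> \<Omega>")
      case False
      then show ?thesis using rk unfolding rkhs_def by (intro exI[of _ 0]) auto
    qed (use rk in \<open>auto simp: rkhs_def\<close>)
  qed
  show ?thesis
  proof (intro integral_rkhs.intro integral_rkhs_axioms.intro P.kernel_bundle_axioms HD.eval_bounded_axioms)
    fix x y q
    have int: "set_integrable lborel {a..b} (\<lambda>s. blinfun_apply (kernel (H s) x y) q)" for q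
      using C.kernel_integrable[of x y q] by (simp add: integrable_restrict_iff)
    have "(\<integral>s. blinfun_apply (kernel (H s) x y) q \<partial>restrict_space lborel {a<..b}) =
        (LINT s:{a<..b}|lborel. blinfun_apply (kernel (H s) x y) q)"
      by (simp add: integral_restrict)
    also have "\<dots> = (LINT s:{a..b}|lborel. blinfun_apply (kernel (H s) x y) q)"
      by (rule set_integral_left_open) (use C.kernel_measurable[of x y q] in simp)
    also have "\<dots> = blinfun_apply (kernel HD x y) q"
    proof (cases "x \<in> \<Omega> \<and> y \<in> \<Omega>")
      case True
      have "linear (\<lambda>q. LINT s:{a..b}|lborel. blinfun_apply (kernel (H s) x y) q)"
        by (rule linearI) (simp_all add: blinfun.add_right blinfun.scaleR_right int)
      then have "bounded_linear (\<lambda>q. LINT s:{a..b}|lborel. blinfun_apply (kernel (H s) x y) q)"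
        by (simp add: linear_conv_bounded_linear)
      then show ?thesis using True
        by (simp add: ker integral_kernel_def bounded_linear_Blinfun_apply)
    next
      case False
      have out: "v z = 0" if "v \<in> vfields HD" "z \<notin> \<Omega>" for v z using rk that unfolding rkhs_def by blast
      have "blinfun_apply (kernel HD x y) q = 0"
        using HD.kernel_eq_0[of x x y q] HD.kernel_eq_0[of y x y q] out False by blast
      moreover have "(LINT s:{a..b}|lborel. blinfun_apply (kernel (H s) x y) q) = (LINT s:{a..b}|lborel. 0::'a)"
        using False by (intro set_lebesgue_integral_cong ballI allI impI C.kernel_outside) (auto simp: space_restrict_space)
      ultimately show ?thesis by (simp add: set_lebesgue_integral_def)
    qed
    finally show "blinfun_apply (kernel HD x y) q = (\<integral>s. blinfun_apply (kernel (H s) x y) q \<partial>restrict_space lborel {a<..b})" ..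
  qed
qed

section \<open>Comparing two minimisation problems through a map of candidates\<close>

lemma minimiser_iff:
  "minimiser R z \<longleftrightarrow> z \<in> feasible R \<and> (\<forall>z'\<in>feasible R. objective R z \<le> objective R z')"
  unfolding minimiser_def is_arg_min_linorder by blast

text \<open>\<open>f\<close> does not increase the objective and has, up to agreement, a right
  inverse that does not increase it either. Hence the infima coincide and \<open>f\<close> preserves
  the objective on minimisers; so injectivity is demanded only of candidates that lose nothing under
  \<open>f\<close>.\<close>

lemma equivalent_viaI:
  assumes feas: "\<And>x. x \<in> feasible P \<Longrightarrow> f x \<in> feasible Q"
    and deform: "\<And>x t. x \<in> feasible P \<Longrightarrow> t \<in> {0..1} \<Longrightarrow> deformation Q (f x) t = deformation P x t"
    and le: "\<And>x. x \<in> feasible P \<Longrightarrow> objective Q (f x) \<le> objective P x"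
    and nonneg: "\<And>x. x \<in> feasible P \<Longrightarrow> 0 \<le> objective P x" "\<And>y. y \<in> feasible Q \<Longrightarrow> 0 \<le> objective Q y"
    and lift: "\<And>y. y \<in> feasible Q \<Longrightarrow> \<exists>x\<in>feasible P. agree Q (f x) y \<and> objective P x \<le> objective Q y"
    and uniq: "\<And>x x'. x \<in> feasible P \<Longrightarrow> x' \<in> feasible P \<Longrightarrow> objective P x \<le> objective Q (f x) \<Longrightarrow>
      objective P x' \<le> objective Q (f x') \<Longrightarrow> agree Q (f x) (f x') \<longleftrightarrow> agree P x x'"
  shows "equivalent_via f P Q"
proof -
  note min = minimiser_iff[of P] and minQ = minimiser_iff[of Q]
  have tight: "objective P x \<le> objective Q (f x)" if x: "minimiser P x" for x
  proof -
    obtain x' where "x' \<in> feasible P" "objective P x' \<le> objective Q (f x)"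
      using lift[OF feas] x min by blast
    then show ?thesis using x min by fastforce
  qed
  have INF: "(INF x\<in>feasible P. objective P x) = (INF y\<in>feasible Q. objective Q y)"
  proof (cases "feasible P = {}")
    case True
    then have "feasible Q = {}" using lift by blast
    then show ?thesis using True by simp
  next
    case False
    then have Q: "feasible Q \<noteq> {}" using feas by blast
    have bP: "bdd_below (objective P ` feasible P)" and bQ: "bdd_below (objective Q ` feasible Q)"
      unfolding bdd_below_def using nonneg by blast+
    show ?thesis
    proof (rule antisym)
      show "(INF x\<in>feasible P. objective P x) \<le> (INF y\<in>feasible Q. objective Q y)"
      proof (rule cINF_greatest[OF Q])
        fix y assume "y \<in> feasible Q"
        then obtain x where "x \<in> feasible P" "objective P x \<le> objective Q y" using lift by blast
        then show "(INF x\<in>feasible P. objective P x) \<le> objective Q y" using cINF_lower2[OF bP] by blast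
      qed
      show "(INF y\<in>feasible Q. objective Q y) \<le> (INF x\<in>feasible P. objective P x)"
      proof (rule cINF_greatest[OF False])
        fix x assume "x \<in> feasible P"
        then show "(INF y\<in>feasible Q. objective Q y) \<le> objective P x"
          using cINF_lower2[OF bQ feas le] by blast
      qed
    qed
  qed
  have toQ: "minimiser Q (f x)" if x: "minimiser P x" for x
    unfolding minQ
  proof (intro conjI ballI)
    show "f x \<in> feasible Q" using x feas min by blast
    fix y assume "y \<in> feasible Q"
    then obtain x' where "x' \<in> feasible P" "objective P x' \<le> objective Q y" using lift by blast
    then show "objective Q (f x) \<le> objective Q y" using x le[of x] min by fastforce
  qed
  have fromQ: "\<exists>x. minimiser P x \<and> agree Q (f x) y" if y: "minimiser Q y" for y
  proof -
    obtain x where x: "x \<in> feasible P" "agree Q (f x) y" "objective P x \<le> objective Q y"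
      using lift y minQ by blast
    have "objective P x \<le> objective P x'" if "x' \<in> feasible P" for x'
      using x(3) y le[OF that] feas[OF that] minQ by fastforce
    then show ?thesis using x min by blast
  qed
  have "agree Q (f x) (f x') \<longleftrightarrow> agree P x x'" if "minimiser P x" "minimiser P x'" for x x'
    using uniq tight that min by blast
  then show ?thesis unfolding equivalent_via_def using feas deform INF toQ fromQ by blast
qed

section \<open>Sampling and gluing\<close>

text \<open>Forwards, the values outside \<open>\<Omega>\<close> are zero. Backwards, the fields are
  continuous, so joint measurability is the Caratheodory criterion and the norm is the root of a
  countable supremum.\<close>

lemma sections_iff:
  fixes G :: "real \<Rightarrow> 'a::euclidean_space field_space"
  assumes G: "\<And>s. s \<in> {0..1} \<Longrightarrow> continuous_rkhs (G s)"
    and out: "\<And>s v x. s \<in> {0..1} \<Longrightarrow> v \<in> vfields (G s) \<Longrightarrow> x \<notin> \<Omega> \<Longrightarrow> v x = 0"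
    and k: "\<And>x y q. (\<lambda>s. blinfun_apply (kernel (G s) x y) q) \<in> borel_measurable (restrict_space borel {0..1})"
  shows "u \<in> sections \<Omega> G \<longleftrightarrow> (\<forall>s\<in>{0..1}. u s \<in> vfields (G s)) \<and>
    (\<forall>x. (\<lambda>s. u s x) \<in> borel_measurable (restrict_space borel {0..1})) \<and>
    set_integrable lborel {0..1} (\<lambda>s. (hnorm (G s) (u s))\<^sup>2)" (is "_ \<longleftrightarrow> ?R")
proof
  assume u: "u \<in> sections \<Omega> G"
  have "(\<lambda>s. u s x) \<in> borel_measurable (restrict_space borel {0..1})" for x
  proof (cases "x \<in> \<Omega>")
    case False
    have "(\<lambda>s. 0::'a) \<in> borel_measurable (restrict_space borel {0..1::real})" by simp
    then show ?thesis
      by (rule measurable_cong[THEN iffD1, rotated])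
        (use u False out[of _ "u _" x] in \<open>simp add: sections_def space_restrict_space\<close>)
  qed (use u in \<open>auto simp: sections_def\<close>)
  then show ?R using u by (auto simp: sections_def)
next
  assume R: ?R
  then have "(\<lambda>(s, x). u s x) \<in> borel_measurable (restrict_space borel ({0..1} \<times> \<Omega>))"
    using G continuous_rkhs.continuous_fields by (intro borel_measurable_joint) blast+
  moreover have "(\<lambda>s. hnorm (G s) (u s)) \<in> borel_measurable (restrict_space borel {0..1})"
    using R by (intro borel_measurable_hnorm G k) (auto simp: space_restrict_space)
  ultimately show "u \<in> sections \<Omega> G" using R unfolding sections_def by auto
qed

text \<open>Instantiated twice: with the given partition for (C), and with a single interval for
  (A).\<close>

locale kernel_partition =
  fixes \<Omega> :: "'a::euclidean_space set" and H :: "real \<Rightarrow> 'a field_space" and M :: "real \<Rightarrow> real"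
    and n :: nat and \<sigma> :: "nat \<Rightarrow> real" and Hd :: "nat \<Rightarrow> 'a field_space"
  assumes kernel_bundle_on: "I \<in> sets borel \<Longrightarrow> I \<subseteq> {0..1} \<Longrightarrow> kernel_bundle (restrict_space lborel I) \<Omega> H M"
    and \<sigma>_0: "\<sigma> 0 = 0" and \<sigma>_n: "\<sigma> n = 1" and \<sigma>_step: "k < n \<Longrightarrow> \<sigma> k < \<sigma> (Suc k)"
    and Hd_kernel: "k \<in> {1..n} \<Longrightarrow> rkhs_with_kernel \<Omega> (integral_kernel H {\<sigma> (k - 1)..\<sigma> k}) (Hd k)"
begin

sublocale F: kernel_bundle "restrict_space lborel {0..1}" \<Omega> H M
  by (rule kernel_bundle_on) auto

text \<open>Half-open, hence disjoint; together the pieces miss only the scale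
  \<open>0\<close>.\<close>

abbreviation I where "I k \<equiv> {\<sigma> (k - 1)<..\<sigma> k}"

abbreviation \<mu>I where "\<mu>I k \<equiv> restrict_space lborel (I k)"

lemma \<sigma>_mono: "i \<le> j \<Longrightarrow> j \<le> n \<Longrightarrow> \<sigma> i \<le> \<sigma> j"
proof (induction j rule: nat_induct_at_least)
  case (Suc j)
  then show ?case using \<sigma>_step[of j] by simp
qed simp

lemma \<sigma>_01: "k \<le> n \<Longrightarrow> \<sigma> k \<in> {0..1}"
  using \<sigma>_mono[of 0 k] \<sigma>_mono[of k n] \<sigma>_0 \<sigma>_n by simp

lemma \<sigma>_prev_01: "k \<in> {1..n} \<Longrightarrow> 0 \<le> \<sigma> (k - 1) \<and> \<sigma> (k - 1) \<le> \<sigma> k \<and> \<sigma> k \<le> 1"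
  using \<sigma>_01[of "k - 1"] \<sigma>_01[of k] \<sigma>_mono[of "k - 1" k] by auto

lemma I_subset: "k \<in> {1..n} \<Longrightarrow> I k \<subseteq> {0..1}"
  using \<sigma>_prev_01[of k] by auto

lemma I_disjoint: "j \<in> {1..n} \<Longrightarrow> k \<in> {1..n} \<Longrightarrow> s \<in> I j \<Longrightarrow> s \<in> I k \<Longrightarrow> j = k"
proof (induction j k rule: linorder_wlog)
  case (le j k)
  show ?case
  proof (rule ccontr)
    assume "j \<noteq> k"
    then have "\<sigma> j \<le> \<sigma> (k - 1)" using le by (intro \<sigma>_mono) auto
    then show False using le by auto
  qed
qed metis

lemma I_cover:
  assumes "0 < s" "s \<le> 1"
  obtains k where "k \<in> {1..n}" "s \<in> I k"
proof -
  define k where "k = (LEAST k. s \<le> \<sigma> k)"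
  have n: "s \<le> \<sigma> n" using assms \<sigma>_n by simp
  have k: "s \<le> \<sigma> k" "k \<le> n" unfolding k_def by (rule LeastI[of _ n], rule n) (rule Least_le, rule n)
  have "k \<noteq> 0" using k assms \<sigma>_0 by (metis not_le)
  then have "\<not> s \<le> \<sigma> (k - 1)" unfolding k_def by (intro not_less_Least) (simp add: k_def[symmetric])
  then show thesis using that[of k] k \<open>k \<noteq> 0\<close> by auto
qed

lemma piece: "k \<in> {1..n} \<Longrightarrow> integral_rkhs (\<mu>I k) \<Omega> H M (Hd k)"
  using \<sigma>_prev_01[of k] by (intro integral_rkhs_piece kernel_bundle_on Hd_kernel) auto

lemma Hd_outside: "k \<in> {1..n} \<Longrightarrow> v \<in> vfields (Hd k) \<Longrightarrow> x \<notin> \<Omega> \<Longrightarrow> v x = 0"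
  using Hd_kernel[of k] unfolding rkhs_with_kernel_def rkhs_def by blast

lemma space_01 [simp]: "space (restrict_space lborel {0..1::real}) = {0..1}"
  by (simp add: space_restrict_space)

lemma sections_H_iff: "u \<in> sections \<Omega> H \<longleftrightarrow> F.L2_section u"
proof -
  have "u \<in> sections \<Omega> H \<longleftrightarrow> (\<forall>s\<in>{0..1}. u s \<in> vfields (H s)) \<and>
    (\<forall>x. (\<lambda>s. u s x) \<in> borel_measurable (restrict_space borel {0..1})) \<and>
    set_integrable lborel {0..1} (\<lambda>s. (hnorm (H s) (u s))\<^sup>2)"
  proof (rule sections_iff)
    show "continuous_rkhs (H s)" if "s \<in> {0..1}" for s using F.continuous_rkhs_H that by simp
    show "v x = 0" if "s \<in> {0..1}" "v \<in> vfields (H s)" "x \<notin> \<Omega>" for s v x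
      using C1_field_outside[OF F.C1_H] that by simp
    show "(\<lambda>s. blinfun_apply (kernel (H s) x y) q) \<in> borel_measurable (restrict_space borel {0..1})" for x y q
      using F.kernel_measurable[of x y q] by simp
  qed
  then show ?thesis by (simp add: F.L2_section_def integrable_restrict_iff)
qed

lemma sections_Hd_iff:
  assumes k: "k \<in> {1..n}"
  shows "u \<in> sections \<Omega> (\<lambda>_. Hd k) \<longleftrightarrow> (\<forall>t\<in>{0..1}. u t \<in> vfields (Hd k)) \<and>
    (\<forall>x. (\<lambda>t. u t x) \<in> borel_measurable (restrict_space borel {0..1})) \<and>
    set_integrable lborel {0..1} (\<lambda>t. (hnorm (Hd k) (u t))\<^sup>2)"
proof -
  interpret integral_rkhs "\<mu>I k" \<Omega> H M "Hd k" by (rule piece[OF k])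
  show ?thesis
    by (rule sections_iff[OF continuous_rkhs_HD]) (use Hd_outside[OF k] in auto)
qed

lemma L2_section_piece:
  assumes u: "F.L2_section u" and k: "k \<in> {1..n}"
  shows "kernel_bundle.L2_section (\<mu>I k) H u"
proof -
  interpret integral_rkhs "\<mu>I k" \<Omega> H M "Hd k" by (rule piece[OF k])
  show ?thesis unfolding L2_section_def
  proof (intro conjI ballI allI)
    show "u s \<in> vfields (H s)" if "s \<in> space (\<mu>I k)" for s
      using that I_subset[OF k] F.L2_sectionD(1)[OF u, of s] by (auto simp: space_restrict_space)
    show "(\<lambda>s. u s x) \<in> borel_measurable (\<mu>I k)" for x
      using F.L2_sectionD(2)[OF u, of x] measurable_restrict_mono[OF _ I_subset[OF k]] by auto
    show "integrable (\<mu>I k) (\<lambda>s. (hnorm (H s) (u s))\<^sup>2)"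
    proof -
      have "set_integrable lborel {0..1} (\<lambda>s. (hnorm (H s) (u s))\<^sup>2)"
        using F.L2_sectionD(3)[OF u] by (simp add: integrable_restrict_iff)
      from set_integrable_subset[OF this _ I_subset[OF k]] show ?thesis
        by (simp add: integrable_restrict_iff)
    qed
  qed
qed

lemma integral_split:
  fixes g :: "real \<Rightarrow> 'b::{banach, second_countable_topology}"
  assumes g: "set_integrable lborel {0..1} g" and gm: "g \<in> borel_measurable (restrict_space borel {0..1})"
  shows "(LINT s:{0..1}|lborel. g s) = (\<Sum>k=1..n. integral\<^sup>L (\<mu>I k) g)"
proof -
  have "(LINT s:{0..\<sigma> j}|lborel. g s) = (\<Sum>k=1..j. integral\<^sup>L (\<mu>I k) g)" if "j \<le> n" for j
    using that
  proof (induction j)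
    case 0
    then show ?case using set_integral_singleton[of 0 g] by (simp add: \<sigma>_0)
  next
    case (Suc j)
    have *: "0 \<le> \<sigma> j" "\<sigma> j \<le> \<sigma> (Suc j)" "\<sigma> (Suc j) \<le> 1"
      using \<sigma>_prev_01[of "Suc j"] Suc.prems by auto
    have "(LINT s:{0..\<sigma> (Suc j)}|lborel. g s) = (LINT s:{0..\<sigma> j}|lborel. g s) + (LINT s:{\<sigma> j..\<sigma> (Suc j)}|lborel. g s)"
      using * by (intro set_integral_combine set_integrable_subset[OF g]) auto
    also have "(LINT s:{\<sigma> j..\<sigma> (Suc j)}|lborel. g s) = integral\<^sup>L (\<mu>I (Suc j)) g"
      using * set_integral_left_open[OF measurable_restrict_mono[OF gm], of "\<sigma> j" "\<sigma> (Suc j)"]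
      by (simp add: integral_restrict)
    finally show ?case using Suc by simp
  qed
  from this[of n] show ?thesis by (simp add: \<sigma>_n)
qed

lemma sampling_eq:
  assumes u: "F.L2_section u" and k: "k \<in> {1..n}"
  shows "sampling \<sigma> u k = (\<lambda>x. \<integral>s. u s x \<partial>\<mu>I k)"
proof
  fix x
  have "(\<lambda>s. u s x) \<in> borel_measurable (restrict_space borel {\<sigma> (k - 1)..\<sigma> k})"
    by (rule measurable_restrict_mono[where A = "{0..1}"])
      (use F.L2_sectionD(2)[OF u, of x] \<sigma>_prev_01[OF k] in auto)
  from set_integral_left_open[OF this] show "sampling \<sigma> u k x = (\<integral>s. u s x \<partial>\<mu>I k)"
    by (simp add: sampling_def family_integral_def integral_restrict)
qed

abbreviation energy where "energy u \<equiv> (LINT s:{0..1}|lborel. (hnorm (H s) (u s))\<^sup>2)"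

lemma energy_split:
  assumes u: "F.L2_section u"
  shows "energy u = (\<Sum>k=1..n. \<integral>s. (hnorm (H s) (u s))\<^sup>2 \<partial>\<mu>I k)"
proof (rule integral_split)
  show "set_integrable lborel {0..1} (\<lambda>s. (hnorm (H s) (u s))\<^sup>2)"
    using F.L2_sectionD(3)[OF u] by (simp add: integrable_restrict_iff)
  show "(\<lambda>s. (hnorm (H s) (u s))\<^sup>2) \<in> borel_measurable (restrict_space borel {0..1})"
    using borel_measurable_integrable[OF F.L2_sectionD(3)[OF u]] by simp
qed

lemma sampling_in:
  assumes u: "F.L2_section u" and k: "k \<in> {1..n}"
  shows "sampling \<sigma> u k \<in> vfields (Hd k)"
    and "(hnorm (Hd k) (sampling \<sigma> u k))\<^sup>2 \<le> (\<integral>s. (hnorm (H s) (u s))\<^sup>2 \<partial>\<mu>I k)"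
proof -
  interpret integral_rkhs "\<mu>I k" \<Omega> H M "Hd k" by (rule piece[OF k])
  show "sampling \<sigma> u k \<in> vfields (Hd k)" "(hnorm (Hd k) (sampling \<sigma> u k))\<^sup>2 \<le> (\<integral>s. (hnorm (H s) (u s))\<^sup>2 \<partial>\<mu>I k)"
    unfolding sampling_eq[OF u k] using integral_in_HD[OF L2_section_piece[OF u k]] by auto
qed

lemma sampling_energy_le:
  assumes u: "F.L2_section u"
  shows "(\<Sum>k=1..n. (hnorm (Hd k) (sampling \<sigma> u k))\<^sup>2) \<le> energy u"
  unfolding energy_split[OF u] by (intro sum_mono sampling_in(2)[OF u]) auto

lemma family_integral_eq_sum:
  assumes u: "F.L2_section u"
  shows "family_integral {0..1} u x = (\<Sum>k=1..n. sampling \<sigma> u k x)"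
proof -
  have "family_integral {0..1} u x = (\<Sum>k=1..n. \<integral>s. u s x \<partial>\<mu>I k)"
    unfolding family_integral_def
  proof (rule integral_split)
    show "set_integrable lborel {0..1} (\<lambda>s. u s x)"
      using F.L2_section_integrable[OF u, of x] by (simp add: integrable_restrict_iff)
    show "(\<lambda>s. u s x) \<in> borel_measurable (restrict_space borel {0..1})"
      using F.L2_sectionD(2)[OF u, of x] by simp
  qed
  also have "\<dots> = (\<Sum>k=1..n. sampling \<sigma> u k x)"
    by (intro sum.cong refl) (simp add: sampling_eq[OF u])
  finally show ?thesis .
qed

lemma minimal_sections_agree:
  assumes u: "F.L2_section u" and u': "F.L2_section u'"
    and eq: "\<And>k. k \<in> {1..n} \<Longrightarrow> sampling \<sigma> u k = sampling \<sigma> u' k"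
    and min: "energy u \<le> (\<Sum>k=1..n. (hnorm (Hd k) (sampling \<sigma> u k))\<^sup>2)"
      "energy u' \<le> (\<Sum>k=1..n. (hnorm (Hd k) (sampling \<sigma> u' k))\<^sup>2)"
  shows "AE s in lborel. s \<in> {0..1} \<longrightarrow> u s = u' s"
proof -
  \<comment> \<open>Sampling is a contraction on each piece, so equality of the total energies
    forces equality on every piece.\<close>
  have tight: "(\<integral>s. (hnorm (H s) (z s))\<^sup>2 \<partial>\<mu>I k) \<le> (hnorm (Hd k) (sampling \<sigma> z k))\<^sup>2"
    if z: "F.L2_section z" and k: "k \<in> {1..n}"
      and min: "energy z \<le> (\<Sum>k=1..n. (hnorm (Hd k) (sampling \<sigma> z k))\<^sup>2)" for z k
  proof -
    have "(\<Sum>k=1..n. (\<integral>s. (hnorm (H s) (z s))\<^sup>2 \<partial>\<mu>I k) - (hnorm (Hd k) (sampling \<sigma> z k))\<^sup>2) \<le> 0"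
      using min unfolding energy_split[OF z] by (simp add: sum_subtractf)
    moreover have nonneg: "0 \<le> (\<integral>s. (hnorm (H s) (z s))\<^sup>2 \<partial>\<mu>I k) - (hnorm (Hd k) (sampling \<sigma> z k))\<^sup>2" if "k \<in> {1..n}" for k
      using sampling_in(2)[OF z that] by simp
    ultimately have "(\<Sum>k=1..n. (\<integral>s. (hnorm (H s) (z s))\<^sup>2 \<partial>\<mu>I k) - (hnorm (Hd k) (sampling \<sigma> z k))\<^sup>2) = 0"
      by (intro antisym sum_nonneg) auto
    then have "\<forall>k\<in>{1..n}. (\<integral>s. (hnorm (H s) (z s))\<^sup>2 \<partial>\<mu>I k) - (hnorm (Hd k) (sampling \<sigma> z k))\<^sup>2 = 0"
      by (subst (asm) sum_nonneg_eq_0_iff) (use nonneg in auto)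
    then show ?thesis using k by auto
  qed
  have "AE s in lborel. s \<in> I k \<longrightarrow> u s = u' s" if k: "k \<in> {1..n}" for k
  proof -
    interpret integral_rkhs "\<mu>I k" \<Omega> H M "Hd k" by (rule piece[OF k])
    have "AE s in \<mu>I k. u s = u' s"
    proof (rule minimal_L2_section_unique[OF L2_section_piece[OF u k] L2_section_piece[OF u' k]])
      show "(\<integral>s. u s x \<partial>\<mu>I k) = (\<integral>s. u' s x \<partial>\<mu>I k)" for x
        using eq[OF k] unfolding sampling_eq[OF u k] sampling_eq[OF u' k] by (rule fun_cong)
      show "(\<integral>s. (hnorm (H s) (u s))\<^sup>2 \<partial>\<mu>I k) \<le> (hnorm (Hd k) (\<lambda>x. \<integral>s. u s x \<partial>\<mu>I k))\<^sup>2"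
        using tight[OF u k min(1)] unfolding sampling_eq[OF u k] .
      show "(\<integral>s. (hnorm (H s) (u' s))\<^sup>2 \<partial>\<mu>I k) \<le> (hnorm (Hd k) (\<lambda>x. \<integral>s. u s x \<partial>\<mu>I k))\<^sup>2"
        using tight[OF u' k min(2)] unfolding eq[OF k, symmetric] sampling_eq[OF u k] .
    qed
    then show ?thesis by (simp add: AE_restrict_space_iff)
  qed
  then have "AE s in lborel. \<forall>k\<in>{1..n}. s \<in> I k \<longrightarrow> u s = u' s" by (intro AE_finite_allI) auto
  \<comment> \<open>The scale \<open>0\<close> belongs to no piece and is discarded as a null
    set.\<close>
  then show ?thesis using AE_lborel_singleton[of 0]
  proof eventually_elim
    case (elim s)
    show ?case
    proof
      assume "s \<in> {0..1}"
      then obtain k where "k \<in> {1..n}" "s \<in> I k" using I_cover[of s] elim(2) by auto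
      then show "u s = u' s" using elim(1) by blast
    qed
  qed
qed

lemma families_L2_section: "v \<in> families \<Omega> H \<Longrightarrow> t \<in> {0..1} \<Longrightarrow> F.L2_section (v t)"
  unfolding families_def sections_H_iff[symmetric] by blast

text \<open>Measurability in time is Fubini's theorem on the piece; square integrability is
  domination by the energy.\<close>

lemma sampling_sections:
  assumes v: "v \<in> families \<Omega> H" and k: "k \<in> {1..n}"
  shows "(\<lambda>t. sampling \<sigma> (v t) k) \<in> sections \<Omega> (\<lambda>_. Hd k)"
  unfolding sections_Hd_iff[OF k]
proof (intro conjI ballI allI)
  interpret integral_rkhs "\<mu>I k" \<Omega> H M "Hd k" by (rule piece[OF k])
  note L2 = families_L2_section[OF v]
  show inn: "sampling \<sigma> (v t) k \<in> vfields (Hd k)" if "t \<in> {0..1}" for t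
    by (rule sampling_in(1)[OF L2[OF that] k])
  show meas: "(\<lambda>t. sampling \<sigma> (v t) k x) \<in> borel_measurable (restrict_space borel {0..1})" for x
  proof (cases "x \<in> \<Omega>")
    case True
    have "(\<lambda>(t, s). v t s x) \<in> borel_measurable (restrict_space borel ({0..1} \<times> {0..1}))"
      using v True unfolding families_def by blast
    then have "(\<lambda>(t, s). v t s x) \<in> borel_measurable (restrict_space borel ({0..1} \<times> I k))"
      by (rule measurable_restrict_mono) (use I_subset[OF k] in auto)
    from borel_measurable_restrict_prod_to_pair[OF this]
    have "(\<lambda>t. \<integral>s. v t s x \<partial>\<mu>I k) \<in> borel_measurable (restrict_space lborel {0..1})"
      by (rule borel_measurable_lebesgue_integral)
    then have "(\<lambda>t. \<integral>s. v t s x \<partial>\<mu>I k) \<in> borel_measurable (restrict_space borel {0..1})" by simp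
    then show ?thesis
      by (rule measurable_cong[THEN iffD1, rotated]) (simp add: sampling_eq[OF L2 k] space_restrict_space)
  next
    case False
    have "(\<lambda>t. 0::'a) \<in> borel_measurable (restrict_space borel {0..1::real})" by simp
    then show ?thesis
      by (rule measurable_cong[THEN iffD1, rotated])
        (use Hd_outside[OF k inn False] in \<open>simp add: space_restrict_space\<close>)
  qed
  show "set_integrable lborel {0..1} (\<lambda>t. (hnorm (Hd k) (sampling \<sigma> (v t) k))\<^sup>2)"
  proof (rule set_integrable_bound)
    show "set_integrable lborel {0..1} (\<lambda>t. energy (v t))" using v unfolding families_def by blast
    have "(\<lambda>t. hnorm (Hd k) (sampling \<sigma> (v t) k)) \<in> borel_measurable (restrict_space borel {0..1})"
      by (intro borel_measurable_hnorm continuous_rkhs_HD borel_measurable_const meas inn)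
        (simp add: space_restrict_space)
    then have "(\<lambda>t. (hnorm (Hd k) (sampling \<sigma> (v t) k))\<^sup>2) \<in> borel_measurable (restrict_space borel {0..1})"
      by measurable
    then show "set_borel_measurable lborel {0..1} (\<lambda>t. (hnorm (Hd k) (sampling \<sigma> (v t) k))\<^sup>2)"
      by (simp add: set_borel_measurable_def borel_measurable_restrict_space_iff)
    have "(hnorm (Hd k) (sampling \<sigma> (v t) k))\<^sup>2 \<le> energy (v t)" if "t \<in> {0..1}" for t
    proof -
      have "(hnorm (Hd k) (sampling \<sigma> (v t) k))\<^sup>2 \<le> (\<Sum>k=1..n. (hnorm (Hd k) (sampling \<sigma> (v t) k))\<^sup>2)"
        using k by (intro member_le_sum) auto
      then show ?thesis using sampling_energy_le[OF L2[OF that]] by simp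
    qed
    then show "AE t in lborel. t \<in> {0..1} \<longrightarrow>
        norm ((hnorm (Hd k) (sampling \<sigma> (v t) k))\<^sup>2) \<le> norm (energy (v t))"
      by (intro AE_I2) (auto intro: order_trans abs_ge_self)
  qed
qed

lemma lift_families:
  assumes u: "\<And>k. k \<in> {1..n} \<Longrightarrow> u k \<in> sections \<Omega> (\<lambda>_. Hd k)"
  obtains v where "v \<in> families \<Omega> H"
    "\<And>t k. t \<in> {0..1} \<Longrightarrow> k \<in> {1..n} \<Longrightarrow> sampling \<sigma> (v t) k = u k t"
    "\<And>t. t \<in> {0..1} \<Longrightarrow> energy (v t) = (\<Sum>k=1..n. (hnorm (Hd k) (u k t))\<^sup>2)"
proof -
  \<comment> \<open>The properties of a lift on one piece are bundled into a predicate, so that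
    lifts on all pieces can be chosen simultaneously.\<close>
  define Q where "Q k W \<longleftrightarrow> (\<forall>t\<in>{0..1}. kernel_bundle.L2_section (\<mu>I k) H (W t) \<and>
      (\<forall>x. (\<integral>s. W t s x \<partial>\<mu>I k) = u k t x) \<and>
      (\<integral>s. (hnorm (H s) (W t s))\<^sup>2 \<partial>\<mu>I k) = (hnorm (Hd k) (u k t))\<^sup>2) \<and>
      (\<forall>x. (\<lambda>(t, s). W t s x) \<in> borel_measurable (restrict_space lborel {0..1} \<Otimes>\<^sub>M \<mu>I k))" for k W
  have "\<exists>W. Q k W" if k: "k \<in> {1..n}" for k
  proof -
    interpret integral_rkhs "\<mu>I k" \<Omega> H M "Hd k" by (rule piece[OF k])
    have uk: "\<And>t. t \<in> {0..1} \<Longrightarrow> u k t \<in> vfields (Hd k)"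
      "\<And>x. (\<lambda>t. u k t x) \<in> borel_measurable (restrict_space borel {0..1})"
      using u[OF k] sections_Hd_iff[OF k] by blast+
    show ?thesis
    proof (rule measurable_lift[of "restrict_space lborel {0..1}" "u k", unfolded space_01])
      fix W assume "\<And>t. t \<in> {0..1} \<Longrightarrow> L2_section (W t)" "\<And>t x. t \<in> {0..1} \<Longrightarrow> (\<integral>s. W t s x \<partial>\<mu>I k) = u k t x"
        "\<And>t. t \<in> {0..1} \<Longrightarrow> (\<integral>s. (hnorm (H s) (W t s))\<^sup>2 \<partial>\<mu>I k) = (hnorm (Hd k) (u k t))\<^sup>2"
        "\<And>x. (\<lambda>(t, s). W t s x) \<in> borel_measurable (restrict_space lborel {0..1} \<Otimes>\<^sub>M \<mu>I k)"
      then show ?thesis unfolding Q_def by blast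
    qed (use uk in auto)
  qed
  then have "\<exists>W. \<forall>k\<in>{1..n}. Q k (W k)" by (intro bchoice ballI)
  then obtain W where "\<forall>k\<in>{1..n}. Q k (W k)" ..
  note WQ = bspec[OF this, unfolded Q_def]
  note W = WQ[THEN conjunct1, THEN bspec, THEN conjunct1]
    WQ[THEN conjunct1, THEN bspec, THEN conjunct2, THEN conjunct1, THEN spec]
    WQ[THEN conjunct1, THEN bspec, THEN conjunct2, THEN conjunct2]
    WQ[THEN conjunct2, THEN spec]
  \<comment> \<open>At most one summand is nonzero. At scales in no piece the sum is the zero field,
    which lies in every \<open>H s\<close>.\<close>
  define v where "v t s x = (\<Sum>k=1..n. if s \<in> I k then W k t s x else 0)" for t s x
  have v_on: "v t s = W k t s" if k: "k \<in> {1..n}" and s: "s \<in> I k" for t s k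
  proof
    fix x
    have "v t s x = (\<Sum>j\<in>{k}. if s \<in> I j then W j t s x else 0)"
      unfolding v_def
    proof (rule sum.mono_neutral_right)
      show "\<forall>j\<in>{1..n} - {k}. (if s \<in> I j then W j t s x else 0) = 0"
        using I_disjoint[OF _ k _ s] by (metis DiffD1 DiffD2 singletonI)
    qed (use k in simp_all)
    then show "v t s x = W k t s x" using s by simp
  qed
  have v_off: "v t s = (\<lambda>x. 0)" if "\<And>k. k \<in> {1..n} \<Longrightarrow> s \<notin> I k" for t s
    unfolding v_def using that by (intro ext sum.neutral) auto
  have L2D: "s \<in> I k \<Longrightarrow> W k t s \<in> vfields (H s)"
    "(\<lambda>s. W k t s x) \<in> borel_measurable (restrict_space borel (I k))"
    "set_integrable lborel (I k) (\<lambda>s. (hnorm (H s) (W k t s))\<^sup>2)"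
    if k: "k \<in> {1..n}" "t \<in> {0..1}" for k t s x
  proof -
    interpret integral_rkhs "\<mu>I k" \<Omega> H M "Hd k" by (rule piece[OF k(1)])
    show "s \<in> I k \<Longrightarrow> W k t s \<in> vfields (H s)"
      "(\<lambda>s. W k t s x) \<in> borel_measurable (restrict_space borel (I k))"
      "set_integrable lborel (I k) (\<lambda>s. (hnorm (H s) (W k t s))\<^sup>2)"
      using L2_sectionD[OF W(1)[OF k]] by (auto simp: space_restrict_space integrable_restrict_iff)
  qed
  have v_in: "v t s \<in> vfields (H s)" if "t \<in> {0..1}" "s \<in> {0..1}" for t s
  proof (cases "\<exists>k\<in>{1..n}. s \<in> I k")
    case True
    then obtain k where k: "k \<in> {1..n}" "s \<in> I k" by blast
    show ?thesis unfolding v_on[OF k] by (rule L2D(1)[OF k(1) that(1) k(2)])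
  next
    case False
    interpret continuous_rkhs "H s" using F.continuous_rkhs_H that by simp
    have "v t s = (\<lambda>x. 0)" using False by (intro v_off) blast
    then show ?thesis using zero_in by simp
  qed
  have v_meas: "(\<lambda>(t, s). v t s x) \<in> borel_measurable (restrict_space borel ({0..1} \<times> {0..1}))" for x
  proof -
    have "(\<lambda>p. indicator ({0..1} \<times> I k) p *\<^sub>R (case p of (t, s) \<Rightarrow> W k t s x)) \<in> borel_measurable borel"
      if k: "k \<in> {1..n}" for k
      using borel_measurable_pair_to_restrict_prod[OF W(4)[OF k, of x]]
      by (subst (asm) borel_measurable_restrict_space_iff) (auto simp: borel_prod[symmetric])
    then have "(\<lambda>p. \<Sum>k=1..n. indicator ({0..1} \<times> I k) p *\<^sub>R (case p of (t, s) \<Rightarrow> W k t s x)) \<in> borel_measurable borel"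
      by (rule borel_measurable_sum)
    then have "(\<lambda>p. \<Sum>k=1..n. indicator ({0..1} \<times> I k) p *\<^sub>R (case p of (t, s) \<Rightarrow> W k t s x)) \<in>
        borel_measurable (restrict_space borel ({0..1} \<times> {0..1}))"
      by (rule measurable_restrict_space1)
    then show ?thesis
      by (rule measurable_cong[THEN iffD1, rotated])
        (auto simp: v_def space_restrict_space indicator_def intro!: sum.cong)
  qed
  have v_meas_s: "(\<lambda>s. v t s x) \<in> borel_measurable (restrict_space borel {0..1})" if t: "t \<in> {0..1}" for t x
  proof (rule measurable_compose[OF _ v_meas[of x], where f = "\<lambda>s. (t, s)", simplified])
    show "(\<lambda>s. (t, s)) \<in> restrict_space borel {0..1} \<rightarrow>\<^sub>M restrict_space borel ({0..1} \<times> {0..1})"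
      using t by (intro measurable_restrict_space2 measurable_restrict_space1 borel_measurable_continuous_onI continuous_intros)
        (auto simp: space_restrict_space)
  qed
  have norm_v: "indicator {0..1} s *\<^sub>R (hnorm (H s) (v t s))\<^sup>2 = (\<Sum>k=1..n. indicator (I k) s *\<^sub>R (hnorm (H s) (W k t s))\<^sup>2)"
    if t: "t \<in> {0..1}" for t s
  proof (cases "\<exists>k\<in>{1..n}. s \<in> I k")
    case True
    then obtain k where k: "k \<in> {1..n}" "s \<in> I k" by blast
    have "(\<Sum>j=1..n. indicator (I j) s *\<^sub>R (hnorm (H s) (W j t s))\<^sup>2) = (\<Sum>j\<in>{k}. indicator (I j) s *\<^sub>R (hnorm (H s) (W j t s))\<^sup>2)"
    proof (rule sum.mono_neutral_right)
      have "s \<notin> I j" if "j \<in> {1..n} - {k}" for j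
        using I_disjoint[OF _ k(1) _ k(2), of j] that by (metis DiffD1 DiffD2 singletonI)
      then show "\<forall>j\<in>{1..n} - {k}. indicator (I j) s *\<^sub>R (hnorm (H s) (W j t s))\<^sup>2 = 0" by simp
    qed (use k in simp_all)
    then show ?thesis using k I_subset[OF k(1)] v_on[OF k, of t] by (auto simp: indicator_def)
  next
    case False
    then have "(\<Sum>k=1..n. indicator (I k) s *\<^sub>R (hnorm (H s) (W k t s))\<^sup>2) = 0" by (intro sum.neutral) auto
    moreover have "indicator {0..1} s *\<^sub>R (hnorm (H s) (v t s))\<^sup>2 = 0"
    proof (cases "s \<in> {0..1}")
      case True
      interpret continuous_rkhs "H s" using F.continuous_rkhs_H True by simp
      have "v t s = (\<lambda>x. 0)" using False by (intro v_off) blast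
      then show ?thesis by simp
    qed simp
    ultimately show ?thesis by simp
  qed
  have norm_int: "set_integrable lborel {0..1} (\<lambda>s. (hnorm (H s) (v t s))\<^sup>2)"
    and norm_eq: "energy (v t) = (\<Sum>k=1..n. (hnorm (Hd k) (u k t))\<^sup>2)" if t: "t \<in> {0..1}" for t
  proof -
    have i: "integrable lborel (\<lambda>s. indicator (I k) s *\<^sub>R (hnorm (H s) (W k t s))\<^sup>2)" if "k \<in> {1..n}" for k
      using L2D(3)[OF that t] unfolding set_integrable_def .
    show "set_integrable lborel {0..1} (\<lambda>s. (hnorm (H s) (v t s))\<^sup>2)"
      unfolding set_integrable_def norm_v[OF t] by (intro Bochner_Integration.integrable_sum i)
    have "energy (v t) = (\<Sum>k=1..n. LINT s:I k|lborel. (hnorm (H s) (W k t s))\<^sup>2)"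
      unfolding set_lebesgue_integral_def norm_v[OF t] by (intro Bochner_Integration.integral_sum i)
    also have "\<dots> = (\<Sum>k=1..n. (hnorm (Hd k) (u k t))\<^sup>2)"
      using W(3)[OF _ t] by (intro sum.cong refl) (simp add: integral_restrict)
    finally show "energy (v t) = (\<Sum>k=1..n. (hnorm (Hd k) (u k t))\<^sup>2)" .
  qed
  have L2: "F.L2_section (v t)" if t: "t \<in> {0..1}" for t
    unfolding F.L2_section_def using v_in[OF t] v_meas_s[OF t] norm_int[OF t]
    by (simp add: integrable_restrict_iff)
  show thesis
  proof (rule that[of v])
    show "energy (v t) = (\<Sum>k=1..n. (hnorm (Hd k) (u k t))\<^sup>2)" if "t \<in> {0..1}" for t
      by (rule norm_eq[OF that])
    show "sampling \<sigma> (v t) k = u k t" if t: "t \<in> {0..1}" and k: "k \<in> {1..n}" for t k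
    proof
      fix x
      have "(\<integral>s. v t s x \<partial>\<mu>I k) = (\<integral>s. W k t s x \<partial>\<mu>I k)"
        using v_on[OF k] by (intro Bochner_Integration.integral_cong refl) (simp add: space_restrict_space)
      then show "sampling \<sigma> (v t) k x = u k t x" using W(2)[OF k t] by (simp add: sampling_eq[OF L2[OF t] k])
    qed
    show "v \<in> families \<Omega> H"
      unfolding families_def mem_Collect_eq
    proof (intro conjI ballI)
      show "v t \<in> sections \<Omega> H" if "t \<in> {0..1}" for t unfolding sections_H_iff by (rule L2[OF that])
      show "(\<lambda>(t, s). v t s x) \<in> borel_measurable (restrict_space borel ({0..1} \<times> {0..1}))" for x by (rule v_meas)
      let ?P = "restrict_space lborel {0..1::real} \<Otimes>\<^sub>M restrict_space lborel {0..1::real}"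
      have "(\<lambda>p. hnorm (H (snd p)) (v (fst p) (snd p))) \<in> borel_measurable ?P"
      proof (rule borel_measurable_hnorm)
        show "continuous_rkhs (H (snd p))" if "p \<in> space ?P" for p
          using that by (intro F.continuous_rkhs_H) (auto simp: space_pair_measure)
        show "(\<lambda>p. blinfun_apply (kernel (H (snd p)) x y) q) \<in> borel_measurable ?P" for x y q
          by (rule measurable_compose[OF measurable_snd F.kernel_measurable])
        show "(\<lambda>p. v (fst p) (snd p) x) \<in> borel_measurable ?P" for x
          using borel_measurable_restrict_prod_to_pair[OF v_meas[of x]] by (simp add: case_prod_beta)
        show "v (fst p) (snd p) \<in> vfields (H (snd p))" if "p \<in> space ?P" for p
          using that by (intro v_in) (auto simp: space_pair_measure)
      qed
      from borel_measurable_pair_to_restrict_prod[OF this]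
      show "(\<lambda>(t, s). hnorm (H s) (v t s)) \<in> borel_measurable (restrict_space borel ({0..1} \<times> {0..1}))"
        by (simp add: case_prod_beta)
      have "set_integrable lborel {0..1} (\<lambda>t. \<Sum>k=1..n. (hnorm (Hd k) (u k t))\<^sup>2)"
        unfolding set_integrable_def scaleR_sum_right
      proof (rule Bochner_Integration.integrable_sum)
        show "integrable lborel (\<lambda>t. indicator {0..1} t *\<^sub>R (hnorm (Hd k) (u k t))\<^sup>2)" if k: "k \<in> {1..n}" for k
          using u[OF k] sections_Hd_iff[OF k] unfolding set_integrable_def by blast
      qed
      then show "set_integrable lborel {0..1} (\<lambda>t. energy (v t))"
        by (rule set_integrable_cong[THEN iffD1, rotated -1]) (use norm_eq in auto)
    qed
  qed
qed

end

section \<open>Equivalence of the matching problems\<close>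

text \<open>Candidates are lifted exactly on \<open>{0..1}\<close> only, so the composed flow has to
  be seen to depend on these times alone.\<close>

lemma semidirect_flow_cong:
  assumes "\<And>k r. k \<in> {1..j} \<Longrightarrow> r \<in> {0..1} \<Longrightarrow> u k r = u' k r"
  shows "semidirect_flow \<Omega> u j = semidirect_flow \<Omega> u' j"
  using assms
proof (induction j)
  case (Suc j)
  then have eq: "semidirect_flow \<Omega> u j = semidirect_flow \<Omega> u' j" by simp
  have "flow (\<lambda>r. Ad \<Omega> (inv (semidirect_flow \<Omega> u' j r)) (u (Suc j) r)) =
      flow (\<lambda>r. Ad \<Omega> (inv (semidirect_flow \<Omega> u' j r)) (u' (Suc j) r))"
    by (rule flow_cong) (use Suc.prems[of "Suc j"] in simp)
  then show ?case by (simp only: semidirect_flow.simps eq)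
qed simp

context kernel_partition
begin

text \<open>The Lipschitz constant in space is \<open>K_HD\<close> times the norm, integrable in
  time because the norm is square integrable on a bounded interval. The field is extended by zero in
  time to fit the locale.\<close>

lemma section_Caratheodory:
  assumes k: "k \<in> {1..n}" and u: "u \<in> sections \<Omega> (\<lambda>_. Hd k)"
  shows "\<exists>m v'. C1_Caratheodory_field m 1 (\<lambda>r x. if r \<in> {0..1} then u r x else 0) \<Omega> v'"
proof -
  interpret integral_rkhs "\<mu>I k" \<Omega> H M "Hd k" by (rule piece[OF k])
  have uin: "u r \<in> vfields (Hd k)" if "r \<in> {0..1}" for r
    using u that unfolding sections_Hd_iff[OF k] by blast
  have um: "(\<lambda>r. u r x) \<in> borel_measurable (restrict_space borel {0..1})" for x
    using u unfolding sections_Hd_iff[OF k] by blast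
  define m where "m r = indicator {0..1} r * (K_HD * hnorm (Hd k) (u r))" for r
  have "\<forall>r. \<exists>D. r \<in> {0..1} \<longrightarrow> (\<forall>x\<in>\<Omega>. (u r has_derivative D x) (at x)) \<and> (\<forall>h. continuous_on \<Omega> (\<lambda>x. D x h))"
    using HD_differentiable[OF uin] by metis
  then obtain D where D: "\<And>r x. r \<in> {0..1} \<Longrightarrow> x \<in> \<Omega> \<Longrightarrow> (u r has_derivative D r x) (at x)"
    "\<And>r h. r \<in> {0..1} \<Longrightarrow> continuous_on \<Omega> (\<lambda>x. D r x h)"
    by metis
  have "C1_Caratheodory_field m 1 (\<lambda>r x. if r \<in> {0..1} then u r x else 0) \<Omega>
      (\<lambda>r x h. if r \<in> {0..1} then D r x h else 0)"
  proof
    show "0 \<le> m r" for r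
      using K_HD_nonneg uin[of r] by (auto simp: m_def indicator_def)
    have "set_integrable lborel {0..1} (\<lambda>r. hnorm (Hd k) (u r))"
    proof (rule set_integrable_bound)
      show "set_integrable lborel {0..1} (\<lambda>r. 1 + (hnorm (Hd k) (u r))\<^sup>2)"
        using u unfolding sections_Hd_iff[OF k] by (intro set_integral_add(1)) (auto simp: set_integrable_def)
      have "(\<lambda>r. hnorm (Hd k) (u r)) \<in> borel_measurable (restrict_space borel {0..1})"
        by (intro borel_measurable_hnorm continuous_rkhs_HD borel_measurable_const um uin)
          (simp add: space_restrict_space)
      then show "set_borel_measurable lborel {0..1} (\<lambda>r. hnorm (Hd k) (u r))"
        by (simp add: set_borel_measurable_def borel_measurable_restrict_space_iff)
      have "\<bar>a\<bar> \<le> \<bar>1 + a\<^sup>2\<bar>" for a :: real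
      proof -
        have "0 \<le> (\<bar>a\<bar> - 1)\<^sup>2" by simp
        then have "2 * \<bar>a\<bar> \<le> 1 + a\<^sup>2" by (simp add: power2_diff)
        then show ?thesis by linarith
      qed
      then show "AE r in lborel. r \<in> {0..1} \<longrightarrow> norm (hnorm (Hd k) (u r)) \<le> norm (1 + (hnorm (Hd k) (u r))\<^sup>2)"
        by simp
    qed
    then have "integrable lborel (\<lambda>r. K_HD * (indicator {0..1} r *\<^sub>R hnorm (Hd k) (u r)))"
      unfolding set_integrable_def by (rule integrable_mult_right)
    then show "integrable lborel m" unfolding m_def by (simp add: mult_ac)
    show "(\<lambda>r. if r \<in> {0..1} then u r x else 0) \<in> borel_measurable borel" for x
    proof -
      have "(\<lambda>r. indicator {0..1} r *\<^sub>R u r x) \<in> borel_measurable borel"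
        using um[of x] by (simp add: borel_measurable_restrict_space_iff)
      moreover have "(\<lambda>r. indicator {0..1} r *\<^sub>R u r x) = (\<lambda>r. if r \<in> {0..1} then u r x else 0)"
        by (auto simp: indicator_def)
      ultimately show ?thesis by simp
    qed
    show "norm ((if r \<in> {0..1} then u r x else 0) - (if r \<in> {0..1} then u r y else 0)) \<le> m r * norm (x - y)" for r x y
      using HD_Lipschitz[OF uin[of r], of x y] by (auto simp: m_def)
    show "norm (if r \<in> {0..1} then u r 0 else 0) \<le> 1 * m r" for r
      using HD_bound[OF uin[of r], of 0] by (auto simp: m_def)
    show "(if r \<in> {0..1} then u r x else 0) = 0" if "x \<notin> \<Omega>" for r x
      using Hd_outside[OF k uin that] by simp
    show "((\<lambda>x. if r \<in> {0..1} then u r x else 0) has_derivative (\<lambda>h. if r \<in> {0..1} then D r x h else 0)) (at x)"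
      if "x \<in> \<Omega>" for r x
      using D(1)[OF _ that, of r] by (cases "r \<in> {0..1}") auto
    show "continuous_on \<Omega> (\<lambda>x. if r \<in> {0..1} then D r x h else 0)" for r h
      using D(2)[of r h] by (cases "r \<in> {0..1}") auto
  qed (use open_\<Omega> in auto)
  then show ?thesis by blast
qed

text \<open>Telescoping: if the first \<open>j\<close> factors compose to the flow of the partial
  sum \<open>V\<close>, then \<open>flow_Ad\<close> identifies the next factor as
  \<open>inv (V.fl t) \<circ> W.fl t\<close>, and the flow of \<open>V\<close> cancels.\<close>

lemma semidirect_flow_eq_fl:
  assumes u: "\<And>k. k \<in> {1..n} \<Longrightarrow> u k \<in> sections \<Omega> (\<lambda>_. Hd k)" and j: "j \<le> n"
  shows "\<exists>m c v'. C1_Caratheodory_field m c (\<lambda>r x. \<Sum>k=1..j. if r \<in> {0..1} then u k r x else 0) \<Omega> v' \<and>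
    (\<forall>t\<in>{0..1}. semidirect_flow \<Omega> u j t =
      Caratheodory_field.fl (\<lambda>r x. \<Sum>k=1..j. if r \<in> {0..1} then u k r x else 0) t)"
  using j
proof (induction j)
  case 0
  interpret Z: C1_Caratheodory_field "\<lambda>_. 0" 0 "\<lambda>r x. 0" \<Omega> "\<lambda>r x h. 0"
    by unfold_locales (use F.open_\<Omega> in auto)
  have "Z.fl t x = x" if "t \<in> {0..1}" for t x
    by (rule Z.fl_eqI[of 1]) (use that in \<open>auto simp: Z.solution_def set_lebesgue_integral_def\<close>)
  then have "Z.fl t = id" if "t \<in> {0..1}" for t using that by (simp add: fun_eq_iff)
  then show ?case using Z.C1_Caratheodory_field_axioms by auto
next
  case (Suc j)
  define V where "V r x = (\<Sum>k=1..j. if r \<in> {0..1} then u k r x else 0)" for r x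
  define U where "U r x = (if r \<in> {0..1} then u (Suc j) r x else 0)" for r x
  obtain m c v' where V: "C1_Caratheodory_field m c V \<Omega> v'"
    and semi: "\<And>t. t \<in> {0..1} \<Longrightarrow> semidirect_flow \<Omega> u j t = Caratheodory_field.fl V t"
  proof -
    have "j \<le> n" using Suc.prems by simp
    from Suc.IH[OF this] obtain m c v'
      where "C1_Caratheodory_field m c (\<lambda>r x. \<Sum>k=1..j. if r \<in> {0..1} then u k r x else 0) \<Omega> v' \<and>
        (\<forall>t\<in>{0..1}. semidirect_flow \<Omega> u j t =
          Caratheodory_field.fl (\<lambda>r x. \<Sum>k=1..j. if r \<in> {0..1} then u k r x else 0) t)"
      by (elim exE)
    then show thesis using that[of m c v'] unfolding V_def[abs_def] by simp
  qed
  obtain m' u' where U: "C1_Caratheodory_field m' 1 U \<Omega> u'"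
  proof -
    have "Suc j \<in> {1..n}" using Suc.prems by simp
    from section_Caratheodory[OF this u[OF this]] show thesis
      using that unfolding U_def[abs_def] by (elim exE)
  qed
  interpret composed_fields m c V \<Omega> v' m' 1 U u' using V U by (rule composed_fields.intro)
  have sum: "(\<lambda>r x. \<Sum>k=1..Suc j. if r \<in> {0..1} then u k r x else 0) = (\<lambda>r x. V r x + U r x)"
    by (simp add: V_def U_def)
  have "semidirect_flow \<Omega> u (Suc j) t = W.fl t" if t: "t \<in> {0..1}" for t
  proof -
    have "flow (\<lambda>r. Ad \<Omega> (inv (semidirect_flow \<Omega> u j r)) (u (Suc j) r)) t = C t"
    proof (rule flow_Ad[OF _ t])
      fix r :: real assume r: "r \<in> {0..1}"
      have "u (Suc j) r = U r" using r by (simp add: U_def fun_eq_iff)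
      then show "Ad \<Omega> (inv (semidirect_flow \<Omega> u j r)) (u (Suc j) r) = w r"
        using semi[OF r] Ad_eq_w[OF r] by simp
    qed
    then show ?thesis using semi[OF t] V_fl_C[OF t] by (simp add: fun_eq_iff)
  qed
  then show ?case unfolding sum using W.C1_Caratheodory_field_axioms by blast
qed

text \<open>Passes from the cut-off sum, to which the flow theory applies, to any field that agrees
  with it on \<open>{0..1}\<close>.\<close>

lemma semidirect_flow_eq_flow:
  assumes u: "\<And>k. k \<in> {1..n} \<Longrightarrow> u k \<in> sections \<Omega> (\<lambda>_. Hd k)" and t: "t \<in> {0..1}"
    and v: "\<And>r x. r \<in> {0..1} \<Longrightarrow> v r x = (\<Sum>k=1..n. u k r x)"
  shows "semidirect_flow \<Omega> u n t = flow v t"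
proof -
  let ?V = "\<lambda>r x. \<Sum>k=1..n. if r \<in> {0..1} then u k r x else 0"
  obtain m c v' where V: "C1_Caratheodory_field m c ?V \<Omega> v'"
    and semi: "\<And>t. t \<in> {0..1} \<Longrightarrow> semidirect_flow \<Omega> u n t = Caratheodory_field.fl ?V t"
  proof -
    have "\<exists>m c v'. C1_Caratheodory_field m c ?V \<Omega> v' \<and>
        (\<forall>t\<in>{0..1}. semidirect_flow \<Omega> u n t = Caratheodory_field.fl ?V t)"
      by (rule semidirect_flow_eq_fl[OF u order_refl])
    then show thesis using that by (elim exE conjE) simp
  qed
  interpret C1_Caratheodory_field m c ?V \<Omega> v' by (rule V)
  have "flow v = flow ?V" by (rule flow_cong) (auto simp: v)
  then show ?thesis using semi[OF t] flow_eq_fl[OF t] by simp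
qed

lemma sampling_energy_integrable:
  assumes v: "v \<in> families \<Omega> H" and k: "k \<in> {1..n}"
  shows "set_integrable lborel {0..1} (\<lambda>t. (hnorm (Hd k) (sampling \<sigma> (v t) k))\<^sup>2)"
  using sampling_sections[OF assms] unfolding sections_Hd_iff[OF k] by blast

lemma sampling_energy_sum:
  assumes v: "v \<in> families \<Omega> H"
  shows "set_integrable lborel {0..1} (\<lambda>t. \<Sum>k=1..n. (hnorm (Hd k) (sampling \<sigma> (v t) k))\<^sup>2)"
    and "(\<Sum>k=1..n. LINT t:{0..1}|lborel. (hnorm (Hd k) (sampling \<sigma> (v t) k))\<^sup>2) =
      (LINT t:{0..1}|lborel. \<Sum>k=1..n. (hnorm (Hd k) (sampling \<sigma> (v t) k))\<^sup>2)"
proof -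
  have i: "integrable lborel (\<lambda>t. indicator {0..1} t *\<^sub>R (hnorm (Hd k) (sampling \<sigma> (v t) k))\<^sup>2)" if "k \<in> {1..n}" for k
    using sampling_energy_integrable[OF v that] unfolding set_integrable_def .
  show "set_integrable lborel {0..1} (\<lambda>t. \<Sum>k=1..n. (hnorm (Hd k) (sampling \<sigma> (v t) k))\<^sup>2)"
    unfolding set_integrable_def scaleR_sum_right by (intro Bochner_Integration.integrable_sum i)
  show "(\<Sum>k=1..n. LINT t:{0..1}|lborel. (hnorm (Hd k) (sampling \<sigma> (v t) k))\<^sup>2) =
      (LINT t:{0..1}|lborel. \<Sum>k=1..n. (hnorm (Hd k) (sampling \<sigma> (v t) k))\<^sup>2)"
    unfolding set_lebesgue_integral_def scaleR_sum_right
    by (intro Bochner_Integration.integral_sum[symmetric] i)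
qed

lemma energy_integrable: "v \<in> families \<Omega> H \<Longrightarrow> set_integrable lborel {0..1} (\<lambda>t. energy (v t))"
  unfolding families_def by blast

text \<open>At each time \<open>sampling_energy_le\<close> gives the opposite inequality, so the
  difference is nonnegative with integral at most zero.\<close>

lemma tight_AE:
  assumes v: "v \<in> families \<Omega> H"
    and le: "(LINT t:{0..1}|lborel. energy (v t)) \<le>
      (\<Sum>k=1..n. LINT t:{0..1}|lborel. (hnorm (Hd k) (sampling \<sigma> (v t) k))\<^sup>2)"
  shows "AE t in lborel. t \<in> {0..1} \<longrightarrow> energy (v t) \<le> (\<Sum>k=1..n. (hnorm (Hd k) (sampling \<sigma> (v t) k))\<^sup>2)"
proof -
  define g where "g t = energy (v t) - (\<Sum>k=1..n. (hnorm (Hd k) (sampling \<sigma> (v t) k))\<^sup>2)" for t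
  have g_int: "set_integrable lborel {0..1} g"
    unfolding g_def by (rule set_integral_diff(1)[OF energy_integrable[OF v] sampling_energy_sum(1)[OF v]])
  have "(LINT t:{0..1}|lborel. g t) \<le> 0"
    unfolding g_def set_integral_diff(2)[OF energy_integrable[OF v] sampling_energy_sum(1)[OF v]]
    using le unfolding sampling_energy_sum(2)[OF v] by simp
  moreover have nonneg: "0 \<le> indicator {0..1} t *\<^sub>R g t" for t
    using sampling_energy_le[OF families_L2_section[OF v]] by (cases "t \<in> {0..1}") (auto simp: g_def)
  ultimately have "(\<integral>t. indicator {0..1} t *\<^sub>R g t \<partial>lborel) = 0"
    unfolding set_lebesgue_integral_def by (intro antisym integral_nonneg_AE AE_I2)
  then have "AE t in lborel. indicator {0..1} t *\<^sub>R g t = 0"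
    using integral_nonneg_eq_0_iff_AE[OF g_int[unfolded set_integrable_def] AE_I2[OF nonneg]] by blast
  then show ?thesis by eventually_elim (auto simp: g_def)
qed

lemma sampling_cong_AE:
  assumes u: "F.L2_section u" and u': "F.L2_section u'" and k: "k \<in> {1..n}"
    and eq: "AE s in lborel. s \<in> {0..1} \<longrightarrow> u s = u' s"
  shows "sampling \<sigma> u k = sampling \<sigma> u' k"
proof -
  interpret integral_rkhs "\<mu>I k" \<Omega> H M "Hd k" by (rule piece[OF k])
  have "AE s in lborel. s \<in> I k \<longrightarrow> u s = u' s"
    using eq by eventually_elim (use I_subset[OF k] in auto)
  then have "AE s in \<mu>I k. u s = u' s" by (simp add: AE_restrict_space_iff)
  then have "(\<integral>s. u s x \<partial>\<mu>I k) = (\<integral>s. u' s x \<partial>\<mu>I k)" for x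
    using L2_sectionD(2)[OF L2_section_piece[OF u k]] L2_sectionD(2)[OF L2_section_piece[OF u' k]]
    by (intro integral_cong_AE) auto
  then show ?thesis unfolding sampling_eq[OF u k] sampling_eq[OF u' k] by simp
qed

text \<open>\<open>enc\<close> lists the components of a candidate: (A) is the case of a single interval.\<close>

lemma equivalent_via_sampling:
  fixes Q :: "('y, 'a) matching_problem" and enc :: "'y \<Rightarrow> nat \<Rightarrow> real \<Rightarrow> 'a vfield"
    and d :: "'q \<Rightarrow> 'q \<Rightarrow> real"
  assumes feasible_Q: "\<And>y. y \<in> feasible Q \<longleftrightarrow> (\<forall>k\<in>{1..n}. enc y k \<in> sections \<Omega> (\<lambda>_. Hd k))"
    and enc_f: "\<And>v k. k \<in> {1..n} \<Longrightarrow> enc (f v) k = (\<lambda>t. sampling \<sigma> (v t) k)"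
    and objective_Q: "\<And>y. objective Q y =
      1 / 2 * (\<Sum>k=1..n. LINT t:{0..1}|lborel. (hnorm (Hd k) (enc y k t))\<^sup>2) + (c y)\<^sup>2"
    and c_f: "\<And>v. v \<in> families \<Omega> H \<Longrightarrow> c (f v) = d (act (flow (total_field v) 1) I0) It"
    and c_cong: "\<And>y y'. (\<And>k t. k \<in> {1..n} \<Longrightarrow> t \<in> {0..1} \<Longrightarrow> enc y k t = enc y' k t) \<Longrightarrow> c y = c y'"
    and deformation_Q: "\<And>v t. v \<in> families \<Omega> H \<Longrightarrow> t \<in> {0..1} \<Longrightarrow> deformation Q (f v) t = flow (total_field v) t"
    and agree_Q: "\<And>y y'. agree Q y y' \<longleftrightarrow>
      (\<forall>k\<in>{1..n}. AE t in lborel. t \<in> {0..1} \<longrightarrow> enc y k t = enc y' k t)"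
  shows "equivalent_via f (problem_B \<Omega> H act d I0 It) Q"
proof -
  let ?P = "problem_B \<Omega> H act d I0 It"
  have P: "feasible ?P = families \<Omega> H"
    "objective ?P v = 1 / 2 * (LINT t:{0..1}|lborel. energy (v t)) + (d (act (flow (total_field v) 1) I0) It)\<^sup>2"
    "deformation ?P v = flow (total_field v)"
    "agree ?P v v' \<longleftrightarrow> (AE t in lborel. t \<in> {0..1} \<longrightarrow> (AE s in lborel. s \<in> {0..1} \<longrightarrow> v t s = v' t s))" for v v'
    by (simp_all add: problem_B_def)
  have objective_f: "objective Q (f v) =
      1 / 2 * (\<Sum>k=1..n. LINT t:{0..1}|lborel. (hnorm (Hd k) (sampling \<sigma> (v t) k))\<^sup>2) + (d (act (flow (total_field v) 1) I0) It)\<^sup>2"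
    if "v \<in> families \<Omega> H" for v
    unfolding objective_Q c_f[OF that] by (simp add: enc_f)
  show ?thesis
  proof (rule equivalent_viaI)
    show "f v \<in> feasible Q" if "v \<in> feasible ?P" for v
      using sampling_sections that unfolding feasible_Q P by (simp add: enc_f)
    show "deformation Q (f v) t = deformation ?P v t" if "v \<in> feasible ?P" "t \<in> {0..1}" for v t
      using deformation_Q that unfolding P by simp
    show "objective Q (f v) \<le> objective ?P v" if "v \<in> feasible ?P" for v
    proof -
      have v: "v \<in> families \<Omega> H" using that P by simp
      have "(LINT t:{0..1}|lborel. \<Sum>k=1..n. (hnorm (Hd k) (sampling \<sigma> (v t) k))\<^sup>2) \<le> (LINT t:{0..1}|lborel. energy (v t))"
        by (rule set_integral_mono[OF sampling_energy_sum(1)[OF v] energy_integrable[OF v]])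
          (rule sampling_energy_le[OF families_L2_section[OF v]])
      then show ?thesis unfolding objective_f[OF v] P(2) sampling_energy_sum(2)[OF v] by simp
    qed
    have int_nonneg: "0 \<le> (LINT t:{0..1}|lborel. g t)" if "\<And>t. 0 \<le> g t" for g :: "real \<Rightarrow> real"
      unfolding set_lebesgue_integral_def using that by (intro integral_nonneg_AE AE_I2) simp
    show "0 \<le> objective ?P v" for v
      unfolding P(2) by (intro add_nonneg_nonneg mult_nonneg_nonneg int_nonneg) auto
    show "0 \<le> objective Q y" for y
      unfolding objective_Q by (intro add_nonneg_nonneg mult_nonneg_nonneg sum_nonneg int_nonneg) auto
    show "\<exists>v\<in>feasible ?P. agree Q (f v) y \<and> objective ?P v \<le> objective Q y" if "y \<in> feasible Q" for y
    proof -
      have y: "enc y k \<in> sections \<Omega> (\<lambda>_. Hd k)" if "k \<in> {1..n}" for k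
        using \<open>y \<in> feasible Q\<close> that unfolding feasible_Q by blast
      obtain v where v: "v \<in> families \<Omega> H"
        and samp: "\<And>t k. t \<in> {0..1} \<Longrightarrow> k \<in> {1..n} \<Longrightarrow> sampling \<sigma> (v t) k = enc y k t"
        and en: "\<And>t. t \<in> {0..1} \<Longrightarrow> energy (v t) = (\<Sum>k=1..n. (hnorm (Hd k) (enc y k t))\<^sup>2)"
        by (rule lift_families[of "enc y"]) (use y in auto)
      have "(LINT t:{0..1}|lborel. energy (v t)) = (LINT t:{0..1}|lborel. \<Sum>k=1..n. (hnorm (Hd k) (sampling \<sigma> (v t) k))\<^sup>2)"
        by (intro set_lebesgue_integral_cong) (simp_all add: en samp)
      also have "\<dots> = (\<Sum>k=1..n. LINT t:{0..1}|lborel. (hnorm (Hd k) (sampling \<sigma> (v t) k))\<^sup>2)"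
        by (rule sampling_energy_sum(2)[OF v, symmetric])
      also have "\<dots> = (\<Sum>k=1..n. LINT t:{0..1}|lborel. (hnorm (Hd k) (enc y k t))\<^sup>2)"
        by (intro sum.cong refl set_lebesgue_integral_cong) (simp_all add: samp)
      finally have "(LINT t:{0..1}|lborel. energy (v t)) = (\<Sum>k=1..n. LINT t:{0..1}|lborel. (hnorm (Hd k) (enc y k t))\<^sup>2)" .
      \<comment> \<open>The lift reproduces \<open>y\<close> only at times in \<open>{0..1}\<close>;
        for this reason the matching term enters through \<open>c\<close> with a congruence
        rule.\<close>
      moreover have "c (f v) = c y" by (rule c_cong) (simp add: enc_f samp)
      ultimately have "objective ?P v = objective Q y" unfolding P(2) objective_Q c_f[OF v, symmetric] by simp
      moreover have "agree Q (f v) y" unfolding agree_Q by (simp add: enc_f samp)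
      ultimately show ?thesis using v P(1) by auto
    qed
    show "agree Q (f v) (f v') \<longleftrightarrow> agree ?P v v'"
      if vP: "v \<in> feasible ?P" "v' \<in> feasible ?P"
        and min: "objective ?P v \<le> objective Q (f v)" "objective ?P v' \<le> objective Q (f v')" for v v'
    proof -
      have v: "v \<in> families \<Omega> H" "v' \<in> families \<Omega> H" using vP P by auto
      have tight: "AE t in lborel. t \<in> {0..1} \<longrightarrow> energy (v t) \<le> (\<Sum>k=1..n. (hnorm (Hd k) (sampling \<sigma> (v t) k))\<^sup>2)"
        by (rule tight_AE[OF v(1)]) (use min(1) in \<open>simp add: P objective_f[OF v(1)]\<close>)
      have tight': "AE t in lborel. t \<in> {0..1} \<longrightarrow> energy (v' t) \<le> (\<Sum>k=1..n. (hnorm (Hd k) (sampling \<sigma> (v' t) k))\<^sup>2)"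
        by (rule tight_AE[OF v(2)]) (use min(2) in \<open>simp add: P objective_f[OF v(2)]\<close>)
      have agree_f: "agree Q (f v) (f v') \<longleftrightarrow> (\<forall>k\<in>{1..n}. AE t in lborel. t \<in> {0..1} \<longrightarrow> sampling \<sigma> (v t) k = sampling \<sigma> (v' t) k)"
        unfolding agree_Q by (simp add: enc_f)
      show ?thesis
      proof
        assume "agree Q (f v) (f v')"
        then have "AE t in lborel. \<forall>k\<in>{1..n}. t \<in> {0..1} \<longrightarrow> sampling \<sigma> (v t) k = sampling \<sigma> (v' t) k"
          unfolding agree_f by (intro AE_finite_allI) auto
        \<comment> \<open>Tightness and equality of the samples hold at almost every time, and at
          such times \<open>minimal_sections_agree\<close> applies.\<close>
        then show "agree ?P v v'" unfolding P(4) using tight tight'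
        proof eventually_elim
          case (elim t)
          show ?case
          proof
            assume t: "t \<in> {0..1}"
            show "AE s in lborel. s \<in> {0..1} \<longrightarrow> v t s = v' t s"
              by (rule minimal_sections_agree[OF families_L2_section[OF v(1) t] families_L2_section[OF v(2) t]])
                (use elim t in auto)
          qed
        qed
      next
        assume "agree ?P v v'"
        then have ae: "AE t in lborel. t \<in> {0..1} \<longrightarrow> (AE s in lborel. s \<in> {0..1} \<longrightarrow> v t s = v' t s)"
          unfolding P(4) .
        show "agree Q (f v) (f v')"
          unfolding agree_f
        proof
          fix k assume k: "k \<in> {1..n}"
          show "AE t in lborel. t \<in> {0..1} \<longrightarrow> sampling \<sigma> (v t) k = sampling \<sigma> (v' t) k"
            using ae by eventually_elim
              (use sampling_cong_AE[OF families_L2_section[OF v(1)] families_L2_section[OF v(2)] k] in blast)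
        qed
      qed
    qed
  qed
qed

end

theorem theorem3p4:
  fixes \<Omega> :: "'a::euclidean_space set"
    and H :: "real \<Rightarrow> 'a field_space"
    and HA :: "'a field_space"
    and Hd :: "nat \<Rightarrow> 'a field_space"
    and n :: nat and \<sigma> :: "nat \<Rightarrow> real"
    and Q :: "'q set" and d :: "'q \<Rightarrow> 'q \<Rightarrow> real"
    and act :: "('a \<Rightarrow> 'a) \<Rightarrow> 'q \<Rightarrow> 'q"
    and I0 Itarget :: 'q
  assumes "open \<Omega>" and "connected \<Omega>" and "\<Omega> \<noteq> {}"
    and "admissible_bundle \<Omega> H"
    and "\<And>s t. 0 \<le> s \<Longrightarrow> s \<le> t \<Longrightarrow> t \<le> 1 \<Longrightarrow> vfields (H s) \<subseteq> vfields (H t)"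
    and "\<sigma> 0 = 0" and "\<sigma> n = 1" and "\<And>k. k < n \<Longrightarrow> \<sigma> k < \<sigma> (Suc k)"
    and "rkhs_with_kernel \<Omega> (integral_kernel H {0..1}) HA"
    and "\<And>k. k \<in> {1..n} \<Longrightarrow>
           rkhs_with_kernel \<Omega> (integral_kernel H {\<sigma> (k - 1)..\<sigma> k}) (Hd k)"
    and "Metric_space Q d" and "I0 \<in> Q" and "Itarget \<in> Q"
    and "acts_on (flow_diffeos \<Omega> HA) Q act"
  shows "equivalent_via total_field
           (problem_B \<Omega> H act d I0 Itarget) (problem_A \<Omega> HA act d I0 Itarget) \<and>
         equivalent_via (\<lambda>v k t. sampling \<sigma> (v t) k)
           (problem_B \<Omega> H act d I0 Itarget) (problem_C \<Omega> n Hd act d I0 Itarget)"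
proof
  obtain M where M: "\<And>I. I \<in> sets borel \<Longrightarrow> I \<subseteq> {0..1} \<Longrightarrow> kernel_bundle (restrict_space lborel I) \<Omega> H M"
    by (rule kernel_bundle_restrict[OF assms(1,4)]) (rule that; assumption)
  \<comment> \<open>With \<open>n = 1\<close> and \<open>\<sigma> = real\<close> the only interval
    is the whole of \<open>{0..1}\<close>, and sampling becomes \<open>total_field\<close>.\<close>
  interpret A: kernel_partition \<Omega> H M 1 real "\<lambda>_. HA"
  proof (rule kernel_partition.intro[OF M])
    show "rkhs_with_kernel \<Omega> (integral_kernel H {real (k - 1)..real k}) HA" if "k \<in> {1..1}" for k
      using that assms(9) by simp
  qed simp_all
  interpret C: kernel_partition \<Omega> H M n \<sigma> Hd
    by (rule kernel_partition.intro[OF M assms(6-8,10)])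
  show "equivalent_via total_field
      (problem_B \<Omega> H act d I0 Itarget) (problem_A \<Omega> HA act d I0 Itarget)"
  proof (rule A.equivalent_via_sampling[where enc = "\<lambda>y k. y" and c = "\<lambda>y. d (act (flow y 1) I0) Itarget"])
    show "d (act (flow y 1) I0) Itarget = d (act (flow y' 1) I0) Itarget"
      if "\<And>k t. k \<in> {1..1::nat} \<Longrightarrow> t \<in> {0..1} \<Longrightarrow> y t = y' t" for y y'
      using flow_cong[of y y'] that[of 1] by simp
  qed (auto simp: problem_A_def total_field_def sampling_def fun_eq_iff)
  have total: "total_field v r x = (\<Sum>k=1..n. sampling \<sigma> (v r) k x)"
    if "v \<in> families \<Omega> H" "r \<in> {0..1}" for v r x
    unfolding total_field_def by (rule C.family_integral_eq_sum[OF C.families_L2_section[OF that]])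
  \<comment> \<open>The samples add up to the total field at each time, and the flow of their sum is
    the semidirect composition.\<close>
  have deform: "semidirect_flow \<Omega> (\<lambda>k t. sampling \<sigma> (v t) k) n t = flow (total_field v) t"
    if "v \<in> families \<Omega> H" "t \<in> {0..1}" for v t
    by (rule C.semidirect_flow_eq_flow[OF C.sampling_sections[OF that(1)] that(2) total[OF that(1)]])
  show "equivalent_via (\<lambda>v k t. sampling \<sigma> (v t) k)
      (problem_B \<Omega> H act d I0 Itarget) (problem_C \<Omega> n Hd act d I0 Itarget)"
  proof (rule C.equivalent_via_sampling[where enc = "\<lambda>y. y" and c = "\<lambda>y. d (act (semidirect_flow \<Omega> y n 1) I0) Itarget"])
    show "d (act (semidirect_flow \<Omega> y n 1) I0) Itarget = d (act (semidirect_flow \<Omega> y' n 1) I0) Itarget"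
      if "\<And>k t. k \<in> {1..n} \<Longrightarrow> t \<in> {0..1} \<Longrightarrow> y k t = y' k t" for y y'
      using semidirect_flow_cong[of n y y' \<Omega>] that by simp
  qed (auto simp: problem_C_def deform)
qed

end
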